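(* Let $k$ be a field of characteristic zero, let $R=k[x_1,\dots,x_n]$ be a polynomial algebra equipped with an arbitrary Poisson bracket $\{-,-\}$, and let $M$ be an arbitrary right Poisson $R$-module. Let $M_t$ be the twisted Poisson module of $M$ twisted by the modular derivation $\phi_\eta$ of $R$ with respect to the volume form $\eta=dx_1\wedge\cdots\wedge dx_n$; that is, $M_t=M$ as an $R$-module, with $\{m,a\}_{M_t}=\{m,a\}_M+m\cdot\phi_\eta(a)$ for $m\in M$, $a\in R$. Then for all $p\in\mathbb{N}$ there is an isomorphism $$\mathrm{PH}_p(R,M_t)\cong \mathrm{PH}^{n-p}(R,M),$$ and this isomorphism is functorial (in $M$).
   Context: All vector spaces and algebras are over $k$. A Poisson algebra is a commutative $k$-algebra $R$ with a bilinear map $\{-,-\}:R\times R\to R$ that is a Lie bracket and is a derivation in each argument. A right Poisson module over $R$ is a $k$-vector space $M$ with bilinear maps $\cdot$ and $\{-,-\}_M: M\times R\to M$ such that: (1) $(M,\cdot)$ is an $R$-module; (2) $(M,\{-,-\}_M)$ is a right Lie module over $(R,\{-,-\})$, i.e. $\{m,\{a,b\}\}_M=\{\{m,a\}_M,b\}_M-\{\{m,b\}_M,a\}_M$; (3) $\{ma,b\}_M=\{m,b\}_M a+m\{a,b\}$; (4) $\{m,ab\}_M=\{m,a\}_M b+\{m,b\}_M a$, for all $a,b\in R$, $m\in M$. A morphism of Poisson modules is an $R$-linear map compatible with $\{-,-\}$. $\Omega^p(R)$ denotes the $R$-module of Kähler differential $p$-forms of $R$ over $k$ (the $p$-th exterior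 power of $\Omega^1(R)$). Modular derivation: for $f\in R$ let $H_f=\{f,-\}$, let $\iota_{H_f}$ be contraction of forms with $H_f$, and $L_{H_f}=[d,\iota_{H_f}]$ (graded commutator) the Lie derivative on $\Omega^\bullet(R)$. Then $\phi_\eta:R\to R$ is defined by $L_{H_f}\eta=\phi_\eta(f)\,\eta$. Concretely $\phi_\eta(f)=\sum_{j=1}^n \partial\{f,x_j\}/\partial x_j$. It is a derivation satisfying $\phi_\eta(\{a,b\})=\{\phi_\eta(a),b\}+\{a,\phi_\eta(b)\}$, and $M_t$ is again a right Poisson $R$-module. Poisson homology: for a right Poisson module $N$, $\mathrm{PH}_p(R,N)$ is the $p$-th homology of the chain complex with terms $N\otimes_R\Omega^p(R)$ in degree $p$ and differential $$\partial(m\otimes da_1\wedge\cdots\wedge da_p)=\sum_{i=1}^p(-1)^{i-1}\{m,a_i\}_N\otimes da_1\wedge\cdots\widehat{da_i}\cdots\wedge da_p+\sum_{1\le i<j\le p}(-1)^{i+j}m\otimes d\{a_i,a_j\}\wedge da_1\wedge\cdots\widehat{da_i}\cdots\widehat{da_j}\cdots\wedge da_p .$$ Poisson cohomology: let $\mathfrak X^p(M)$ be the set of all $F\in \mathrm{Hom}_k(\wedge^p R,M)$ (skew-symmetric $p$-fold $k$-linear maps) that are derivations in each argument; $\mathfrak X^0(M)=M$. $\mathrm{PH}^p(R,M)$ is the $p$-th cohomology of the cochain complex $\mathfrak X^\bullet(M)$ with differential $\delta:\mathfrak X^p(M)\to\mathfrak X^{p+1}(M)$, $$\delta(F)(a_1\wedge\cdots\wedge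 a_{p+1})=\sum_{i=1}^{p+1}(-1)^i\{F(a_1\wedge\cdots\widehat{a_i}\cdots\wedge a_{p+1}),a_i\}_M+\sum_{1\le i<j\le p+1}(-1)^{i+j}F(\{a_i,a_j\}\wedge a_1\wedge\cdots\widehat{a_i}\cdots\widehat{a_j}\cdots\wedge a_{p+1}).$$ Convention: $\mathrm{PH}^q(R,M)=0$ for $q<0$. *)

theory Defs
  imports
    "HOL-Library.Poly_Mapping"
    "HOL-Algebra.Module"
    "HOL-Algebra.AbelCoset"
begin

section \<open>Linear maps, quotients and presentations of modules\<close>

definition lin_hom ::
  "('a, 'r) ring_scheme \<Rightarrow> ('a, 'v, 's) module_scheme \<Rightarrow> ('a, 'w, 't) module_scheme \<Rightarrow> ('v \<Rightarrow> 'w) set"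
  where "lin_hom R V W = {h \<in> carrier V \<rightarrow> carrier W.
     (\<forall>x\<in>carrier V. \<forall>y\<in>carrier V. h (x \<oplus>\<^bsub>V\<^esub> y) = h x \<oplus>\<^bsub>W\<^esub> h y) \<and>
     (\<forall>c\<in>carrier R. \<forall>x\<in>carrier V. h (c \<odot>\<^bsub>V\<^esub> x) = c \<odot>\<^bsub>W\<^esub> h x)}"

definition lin_iso ::
  "('a, 'r) ring_scheme \<Rightarrow> ('a, 'v, 's) module_scheme \<Rightarrow> ('a, 'w, 't) module_scheme \<Rightarrow> ('v \<Rightarrow> 'w) set"
  where "lin_iso R V W = {h \<in> lin_hom R V W. bij_betw h (carrier V) (carrier W)}"

text \<open>The record type of modules extends that of rings; the ring multiplication and unit play no
  role for modules and are left unspecified below.\<close>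

definition zero_module :: "'v \<Rightarrow> ('a, 'v) module"
  where "zero_module z = \<lparr>carrier = {z}, mult = undefined, one = undefined, zero = z,
     add = (\<lambda>_ _. z), smult = (\<lambda>_ _. z)\<rparr>"

definition quotient_module :: "('a, 'v, 's) module_scheme \<Rightarrow> 'v set \<Rightarrow> ('a, 'v set) module"
  where "quotient_module V N = \<lparr>carrier = a_rcosets\<^bsub>V\<^esub> N, mult = undefined, one = undefined,
     zero = N, add = set_add V,
     smult = (\<lambda>c C. \<Union>x\<in>C. N +>\<^bsub>V\<^esub> (c \<odot>\<^bsub>V\<^esub> x))\<rparr>"

text \<open>The map induced on cosets by \<open>h\<close>; all members of the union are the same coset whenever
  \<open>h\<close> is compatible with the two submodules.\<close>

definition induced_map :: "('a, 'w, 't) module_scheme \<Rightarrow> 'w set \<Rightarrow> ('v \<Rightarrow> 'w) \<Rightarrow> 'v set \<Rightarrow> 'w set"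
  where "induced_map W N h C = (\<Union>x\<in>C. N +>\<^bsub>W\<^esub> h x)"

definition submodule_span :: "('a, 'r) ring_scheme \<Rightarrow> ('a, 'v) module \<Rightarrow> 'v set \<Rightarrow> 'v set"
  where "submodule_span R V G = \<Inter>{H. submodule H R V \<and> G \<subseteq> H}"

definition free_module :: "('a, 'r) ring_scheme \<Rightarrow> 's set \<Rightarrow> ('a, 's \<Rightarrow> 'a) module"
  where "free_module R S = \<lparr>
     carrier = {f. (\<forall>s\<in>S. f s \<in> carrier R) \<and> (\<forall>s. s \<notin> S \<longrightarrow> f s = \<zero>\<^bsub>R\<^esub>) \<and> finite {s. f s \<noteq> \<zero>\<^bsub>R\<^esub>}},
     mult = undefined, one = undefined,
     zero = (\<lambda>_. \<zero>\<^bsub>R\<^esub>), add = (\<lambda>f g s. f s \<oplus>\<^bsub>R\<^esub> g s), smult = (\<lambda>c f s. c \<otimes>\<^bsub>R\<^esub> f s)\<rparr>"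

definition free_gen :: "('a, 'r) ring_scheme \<Rightarrow> 's \<Rightarrow> 's \<Rightarrow> 'a"
  where "free_gen R s = (\<lambda>t. if t = s then \<one>\<^bsub>R\<^esub> else \<zero>\<^bsub>R\<^esub>)"

definition presented_module ::
  "('a, 'r) ring_scheme \<Rightarrow> 's set \<Rightarrow> ('s \<Rightarrow> 'a) set \<Rightarrow> ('a, ('s \<Rightarrow> 'a) set) module"
  where "presented_module R S E =
     quotient_module (free_module R S) (submodule_span R (free_module R S) E)"

definition presented_gen ::
  "('a, 'r) ring_scheme \<Rightarrow> 's set \<Rightarrow> ('s \<Rightarrow> 'a) set \<Rightarrow> 's \<Rightarrow> ('s \<Rightarrow> 'a) set"
  where "presented_gen R S E s =
     submodule_span R (free_module R S) E +>\<^bsub>free_module R S\<^esub> free_gen R s"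

definition scalar :: "('k, 'a, 's) module_scheme \<Rightarrow> ('a, 'v, 't) module_scheme \<Rightarrow> 'k \<Rightarrow> 'v \<Rightarrow> 'v"
  where "scalar R V c v = (c \<odot>\<^bsub>R\<^esub> \<one>\<^bsub>R\<^esub>) \<odot>\<^bsub>V\<^esub> v"

definition restrict_scalars ::
  "('k, 'a, 's) module_scheme \<Rightarrow> ('a, 'v, 't) module_scheme \<Rightarrow> ('k, 'v) module"
  where "restrict_scalars R V = \<lparr>carrier = carrier V, mult = mult V, one = one V,
     zero = zero V, add = add V, smult = scalar R V\<rparr>"

text \<open>\<open>signed V i x\<close> is $(-1)^i x$.\<close>

definition signed :: "('v, 's) ring_scheme \<Rightarrow> nat \<Rightarrow> 'v \<Rightarrow> 'v"
  where "signed V i x = (if even i then x else \<ominus>\<^bsub>V\<^esub> x)"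

definition tuples :: "nat \<Rightarrow> 'a set \<Rightarrow> 'a list set"
  where "tuples p A = {xs. length xs = p \<and> set xs \<subseteq> A}"

definition omit :: "nat \<Rightarrow> 'a list \<Rightarrow> 'a list"
  where "omit i xs = take i xs @ drop (Suc i) xs"


section \<open>Tensor products, exterior powers and differential forms\<close>

definition tensor_rels ::
  "('a, 'r) ring_scheme \<Rightarrow> ('a, 'v, 's) module_scheme \<Rightarrow> ('a, 'w, 't) module_scheme \<Rightarrow> ('v \<times> 'w \<Rightarrow> 'a) set"
  where "tensor_rels R V W = (let F = free_module R (carrier V \<times> carrier W); g = free_gen R in
     {g (v \<oplus>\<^bsub>V\<^esub> v', w) \<ominus>\<^bsub>F\<^esub> (g (v, w) \<oplus>\<^bsub>F\<^esub> g (v', w)) | v v' w.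
        v \<in> carrier V \<and> v' \<in> carrier V \<and> w \<in> carrier W} \<union>
     {g (v, w \<oplus>\<^bsub>W\<^esub> w') \<ominus>\<^bsub>F\<^esub> (g (v, w) \<oplus>\<^bsub>F\<^esub> g (v, w')) | v w w'.
        v \<in> carrier V \<and> w \<in> carrier W \<and> w' \<in> carrier W} \<union>
     {g (r \<odot>\<^bsub>V\<^esub> v, w) \<ominus>\<^bsub>F\<^esub> (r \<odot>\<^bsub>F\<^esub> g (v, w)) | r v w.
        r \<in> carrier R \<and> v \<in> carrier V \<and> w \<in> carrier W} \<union>
     {g (v, r \<odot>\<^bsub>W\<^esub> w) \<ominus>\<^bsub>F\<^esub> (r \<odot>\<^bsub>F\<^esub> g (v, w)) | r v w.
        r \<in> carrier R \<and> v \<in> carrier V \<and> w \<in> carrier W})"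

definition tensor ::
  "('a, 'r) ring_scheme \<Rightarrow> ('a, 'v, 's) module_scheme \<Rightarrow> ('a, 'w, 't) module_scheme
     \<Rightarrow> ('a, ('v \<times> 'w \<Rightarrow> 'a) set) module"
  where "tensor R V W = presented_module R (carrier V \<times> carrier W) (tensor_rels R V W)"

definition pure_tensor ::
  "('a, 'r) ring_scheme \<Rightarrow> ('a, 'v, 's) module_scheme \<Rightarrow> ('a, 'w, 't) module_scheme
     \<Rightarrow> 'v \<Rightarrow> 'w \<Rightarrow> ('v \<times> 'w \<Rightarrow> 'a) set"
  where "pure_tensor R V W v w =
     presented_gen R (carrier V \<times> carrier W) (tensor_rels R V W) (v, w)"

text \<open>The map \<open>h \<otimes> id\<close>.\<close>

definition tensor_map ::
  "('a, 'r) ring_scheme \<Rightarrow> ('a, 'v, 's) module_scheme \<Rightarrow> ('a, 'v', 's') module_scheme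
     \<Rightarrow> ('a, 'w, 't) module_scheme \<Rightarrow> ('v \<Rightarrow> 'v') \<Rightarrow> ('v \<times> 'w \<Rightarrow> 'a) set \<Rightarrow> ('v' \<times> 'w \<Rightarrow> 'a) set"
  where "tensor_map R V V' W h = (THE g.
     g \<in> lin_hom R (tensor R V W) (tensor R V' W) \<and> g \<in> extensional (carrier (tensor R V W)) \<and>
     (\<forall>v\<in>carrier V. \<forall>w\<in>carrier W. g (pure_tensor R V W v w) = pure_tensor R V' W (h v) w))"

definition exterior_rels ::
  "('a, 'r) ring_scheme \<Rightarrow> nat \<Rightarrow> ('a, 'v, 's) module_scheme \<Rightarrow> ('v list \<Rightarrow> 'a) set"
  where "exterior_rels R p V = (let F = free_module R (tuples p (carrier V)); g = free_gen R in
     {g (vs[i := v \<oplus>\<^bsub>V\<^esub> w]) \<ominus>\<^bsub>F\<^esub> (g (vs[i := v]) \<oplus>\<^bsub>F\<^esub> g (vs[i := w])) | vs i v w.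
        vs \<in> tuples p (carrier V) \<and> i < p \<and> v \<in> carrier V \<and> w \<in> carrier V} \<union>
     {g (vs[i := r \<odot>\<^bsub>V\<^esub> v]) \<ominus>\<^bsub>F\<^esub> (r \<odot>\<^bsub>F\<^esub> g (vs[i := v])) | vs i r v.
        vs \<in> tuples p (carrier V) \<and> i < p \<and> r \<in> carrier R \<and> v \<in> carrier V} \<union>
     {g vs | vs i j. vs \<in> tuples p (carrier V) \<and> i < j \<and> j < p \<and> vs ! i = vs ! j})"

definition exterior_power ::
  "('a, 'r) ring_scheme \<Rightarrow> nat \<Rightarrow> ('a, 'v, 's) module_scheme \<Rightarrow> ('a, ('v list \<Rightarrow> 'a) set) module"
  where "exterior_power R p V = presented_module R (tuples p (carrier V)) (exterior_rels R p V)"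

definition wedge ::
  "('a, 'r) ring_scheme \<Rightarrow> nat \<Rightarrow> ('a, 'v, 's) module_scheme \<Rightarrow> 'v list \<Rightarrow> ('v list \<Rightarrow> 'a) set"
  where "wedge R p V vs = presented_gen R (tuples p (carrier V)) (exterior_rels R p V) vs"

definition kaehler_rels ::
  "('k, 'l) ring_scheme \<Rightarrow> ('k, 'a, 's) module_scheme \<Rightarrow> ('a \<Rightarrow> 'a) set"
  where "kaehler_rels K R = (let F = free_module R (carrier R); g = free_gen R in
     {g (a \<oplus>\<^bsub>R\<^esub> b) \<ominus>\<^bsub>F\<^esub> (g a \<oplus>\<^bsub>F\<^esub> g b) | a b. a \<in> carrier R \<and> b \<in> carrier R} \<union>
     {g (c \<odot>\<^bsub>R\<^esub> a) \<ominus>\<^bsub>F\<^esub> scalar R F c (g a) | c a. c \<in> carrier K \<and> a \<in> carrier R} \<union>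
     {g (a \<otimes>\<^bsub>R\<^esub> b) \<ominus>\<^bsub>F\<^esub> (a \<odot>\<^bsub>F\<^esub> g b \<oplus>\<^bsub>F\<^esub> b \<odot>\<^bsub>F\<^esub> g a) | a b. a \<in> carrier R \<and> b \<in> carrier R})"

definition kaehler ::
  "('k, 'l) ring_scheme \<Rightarrow> ('k, 'a, 's) module_scheme \<Rightarrow> ('a, ('a \<Rightarrow> 'a) set) module"
  where "kaehler K R = presented_module R (carrier R) (kaehler_rels K R)"

definition kaehler_d ::
  "('k, 'l) ring_scheme \<Rightarrow> ('k, 'a, 's) module_scheme \<Rightarrow> 'a \<Rightarrow> ('a \<Rightarrow> 'a) set"
  where "kaehler_d K R a = presented_gen R (carrier R) (kaehler_rels K R) a"

type_synonym 'a form = "(('a \<Rightarrow> 'a) set list \<Rightarrow> 'a) set"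

definition forms ::
  "('k, 'l) ring_scheme \<Rightarrow> ('k, 'a, 's) module_scheme \<Rightarrow> nat \<Rightarrow> ('a, 'a form) module"
  where "forms K R p = exterior_power R p (kaehler K R)"

text \<open>\<open>d_wedge K R [a\<^sub>1, \<dots>, a\<^sub>p]\<close> is $da_1 \wedge \cdots \wedge da_p$.\<close>

definition d_wedge ::
  "('k, 'l) ring_scheme \<Rightarrow> ('k, 'a, 's) module_scheme \<Rightarrow> 'a list \<Rightarrow> 'a form"
  where "d_wedge K R as = wedge R (length as) (kaehler K R) (map (kaehler_d K R) as)"

definition de_rham ::
  "('k, 'l) ring_scheme \<Rightarrow> ('k, 'a, 's) module_scheme \<Rightarrow> nat \<Rightarrow> 'a form \<Rightarrow> 'a form"
  where "de_rham K R p = (THE h.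
     h \<in> lin_hom K (restrict_scalars R (forms K R p)) (restrict_scalars R (forms K R (Suc p))) \<and>
     h \<in> extensional (carrier (forms K R p)) \<and>
     (\<forall>a\<in>carrier R. \<forall>as\<in>tuples p (carrier R).
        h (a \<odot>\<^bsub>forms K R p\<^esub> d_wedge K R as) = d_wedge K R (a # as)))"

text \<open>Contraction with the derivation \<open>H\<close>, from \<open>p\<close>-forms to \<open>(p - 1)\<close>-forms. For \<open>p = 0\<close> the sum is
  empty and this is the zero map.\<close>

definition contraction ::
  "('k, 'l) ring_scheme \<Rightarrow> ('k, 'a, 's) module_scheme \<Rightarrow> ('a \<Rightarrow> 'a) \<Rightarrow> nat \<Rightarrow> 'a form \<Rightarrow> 'a form"
  where "contraction K R H p = (THE h.
     h \<in> lin_hom R (forms K R p) (forms K R (p - 1)) \<and>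
     h \<in> extensional (carrier (forms K R p)) \<and>
     (\<forall>as\<in>tuples p (carrier R). h (d_wedge K R as) =
        (\<Oplus>\<^bsub>forms K R (p - 1)\<^esub>i\<in>{..<p}. signed (forms K R (p - 1)) i
           (H (as ! i) \<odot>\<^bsub>forms K R (p - 1)\<^esub> d_wedge K R (omit i as)))))"

text \<open>Since $d$ has degree $1$ and $\iota_H$ degree $-1$, the graded commutator is
  $d\iota_H + \iota_H d$.\<close>

definition lie_derivative ::
  "('k, 'l) ring_scheme \<Rightarrow> ('k, 'a, 's) module_scheme \<Rightarrow> ('a \<Rightarrow> 'a) \<Rightarrow> nat \<Rightarrow> 'a form \<Rightarrow> 'a form"
  where "lie_derivative K R H p w =
     (if p = 0 then contraction K R H 1 (de_rham K R 0 w)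
      else de_rham K R (p - 1) (contraction K R H p w) \<oplus>\<^bsub>forms K R p\<^esub>
           contraction K R H (Suc p) (de_rham K R p w))"


section \<open>Poisson algebras and Poisson modules\<close>

record ('k, 'a) poisson_alg = "('k, 'a) module" +
  pbracket :: "'a \<Rightarrow> 'a \<Rightarrow> 'a"

record ('a, 'm) poisson_mod = "('a, 'm) module" +
  mbracket :: "'m \<Rightarrow> 'a \<Rightarrow> 'm"

locale poisson_algebra = field K + algebra K R
  for K :: "('k, 'l) ring_scheme" (structure) and R :: "('k, 'a, 's) poisson_alg_scheme" (structure) +
  assumes pbracket_closed:
      "\<lbrakk>a \<in> carrier R; b \<in> carrier R\<rbrakk> \<Longrightarrow> pbracket R a b \<in> carrier R"
    and pbracket_add_l: "\<lbrakk>a \<in> carrier R; b \<in> carrier R; c \<in> carrier R\<rbrakk> \<Longrightarrow>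
      pbracket R (a \<oplus>\<^bsub>R\<^esub> b) c = pbracket R a c \<oplus>\<^bsub>R\<^esub> pbracket R b c"
    and pbracket_add_r: "\<lbrakk>a \<in> carrier R; b \<in> carrier R; c \<in> carrier R\<rbrakk> \<Longrightarrow>
      pbracket R a (b \<oplus>\<^bsub>R\<^esub> c) = pbracket R a b \<oplus>\<^bsub>R\<^esub> pbracket R a c"
    and pbracket_smult_l: "\<lbrakk>r \<in> carrier K; a \<in> carrier R; b \<in> carrier R\<rbrakk> \<Longrightarrow>
      pbracket R (r \<odot>\<^bsub>R\<^esub> a) b = r \<odot>\<^bsub>R\<^esub> pbracket R a b"
    and pbracket_smult_r: "\<lbrakk>r \<in> carrier K; a \<in> carrier R; b \<in> carrier R\<rbrakk> \<Longrightarrow>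
      pbracket R a (r \<odot>\<^bsub>R\<^esub> b) = r \<odot>\<^bsub>R\<^esub> pbracket R a b"
    and pbracket_self: "a \<in> carrier R \<Longrightarrow> pbracket R a a = \<zero>\<^bsub>R\<^esub>"
    and pbracket_jacobi: "\<lbrakk>a \<in> carrier R; b \<in> carrier R; c \<in> carrier R\<rbrakk> \<Longrightarrow>
      pbracket R a (pbracket R b c) \<oplus>\<^bsub>R\<^esub> pbracket R b (pbracket R c a) \<oplus>\<^bsub>R\<^esub>
      pbracket R c (pbracket R a b) = \<zero>\<^bsub>R\<^esub>"
    and pbracket_mult_l: "\<lbrakk>a \<in> carrier R; b \<in> carrier R; c \<in> carrier R\<rbrakk> \<Longrightarrow>
      pbracket R (a \<otimes>\<^bsub>R\<^esub> b) c = a \<otimes>\<^bsub>R\<^esub> pbracket R b c \<oplus>\<^bsub>R\<^esub> b \<otimes>\<^bsub>R\<^esub> pbracket R a c"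
    and pbracket_mult_r: "\<lbrakk>a \<in> carrier R; b \<in> carrier R; c \<in> carrier R\<rbrakk> \<Longrightarrow>
      pbracket R a (b \<otimes>\<^bsub>R\<^esub> c) = b \<otimes>\<^bsub>R\<^esub> pbracket R a c \<oplus>\<^bsub>R\<^esub> c \<otimes>\<^bsub>R\<^esub> pbracket R a b"

text \<open>Right Poisson modules. Since \<open>R\<close> is commutative, $m \cdot a$ is written \<open>a \<odot>\<^bsub>M\<^esub> m\<close>. The
  $k$-vector space structure of \<open>M\<close> is the one obtained from the \<open>R\<close>-action through $k \to R$, which is
  forced by bilinearity of the action.\<close>

locale poisson_module = poisson_algebra K R + M?: module R M
  for K :: "('k, 'l) ring_scheme" (structure) and R :: "('k, 'a, 's) poisson_alg_scheme" (structure)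
    and M :: "('a, 'm, 't) poisson_mod_scheme" (structure) +
  assumes mbracket_closed:
      "\<lbrakk>m \<in> carrier M; a \<in> carrier R\<rbrakk> \<Longrightarrow> mbracket M m a \<in> carrier M"
    and mbracket_add_l: "\<lbrakk>m \<in> carrier M; m' \<in> carrier M; a \<in> carrier R\<rbrakk> \<Longrightarrow>
      mbracket M (m \<oplus>\<^bsub>M\<^esub> m') a = mbracket M m a \<oplus>\<^bsub>M\<^esub> mbracket M m' a"
    and mbracket_add_r: "\<lbrakk>m \<in> carrier M; a \<in> carrier R; b \<in> carrier R\<rbrakk> \<Longrightarrow>
      mbracket M m (a \<oplus>\<^bsub>R\<^esub> b) = mbracket M m a \<oplus>\<^bsub>M\<^esub> mbracket M m b"
    and mbracket_smult_l: "\<lbrakk>c \<in> carrier K; m \<in> carrier M; a \<in> carrier R\<rbrakk> \<Longrightarrow>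
      mbracket M (scalar R M c m) a = scalar R M c (mbracket M m a)"
    and mbracket_smult_r: "\<lbrakk>c \<in> carrier K; m \<in> carrier M; a \<in> carrier R\<rbrakk> \<Longrightarrow>
      mbracket M m (c \<odot>\<^bsub>R\<^esub> a) = scalar R M c (mbracket M m a)"
    and mbracket_lie: "\<lbrakk>m \<in> carrier M; a \<in> carrier R; b \<in> carrier R\<rbrakk> \<Longrightarrow>
      mbracket M m (pbracket R a b) =
        mbracket M (mbracket M m a) b \<ominus>\<^bsub>M\<^esub> mbracket M (mbracket M m b) a"
    and mbracket_action: "\<lbrakk>m \<in> carrier M; a \<in> carrier R; b \<in> carrier R\<rbrakk> \<Longrightarrow>
      mbracket M (a \<odot>\<^bsub>M\<^esub> m) b = a \<odot>\<^bsub>M\<^esub> mbracket M m b \<oplus>\<^bsub>M\<^esub> pbracket R a b \<odot>\<^bsub>M\<^esub> m"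
    and mbracket_mult: "\<lbrakk>m \<in> carrier M; a \<in> carrier R; b \<in> carrier R\<rbrakk> \<Longrightarrow>
      mbracket M m (a \<otimes>\<^bsub>R\<^esub> b) = b \<odot>\<^bsub>M\<^esub> mbracket M m a \<oplus>\<^bsub>M\<^esub> a \<odot>\<^bsub>M\<^esub> mbracket M m b"

definition poisson_mod_hom ::
  "('k, 'a, 's) poisson_alg_scheme \<Rightarrow> ('a, 'm, 't) poisson_mod_scheme \<Rightarrow>
     ('a, 'n, 'u) poisson_mod_scheme \<Rightarrow> ('m \<Rightarrow> 'n) set"
  where "poisson_mod_hom R M N = {f \<in> lin_hom R M N.
     \<forall>m\<in>carrier M. \<forall>a\<in>carrier R. f (mbracket M m a) = mbracket N (f m) a}"

definition modular_derivation ::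
  "('k, 'l) ring_scheme \<Rightarrow> ('k, 'a, 's) poisson_alg_scheme \<Rightarrow> nat \<Rightarrow> 'a form \<Rightarrow> 'a \<Rightarrow> 'a"
  where "modular_derivation K R n \<eta> f = (THE c. c \<in> carrier R \<and>
     lie_derivative K R (pbracket R f) n \<eta> = c \<odot>\<^bsub>forms K R n\<^esub> \<eta>)"

definition twist :: "('a \<Rightarrow> 'a) \<Rightarrow> ('a, 'm) poisson_mod \<Rightarrow> ('a, 'm) poisson_mod"
  where "twist \<phi> M = M\<lparr>mbracket := \<lambda>m a. mbracket M m a \<oplus>\<^bsub>M\<^esub> \<phi> a \<odot>\<^bsub>M\<^esub> m\<rparr>"


section \<open>Poisson homology\<close>

text \<open>Argument positions are counted from \<open>0\<close>, so $(-1)^{i-1}$ becomes \<open>(-1)\<^sup>i\<close> while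
  $(-1)^{i+j}$ is unchanged.\<close>

type_synonym ('a, 'm) chain = "('m \<times> 'a form \<Rightarrow> 'a) set"

definition chains ::
  "('k, 'l) ring_scheme \<Rightarrow> ('k, 'a, 's) module_scheme \<Rightarrow> ('a, 'm, 't) module_scheme \<Rightarrow> nat
     \<Rightarrow> ('k, ('a, 'm) chain) module"
  where "chains K R N p = restrict_scalars R (tensor R N (forms K R p))"

definition elem_chain ::
  "('k, 'l) ring_scheme \<Rightarrow> ('k, 'a, 's) module_scheme \<Rightarrow> ('a, 'm, 't) module_scheme
     \<Rightarrow> 'm \<Rightarrow> 'a list \<Rightarrow> ('a, 'm) chain"
  where "elem_chain K R N m as = pure_tensor R N (forms K R (length as)) m (d_wedge K R as)"

text \<open>The differential from degree \<open>p\<close> to degree \<open>p - 1\<close>. For \<open>p = 0\<close> both sums are empty and this is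
  the zero map, so that every chain of degree \<open>0\<close> is a cycle.\<close>

definition boundary ::
  "('k, 'l) ring_scheme \<Rightarrow> ('k, 'a, 's) poisson_alg_scheme \<Rightarrow> ('a, 'm, 't) poisson_mod_scheme
     \<Rightarrow> nat \<Rightarrow> ('a, 'm) chain \<Rightarrow> ('a, 'm) chain"
  where "boundary K R N p = (THE h.
     h \<in> lin_hom K (chains K R N p) (chains K R N (p - 1)) \<and>
     h \<in> extensional (carrier (chains K R N p)) \<and>
     (\<forall>m\<in>carrier N. \<forall>as\<in>tuples p (carrier R).
        h (elem_chain K R N m as) =
          (\<Oplus>\<^bsub>chains K R N (p - 1)\<^esub>i\<in>{..<p}. signed (chains K R N (p - 1)) i
              (elem_chain K R N (mbracket N m (as ! i)) (omit i as))) \<oplus>\<^bsub>chains K R N (p - 1)\<^esub>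
          (\<Oplus>\<^bsub>chains K R N (p - 1)\<^esub>j\<in>{..<p}. \<Oplus>\<^bsub>chains K R N (p - 1)\<^esub>i\<in>{..<j}. signed (chains K R N (p - 1)) (i + j)
              (elem_chain K R N m (pbracket R (as ! i) (as ! j) # omit i (omit j as))))))"

definition cycles ::
  "('k, 'l) ring_scheme \<Rightarrow> ('k, 'a, 's) poisson_alg_scheme \<Rightarrow> ('a, 'm, 't) poisson_mod_scheme
     \<Rightarrow> nat \<Rightarrow> ('a, 'm) chain set"
  where "cycles K R N p =
     {x \<in> carrier (chains K R N p). boundary K R N p x = \<zero>\<^bsub>chains K R N (p - 1)\<^esub>}"

definition boundaries ::
  "('k, 'l) ring_scheme \<Rightarrow> ('k, 'a, 's) poisson_alg_scheme \<Rightarrow> ('a, 'm, 't) poisson_mod_scheme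
     \<Rightarrow> nat \<Rightarrow> ('a, 'm) chain set"
  where "boundaries K R N p = boundary K R N (Suc p) ` carrier (chains K R N (Suc p))"

definition poisson_homology ::
  "('k, 'l) ring_scheme \<Rightarrow> ('k, 'a, 's) poisson_alg_scheme \<Rightarrow> ('a, 'm, 't) poisson_mod_scheme
     \<Rightarrow> nat \<Rightarrow> ('k, ('a, 'm) chain set) module"
  where "poisson_homology K R N p =
     quotient_module ((chains K R N p)\<lparr>carrier := cycles K R N p\<rparr>) (boundaries K R N p)"

definition poisson_homology_map ::
  "('k, 'l) ring_scheme \<Rightarrow> ('k, 'a, 's) poisson_alg_scheme \<Rightarrow> ('a, 'm, 't) poisson_mod_scheme
     \<Rightarrow> ('a, 'n, 'u) poisson_mod_scheme \<Rightarrow> nat \<Rightarrow> ('m \<Rightarrow> 'n)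
     \<Rightarrow> ('a, 'm) chain set \<Rightarrow> ('a, 'n) chain set"
  where "poisson_homology_map K R N N' p f =
     induced_map (chains K R N' p) (boundaries K R N' p) (tensor_map R N N' (forms K R p) f)"


section \<open>Poisson cohomology\<close>

text \<open>A $p$-cochain is a function on lists of length \<open>p\<close>; for \<open>p = 0\<close> it amounts to its value at the
  empty list, an arbitrary element of \<open>M\<close>.\<close>

type_synonym ('a, 'm) cochain = "'a list \<Rightarrow> 'm"

definition cochains ::
  "('k, 'l) ring_scheme \<Rightarrow> ('k, 'a, 's) module_scheme \<Rightarrow> ('a, 'm, 't) module_scheme \<Rightarrow> nat
     \<Rightarrow> ('k, ('a, 'm) cochain) module"
  where "cochains K R M p = \<lparr>
     carrier = {F \<in> tuples p (carrier R) \<rightarrow>\<^sub>E carrier M.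
       (\<forall>as\<in>tuples p (carrier R). \<forall>i<p. \<forall>a\<in>carrier R. \<forall>b\<in>carrier R.
          F (as[i := a \<oplus>\<^bsub>R\<^esub> b]) = F (as[i := a]) \<oplus>\<^bsub>M\<^esub> F (as[i := b])) \<and>
       (\<forall>as\<in>tuples p (carrier R). \<forall>i<p. \<forall>c\<in>carrier K. \<forall>a\<in>carrier R.
          F (as[i := c \<odot>\<^bsub>R\<^esub> a]) = scalar R M c (F (as[i := a]))) \<and>
       (\<forall>as\<in>tuples p (carrier R). \<forall>i<p. \<forall>j<p. i \<noteq> j \<longrightarrow>
          F (as[i := as ! j, j := as ! i]) = \<ominus>\<^bsub>M\<^esub> F as) \<and>
       (\<forall>as\<in>tuples p (carrier R). \<forall>i<p. \<forall>a\<in>carrier R. \<forall>b\<in>carrier R.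
          F (as[i := a \<otimes>\<^bsub>R\<^esub> b]) = a \<odot>\<^bsub>M\<^esub> F (as[i := b]) \<oplus>\<^bsub>M\<^esub> b \<odot>\<^bsub>M\<^esub> F (as[i := a]))},
     mult = undefined, one = undefined,
     zero = (\<lambda>as\<in>tuples p (carrier R). \<zero>\<^bsub>M\<^esub>),
     add = (\<lambda>F G. \<lambda>as\<in>tuples p (carrier R). F as \<oplus>\<^bsub>M\<^esub> G as),
     smult = (\<lambda>c F. \<lambda>as\<in>tuples p (carrier R). scalar R M c (F as))\<rparr>"

definition coboundary ::
  "('k, 'a, 's) poisson_alg_scheme \<Rightarrow> ('a, 'm, 't) poisson_mod_scheme \<Rightarrow> nat
     \<Rightarrow> ('a, 'm) cochain \<Rightarrow> ('a, 'm) cochain"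
  where "coboundary R M p F = (\<lambda>as\<in>tuples (Suc p) (carrier R).
     (\<Oplus>\<^bsub>M\<^esub>i\<in>{..<Suc p}. signed M (Suc i) (mbracket M (F (omit i as)) (as ! i))) \<oplus>\<^bsub>M\<^esub>
     (\<Oplus>\<^bsub>M\<^esub>j\<in>{..<Suc p}. \<Oplus>\<^bsub>M\<^esub>i\<in>{..<j}. signed M (i + j)
        (F (pbracket R (as ! i) (as ! j) # omit i (omit j as)))))"

definition cocycles ::
  "('k, 'l) ring_scheme \<Rightarrow> ('k, 'a, 's) poisson_alg_scheme \<Rightarrow> ('a, 'm, 't) poisson_mod_scheme
     \<Rightarrow> nat \<Rightarrow> ('a, 'm) cochain set"
  where "cocycles K R M p =
     {F \<in> carrier (cochains K R M p). coboundary R M p F = \<zero>\<^bsub>cochains K R M (Suc p)\<^esub>}"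

definition coboundaries ::
  "('k, 'l) ring_scheme \<Rightarrow> ('k, 'a, 's) poisson_alg_scheme \<Rightarrow> ('a, 'm, 't) poisson_mod_scheme
     \<Rightarrow> nat \<Rightarrow> ('a, 'm) cochain set"
  where "coboundaries K R M p =
     (if p = 0 then {\<zero>\<^bsub>cochains K R M 0\<^esub>}
      else coboundary R M (p - 1) ` carrier (cochains K R M (p - 1)))"

definition poisson_cohomology ::
  "('k, 'l) ring_scheme \<Rightarrow> ('k, 'a, 's) poisson_alg_scheme \<Rightarrow> ('a, 'm, 't) poisson_mod_scheme
     \<Rightarrow> int \<Rightarrow> ('k, ('a, 'm) cochain set) module"
  where "poisson_cohomology K R M q =
     (if q < 0 then zero_module {}
      else quotient_module ((cochains K R M (nat q))\<lparr>carrier := cocycles K R M (nat q)\<rparr>)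
             (coboundaries K R M (nat q)))"

definition poisson_cohomology_map ::
  "('k, 'l) ring_scheme \<Rightarrow> ('k, 'a, 's) poisson_alg_scheme \<Rightarrow> ('a, 'n, 'u) poisson_mod_scheme
     \<Rightarrow> int \<Rightarrow> ('m \<Rightarrow> 'n) \<Rightarrow> ('a, 'm) cochain set \<Rightarrow> ('a, 'n) cochain set"
  where "poisson_cohomology_map K R M' q f =
     (if q < 0 then (\<lambda>_. {})
      else induced_map (cochains K R M' (nat q)) (coboundaries K R M' (nat q))
             (\<lambda>F. \<lambda>as\<in>tuples (nat q) (carrier R). f (F as)))"


section \<open>Polynomial Poisson algebras\<close>

definition type_field :: "'k::field ring"
  where "type_field = \<lparr>carrier = UNIV, mult = (*), one = 1, zero = 0, add = (+)\<rparr>"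

text \<open>Polynomials in countably many variables with coefficients in \<open>'k\<close>; $k[x_1, \dots, x_n]$ is the
  subalgebra of those involving only the variables with index below \<open>n\<close>.\<close>

type_synonym 'k mpoly = "(nat \<Rightarrow>\<^sub>0 nat) \<Rightarrow>\<^sub>0 'k"

definition poly_var :: "nat \<Rightarrow> 'k::field mpoly"
  where "poly_var i = Poly_Mapping.single (Poly_Mapping.single i 1) 1"

definition poly_poisson_alg ::
  "nat \<Rightarrow> ('k mpoly \<Rightarrow> 'k mpoly \<Rightarrow> 'k mpoly) \<Rightarrow> ('k::field, 'k mpoly) poisson_alg"
  where "poly_poisson_alg n br = \<lparr>
     carrier = {f. \<forall>t\<in>Poly_Mapping.keys f. Poly_Mapping.keys t \<subseteq> {..<n}},
     mult = (*), one = 1, zero = 0, add = (+),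
     smult = (\<lambda>c f. Poly_Mapping.single 0 c * f), pbracket = br\<rparr>"

definition volume_form :: "('k::field, 'k mpoly) poisson_alg \<Rightarrow> nat \<Rightarrow> 'k mpoly form"
  where "volume_form R n = d_wedge type_field R (map poly_var [0..<n])"

end

theory Submission
  imports "Jordan_Normal_Form.Determinant" Defs
begin

text \<open>
  Write \<open>J\<close> for the Jacobian determinant of \<open>n\<close> polynomials. The map sending
  \<open>m \<otimes> db\<^sub>1 \<and> \<dots> \<and> db\<^sub>p\<close> to the cochain
  \<open>(a\<^sub>1, \<dots>, a\<^sub>n\<^sub>-\<^sub>p) \<mapsto> J(b\<^sub>1, \<dots>, b\<^sub>p, a\<^sub>1, \<dots>, a\<^sub>n\<^sub>-\<^sub>p) m\<close>
  is an isomorphism from \<open>p\<close>-chains to \<open>(n - p)\<close>-cochains, because forms and skew multiderivations are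
  determined by their coefficients at increasing tuples of variables, and on those \<open>J\<close> pairs
  complementary tuples to \<open>\<plusminus>1\<close> and all other ones to \<open>0\<close>.

  It commutes with the differentials up to the sign \<open>(-1)\<^sup>p\<close>. Two facts give this. First, for a
  derivation \<open>D\<close> and \<open>n + 1\<close> polynomials \<open>c\<^sub>i\<close>, the alternating sum of
  \<open>D c\<^sub>i J(c\<^sub>0, \<dots>, c\<^sub>i\<^sub>-\<^sub>1, c\<^sub>i\<^sub>+\<^sub>1, \<dots>, c\<^sub>n)\<close> is a Laplace expansion with two equal columns and vanishes;
  applied to \<open>D = {m, -}\<close> it matches the terms that contain the bracket of \<open>M\<close>. Second, the Lie derivative
  along a Hamiltonian derivation shows that
  \<open>{f, J(c\<^sub>1, \<dots>, c\<^sub>n)} + \<phi>(f) J(c\<^sub>1, \<dots>, c\<^sub>n) = \<Sum>\<^sub>i J(c\<^sub>1, \<dots>, {f, c\<^sub>i}, \<dots>, c\<^sub>n)\<close> with \<open>\<phi>\<close>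
  the modular derivation, so the terms of the twist account exactly for the difference between the brackets of
  polynomials on the two sides.
\<close>

section \<open>Linear maps and quotient modules\<close>

text \<open>The operators \<open>boundary\<close>, \<open>de_rham\<close>,
  \<open>contraction\<close>, \<open>tensor_map\<close> and \<open>modular_derivation\<close> are
  definite descriptions, so nothing can be said about them before existence and uniqueness are
  known. For the boundary map, checking the formula against all relations of tensor and exterior
  products is avoided: the signed coboundary is pulled back through the bijection of chains with
  cochains, and the two facts of the overview show that it has the prescribed values on elementary
  chains. For the Lie derivative of the volume form, \<open>de_rham\<close> and
  \<open>contraction\<close> are determined only next to the top degree, where a form is a single
  coefficient or a vector field. The sign (-1)^p is not built into the map: it changes neither
  kernels nor images. Polynomial identities that are alternating and derivations in each slot are
  verified on variables only, where Jacobians are constant; this replaces computations with second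
  derivatives. Characteristic zero serves to divide by two when sums over pairs \<open>i < j\<close>
  are compared with sums over full squares, and to pass from skew-symmetric to alternating.\<close>

lemma lin_homI:
  assumes "\<And>x. x \<in> carrier V \<Longrightarrow> h x \<in> carrier W"
    and "\<And>x y. \<lbrakk>x \<in> carrier V; y \<in> carrier V\<rbrakk> \<Longrightarrow> h (x \<oplus>\<^bsub>V\<^esub> y) = h x \<oplus>\<^bsub>W\<^esub> h y"
    and "\<And>c x. \<lbrakk>c \<in> carrier R; x \<in> carrier V\<rbrakk> \<Longrightarrow> h (c \<odot>\<^bsub>V\<^esub> x) = c \<odot>\<^bsub>W\<^esub> h x"
  shows "h \<in> lin_hom R V W"
  using assms unfolding lin_hom_def by auto

lemma
  assumes "h \<in> lin_hom R V W"
  shows lin_hom_closed: "x \<in> carrier V \<Longrightarrow> h x \<in> carrier W"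
    and lin_hom_add: "\<lbrakk>x \<in> carrier V; y \<in> carrier V\<rbrakk> \<Longrightarrow> h (x \<oplus>\<^bsub>V\<^esub> y) = h x \<oplus>\<^bsub>W\<^esub> h y"
    and lin_hom_smult: "\<lbrakk>c \<in> carrier R; x \<in> carrier V\<rbrakk> \<Longrightarrow> h (c \<odot>\<^bsub>V\<^esub> x) = c \<odot>\<^bsub>W\<^esub> h x"
  using assms unfolding lin_hom_def by auto

text \<open>Only additivity is assumed because the maps of interest are linear over different rings:
  lifts to forms and tensors are \<open>R\<close>-linear, while the boundary and the exterior
  derivative are merely \<open>k\<close>-linear. Zero, negatives, signs and finite sums need no more
  than this.\<close>

locale additive_map = V: abelian_group V + W: abelian_group W
  for V :: "('v, 's) ring_scheme" and W :: "('w, 't) ring_scheme" and h :: "'v \<Rightarrow> 'w" +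
  assumes closed [simp]: "x \<in> carrier V \<Longrightarrow> h x \<in> carrier W"
    and add: "\<lbrakk>x \<in> carrier V; y \<in> carrier V\<rbrakk> \<Longrightarrow> h (x \<oplus>\<^bsub>V\<^esub> y) = h x \<oplus>\<^bsub>W\<^esub> h y"
begin

lemma zero: "h \<zero>\<^bsub>V\<^esub> = \<zero>\<^bsub>W\<^esub>"
proof -
  have "h \<zero>\<^bsub>V\<^esub> \<oplus>\<^bsub>W\<^esub> h \<zero>\<^bsub>V\<^esub> = h \<zero>\<^bsub>V\<^esub>"
    using add[of "\<zero>\<^bsub>V\<^esub>" "\<zero>\<^bsub>V\<^esub>"] by simp
  then show ?thesis
    by (metis V.zero_closed W.add.r_cancel_one' closed)
qed

lemma uminus:
  assumes "x \<in> carrier V"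
  shows "h (\<ominus>\<^bsub>V\<^esub> x) = \<ominus>\<^bsub>W\<^esub> h x"
proof -
  have "h (\<ominus>\<^bsub>V\<^esub> x) \<oplus>\<^bsub>W\<^esub> h x = \<zero>\<^bsub>W\<^esub>"
    using add[of "\<ominus>\<^bsub>V\<^esub> x" x] assms by (simp add: V.l_neg zero)
  then show ?thesis
    using assms by (simp add: W.minus_equality)
qed

lemma diff:
  assumes "x \<in> carrier V" "y \<in> carrier V"
  shows "h (x \<ominus>\<^bsub>V\<^esub> y) = h x \<ominus>\<^bsub>W\<^esub> h y"
  using assms by (simp add: V.minus_eq W.minus_eq add uminus)

lemma signed:
  assumes "x \<in> carrier V"
  shows "h (signed V i x) = signed W i (h x)"
  using assms by (simp add: signed_def uminus)

lemma finsum: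
  assumes "finite A" "f \<in> A \<rightarrow> carrier V"
  shows "h (\<Oplus>\<^bsub>V\<^esub>i\<in>A. f i) = (\<Oplus>\<^bsub>W\<^esub>i\<in>A. h (f i))"
  using assms
proof (induction rule: finite_induct)
  case empty
  then show ?case by (simp add: zero)
next
  case (insert a A)
  then have "f a \<in> carrier V" "f \<in> A \<rightarrow> carrier V" "(\<lambda>i. h (f i)) \<in> A \<rightarrow> carrier W"
    by (auto simp: Pi_iff)
  with insert show ?case by (simp add: add)
qed

end

lemma lin_hom_additive_map:
  assumes "h \<in> lin_hom R V W" "abelian_group V" "abelian_group W"
  shows "additive_map V W h"
  using assms by (intro additive_map.intro additive_map_axioms.intro) (auto simp: lin_hom_def)

lemma (in abelian_group) signed_closed [simp]:
  "x \<in> carrier G \<Longrightarrow> signed G i x \<in> carrier G"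
  by (simp add: signed_def)

lemma (in abelian_group) uminus_zero: "\<ominus> \<zero> = \<zero>"
  by (rule minus_equality) simp_all

lemma (in module) diff_eq_zero_iff:
  "\<lbrakk>x \<in> carrier M; y \<in> carrier M\<rbrakk> \<Longrightarrow> x \<ominus>\<^bsub>M\<^esub> y = \<zero>\<^bsub>M\<^esub> \<longleftrightarrow> x = y"
  by (metis M.add.inv_closed M.minus_eq M.minus_equality M.minus_minus M.r_neg)

section \<open>Free modules and their universal property\<close>

lemma free_module_simps [simp]:
  "f \<in> carrier (free_module R S) \<longleftrightarrow> (\<forall>s\<in>S. f s \<in> carrier R) \<and> (\<forall>s. s \<notin> S \<longrightarrow> f s = \<zero>\<^bsub>R\<^esub>) \<and>
     finite {s. f s \<noteq> \<zero>\<^bsub>R\<^esub>}"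
  "\<zero>\<^bsub>free_module R S\<^esub> = (\<lambda>_. \<zero>\<^bsub>R\<^esub>)"
  "f \<oplus>\<^bsub>free_module R S\<^esub> g = (\<lambda>s. f s \<oplus>\<^bsub>R\<^esub> g s)"
  "c \<odot>\<^bsub>free_module R S\<^esub> f = (\<lambda>s. c \<otimes>\<^bsub>R\<^esub> f s)"
  by (auto simp: free_module_def)

context cring begin

lemma free_module_coeff_closed:
  "f \<in> carrier (free_module R S) \<Longrightarrow> f s \<in> carrier R"
  by (cases "s \<in> S") auto

lemma free_module_add_closed:
  assumes "f \<in> carrier (free_module R S)" "g \<in> carrier (free_module R S)"
  shows "f \<oplus>\<^bsub>free_module R S\<^esub> g \<in> carrier (free_module R S)"
proof -
  have "{s. f s \<oplus> g s \<noteq> \<zero>} \<subseteq> {s. f s \<noteq> \<zero>} \<union> {s. g s \<noteq> \<zero>}"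
    by auto
  moreover have "finite ({s. f s \<noteq> \<zero>} \<union> {s. g s \<noteq> \<zero>})"
    using assms by simp
  ultimately have "finite {s. f s \<oplus> g s \<noteq> \<zero>}"
    by (rule finite_subset)
  with assms show ?thesis by auto
qed

lemma free_module_smult_closed:
  assumes "c \<in> carrier R" "f \<in> carrier (free_module R S)"
  shows "c \<odot>\<^bsub>free_module R S\<^esub> f \<in> carrier (free_module R S)"
proof -
  have "{s. c \<otimes> f s \<noteq> \<zero>} \<subseteq> {s. f s \<noteq> \<zero>}"
    using assms by auto
  moreover have "finite {s. f s \<noteq> \<zero>}"
    using assms by simp
  ultimately have "finite {s. c \<otimes> f s \<noteq> \<zero>}"
    by (rule finite_subset)
  with assms show ?thesis by auto
qed

lemma free_module_is_module: "module R (free_module R S)"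
proof (rule moduleI)
  note coeff = free_module_coeff_closed
  show "abelian_group (free_module R S)"
  proof (rule abelian_groupI)
    fix f assume f: "f \<in> carrier (free_module R S)"
    have "(\<ominus> \<one>) \<odot>\<^bsub>free_module R S\<^esub> f \<oplus>\<^bsub>free_module R S\<^esub> f = \<zero>\<^bsub>free_module R S\<^esub>"
      using coeff[OF f] by (auto simp: l_minus l_neg)
    then show "\<exists>g\<in>carrier (free_module R S). g \<oplus>\<^bsub>free_module R S\<^esub> f = \<zero>\<^bsub>free_module R S\<^esub>"
      using f by (meson a_inv_closed free_module_smult_closed one_closed)
  next
    fix f g h
    assume f: "f \<in> carrier (free_module R S)" and g: "g \<in> carrier (free_module R S)"
      and h: "h \<in> carrier (free_module R S)"
    show "f \<oplus>\<^bsub>free_module R S\<^esub> g \<oplus>\<^bsub>free_module R S\<^esub> h = f \<oplus>\<^bsub>free_module R S\<^esub> (g \<oplus>\<^bsub>free_module R S\<^esub> h)"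
      using coeff[OF f] coeff[OF g] coeff[OF h] by (simp add: a_assoc)
  next
    fix f g
    assume f: "f \<in> carrier (free_module R S)" and g: "g \<in> carrier (free_module R S)"
    show "f \<oplus>\<^bsub>free_module R S\<^esub> g = g \<oplus>\<^bsub>free_module R S\<^esub> f"
      using coeff[OF f] coeff[OF g] by (simp add: a_comm)
  next
    fix f assume f: "f \<in> carrier (free_module R S)"
    show "\<zero>\<^bsub>free_module R S\<^esub> \<oplus>\<^bsub>free_module R S\<^esub> f = f"
      using coeff[OF f] by simp
  next
    fix f g assume "f \<in> carrier (free_module R S)" "g \<in> carrier (free_module R S)"
    then show "f \<oplus>\<^bsub>free_module R S\<^esub> g \<in> carrier (free_module R S)"
      by (rule free_module_add_closed)
  qed simp
  show "cring R" by (rule is_cring)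
next
  fix a f assume "a \<in> carrier R" "f \<in> carrier (free_module R S)"
  then show "a \<odot>\<^bsub>free_module R S\<^esub> f \<in> carrier (free_module R S)"
    by (rule free_module_smult_closed)
next
  fix a b f assume a: "a \<in> carrier R" "b \<in> carrier R" and f: "f \<in> carrier (free_module R S)"
  show "(a \<oplus> b) \<odot>\<^bsub>free_module R S\<^esub> f = a \<odot>\<^bsub>free_module R S\<^esub> f \<oplus>\<^bsub>free_module R S\<^esub> b \<odot>\<^bsub>free_module R S\<^esub> f"
    using a free_module_coeff_closed[OF f] by (simp add: l_distr)
  show "(a \<otimes> b) \<odot>\<^bsub>free_module R S\<^esub> f = a \<odot>\<^bsub>free_module R S\<^esub> (b \<odot>\<^bsub>free_module R S\<^esub> f)"
    using a free_module_coeff_closed[OF f] by (simp add: m_assoc)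
next
  fix a f g assume a: "a \<in> carrier R" and f: "f \<in> carrier (free_module R S)"
    and g: "g \<in> carrier (free_module R S)"
  show "a \<odot>\<^bsub>free_module R S\<^esub> (f \<oplus>\<^bsub>free_module R S\<^esub> g) = a \<odot>\<^bsub>free_module R S\<^esub> f \<oplus>\<^bsub>free_module R S\<^esub> a \<odot>\<^bsub>free_module R S\<^esub> g"
    using a free_module_coeff_closed[OF f] free_module_coeff_closed[OF g] by (simp add: r_distr)
next
  fix f assume f: "f \<in> carrier (free_module R S)"
  show "\<one> \<odot>\<^bsub>free_module R S\<^esub> f = f"
    using free_module_coeff_closed[OF f] by simp
qed

lemma free_gen_closed: "s \<in> S \<Longrightarrow> free_gen R s \<in> carrier (free_module R S)"
  by (auto simp: free_gen_def)

text \<open>Induction on a finite set containing the support: the value at one further point is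
  split off as a multiple of a generator.\<close>

lemma free_module_induct:
  assumes "f \<in> carrier (free_module R S)"
    and zero: "P \<zero>\<^bsub>free_module R S\<^esub>"
    and add: "\<And>g h. \<lbrakk>g \<in> carrier (free_module R S); h \<in> carrier (free_module R S); P g; P h\<rbrakk>
      \<Longrightarrow> P (g \<oplus>\<^bsub>free_module R S\<^esub> h)"
    and gen: "\<And>c s. \<lbrakk>c \<in> carrier R; s \<in> S\<rbrakk> \<Longrightarrow> P (c \<odot>\<^bsub>free_module R S\<^esub> free_gen R s)"
  shows "P f"
proof -
  have "\<forall>f. f \<in> carrier (free_module R S) \<and> {s. f s \<noteq> \<zero>} \<subseteq> T \<longrightarrow> P f" if "finite T" for T
    using that
  proof (induction rule: finite_induct)
    case empty
    show ?case
    proof (intro allI impI)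
      fix f assume "f \<in> carrier (free_module R S) \<and> {s. f s \<noteq> \<zero>} \<subseteq> {}"
      then have "f = \<zero>\<^bsub>free_module R S\<^esub>" by auto
      then show "P f" using zero by simp
    qed
  next
    case (insert t T)
    show ?case
    proof (intro allI impI)
      fix f assume f: "f \<in> carrier (free_module R S) \<and> {s. f s \<noteq> \<zero>} \<subseteq> insert t T"
      let ?g = "f(t := \<zero>)" and ?h = "f t \<odot>\<^bsub>free_module R S\<^esub> free_gen R t"
      note coeff = free_module_coeff_closed[of f S]
      show "P f"
      proof (cases "f t = \<zero>")
        case True
        with f have "{s. f s \<noteq> \<zero>} \<subseteq> T" by auto
        with f insert.IH show ?thesis by blast
      next
        case False
        then have t: "t \<in> S" using f by auto
        have "{s. ?g s \<noteq> \<zero>} \<subseteq> {s. f s \<noteq> \<zero>}" by auto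
        then have "finite {s. ?g s \<noteq> \<zero>}"
          by (rule finite_subset) (use f in simp)
        then have g: "?g \<in> carrier (free_module R S)" using f by auto
        have "{s. ?g s \<noteq> \<zero>} \<subseteq> T" using f by auto
        then have "P ?g" using insert.IH g by blast
        moreover have "P ?h" using gen t f coeff by blast
        moreover have "?h \<in> carrier (free_module R S)"
          using t f coeff by (intro free_module_smult_closed free_gen_closed) auto
        ultimately have "P (?g \<oplus>\<^bsub>free_module R S\<^esub> ?h)" using g add by blast
        moreover have "?g \<oplus>\<^bsub>free_module R S\<^esub> ?h = f"
          using f coeff by (auto simp: free_gen_def fun_eq_iff)
        ultimately show ?thesis by simp
      qed
    qed
  qed
  from this[of "{s. f s \<noteq> \<zero>}"] show ?thesis using assms(1) by simp
qed

end

lemma (in module) free_module_lift: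
  assumes f: "f \<in> S \<rightarrow> carrier M"
  shows "\<exists>h\<in>lin_hom R (free_module R S) M. \<forall>s\<in>S. h (free_gen R s) = f s"
proof -
  define h where "h a = (\<Oplus>\<^bsub>M\<^esub>s\<in>{s. a s \<noteq> \<zero>}. a s \<odot>\<^bsub>M\<^esub> f s)" for a
  have supp: "{s. a s \<noteq> \<zero>} \<subseteq> S" if "a \<in> carrier (free_module R S)" for a
    using that by auto
  have summand: "a s \<odot>\<^bsub>M\<^esub> f s \<in> carrier M" if "a \<in> carrier (free_module R S)" "s \<in> S" for a s
    using that f by (intro smult_closed) auto
  \<comment> \<open>The supports of two elements, of their sum and of a multiple all differ; summing
    over any finite superset inside \<open>S\<close> puts them on a common index set.\<close>
  have ext: "h a = (\<Oplus>\<^bsub>M\<^esub>s\<in>T. a s \<odot>\<^bsub>M\<^esub> f s)"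
    if a: "a \<in> carrier (free_module R S)" and T: "finite T" "T \<subseteq> S" "{s. a s \<noteq> \<zero>} \<subseteq> T" for a T
    unfolding h_def
  proof (rule M.add.finprod_mono_neutral_cong_left)
    show "\<And>i. i \<in> T - {s. a s \<noteq> \<zero>} \<Longrightarrow> a i \<odot>\<^bsub>M\<^esub> f i = \<zero>\<^bsub>M\<^esub>"
      using T f by (auto simp: Pi_iff subset_iff)
    show "(\<lambda>i. a i \<odot>\<^bsub>M\<^esub> f i) \<in> T \<rightarrow> carrier M"
      using summand[OF a] T by blast
  qed (use T in auto)
  have "h \<in> lin_hom R (free_module R S) M"
  proof (rule lin_homI)
    fix a assume a: "a \<in> carrier (free_module R S)"
    then show "h a \<in> carrier M"
      unfolding h_def using summand[OF a] supp[OF a] by (intro M.finsum_closed) blast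
    fix c assume c: "c \<in> carrier R"
    let ?T = "{s. a s \<noteq> \<zero>}"
    have ca: "c \<odot>\<^bsub>free_module R S\<^esub> a \<in> carrier (free_module R S)"
      using a c R.free_module_smult_closed by blast
    have "h (c \<odot>\<^bsub>free_module R S\<^esub> a) = (\<Oplus>\<^bsub>M\<^esub>s\<in>?T. (c \<otimes> a s) \<odot>\<^bsub>M\<^esub> f s)"
      using ext[OF ca, of ?T] a c supp[OF a] by fastforce
    also have "\<dots> = (\<Oplus>\<^bsub>M\<^esub>s\<in>?T. c \<odot>\<^bsub>M\<^esub> (a s \<odot>\<^bsub>M\<^esub> f s))"
    proof (rule M.finsum_cong')
      show "(\<lambda>s. c \<odot>\<^bsub>M\<^esub> (a s \<odot>\<^bsub>M\<^esub> f s)) \<in> ?T \<rightarrow> carrier M"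
        using summand[OF a] supp[OF a] c by blast
      fix s assume "s \<in> ?T"
      then have "s \<in> S" using supp[OF a] by blast
      then show "(c \<otimes> a s) \<odot>\<^bsub>M\<^esub> f s = c \<odot>\<^bsub>M\<^esub> (a s \<odot>\<^bsub>M\<^esub> f s)"
        using a c f by (intro smult_assoc1) auto
    qed simp
    also have "\<dots> = c \<odot>\<^bsub>M\<^esub> h a"
      unfolding h_def using summand[OF a] supp[OF a] c a
      by (intro finsum_smult_ldistr[symmetric]) (auto simp del: M.add.finprod_infinite)
    finally show "h (c \<odot>\<^bsub>free_module R S\<^esub> a) = c \<odot>\<^bsub>M\<^esub> h a" .
  next
    fix a b assume a: "a \<in> carrier (free_module R S)" and b: "b \<in> carrier (free_module R S)"
    let ?T = "{s. a s \<noteq> \<zero>} \<union> {s. b s \<noteq> \<zero>}"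
    have T: "finite ?T" "?T \<subseteq> S" using a b by auto
    have ab: "a \<oplus>\<^bsub>free_module R S\<^esub> b \<in> carrier (free_module R S)"
      using a b R.free_module_add_closed by blast
    have "h (a \<oplus>\<^bsub>free_module R S\<^esub> b) = (\<Oplus>\<^bsub>M\<^esub>s\<in>?T. (a s \<oplus> b s) \<odot>\<^bsub>M\<^esub> f s)"
      using ext[OF ab T] by fastforce
    also have "\<dots> = (\<Oplus>\<^bsub>M\<^esub>s\<in>?T. a s \<odot>\<^bsub>M\<^esub> f s \<oplus>\<^bsub>M\<^esub> b s \<odot>\<^bsub>M\<^esub> f s)"
    proof (rule M.finsum_cong')
      show "(\<lambda>s. a s \<odot>\<^bsub>M\<^esub> f s \<oplus>\<^bsub>M\<^esub> b s \<odot>\<^bsub>M\<^esub> f s) \<in> ?T \<rightarrow> carrier M"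
        using summand[OF a] summand[OF b] T by blast
      fix s assume "s \<in> ?T"
      then have "s \<in> S" using T by blast
      then show "(a s \<oplus> b s) \<odot>\<^bsub>M\<^esub> f s = a s \<odot>\<^bsub>M\<^esub> f s \<oplus>\<^bsub>M\<^esub> b s \<odot>\<^bsub>M\<^esub> f s"
        using a b f by (intro smult_l_distr) auto
    qed simp
    also have "\<dots> = (\<Oplus>\<^bsub>M\<^esub>s\<in>?T. a s \<odot>\<^bsub>M\<^esub> f s) \<oplus>\<^bsub>M\<^esub> (\<Oplus>\<^bsub>M\<^esub>s\<in>?T. b s \<odot>\<^bsub>M\<^esub> f s)"
      using summand[OF a] summand[OF b] T by (intro M.finsum_addf) blast+
    also have "\<dots> = h a \<oplus>\<^bsub>M\<^esub> h b"
      using ext[OF a T] ext[OF b T] by simp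
    finally show "h (a \<oplus>\<^bsub>free_module R S\<^esub> b) = h a \<oplus>\<^bsub>M\<^esub> h b" .
  qed
  moreover have "h (free_gen R s) = f s" if s: "s \<in> S" for s
  proof -
    have "h (free_gen R s) = (\<Oplus>\<^bsub>M\<^esub>t\<in>{s}. free_gen R s t \<odot>\<^bsub>M\<^esub> f t)"
      using s R.free_gen_closed[OF s] by (intro ext) (auto simp: free_gen_def)
    also have "\<dots> = f s"
      using s f by (simp add: free_gen_def Pi_iff)
    finally show ?thesis .
  qed
  ultimately show ?thesis by blast
qed

lemma
  fixes V :: "('a, 'v) module"
  assumes V: "module R V" and G: "G \<subseteq> carrier V"
  shows submodule_span_submodule: "submodule (submodule_span R V G) R V"
    and submodule_span_superset: "G \<subseteq> submodule_span R V G"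
proof -
  interpret module R V by (rule V)
  have sub: "submodule_span R V G \<subseteq> carrier V"
    unfolding submodule_span_def using carrier_is_submodule G by blast
  show "submodule (submodule_span R V G) R V"
  proof (rule submoduleI)
    show "\<zero>\<^bsub>V\<^esub> \<in> submodule_span R V G"
      unfolding submodule_span_def
      using subgroup.one_closed[OF submodule.axioms(1)] by fastforce
  qed (use sub submoduleE in \<open>auto simp: submodule_span_def\<close>)
  show "G \<subseteq> submodule_span R V G"
    unfolding submodule_span_def by blast
qed

lemma submodule_span_least:
  "\<lbrakk>submodule H R V; G \<subseteq> H\<rbrakk> \<Longrightarrow> submodule_span R V G \<subseteq> H"
  unfolding submodule_span_def by blast

section \<open>Quotient modules realised by cosets\<close>

lemma quotient_module_simps [simp]:
  "carrier (quotient_module V N) = a_rcosets\<^bsub>V\<^esub> N"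
  "\<zero>\<^bsub>quotient_module V N\<^esub> = N"
  "C \<oplus>\<^bsub>quotient_module V N\<^esub> D = C <+>\<^bsub>V\<^esub> D"
  "c \<odot>\<^bsub>quotient_module V N\<^esub> C = (\<Union>x\<in>C. N +>\<^bsub>V\<^esub> (c \<odot>\<^bsub>V\<^esub> x))"
  by (auto simp: quotient_module_def)

lemma a_rcosets_conv_image: "a_rcosets\<^bsub>V\<^esub> N = (\<lambda>x. N +>\<^bsub>V\<^esub> x) ` carrier V"
  by (auto simp: A_RCOSETS_def' )

text \<open>Each operation on cosets, defined on the underlying sets, is first computed on
  representatives; the module axioms are then images of those of \<open>M\<close>.\<close>

lemma (in module)
  assumes N: "submodule N R M"
  shows quotient_module_is_module: "module R (quotient_module M N)"
    and quotient_module_proj: "(\<lambda>x. N +>\<^bsub>M\<^esub> x) \<in> lin_hom R M (quotient_module M N)"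
    and quotient_module_proj_eq_iff: "\<lbrakk>x \<in> carrier M; y \<in> carrier M\<rbrakk> \<Longrightarrow>
      N +>\<^bsub>M\<^esub> x = N +>\<^bsub>M\<^esub> y \<longleftrightarrow> x \<ominus>\<^bsub>M\<^esub> y \<in> N"
proof -
  interpret N: abelian_subgroup N M
    using submodule.axioms(1)[OF N] M.abelian_group_axioms
    by (intro abelian_subgroupI3 additive_subgroup.intro)
  let ?Q = "quotient_module M N" and ?\<pi> = "\<lambda>x. N +>\<^bsub>M\<^esub> x"
  have eqI: "?\<pi> x = ?\<pi> y" if "x \<ominus>\<^bsub>M\<^esub> y \<in> N" "x \<in> carrier M" "y \<in> carrier M" for x y
    using N.a_rcos_module_rev[of y x] that
    by (metis N.a_repr_independence' N.is_additive_subgroup M.minus_eq additive_subgroup.a_subgroup)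
  have eqD: "x \<ominus>\<^bsub>M\<^esub> y \<in> N" if "?\<pi> x = ?\<pi> y" "x \<in> carrier M" "y \<in> carrier M" for x y
    using N.a_rcos_self[of x] N.a_rcos_module_imp[of y x] that by (simp add: M.minus_eq)
  show iff: "?\<pi> x = ?\<pi> y \<longleftrightarrow> x \<ominus>\<^bsub>M\<^esub> y \<in> N" if "x \<in> carrier M" "y \<in> carrier M" for x y
    using that eqI eqD by blast
  have car: "carrier ?Q = ?\<pi> ` carrier M"
    by (simp add: a_rcosets_conv_image)
  have add: "?\<pi> x \<oplus>\<^bsub>?Q\<^esub> ?\<pi> y = ?\<pi> (x \<oplus>\<^bsub>M\<^esub> y)" if "x \<in> carrier M" "y \<in> carrier M" for x y
    using that by (simp add: N.a_rcos_sum)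
  have zero: "\<zero>\<^bsub>?Q\<^esub> = ?\<pi> \<zero>\<^bsub>M\<^esub>"
    by (simp add: N.a_subset)
  have smult: "c \<odot>\<^bsub>?Q\<^esub> ?\<pi> x = ?\<pi> (c \<odot>\<^bsub>M\<^esub> x)" if c: "c \<in> carrier R" and x: "x \<in> carrier M" for c x
  proof -
    \<comment> \<open>Scalar multiplication of a coset is a union over its members; it is a single
      coset because the members differ by elements of the submodule \<open>N\<close>.\<close>
    have "?\<pi> (c \<odot>\<^bsub>M\<^esub> y) = ?\<pi> (c \<odot>\<^bsub>M\<^esub> x)" if y: "y \<in> ?\<pi> x" for y
    proof (rule eqI)
      have yM: "y \<in> carrier M"
        using y x N.a_elemrcos_carrier by blast
      then have "y \<ominus>\<^bsub>M\<^esub> x \<in> N"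
        using N.a_rcos_module_imp[OF x y] by (simp add: M.minus_eq)
      then have "c \<odot>\<^bsub>M\<^esub> (y \<ominus>\<^bsub>M\<^esub> x) \<in> N"
        using N c by (simp add: submodule.smult_closed)
      then show "c \<odot>\<^bsub>M\<^esub> y \<ominus>\<^bsub>M\<^esub> c \<odot>\<^bsub>M\<^esub> x \<in> N"
        using c x yM by (simp add: M.minus_eq smult_r_distr smult_r_minus)
    qed (use c x y N.a_elemrcos_carrier in auto)
    moreover have "?\<pi> x \<noteq> {}" using N.a_rcos_self[OF x] by blast
    ultimately show ?thesis
      unfolding quotient_module_simps by (intro SUP_eq_const)
  qed
  show "module R ?Q"
  proof (rule moduleI)
    show "abelian_group ?Q"
    proof (rule abelian_groupI)
      fix X assume "X \<in> carrier ?Q"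
      then obtain x where x: "x \<in> carrier M" "X = ?\<pi> x" unfolding car by blast
      then have "?\<pi> (\<ominus>\<^bsub>M\<^esub> x) \<oplus>\<^bsub>?Q\<^esub> X = \<zero>\<^bsub>?Q\<^esub>"
        unfolding zero by (simp only: add M.a_inv_closed M.l_neg)
      then show "\<exists>Y\<in>carrier ?Q. Y \<oplus>\<^bsub>?Q\<^esub> X = \<zero>\<^bsub>?Q\<^esub>"
        unfolding car using x by blast
    next
      fix X Y Z assume "X \<in> carrier ?Q" "Y \<in> carrier ?Q" "Z \<in> carrier ?Q"
      then obtain x y z where "x \<in> carrier M" "X = ?\<pi> x" "y \<in> carrier M" "Y = ?\<pi> y"
        "z \<in> carrier M" "Z = ?\<pi> z" unfolding car by blast
      then show "X \<oplus>\<^bsub>?Q\<^esub> Y \<oplus>\<^bsub>?Q\<^esub> Z = X \<oplus>\<^bsub>?Q\<^esub> (Y \<oplus>\<^bsub>?Q\<^esub> Z)"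
        by (simp only: add M.add.m_closed M.a_assoc)
    next
      fix X Y assume "X \<in> carrier ?Q" "Y \<in> carrier ?Q"
      then obtain x y where *: "x \<in> carrier M" "X = ?\<pi> x" "y \<in> carrier M" "Y = ?\<pi> y"
        unfolding car by blast
      then show "X \<oplus>\<^bsub>?Q\<^esub> Y = Y \<oplus>\<^bsub>?Q\<^esub> X"
        by (simp only: add M.a_comm)
      show "X \<oplus>\<^bsub>?Q\<^esub> Y \<in> carrier ?Q"
        using * by (simp only: add car M.add.m_closed imageI)
    next
      show "\<zero>\<^bsub>?Q\<^esub> \<in> carrier ?Q"
        unfolding zero car by blast
    next
      fix X assume "X \<in> carrier ?Q"
      then obtain x where x: "x \<in> carrier M" "X = ?\<pi> x" unfolding car by blast
      then show "\<zero>\<^bsub>?Q\<^esub> \<oplus>\<^bsub>?Q\<^esub> X = X"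
        unfolding zero by (simp only: add M.zero_closed M.l_zero)
    qed
    show "cring R" by (rule R.is_cring)
  next
    fix a X assume "a \<in> carrier R" "X \<in> carrier ?Q"
    then obtain x where *: "a \<in> carrier R" "x \<in> carrier M" "X = ?\<pi> x" unfolding car by blast
    show "a \<odot>\<^bsub>?Q\<^esub> X \<in> carrier ?Q"
      using * by (simp only: smult car smult_closed imageI)
  next
    fix a b X assume "a \<in> carrier R" "b \<in> carrier R" "X \<in> carrier ?Q"
    then obtain x where *: "a \<in> carrier R" "b \<in> carrier R" "x \<in> carrier M" "X = ?\<pi> x"
      unfolding car by blast
    show "(a \<oplus> b) \<odot>\<^bsub>?Q\<^esub> X = a \<odot>\<^bsub>?Q\<^esub> X \<oplus>\<^bsub>?Q\<^esub> b \<odot>\<^bsub>?Q\<^esub> X"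
      using * by (simp only: smult add smult_closed smult_l_distr R.add.m_closed)
    show "(a \<otimes> b) \<odot>\<^bsub>?Q\<^esub> X = a \<odot>\<^bsub>?Q\<^esub> (b \<odot>\<^bsub>?Q\<^esub> X)"
      using * by (simp only: smult add smult_closed smult_assoc1 R.m_closed)
  next
    fix a X Y assume "a \<in> carrier R" "X \<in> carrier ?Q" "Y \<in> carrier ?Q"
    then obtain x y where *: "a \<in> carrier R" "x \<in> carrier M" "X = ?\<pi> x" "y \<in> carrier M" "Y = ?\<pi> y"
      unfolding car by blast
    show "a \<odot>\<^bsub>?Q\<^esub> (X \<oplus>\<^bsub>?Q\<^esub> Y) = a \<odot>\<^bsub>?Q\<^esub> X \<oplus>\<^bsub>?Q\<^esub> a \<odot>\<^bsub>?Q\<^esub> Y"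
      using * by (simp only: smult add smult_closed smult_r_distr M.add.m_closed)
  next
    fix X assume "X \<in> carrier ?Q"
    then obtain x where *: "x \<in> carrier M" "X = ?\<pi> x" unfolding car by blast
    show "\<one> \<odot>\<^bsub>?Q\<^esub> X = X"
      using * by (simp only: smult R.one_closed smult_one)
  qed
  show "?\<pi> \<in> lin_hom R M ?Q"
    by (rule lin_homI) (simp_all only: car imageI add smult)
qed

text \<open>A linear map that kills \<open>N\<close> is constant on cosets, so its value at a chosen
  representative is well defined.\<close>

lemma (in module) quotient_module_lift:
  assumes V: "module R V" and N: "submodule N R V"
    and h: "h \<in> lin_hom R V M" and ker: "\<And>x. x \<in> N \<Longrightarrow> h x = \<zero>\<^bsub>M\<^esub>"
  shows "\<exists>g\<in>lin_hom R (quotient_module V N) M. \<forall>x\<in>carrier V. g (N +>\<^bsub>V\<^esub> x) = h x"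
proof -
  interpret V: module R V by (rule V)
  interpret h: additive_map V M h
    using lin_hom_additive_map[OF h] V.M.abelian_group_axioms M.abelian_group_axioms .
  let ?\<pi> = "\<lambda>x. N +>\<^bsub>V\<^esub> x" and ?Q = "quotient_module V N"
  note proj = V.quotient_module_proj[OF N]
  have car: "carrier ?Q = ?\<pi> ` carrier V"
    by (simp add: a_rcosets_conv_image)
  have wd: "h x = h y" if "?\<pi> x = ?\<pi> y" "x \<in> carrier V" "y \<in> carrier V" for x y
    using that V.quotient_module_proj_eq_iff[OF N] ker[of "x \<ominus>\<^bsub>V\<^esub> y"]
    by (simp add: h.diff diff_eq_zero_iff)
  define g where "g X = h (SOME x. x \<in> carrier V \<and> ?\<pi> x = X)" for X
  have g: "g (?\<pi> x) = h x" if "x \<in> carrier V" for x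
  proof -
    have "(SOME y. y \<in> carrier V \<and> ?\<pi> y = ?\<pi> x) \<in> carrier V \<and>
        ?\<pi> (SOME y. y \<in> carrier V \<and> ?\<pi> y = ?\<pi> x) = ?\<pi> x"
      using that by (intro someI[of "\<lambda>y. y \<in> carrier V \<and> ?\<pi> y = ?\<pi> x"]) simp
    then show ?thesis unfolding g_def using wd that by blast
  qed
  have "g \<in> lin_hom R ?Q M"
  proof (rule lin_homI)
    fix X assume "X \<in> carrier ?Q"
    then obtain x where x: "x \<in> carrier V" "X = ?\<pi> x" unfolding car by blast
    then show "g X \<in> carrier M" by (simp add: g)
    fix c assume c: "c \<in> carrier R"
    then show "g (c \<odot>\<^bsub>?Q\<^esub> X) = c \<odot>\<^bsub>M\<^esub> g X"
      unfolding x(2) by (metis x(1) g V.smult_closed lin_hom_smult[OF proj] lin_hom_smult[OF h])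
  next
    fix X Y assume "X \<in> carrier ?Q" "Y \<in> carrier ?Q"
    then obtain x y where xy: "x \<in> carrier V" "y \<in> carrier V" and "X = ?\<pi> x" "Y = ?\<pi> y"
      unfolding car by blast
    then show "g (X \<oplus>\<^bsub>?Q\<^esub> Y) = g X \<oplus>\<^bsub>M\<^esub> g Y"
      by (metis g V.M.add.m_closed lin_hom_add[OF proj] h.add)
  qed
  with g show ?thesis by blast
qed

text \<open>Kaehler differentials, exterior powers and tensor products are all given by generators
  and relations; the induction principle and the universal property that each of them needs are
  proved here once.\<close>

locale presentation = cring R for R (structure) +
  fixes S :: "'s set" and E :: "('s \<Rightarrow> 'a) set"
  assumes rels_closed: "E \<subseteq> carrier (free_module R S)"
begin

abbreviation "F \<equiv> free_module R S"
abbreviation "P \<equiv> presented_module R S E"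
abbreviation "proj x \<equiv> submodule_span R F E +>\<^bsub>F\<^esub> x"

lemma span_submodule: "submodule (submodule_span R F E) R F"
  by (rule submodule_span_submodule[OF free_module_is_module rels_closed])

lemma presented_module_is_module: "module R P"
  unfolding presented_module_def
  by (rule module.quotient_module_is_module[OF free_module_is_module span_submodule])

lemma proj_hom: "(\<lambda>x. proj x) \<in> lin_hom R F P"
  unfolding presented_module_def
  by (rule module.quotient_module_proj[OF free_module_is_module span_submodule])

lemma proj_additive: "additive_map F P (\<lambda>x. proj x)"
  by (rule lin_hom_additive_map[OF proj_hom])
    (rule module.axioms(2)[OF free_module_is_module] module.axioms(2)[OF presented_module_is_module])+

lemmas proj_closed = additive_map.closed[OF proj_additive]
lemmas proj_add = additive_map.add[OF proj_additive]
lemmas proj_diff = additive_map.diff[OF proj_additive]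
lemmas proj_zero = additive_map.zero[OF proj_additive]

lemma proj_smult: "\<lbrakk>c \<in> carrier R; x \<in> carrier F\<rbrakk> \<Longrightarrow> proj (c \<odot>\<^bsub>F\<^esub> x) = c \<odot>\<^bsub>P\<^esub> proj x"
  by (rule lin_hom_smult[OF proj_hom])

lemma gen_closed: "s \<in> S \<Longrightarrow> presented_gen R S E s \<in> carrier P"
  unfolding presented_gen_def by (rule proj_closed[OF free_gen_closed])

lemma proj_gen: "proj (free_gen R s) = presented_gen R S E s"
  by (rule presented_gen_def[symmetric])

lemma proj_rel:
  assumes "x \<in> E"
  shows "proj x = \<zero>\<^bsub>P\<^esub>"
proof -
  interpret F: module R F by (rule free_module_is_module)
  have x: "x \<in> carrier F" by (rule subsetD[OF rels_closed assms])
  have "x \<in> submodule_span R F E"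
    by (rule subsetD[OF submodule_span_superset[OF F.module_axioms rels_closed] assms])
  moreover have "x \<ominus>\<^bsub>F\<^esub> \<zero>\<^bsub>F\<^esub> = x"
    using x by (simp only: F.M.minus_eq F.M.uminus_zero F.M.r_zero)
  ultimately have "proj x = proj \<zero>\<^bsub>F\<^esub>"
    by (subst F.quotient_module_proj_eq_iff[OF span_submodule x F.M.zero_closed]) (simp only:)
  also have "\<dots> = \<zero>\<^bsub>P\<^esub>" by (rule proj_zero)
  finally show ?thesis .
qed

text \<open>Every class has a representative in the free module, where the corresponding induction
  applies and is pushed through the projection.\<close>

lemma presented_induct [consumes 1, case_names zero add gen]:
  assumes "x \<in> carrier P" "Q \<zero>\<^bsub>P\<^esub>"
    and add: "\<And>x y. \<lbrakk>x \<in> carrier P; y \<in> carrier P; Q x; Q y\<rbrakk> \<Longrightarrow> Q (x \<oplus>\<^bsub>P\<^esub> y)"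
    and gen: "\<And>c s. \<lbrakk>c \<in> carrier R; s \<in> S\<rbrakk> \<Longrightarrow> Q (c \<odot>\<^bsub>P\<^esub> presented_gen R S E s)"
  shows "Q x"
proof -
  have "x \<in> (\<lambda>y. proj y) ` carrier F"
    using assms(1) by (simp only: presented_module_def quotient_module_simps a_rcosets_conv_image)
  then obtain y where y: "y \<in> carrier F" "x = proj y" by (rule imageE)
  from y(1) have "Q (proj y)"
  proof (rule free_module_induct)
    show "Q (proj \<zero>\<^bsub>F\<^esub>)" using assms(2) by (simp only: proj_zero)
    show "Q (proj (g \<oplus>\<^bsub>F\<^esub> h))" if "g \<in> carrier F" "h \<in> carrier F" "Q (proj g)" "Q (proj h)" for g h
      using add[OF proj_closed[OF that(1)] proj_closed[OF that(2)] that(3,4)] that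
      by (simp only: proj_add)
    show "Q (proj (c \<odot>\<^bsub>F\<^esub> free_gen R s))" if "c \<in> carrier R" "s \<in> S" for c s
      using gen[OF that] that by (simp only: proj_smult free_gen_closed proj_gen)
  qed
  with y show ?thesis by simp
qed

text \<open>The kernel of the lift from the free module is a submodule containing the relations,
  hence their span, so the lift descends. The last hypothesis hands over the linearity of that lift:
  each instance only has to evaluate it on its listed relations.\<close>

lemma presented_lift:
  assumes W: "module R W" and f: "f \<in> S \<rightarrow> carrier W"
    and rels: "\<And>h x. \<lbrakk>h \<in> lin_hom R F W; additive_map F W h; \<And>s. s \<in> S \<Longrightarrow> h (free_gen R s) = f s; x \<in> E\<rbrakk>
      \<Longrightarrow> h x = \<zero>\<^bsub>W\<^esub>"
  shows "\<exists>g\<in>lin_hom R P W. \<forall>s\<in>S. g (presented_gen R S E s) = f s"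
proof -
  interpret F: module R F by (rule free_module_is_module)
  have F: "abelian_group F" and Wg: "abelian_group W"
    by (rule module.axioms(2)[OF free_module_is_module] module.axioms(2)[OF W])+
  from module.free_module_lift[OF W f] obtain h
    where h: "h \<in> lin_hom R F W" and hf: "\<forall>s\<in>S. h (free_gen R s) = f s"
    by (rule bexE)
  have hf': "h (free_gen R s) = f s" if "s \<in> S" for s
    using hf that by (rule bspec)
  note h' = lin_hom_additive_map[OF h F Wg]
  let ?N = "{x \<in> carrier F. h x = \<zero>\<^bsub>W\<^esub>}"
  have "submodule ?N R F"
  proof (rule F.submoduleI)
    show "a \<oplus>\<^bsub>F\<^esub> b \<in> ?N" if "a \<in> ?N" "b \<in> ?N" for a b
      using that additive_map.add[OF h', of a b] abelian_groupE(5)[OF Wg abelian_groupE(2)[OF Wg]]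
      by (simp del: free_module_simps)
    show "\<ominus>\<^bsub>F\<^esub> a \<in> ?N" if "a \<in> ?N" for a
      using that additive_map.uminus[OF h', of a] abelian_group.uminus_zero[OF Wg]
      by (simp only: mem_Collect_eq F.M.a_inv_closed simp_thms)
    show "c \<odot>\<^bsub>F\<^esub> a \<in> ?N" if "c \<in> carrier R" "a \<in> ?N" for c a
      using that lin_hom_smult[OF h, of c a] module.smult_r_null[OF W]
      by (simp only: mem_Collect_eq F.smult_closed simp_thms)
  qed (simp_all only: additive_map.zero[OF h'] F.M.zero_closed mem_Collect_eq simp_thms Collect_subset)
  moreover have "E \<subseteq> ?N"
  proof
    fix x assume "x \<in> E"
    with rels[OF h h' hf' this] rels_closed show "x \<in> ?N" by (simp only: mem_Collect_eq subsetD)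
  qed
  ultimately have "submodule_span R F E \<subseteq> ?N"
    by (rule submodule_span_least)
  then have "h x = \<zero>\<^bsub>W\<^esub>" if "x \<in> submodule_span R F E" for x
    using that by (simp only: subset_iff mem_Collect_eq)
  from module.quotient_module_lift[OF W free_module_is_module span_submodule h this]
  obtain g where g: "g \<in> lin_hom R P W" and gh: "\<forall>x\<in>carrier F. g (proj x) = h x"
    unfolding presented_module_def by (rule bexE)
  have "\<forall>s\<in>S. g (presented_gen R S E s) = f s"
  proof
    fix s assume s: "s \<in> S"
    show "g (presented_gen R S E s) = f s"
      using bspec[OF gh free_gen_closed[OF s]] hf'[OF s] by (simp only: proj_gen)
  qed
  then show ?thesis using g by (rule bexI)
qed

lemma rel_eq:
  assumes "x \<ominus>\<^bsub>F\<^esub> y \<in> E" "x \<in> carrier F" "y \<in> carrier F"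
  shows "proj x = proj y"
  using proj_rel[OF assms(1)] assms(2,3)
  by (simp only: proj_diff proj_closed module.diff_eq_zero_iff[OF presented_module_is_module])

end

lemma (in additive_map) diff_zero:
  "\<lbrakk>x \<in> carrier V; y \<in> carrier V; h x = h y\<rbrakk> \<Longrightarrow> h (x \<ominus>\<^bsub>V\<^esub> y) = \<zero>\<^bsub>W\<^esub>"
  by (simp add: diff W.minus_eq W.r_neg)

section \<open>Universal properties\<close>

context
  fixes K :: "('k, 'l) ring_scheme" and R :: "('k, 'a, 's) module_scheme"
  assumes alg: "algebra K R"
begin

interpretation algebra K R by (rule alg)

lemma unit_smult_closed: "c \<in> carrier K \<Longrightarrow> c \<odot>\<^bsub>R\<^esub> \<one>\<^bsub>R\<^esub> \<in> carrier R"
  by (rule smult_closed[OF _ cring.cring_simprules(6)[OF M_cring]])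

lemmas algebra_closed = cring.cring_simprules(1,5)[OF M_cring] smult_closed unit_smult_closed

lemma kaehler_free_gen_closed: "a \<in> carrier R \<Longrightarrow> free_gen R a \<in> carrier (free_module R (carrier R))"
  by (rule cring.free_gen_closed[OF M_cring])

lemma kaehler_presentation: "presentation R (carrier R) (kaehler_rels K R)"
proof (intro presentation.intro presentation_axioms.intro M_cring)
  interpret F: module R "free_module R (carrier R)" by (rule cring.free_module_is_module[OF M_cring])
  show "kaehler_rels K R \<subseteq> carrier (free_module R (carrier R))"
    unfolding kaehler_rels_def Let_def scalar_def
    by (auto simp del: free_module_simps intro!: F.M.minus_closed F.M.add.m_closed F.smult_closed
        cring.free_gen_closed[OF M_cring] algebra_closed)
qed

interpretation Om: presentation R "carrier R" "kaehler_rels K R"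
  by (rule kaehler_presentation)

lemma kaehler_module: "module R (kaehler K R)"
  unfolding kaehler_def by (rule Om.presented_module_is_module)

lemma kaehler_d_closed: "a \<in> carrier R \<Longrightarrow> kaehler_d K R a \<in> carrier (kaehler K R)"
  unfolding kaehler_def kaehler_d_def by (rule Om.gen_closed)

lemma kaehler_d_add:
  assumes "a \<in> carrier R" "b \<in> carrier R"
  shows "kaehler_d K R (a \<oplus>\<^bsub>R\<^esub> b) = kaehler_d K R a \<oplus>\<^bsub>kaehler K R\<^esub> kaehler_d K R b"
proof -
  interpret F: module R "free_module R (carrier R)" by (rule cring.free_module_is_module[OF M_cring])
  note gen = kaehler_free_gen_closed F.M.add.m_closed F.smult_closed algebra_closed
  have "free_gen R (a \<oplus>\<^bsub>R\<^esub> b) \<ominus>\<^bsub>Om.F\<^esub> (free_gen R a \<oplus>\<^bsub>Om.F\<^esub> free_gen R b) \<in> kaehler_rels K R"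
    unfolding kaehler_rels_def Let_def using assms by blast
  then have "Om.proj (free_gen R (a \<oplus>\<^bsub>R\<^esub> b)) = Om.proj (free_gen R a \<oplus>\<^bsub>Om.F\<^esub> free_gen R b)"
    by (rule Om.rel_eq) (intro gen assms)+
  then show ?thesis
    unfolding kaehler_def kaehler_d_def using assms gen Om.proj_add by (simp only: Om.proj_gen)
qed

lemma kaehler_d_smult:
  assumes "c \<in> carrier K" "a \<in> carrier R"
  shows "kaehler_d K R (c \<odot>\<^bsub>R\<^esub> a) = scalar R (kaehler K R) c (kaehler_d K R a)"
proof -
  interpret F: module R "free_module R (carrier R)" by (rule cring.free_module_is_module[OF M_cring])
  note gen = kaehler_free_gen_closed F.M.add.m_closed F.smult_closed algebra_closed
  have "free_gen R (c \<odot>\<^bsub>R\<^esub> a) \<ominus>\<^bsub>Om.F\<^esub> ((c \<odot>\<^bsub>R\<^esub> \<one>\<^bsub>R\<^esub>) \<odot>\<^bsub>Om.F\<^esub> free_gen R a) \<in> kaehler_rels K R"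
    unfolding kaehler_rels_def Let_def scalar_def using assms by blast
  then have "Om.proj (free_gen R (c \<odot>\<^bsub>R\<^esub> a)) = Om.proj ((c \<odot>\<^bsub>R\<^esub> \<one>\<^bsub>R\<^esub>) \<odot>\<^bsub>Om.F\<^esub> free_gen R a)"
    by (rule Om.rel_eq) (intro gen assms)+
  then show ?thesis
    unfolding kaehler_def kaehler_d_def scalar_def using assms gen Om.proj_smult unit_smult_closed
    by (simp only: Om.proj_gen)
qed

lemma kaehler_d_mult:
  assumes "a \<in> carrier R" "b \<in> carrier R"
  shows "kaehler_d K R (a \<otimes>\<^bsub>R\<^esub> b) =
    a \<odot>\<^bsub>kaehler K R\<^esub> kaehler_d K R b \<oplus>\<^bsub>kaehler K R\<^esub> b \<odot>\<^bsub>kaehler K R\<^esub> kaehler_d K R a"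
proof -
  interpret F: module R "free_module R (carrier R)" by (rule cring.free_module_is_module[OF M_cring])
  note gen = kaehler_free_gen_closed F.M.add.m_closed F.smult_closed algebra_closed
  let ?x = "a \<odot>\<^bsub>Om.F\<^esub> free_gen R b \<oplus>\<^bsub>Om.F\<^esub> b \<odot>\<^bsub>Om.F\<^esub> free_gen R a"
  have "free_gen R (a \<otimes>\<^bsub>R\<^esub> b) \<ominus>\<^bsub>Om.F\<^esub> ?x \<in> kaehler_rels K R"
    unfolding kaehler_rels_def Let_def using assms by blast
  then have "Om.proj (free_gen R (a \<otimes>\<^bsub>R\<^esub> b)) = Om.proj ?x"
    by (rule Om.rel_eq) (intro gen assms)+
  then show ?thesis
    unfolding kaehler_def kaehler_d_def using assms gen Om.proj_add Om.proj_smult F.smult_closed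
    by (simp only: Om.proj_gen)
qed

lemma kaehler_induct [consumes 1, case_names zero add gen]:
  assumes "x \<in> carrier (kaehler K R)" "Q \<zero>\<^bsub>kaehler K R\<^esub>"
    and "\<And>x y. \<lbrakk>x \<in> carrier (kaehler K R); y \<in> carrier (kaehler K R); Q x; Q y\<rbrakk> \<Longrightarrow> Q (x \<oplus>\<^bsub>kaehler K R\<^esub> y)"
    and "\<And>c a. \<lbrakk>c \<in> carrier R; a \<in> carrier R\<rbrakk> \<Longrightarrow> Q (c \<odot>\<^bsub>kaehler K R\<^esub> kaehler_d K R a)"
  shows "Q x"
  using assms unfolding kaehler_def kaehler_d_def by (rule Om.presented_induct)

text \<open>Universal property: a \<open>k\<close>-linear derivation from \<open>R\<close> to
  \<open>W\<close> factors through \<open>d\<close>. The three kinds of relations correspond one by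
  one to the three identities assumed of \<open>f\<close>.\<close>

lemma kaehler_lift:
  assumes W: "module R W" and f: "f \<in> carrier R \<rightarrow> carrier W"
    and add: "\<And>a b. \<lbrakk>a \<in> carrier R; b \<in> carrier R\<rbrakk> \<Longrightarrow> f (a \<oplus>\<^bsub>R\<^esub> b) = f a \<oplus>\<^bsub>W\<^esub> f b"
    and smult: "\<And>c a. \<lbrakk>c \<in> carrier K; a \<in> carrier R\<rbrakk> \<Longrightarrow> f (c \<odot>\<^bsub>R\<^esub> a) = scalar R W c (f a)"
    and mult: "\<And>a b. \<lbrakk>a \<in> carrier R; b \<in> carrier R\<rbrakk> \<Longrightarrow>
      f (a \<otimes>\<^bsub>R\<^esub> b) = a \<odot>\<^bsub>W\<^esub> f b \<oplus>\<^bsub>W\<^esub> b \<odot>\<^bsub>W\<^esub> f a"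
  shows "\<exists>g\<in>lin_hom R (kaehler K R) W. \<forall>a\<in>carrier R. g (kaehler_d K R a) = f a"
  unfolding kaehler_def kaehler_d_def
proof (rule Om.presented_lift[OF W f])
  interpret F: module R "free_module R (carrier R)" by (rule cring.free_module_is_module[OF M_cring])
  note gen = kaehler_free_gen_closed F.M.add.m_closed F.smult_closed algebra_closed
  fix h x
  assume h: "h \<in> lin_hom R Om.F W" and h': "additive_map Om.F W h"
    and hf: "\<And>s. s \<in> carrier R \<Longrightarrow> h (free_gen R s) = f s" and x: "x \<in> kaehler_rels K R"
  note zero = additive_map.diff_zero[OF h'] and hadd = additive_map.add[OF h'] and hsmult = lin_hom_smult[OF h]
  from x consider
    (1) a b where "x = free_gen R (a \<oplus>\<^bsub>R\<^esub> b) \<ominus>\<^bsub>Om.F\<^esub> (free_gen R a \<oplus>\<^bsub>Om.F\<^esub> free_gen R b)"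
      "a \<in> carrier R" "b \<in> carrier R"
  | (2) c a where "x = free_gen R (c \<odot>\<^bsub>R\<^esub> a) \<ominus>\<^bsub>Om.F\<^esub> scalar R Om.F c (free_gen R a)"
      "c \<in> carrier K" "a \<in> carrier R"
  | (3) a b where "x = free_gen R (a \<otimes>\<^bsub>R\<^esub> b) \<ominus>\<^bsub>Om.F\<^esub>
        (a \<odot>\<^bsub>Om.F\<^esub> free_gen R b \<oplus>\<^bsub>Om.F\<^esub> b \<odot>\<^bsub>Om.F\<^esub> free_gen R a)" "a \<in> carrier R" "b \<in> carrier R"
    unfolding kaehler_rels_def Let_def by blast
  then show "h x = \<zero>\<^bsub>W\<^esub>"
  proof cases
    case 1
    show ?thesis
      unfolding 1(1) by (rule zero) (use 1(2,3) gen hf hadd add in \<open>simp_all del: free_module_simps\<close>)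
  next
    case 2
    show ?thesis
      unfolding 2(1) scalar_def
      by (rule zero) (use 2(2,3) gen hf hsmult smult in \<open>simp_all add: scalar_def del: free_module_simps\<close>)
  next
    case 3
    show ?thesis
      unfolding 3(1)
      by (rule zero) (use 3(2,3) gen hf hadd hsmult mult in \<open>simp_all del: free_module_simps\<close>)
  qed
qed

end

section \<open>Exterior powers\<close>

lemma tuples_update: "\<lbrakk>vs \<in> tuples p A; v \<in> A\<rbrakk> \<Longrightarrow> vs[i := v] \<in> tuples p A"
  using set_update_subset_insert[of vs i v] by (auto simp: tuples_def)

context
  fixes R :: "('a, 'r) ring_scheme" and V :: "('a, 'v, 's) module_scheme" and p :: nat
  assumes V: "module R V"
begin

interpretation V: module R V by (rule V)

lemma carrier_tuples_update:
  "\<lbrakk>vs \<in> tuples p (carrier V); v \<in> carrier V\<rbrakk> \<Longrightarrow> vs[i := v] \<in> tuples p (carrier V)"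
  by (rule tuples_update)

lemma exterior_free_gen_closed:
  "vs \<in> tuples p (carrier V) \<Longrightarrow> free_gen R vs \<in> carrier (free_module R (tuples p (carrier V)))"
  by (rule V.R.free_gen_closed)

lemma exterior_presentation: "presentation R (tuples p (carrier V)) (exterior_rels R p V)"
proof (intro presentation.intro presentation_axioms.intro V.R.is_cring)
  interpret F: module R "free_module R (tuples p (carrier V))"
    by (rule V.R.free_module_is_module)
  show "exterior_rels R p V \<subseteq> carrier (free_module R (tuples p (carrier V)))"
    unfolding exterior_rels_def Let_def
    using F.M.minus_closed F.M.add.m_closed F.smult_closed exterior_free_gen_closed carrier_tuples_update
    by (auto simp del: free_module_simps)
qed

interpretation Ex: presentation R "tuples p (carrier V)" "exterior_rels R p V"
  by (rule exterior_presentation)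

lemma exterior_module: "module R (exterior_power R p V)"
  unfolding exterior_power_def by (rule Ex.presented_module_is_module)

lemma wedge_closed: "vs \<in> tuples p (carrier V) \<Longrightarrow> wedge R p V vs \<in> carrier (exterior_power R p V)"
  unfolding exterior_power_def wedge_def by (rule Ex.gen_closed)

lemma wedge_add:
  assumes "vs \<in> tuples p (carrier V)" "i < p" "v \<in> carrier V" "w \<in> carrier V"
  shows "wedge R p V (vs[i := v \<oplus>\<^bsub>V\<^esub> w]) =
    wedge R p V (vs[i := v]) \<oplus>\<^bsub>exterior_power R p V\<^esub> wedge R p V (vs[i := w])"
proof -
  interpret F: module R Ex.F by (rule V.R.free_module_is_module)
  note gen = exterior_free_gen_closed
  let ?x = "free_gen R (vs[i := v \<oplus>\<^bsub>V\<^esub> w])"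
    and ?y = "free_gen R (vs[i := v]) \<oplus>\<^bsub>Ex.F\<^esub> free_gen R (vs[i := w])"
  have "?x \<ominus>\<^bsub>Ex.F\<^esub> ?y \<in> exterior_rels R p V"
    unfolding exterior_rels_def Let_def using assms by blast
  then have "Ex.proj ?x = Ex.proj ?y"
    by (rule Ex.rel_eq) (use assms gen carrier_tuples_update in \<open>simp_all del: free_module_simps\<close>)
  then show ?thesis
    unfolding exterior_power_def wedge_def using assms gen Ex.proj_add carrier_tuples_update
    by (simp only: Ex.proj_gen)
qed

lemma wedge_smult:
  assumes "vs \<in> tuples p (carrier V)" "i < p" "r \<in> carrier R" "v \<in> carrier V"
  shows "wedge R p V (vs[i := r \<odot>\<^bsub>V\<^esub> v]) = r \<odot>\<^bsub>exterior_power R p V\<^esub> wedge R p V (vs[i := v])"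
proof -
  interpret F: module R Ex.F by (rule V.R.free_module_is_module)
  note gen = exterior_free_gen_closed
  let ?x = "free_gen R (vs[i := r \<odot>\<^bsub>V\<^esub> v])" and ?y = "r \<odot>\<^bsub>Ex.F\<^esub> free_gen R (vs[i := v])"
  have "?x \<ominus>\<^bsub>Ex.F\<^esub> ?y \<in> exterior_rels R p V"
    unfolding exterior_rels_def Let_def using assms by blast
  then have "Ex.proj ?x = Ex.proj ?y"
    by (rule Ex.rel_eq) (use assms gen carrier_tuples_update in \<open>simp_all del: free_module_simps\<close>)
  then show ?thesis
    unfolding exterior_power_def wedge_def using assms gen Ex.proj_smult carrier_tuples_update
    by (simp only: Ex.proj_gen)
qed

lemma wedge_repeat:
  assumes "vs \<in> tuples p (carrier V)" "i < j" "j < p" "vs ! i = vs ! j"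
  shows "wedge R p V vs = \<zero>\<^bsub>exterior_power R p V\<^esub>"
proof -
  have "free_gen R vs \<in> exterior_rels R p V"
    unfolding exterior_rels_def Let_def using assms by blast
  from Ex.proj_rel[OF this] show ?thesis
    unfolding exterior_power_def wedge_def by (simp only: Ex.proj_gen)
qed

lemma exterior_induct [consumes 1, case_names zero add gen]:
  assumes "x \<in> carrier (exterior_power R p V)" "Q \<zero>\<^bsub>exterior_power R p V\<^esub>"
    and "\<And>x y. \<lbrakk>x \<in> carrier (exterior_power R p V); y \<in> carrier (exterior_power R p V); Q x; Q y\<rbrakk>
      \<Longrightarrow> Q (x \<oplus>\<^bsub>exterior_power R p V\<^esub> y)"
    and "\<And>c vs. \<lbrakk>c \<in> carrier R; vs \<in> tuples p (carrier V)\<rbrakk>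
      \<Longrightarrow> Q (c \<odot>\<^bsub>exterior_power R p V\<^esub> wedge R p V vs)"
  shows "Q x"
  using assms unfolding exterior_power_def wedge_def by (rule Ex.presented_induct)

lemma exterior_lift:
  assumes W: "module R W" and f: "f \<in> tuples p (carrier V) \<rightarrow> carrier W"
    and add: "\<And>vs i v w. \<lbrakk>vs \<in> tuples p (carrier V); i < p; v \<in> carrier V; w \<in> carrier V\<rbrakk> \<Longrightarrow>
      f (vs[i := v \<oplus>\<^bsub>V\<^esub> w]) = f (vs[i := v]) \<oplus>\<^bsub>W\<^esub> f (vs[i := w])"
    and smult: "\<And>vs i r v. \<lbrakk>vs \<in> tuples p (carrier V); i < p; r \<in> carrier R; v \<in> carrier V\<rbrakk> \<Longrightarrow>
      f (vs[i := r \<odot>\<^bsub>V\<^esub> v]) = r \<odot>\<^bsub>W\<^esub> f (vs[i := v])"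
    and alt: "\<And>vs i j. \<lbrakk>vs \<in> tuples p (carrier V); i < j; j < p; vs ! i = vs ! j\<rbrakk> \<Longrightarrow> f vs = \<zero>\<^bsub>W\<^esub>"
  shows "\<exists>g\<in>lin_hom R (exterior_power R p V) W. \<forall>vs\<in>tuples p (carrier V). g (wedge R p V vs) = f vs"
  unfolding exterior_power_def wedge_def
proof (rule Ex.presented_lift[OF W f])
  interpret F: module R Ex.F by (rule V.R.free_module_is_module)
  note gen = exterior_free_gen_closed
  fix h x
  assume h: "h \<in> lin_hom R Ex.F W" and h': "additive_map Ex.F W h"
    and hf: "\<And>s. s \<in> tuples p (carrier V) \<Longrightarrow> h (free_gen R s) = f s" and x: "x \<in> exterior_rels R p V"
  note zero = additive_map.diff_zero[OF h'] and hadd = additive_map.add[OF h'] and hsmult = lin_hom_smult[OF h]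
  from x consider
    (1) vs i v w where "x = free_gen R (vs[i := v \<oplus>\<^bsub>V\<^esub> w]) \<ominus>\<^bsub>Ex.F\<^esub>
        (free_gen R (vs[i := v]) \<oplus>\<^bsub>Ex.F\<^esub> free_gen R (vs[i := w]))"
      "vs \<in> tuples p (carrier V)" "i < p" "v \<in> carrier V" "w \<in> carrier V"
  | (2) vs i r v where "x = free_gen R (vs[i := r \<odot>\<^bsub>V\<^esub> v]) \<ominus>\<^bsub>Ex.F\<^esub> (r \<odot>\<^bsub>Ex.F\<^esub> free_gen R (vs[i := v]))"
      "vs \<in> tuples p (carrier V)" "i < p" "r \<in> carrier R" "v \<in> carrier V"
  | (3) vs i j where "x = free_gen R vs" "vs \<in> tuples p (carrier V)" "i < j" "j < p" "vs ! i = vs ! j"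
    unfolding exterior_rels_def Let_def by blast
  then show "h x = \<zero>\<^bsub>W\<^esub>"
  proof cases
    case 1
    show ?thesis
      unfolding 1(1)
      by (rule zero) (use 1(2-) gen hf hadd add carrier_tuples_update in \<open>simp_all del: free_module_simps\<close>)
  next
    case 2
    show ?thesis
      unfolding 2(1)
      by (rule zero) (use 2(2-) gen hf hsmult smult carrier_tuples_update in \<open>simp_all del: free_module_simps\<close>)
  next
    case 3
    show ?thesis unfolding 3(1) hf[OF 3(2)] by (rule alt[OF 3(2-)])
  qed
qed

end

section \<open>Tensor products\<close>

context
  fixes R :: "('a, 'r) ring_scheme" and V :: "('a, 'v, 's) module_scheme"
    and W :: "('a, 'w, 't) module_scheme"
  assumes V: "module R V" and W: "module R W"
begin

interpretation V: module R V by (rule V)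
interpretation W: module R W by (rule W)

lemma tensor_free_gen_closed:
  "s \<in> carrier V \<times> carrier W \<Longrightarrow> free_gen R s \<in> carrier (free_module R (carrier V \<times> carrier W))"
  by (rule V.R.free_gen_closed)

lemma tensor_presentation: "presentation R (carrier V \<times> carrier W) (tensor_rels R V W)"
proof (intro presentation.intro presentation_axioms.intro V.R.is_cring)
  interpret F: module R "free_module R (carrier V \<times> carrier W)"
    by (rule V.R.free_module_is_module)
  show "tensor_rels R V W \<subseteq> carrier (free_module R (carrier V \<times> carrier W))"
    unfolding tensor_rels_def Let_def
    using F.M.minus_closed F.M.add.m_closed F.smult_closed tensor_free_gen_closed
    by (auto simp del: free_module_simps)
qed

interpretation T: presentation R "carrier V \<times> carrier W" "tensor_rels R V W"
  by (rule tensor_presentation)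

lemma tensor_module: "module R (tensor R V W)"
  unfolding tensor_def by (rule T.presented_module_is_module)

lemma pure_tensor_closed:
  "\<lbrakk>v \<in> carrier V; w \<in> carrier W\<rbrakk> \<Longrightarrow> pure_tensor R V W v w \<in> carrier (tensor R V W)"
  unfolding tensor_def pure_tensor_def by (rule T.gen_closed) blast

lemma pure_tensor_add_l:
  assumes "v \<in> carrier V" "v' \<in> carrier V" "w \<in> carrier W"
  shows "pure_tensor R V W (v \<oplus>\<^bsub>V\<^esub> v') w =
    pure_tensor R V W v w \<oplus>\<^bsub>tensor R V W\<^esub> pure_tensor R V W v' w"
proof -
  interpret F: module R T.F by (rule V.R.free_module_is_module)
  note gen = tensor_free_gen_closed
  let ?x = "free_gen R (v \<oplus>\<^bsub>V\<^esub> v', w)" and ?y = "free_gen R (v, w) \<oplus>\<^bsub>T.F\<^esub> free_gen R (v', w)"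
  have "?x \<ominus>\<^bsub>T.F\<^esub> ?y \<in> tensor_rels R V W"
    unfolding tensor_rels_def Let_def using assms by blast
  then have "T.proj ?x = T.proj ?y"
    by (rule T.rel_eq) (use assms gen in \<open>simp_all del: free_module_simps\<close>)
  then show ?thesis
    unfolding tensor_def pure_tensor_def using assms gen T.proj_add
    by (simp only: T.proj_gen mem_Sigma_iff simp_thms)
qed

lemma pure_tensor_add_r:
  assumes "v \<in> carrier V" "w \<in> carrier W" "w' \<in> carrier W"
  shows "pure_tensor R V W v (w \<oplus>\<^bsub>W\<^esub> w') =
    pure_tensor R V W v w \<oplus>\<^bsub>tensor R V W\<^esub> pure_tensor R V W v w'"
proof -
  interpret F: module R T.F by (rule V.R.free_module_is_module)
  note gen = tensor_free_gen_closed
  let ?x = "free_gen R (v, w \<oplus>\<^bsub>W\<^esub> w')" and ?y = "free_gen R (v, w) \<oplus>\<^bsub>T.F\<^esub> free_gen R (v, w')"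
  have "?x \<ominus>\<^bsub>T.F\<^esub> ?y \<in> tensor_rels R V W"
    unfolding tensor_rels_def Let_def using assms by blast
  then have "T.proj ?x = T.proj ?y"
    by (rule T.rel_eq) (use assms gen in \<open>simp_all del: free_module_simps\<close>)
  then show ?thesis
    unfolding tensor_def pure_tensor_def using assms gen T.proj_add
    by (simp only: T.proj_gen mem_Sigma_iff simp_thms)
qed

lemma pure_tensor_smult_l:
  assumes "r \<in> carrier R" "v \<in> carrier V" "w \<in> carrier W"
  shows "pure_tensor R V W (r \<odot>\<^bsub>V\<^esub> v) w = r \<odot>\<^bsub>tensor R V W\<^esub> pure_tensor R V W v w"
proof -
  interpret F: module R T.F by (rule V.R.free_module_is_module)
  note gen = tensor_free_gen_closed
  let ?x = "free_gen R (r \<odot>\<^bsub>V\<^esub> v, w)" and ?y = "r \<odot>\<^bsub>T.F\<^esub> free_gen R (v, w)"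
  have "?x \<ominus>\<^bsub>T.F\<^esub> ?y \<in> tensor_rels R V W"
    unfolding tensor_rels_def Let_def using assms by blast
  then have "T.proj ?x = T.proj ?y"
    by (rule T.rel_eq) (use assms gen in \<open>simp_all del: free_module_simps\<close>)
  then show ?thesis
    unfolding tensor_def pure_tensor_def using assms gen T.proj_smult
    by (simp only: T.proj_gen mem_Sigma_iff simp_thms)
qed

lemma pure_tensor_smult_r:
  assumes "r \<in> carrier R" "v \<in> carrier V" "w \<in> carrier W"
  shows "pure_tensor R V W v (r \<odot>\<^bsub>W\<^esub> w) = r \<odot>\<^bsub>tensor R V W\<^esub> pure_tensor R V W v w"
proof -
  interpret F: module R T.F by (rule V.R.free_module_is_module)
  note gen = tensor_free_gen_closed
  let ?x = "free_gen R (v, r \<odot>\<^bsub>W\<^esub> w)" and ?y = "r \<odot>\<^bsub>T.F\<^esub> free_gen R (v, w)"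
  have "?x \<ominus>\<^bsub>T.F\<^esub> ?y \<in> tensor_rels R V W"
    unfolding tensor_rels_def Let_def using assms by blast
  then have "T.proj ?x = T.proj ?y"
    by (rule T.rel_eq) (use assms gen in \<open>simp_all del: free_module_simps\<close>)
  then show ?thesis
    unfolding tensor_def pure_tensor_def using assms gen T.proj_smult
    by (simp only: T.proj_gen mem_Sigma_iff simp_thms)
qed

text \<open>No coefficient appears in the generator case: a scalar multiple of a pure tensor is
  again pure, the scalar being absorbed by the left factor.\<close>

lemma tensor_induct [consumes 1, case_names zero add gen]:
  assumes "x \<in> carrier (tensor R V W)" "Q \<zero>\<^bsub>tensor R V W\<^esub>"
    and "\<And>x y. \<lbrakk>x \<in> carrier (tensor R V W); y \<in> carrier (tensor R V W); Q x; Q y\<rbrakk>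
      \<Longrightarrow> Q (x \<oplus>\<^bsub>tensor R V W\<^esub> y)"
    and gen: "\<And>v w. \<lbrakk>v \<in> carrier V; w \<in> carrier W\<rbrakk> \<Longrightarrow> Q (pure_tensor R V W v w)"
  shows "Q x"
  using assms(1-3) unfolding tensor_def
proof (rule T.presented_induct)
  fix c s assume c: "c \<in> carrier R" and "s \<in> carrier V \<times> carrier W"
  then obtain v w where s: "s = (v, w)" "v \<in> carrier V" "w \<in> carrier W" by blast
  show "Q (c \<odot>\<^bsub>T.P\<^esub> presented_gen R (carrier V \<times> carrier W) (tensor_rels R V W) s)"
    using gen[of "c \<odot>\<^bsub>V\<^esub> v" w] pure_tensor_smult_l[of c v w] c s
    by (simp add: pure_tensor_def tensor_def)
qed

lemma tensor_lift:
  assumes U: "module R U"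
    and f: "\<And>v w. \<lbrakk>v \<in> carrier V; w \<in> carrier W\<rbrakk> \<Longrightarrow> f v w \<in> carrier U"
    and add_l: "\<And>v v' w. \<lbrakk>v \<in> carrier V; v' \<in> carrier V; w \<in> carrier W\<rbrakk> \<Longrightarrow>
      f (v \<oplus>\<^bsub>V\<^esub> v') w = f v w \<oplus>\<^bsub>U\<^esub> f v' w"
    and add_r: "\<And>v w w'. \<lbrakk>v \<in> carrier V; w \<in> carrier W; w' \<in> carrier W\<rbrakk> \<Longrightarrow>
      f v (w \<oplus>\<^bsub>W\<^esub> w') = f v w \<oplus>\<^bsub>U\<^esub> f v w'"
    and smult_l: "\<And>r v w. \<lbrakk>r \<in> carrier R; v \<in> carrier V; w \<in> carrier W\<rbrakk> \<Longrightarrow>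
      f (r \<odot>\<^bsub>V\<^esub> v) w = r \<odot>\<^bsub>U\<^esub> f v w"
    and smult_r: "\<And>r v w. \<lbrakk>r \<in> carrier R; v \<in> carrier V; w \<in> carrier W\<rbrakk> \<Longrightarrow>
      f v (r \<odot>\<^bsub>W\<^esub> w) = r \<odot>\<^bsub>U\<^esub> f v w"
  shows "\<exists>g\<in>lin_hom R (tensor R V W) U.
    \<forall>v\<in>carrier V. \<forall>w\<in>carrier W. g (pure_tensor R V W v w) = f v w"
proof -
  interpret F: module R T.F by (rule V.R.free_module_is_module)
  note gen = tensor_free_gen_closed
  have "\<exists>g\<in>lin_hom R T.P U. \<forall>s\<in>carrier V \<times> carrier W.
    g (presented_gen R (carrier V \<times> carrier W) (tensor_rels R V W) s) = case_prod f s"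
  proof (rule T.presented_lift[OF U])
    show "case_prod f \<in> carrier V \<times> carrier W \<rightarrow> carrier U" using f by auto
    fix h x
    assume h: "h \<in> lin_hom R T.F U" and h': "additive_map T.F U h"
      and hf: "\<And>s. s \<in> carrier V \<times> carrier W \<Longrightarrow> h (free_gen R s) = case_prod f s"
      and x: "x \<in> tensor_rels R V W"
    note zero = additive_map.diff_zero[OF h'] and hadd = additive_map.add[OF h']
      and hsmult = lin_hom_smult[OF h]
    from x consider
      (1) v v' w where "x = free_gen R (v \<oplus>\<^bsub>V\<^esub> v', w) \<ominus>\<^bsub>T.F\<^esub> (free_gen R (v, w) \<oplus>\<^bsub>T.F\<^esub> free_gen R (v', w))"
        "v \<in> carrier V" "v' \<in> carrier V" "w \<in> carrier W"
    | (2) v w w' where "x = free_gen R (v, w \<oplus>\<^bsub>W\<^esub> w') \<ominus>\<^bsub>T.F\<^esub> (free_gen R (v, w) \<oplus>\<^bsub>T.F\<^esub> free_gen R (v, w'))"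
        "v \<in> carrier V" "w \<in> carrier W" "w' \<in> carrier W"
    | (3) r v w where "x = free_gen R (r \<odot>\<^bsub>V\<^esub> v, w) \<ominus>\<^bsub>T.F\<^esub> (r \<odot>\<^bsub>T.F\<^esub> free_gen R (v, w))"
        "r \<in> carrier R" "v \<in> carrier V" "w \<in> carrier W"
    | (4) r v w where "x = free_gen R (v, r \<odot>\<^bsub>W\<^esub> w) \<ominus>\<^bsub>T.F\<^esub> (r \<odot>\<^bsub>T.F\<^esub> free_gen R (v, w))"
        "r \<in> carrier R" "v \<in> carrier V" "w \<in> carrier W"
      unfolding tensor_rels_def Let_def by blast
    then show "h x = \<zero>\<^bsub>U\<^esub>"
    proof cases
      case 1
      show ?thesis
        unfolding 1(1)
        by (rule zero) (use 1(2-) gen hf hadd add_l in \<open>simp_all del: free_module_simps\<close>)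
    next
      case 2
      show ?thesis
        unfolding 2(1)
        by (rule zero) (use 2(2-) gen hf hadd add_r in \<open>simp_all del: free_module_simps\<close>)
    next
      case 3
      show ?thesis
        unfolding 3(1)
        by (rule zero) (use 3(2-) gen hf hsmult smult_l in \<open>simp_all del: free_module_simps\<close>)
    next
      case 4
      show ?thesis
        unfolding 4(1)
        by (rule zero) (use 4(2-) gen hf hsmult smult_r in \<open>simp_all del: free_module_simps\<close>)
    qed
  qed
  then show ?thesis
    unfolding tensor_def pure_tensor_def by fastforce
qed

end

section \<open>Polynomials and partial derivatives\<close>

abbreviation mmonom :: "(nat \<Rightarrow>\<^sub>0 nat) \<Rightarrow> 'k \<Rightarrow> 'k::field mpoly"
  where "mmonom \<equiv> Poly_Mapping.single"

lemma mpoly_conv_sum: "(f :: 'k::field mpoly) = (\<Sum>t\<in>Poly_Mapping.keys f. mmonom t (Poly_Mapping.lookup f t))"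
proof (rule poly_mapping_eqI)
  fix s
  have "(\<Sum>t\<in>Poly_Mapping.keys f. Poly_Mapping.lookup (mmonom t (Poly_Mapping.lookup f t)) s) =
    (\<Sum>t\<in>Poly_Mapping.keys f. if t = s then Poly_Mapping.lookup f t else 0)"
    by (intro sum.cong) (auto simp: lookup_single)
  also have "\<dots> = Poly_Mapping.lookup f s"
    by (simp add: sum.delta' in_keys_iff)
  finally show "Poly_Mapping.lookup f s =
      Poly_Mapping.lookup (\<Sum>t\<in>Poly_Mapping.keys f. mmonom t (Poly_Mapping.lookup f t)) s"
    by (simp add: lookup_sum)
qed

lemma mpoly_monom_induct [case_names monom add]:
  assumes "\<And>t c. P (mmonom t c)" "\<And>f g. P f \<Longrightarrow> P g \<Longrightarrow> P (f + g)"
  shows "P (f :: 'k::field mpoly)"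
proof -
  have "P (\<Sum>t\<in>T. mmonom t (Poly_Mapping.lookup f t))" if "finite T" for T
    using that
  proof (induction rule: finite_induct)
    case empty
    then show ?case using assms(1)[of 0 0] by simp
  qed (simp add: assms)
  from this[of "Poly_Mapping.keys f"] show ?thesis
    using mpoly_conv_sum[of f] by simp
qed

definition polys :: "nat \<Rightarrow> 'k::field mpoly set"
  where "polys n = {f. \<forall>t\<in>Poly_Mapping.keys f. Poly_Mapping.keys t \<subseteq> {..<n}}"

lemma polys_const [simp]: "mmonom 0 c \<in> polys n"
  by (auto simp: polys_def)

lemma polys_0 [simp]: "0 \<in> polys n" and polys_1 [simp]: "1 \<in> polys n"
  by (auto simp: polys_def)

lemma polys_add [simp]: "f \<in> polys n \<Longrightarrow> g \<in> polys n \<Longrightarrow> f + g \<in> polys n"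
  unfolding polys_def using keys_add[of f g] by blast

lemma polys_uminus [simp]: "f \<in> polys n \<Longrightarrow> - f \<in> polys n"
  by (auto simp: polys_def in_keys_iff)

lemma polys_mult [simp]:
  assumes "f \<in> polys n" "g \<in> polys n" shows "f * g \<in> polys n"
  unfolding polys_def mem_Collect_eq
proof
  fix t assume "t \<in> Poly_Mapping.keys (f * g)"
  then obtain a b where "t = a + b" "a \<in> Poly_Mapping.keys f" "b \<in> Poly_Mapping.keys g"
    using keys_mult[of f g] by auto
  then show "Poly_Mapping.keys t \<subseteq> {..<n}"
    using assms keys_add[of a b] unfolding polys_def by blast
qed

lemma polys_sum [simp]: "(\<And>i. i \<in> A \<Longrightarrow> f i \<in> polys n) \<Longrightarrow> sum f A \<in> polys n"
  by (induction A rule: infinite_finite_induct) auto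

lemma polys_prod [simp]: "(\<And>i. i \<in> A \<Longrightarrow> f i \<in> polys n) \<Longrightarrow> prod f A \<in> polys n"
  by (induction A rule: infinite_finite_induct) auto

lemma polys_sign [simp]: "(- 1) ^ i \<in> polys n"
  by (cases "even i") auto

lemma polys_var [simp]: "k < n \<Longrightarrow> poly_var k \<in> polys n"
  by (auto simp: polys_def poly_var_def)

lemma poly_var_power: "poly_var k ^ m = mmonom (Poly_Mapping.single k m) 1"
  by (induction m) (simp_all add: poly_var_def mult_single single_add[symmetric])

lemma monom_sum_exponents:
  "finite A \<Longrightarrow> mmonom (\<Sum>k\<in>A. e k) 1 = (\<Prod>k\<in>A. mmonom (e k) (1 :: 'k::field))"
proof (induction rule: finite_induct)
  case (insert a A)
  have "mmonom (e a + (\<Sum>k\<in>A. e k)) (1 :: 'k) = mmonom (e a) 1 * mmonom (\<Sum>k\<in>A. e k) 1"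
    by (simp add: mult_single)
  with insert show ?case by simp
qed simp

text \<open>Constants and variables generate the algebra. This underlies the reduction of
  derivations to their values on variables and the generation of one-forms by the differentials of
  variables.\<close>

lemma polys_induct [consumes 1, case_names const var add mult]:
  assumes f: "f \<in> polys n"
    and const: "\<And>c. P (mmonom 0 c)" and var: "\<And>k. k < n \<Longrightarrow> P (poly_var k)"
    and add: "\<And>f g. \<lbrakk>f \<in> polys n; g \<in> polys n; P f; P g\<rbrakk> \<Longrightarrow> P (f + g)"
    and mult: "\<And>f g. \<lbrakk>f \<in> polys n; g \<in> polys n; P f; P g\<rbrakk> \<Longrightarrow> P (f * g)"
  shows "P f"
proof -
  have one: "P 1" using const[of 1] by simp
  have power: "(poly_var k ^ m :: 'a mpoly) \<in> polys n \<and> P (poly_var k ^ m :: 'a mpoly)" if "k < n" for k m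
    using that by (induction m) (auto simp: one var intro!: mult)
  \<comment> \<open>Membership in \<open>polys n\<close> is carried along since the rules for sums
    and products demand it of both operands.\<close>
  have monoms: "P (mmonom t c) \<and> mmonom t c \<in> polys n" if t: "Poly_Mapping.keys t \<subseteq> {..<n}" for t c
  proof -
    have prod: "P (\<Prod>k\<in>A. poly_var k ^ Poly_Mapping.lookup t k)" if "A \<subseteq> {..<n}" for A
    proof -
      have "finite A" using that finite_subset by blast
      then show ?thesis using that
        by (induction rule: finite_induct) (auto simp: one power intro!: mult polys_prod)
    qed
    have "t = (\<Sum>k<n. Poly_Mapping.single k (Poly_Mapping.lookup t k))"
    proof (rule poly_mapping_eqI)
      fix j
      have "(\<Sum>k<n. Poly_Mapping.lookup (Poly_Mapping.single k (Poly_Mapping.lookup t k)) j) =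
        (\<Sum>k<n. if k = j then Poly_Mapping.lookup t k else 0)"
        by (intro sum.cong) (auto simp: lookup_single)
      also have "\<dots> = Poly_Mapping.lookup t j"
        using t by (auto simp: sum.delta' in_keys_iff)
      finally show "Poly_Mapping.lookup t j =
          Poly_Mapping.lookup (\<Sum>k<n. Poly_Mapping.single k (Poly_Mapping.lookup t k)) j"
        by (simp add: lookup_sum)
    qed
    then have "mmonom t 1 = (\<Prod>k<n. mmonom (Poly_Mapping.single k (Poly_Mapping.lookup t k)) (1 :: 'a))"
      using monom_sum_exponents[of "{..<n}" "\<lambda>k. Poly_Mapping.single k (Poly_Mapping.lookup t k)"] by simp
    then have eq: "mmonom t 1 = (\<Prod>k<n. poly_var k ^ Poly_Mapping.lookup t k :: 'a mpoly)"
      by (simp add: poly_var_power)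
    have "mmonom t c = mmonom 0 c * mmonom t 1" by (simp add: mult_single)
    moreover have pr: "(\<Prod>k<n. poly_var k ^ Poly_Mapping.lookup t k :: 'a mpoly) \<in> polys n"
      by (intro polys_prod) (use power in auto)
    ultimately show ?thesis unfolding eq
      using mult[OF polys_const pr const prod[of "{..<n}"], of c] by (simp del: polys_prod)
  qed
  have "P (\<Sum>t\<in>T. mmonom t (Poly_Mapping.lookup f t)) \<and> (\<Sum>t\<in>T. mmonom t (Poly_Mapping.lookup f t)) \<in> polys n"
    if "T \<subseteq> Poly_Mapping.keys f" for T
  proof -
    have "finite T" by (rule finite_subset[OF that finite_keys])
    then show ?thesis using that
    proof (induction rule: finite_induct)
      case empty
      then show ?case using const[of 0] by simp
    next
      case (insert t T)
      moreover have "P (mmonom t (Poly_Mapping.lookup f t)) \<and> mmonom t (Poly_Mapping.lookup f t) \<in> polys n"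
        using f insert.prems by (intro monoms) (simp add: polys_def)
      ultimately show ?case by (simp add: add)
    qed
  qed
  from this[of "Poly_Mapping.keys f"] show ?thesis
    using mpoly_conv_sum[of f] by simp
qed

text \<open>Subtraction of exponents is truncated, but whenever the exponent of the variable is zero
  the coefficient \<open>of_nat 0\<close> kills the term.\<close>

definition pd :: "nat \<Rightarrow> 'k::field mpoly \<Rightarrow> 'k mpoly"
  where "pd k f = (\<Sum>t\<in>Poly_Mapping.keys f. mmonom (t - Poly_Mapping.single k 1)
     (of_nat (Poly_Mapping.lookup t k) * Poly_Mapping.lookup f t))"

lemma pd_superset:
  assumes "finite T" "Poly_Mapping.keys f \<subseteq> T"
  shows "pd k f = (\<Sum>t\<in>T. mmonom (t - Poly_Mapping.single k 1)
     (of_nat (Poly_Mapping.lookup t k) * Poly_Mapping.lookup f t))"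
  unfolding pd_def by (rule sum.mono_neutral_left) (use assms in \<open>auto simp: in_keys_iff\<close>)

lemma pd_add: "pd k (f + g) = pd k f + pd k g"
proof -
  let ?T = "Poly_Mapping.keys f \<union> Poly_Mapping.keys g"
  have "finite ?T" "Poly_Mapping.keys (f + g) \<subseteq> ?T" by (simp_all add: keys_add)
  then show ?thesis
    by (simp add: pd_superset[of ?T] lookup_add distrib_left single_add sum.distrib)
qed

lemma pd_monom: "pd k (mmonom t c) = mmonom (t - Poly_Mapping.single k 1) (of_nat (Poly_Mapping.lookup t k) * c)"
  by (simp add: pd_superset[of "{t}"])

lemma pd_0 [simp]: "pd k 0 = 0"
  by (simp add: pd_def)

lemma pd_uminus: "pd k (- f) = - pd k f"
  using pd_add[of k f "- f"] by (simp add: add_eq_0_iff2)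

lemma pd_sum: "pd k (sum f A) = (\<Sum>a\<in>A. pd k (f a))"
  by (induction A rule: infinite_finite_induct) (auto simp: pd_add)

lemma pd_const [simp]: "pd k (mmonom 0 c) = 0"
  by (simp add: pd_monom)

lemma pd_1 [simp]: "pd k 1 = 0"
  using pd_const[of k 1] by simp

lemma pd_var: "pd k (poly_var j) = (if k = j then 1 else 0)"
  by (simp add: poly_var_def pd_monom lookup_single)

lemma pd_mult_monom:
  "pd k (mmonom s a * mmonom t b) = mmonom s a * pd k (mmonom t b) + mmonom t b * pd k (mmonom s a)"
proof -
  \<comment> \<open>Truncated subtraction may be moved past \<open>s\<close>: either the exponent of
    the variable in \<open>t\<close> is positive, or the coefficient vanishes.\<close>
  have shift: "mmonom (s + t - Poly_Mapping.single k 1) (of_nat (Poly_Mapping.lookup t k) * c) =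
    mmonom (s + (t - Poly_Mapping.single k 1)) (of_nat (Poly_Mapping.lookup t k) * c)" for s t c
  proof (cases "Poly_Mapping.lookup t k = 0")
    case False
    then have "s + t - Poly_Mapping.single k 1 = s + (t - Poly_Mapping.single k 1)"
      by (intro poly_mapping_eqI) (auto simp: lookup_add lookup_minus lookup_single when_def)
    then show ?thesis by simp
  qed simp
  have "pd k (mmonom s a * mmonom t b) = mmonom (s + t - Poly_Mapping.single k 1) (of_nat (Poly_Mapping.lookup t k) * (a * b))
    + mmonom (t + s - Poly_Mapping.single k 1) (of_nat (Poly_Mapping.lookup s k) * (a * b))"
    by (simp add: mult_single pd_monom lookup_add distrib_right single_add[symmetric] add.commute)
  also have "\<dots> = mmonom s a * pd k (mmonom t b) + mmonom t b * pd k (mmonom s a)"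
    unfolding shift by (simp add: mult_single pd_monom mult_ac)
  finally show ?thesis .
qed

lemma pd_mult: "pd k (f * g) = f * pd k g + g * pd k f"
proof (induction f rule: mpoly_monom_induct)
  case (monom s a)
  show ?case
  proof (induction g rule: mpoly_monom_induct)
    case (monom t b)
    show ?case by (rule pd_mult_monom)
  next
    case (add f g)
    then show ?case by (simp add: pd_add algebra_simps)
  qed
next
  case (add f1 f2)
  then show ?case by (simp add: pd_add algebra_simps)
qed

lemma pd_smult: "pd k (mmonom 0 c * f) = mmonom 0 c * pd k f"
  by (simp add: pd_mult)

lemma pd_closed [simp]: "f \<in> polys n \<Longrightarrow> pd k f \<in> polys n"
  by (induction rule: polys_induct) (auto simp: pd_add pd_mult pd_var)

section \<open>Determinants of lists of rows\<close>

text \<open>Rows are functions of the column index, which lets gradients of polynomials and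
  coordinate vectors of one-forms be mixed in one list. The value 0 for a wrong number of rows makes
  the linearity, swap and repetition rules hold for lists of any length.\<close>

definition rows_det :: "nat \<Rightarrow> (nat \<Rightarrow> 'r::comm_ring_1) list \<Rightarrow> 'r"
  where "rows_det n vs = (if length vs = n then det (mat n n (\<lambda>(i, j). (vs ! i) j)) else 0)"

text \<open>Leibniz expansion with the factor of row \<open>i\<close> isolated, so that linearity in
  that row can be read off termwise.\<close>

lemma rows_det_update:
  assumes "i < length vs" "length vs = n"
  shows "rows_det n (vs[i := u]) = (\<Sum>p\<in>{p. p permutes {0..<n}}.
    signof p * (u (p i) * (\<Prod>j\<in>{0..<n} - {i}. (vs ! j) (p j))))"
proof -
  let ?A = "mat n n (\<lambda>(k, j). (vs[i := u] ! k) j)"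
  have "?A \<in> carrier_mat n n" by simp
  have "rows_det n (vs[i := u]) = det ?A"
    using assms by (simp add: rows_det_def)
  also have "\<dots> = (\<Sum>p\<in>{p. p permutes {0..<n}}. signof p * (\<Prod>k = 0..<n. ?A $$ (k, p k)))"
    by (rule det_def'[OF \<open>?A \<in> carrier_mat n n\<close>])
  also have "\<dots> = (\<Sum>p\<in>{p. p permutes {0..<n}}.
    signof p * (u (p i) * (\<Prod>j\<in>{0..<n} - {i}. (vs ! j) (p j))))"
  proof (intro sum.cong refl arg_cong2[where f = "(*)"])
    fix p assume "p \<in> {p. p permutes {0..<n}}"
    then have p: "p k < n" if "k < n" for k
      using that permutes_in_image[of p "{0..<n}" k] by simp
    have "(\<Prod>k = 0..<n. ?A $$ (k, p k)) = ?A $$ (i, p i) * (\<Prod>k\<in>{0..<n} - {i}. ?A $$ (k, p k))"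
      using assms by (intro prod.remove) auto
    also have "\<dots> = u (p i) * (\<Prod>j\<in>{0..<n} - {i}. (vs ! j) (p j))"
      using assms p by (intro arg_cong2[where f = "(*)"] prod.cong) auto
    finally show "(\<Prod>k = 0..<n. ?A $$ (k, p k)) = u (p i) * (\<Prod>j\<in>{0..<n} - {i}. (vs ! j) (p j))" .
  qed
  finally show ?thesis .
qed

lemma rows_det_wrong_length: "length vs \<noteq> n \<Longrightarrow> rows_det n vs = 0"
  by (simp add: rows_det_def)

lemma rows_det_add:
  assumes "i < length vs" "\<And>k. k < n \<Longrightarrow> w k = u k + v k"
  shows "rows_det n (vs[i := w]) = rows_det n (vs[i := u]) + rows_det n (vs[i := v])"
proof (cases "length vs = n")
  case True
  have "w (p i) = u (p i) + v (p i)" if "p permutes {0..<n}" for p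
    using permutes_in_image[OF that, of i] assms True by simp
  then show ?thesis
    using assms True by (simp add: rows_det_update sum.distrib[symmetric] algebra_simps)
qed (simp add: rows_det_wrong_length)

lemma rows_det_smult:
  assumes "i < length vs" "\<And>k. k < n \<Longrightarrow> w k = r * u k"
  shows "rows_det n (vs[i := w]) = r * rows_det n (vs[i := u])"
proof (cases "length vs = n")
  case True
  have "w (p i) = r * u (p i)" if "p permutes {0..<n}" for p
    using permutes_in_image[OF that, of i] assms True by simp
  then show ?thesis
    using assms True by (simp add: rows_det_update sum_distrib_left mult_ac)
qed (simp add: rows_det_wrong_length)

lemma rows_det_repeat:
  assumes "i < length vs" "j < length vs" "i \<noteq> j" "vs ! i = vs ! j"
  shows "rows_det n vs = 0"
proof (cases "length vs = n")
  case True
  then show ?thesis unfolding rows_det_def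
    using assms by (auto intro!: det_identical_rows[of _ n i j] eq_vecI)
qed (simp add: rows_det_wrong_length)

lemma rows_det_swap:
  assumes "i < length vs" "j < length vs" "i \<noteq> j"
  shows "rows_det n (vs[i := vs ! j, j := vs ! i]) = - rows_det n vs"
proof (cases "length vs = n")
  case True
  have "mat n n (\<lambda>(k, l). (vs[i := vs ! j, j := vs ! i] ! k) l) = swaprows i j (mat n n (\<lambda>(k, l). (vs ! k) l))"
    using assms True by (intro eq_matI) (auto simp: nth_list_update)
  then show ?thesis
    using det_swaprows[of i n j "mat n n (\<lambda>(k, l). (vs ! k) l)"] assms True
    by (simp add: rows_det_def)
qed (simp add: rows_det_wrong_length)

lemma length_omit [simp]: "i < length xs \<Longrightarrow> length (omit i xs) = length xs - 1"
  by (simp add: omit_def)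

lemma nth_omit: "\<lbrakk>i < length xs; k < length xs - 1\<rbrakk> \<Longrightarrow> omit i xs ! k = (if k < i then xs ! k else xs ! Suc k)"
  by (auto simp: omit_def nth_append min_def)

text \<open>Prepending a copy of column \<open>k\<close> gives a square matrix of size n + 1 with
  two equal columns; its vanishing determinant is expanded along the new first column.\<close>

lemma rows_det_laplace_zero:
  fixes vs :: "(nat \<Rightarrow> 'r::comm_ring_1) list"
  assumes "length vs = Suc n" "k < n"
  shows "(\<Sum>i<Suc n. (- 1) ^ i * rows_det n (omit i vs) * (vs ! i) k) = 0"
proof -
  let ?A = "mat (Suc n) (Suc n) (\<lambda>(i, j). if j = 0 then (vs ! i) k else (vs ! i) (j - 1))"
  have A: "?A \<in> carrier_mat (Suc n) (Suc n)" by simp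
  have "det ?A = 0"
    by (rule det_identical_columns[OF A, of 0 "Suc k"]) (use assms in \<open>auto intro!: eq_vecI\<close>)
  moreover have "det ?A = (\<Sum>i<Suc n. ?A $$ (i, 0) * cofactor ?A i 0)"
    by (rule laplace_expansion_column[OF A]) simp
  moreover have "?A $$ (i, 0) * cofactor ?A i 0 = (- 1) ^ i * rows_det n (omit i vs) * (vs ! i) k"
    if i: "i < Suc n" for i
  proof -
    have "mat_delete ?A i 0 = mat n n (\<lambda>(i', j). (omit i vs ! i') j)"
      using i assms by (intro eq_matI) (auto simp: mat_delete_def nth_omit)
    then show ?thesis
      using i assms by (simp add: cofactor_def rows_det_def)
  qed
  ultimately show ?thesis by simp
qed

lemma rows_det_unit: "rows_det n (map (\<lambda>i k. if k = i then 1 else 0) [0..<n]) = 1"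
proof -
  have "mat n n (\<lambda>(i, j). (map (\<lambda>i k. if k = i then 1 else 0) [0..<n] ! i) j) = (1\<^sub>m n :: 'a mat)"
    by (intro eq_matI) auto
  then show ?thesis by (simp add: rows_det_def)
qed

lemma rows_det_closed:
  assumes "\<And>v k. v \<in> set vs \<Longrightarrow> k < n \<Longrightarrow> v k \<in> polys m"
  shows "rows_det n vs \<in> polys m"
proof (cases "length vs = n")
  case True
  have "(vs ! i) (p i) \<in> polys m" if "p permutes {0..<n}" "i < n" for p i
    using permutes_in_image[OF that(1), of i] that assms True by simp
  moreover have "signof p \<in> polys m" for p
    by (simp add: sign_def)
  ultimately show ?thesis
    using True unfolding rows_det_def
    by (auto simp: det_def intro!: polys_sum polys_mult polys_prod)
qed (simp add: rows_det_wrong_length)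

section \<open>Reduction of alternating conditions to increasing tuples of generators\<close>

text \<open>Transpositions reach every rearrangement: the first entry of the target is swapped into
  place and the argument continues on the rest.\<close>

lemma swap_closed_mset_eq:
  assumes swap: "\<And>xs i j. \<lbrakk>P xs; i < j; j < length xs\<rbrakk> \<Longrightarrow> P (xs[i := xs ! j, j := xs ! i])"
    and "mset xs = mset ys" "P xs"
  shows "P ys"
proof -
  \<comment> \<open>The prefix \<open>zs\<close> collects the entries already in place; the swap
    hypothesis speaks of the whole list, so the prefix has to be kept.\<close>
  have "P (zs @ xs) \<Longrightarrow> mset xs = mset ys \<Longrightarrow> P (zs @ ys)" for zs xs
  proof (induction ys arbitrary: zs xs)
    case (Cons y ys)
    then obtain x xs' where xs: "xs = x # xs'" by (cases xs) auto
    have "y \<in> set xs" using Cons.prems(2) by (metis list.set_intros(1) set_mset_mset)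
    show ?case
    proof (cases "x = y")
      case True
      then show ?thesis using Cons.IH[of "zs @ [y]" xs'] Cons.prems xs by simp
    next
      case False
      with \<open>y \<in> set xs\<close> xs obtain us vs where us: "xs' = us @ y # vs"
        by (metis set_ConsD split_list)
      have "P ((zs @ xs)[length zs := (zs @ xs) ! (length zs + Suc (length us)),
          length zs + Suc (length us) := (zs @ xs) ! length zs])"
        using Cons.prems(1) by (intro swap) (auto simp: xs us)
      also have "(zs @ xs)[length zs := (zs @ xs) ! (length zs + Suc (length us)),
          length zs + Suc (length us) := (zs @ xs) ! length zs] = (zs @ [y]) @ us @ x # vs"
        by (simp add: xs us nth_append list_update_append)
      finally have "P ((zs @ [y]) @ us @ x # vs)" .
      moreover have "mset (us @ x # vs) = mset ys"
        using Cons.prems(2) by (simp add: xs us add_mset_commute)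
      ultimately have "P ((zs @ [y]) @ ys)" using Cons.IH by blast
      then show ?thesis by simp
    qed
  qed simp
  from this[of "[]" xs] show ?thesis using assms(2,3) by simp
qed

lemma tuples_nth: "\<lbrakk>vs \<in> tuples p A; i < p\<rbrakk> \<Longrightarrow> vs ! i \<in> A"
  by (auto simp: tuples_def)

text \<open>Common scheme for properties of tuples that are compatible with alternation and are
  controlled slot by slot by generators \<open>X k\<close>. The hypothesis \<open>lin\<close> hides
  how one slot is reduced to generators: by the Leibniz rule for polynomials, by
  \<open>R\<close>-linear combinations for one-forms. Tuples of generators are then either
  repetitive or can be sorted.\<close>

lemma alternating_reduction:
  assumes X: "\<And>k. k < n \<Longrightarrow> X k \<in> A"
    and lin: "\<And>vs i. \<lbrakk>vs \<in> tuples p A; i < p; \<And>k. k < n \<Longrightarrow> P (vs[i := X k])\<rbrakk> \<Longrightarrow> P vs"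
    and repeat: "\<And>vs i j. \<lbrakk>vs \<in> tuples p A; i < j; j < p; vs ! i = vs ! j\<rbrakk> \<Longrightarrow> P vs"
    and swap: "\<And>vs i j. \<lbrakk>vs \<in> tuples p A; i < j; j < p; P vs\<rbrakk> \<Longrightarrow> P (vs[i := vs ! j, j := vs ! i])"
    and base: "\<And>I. \<lbrakk>I \<subseteq> {..<n}; card I = p\<rbrakk> \<Longrightarrow> P (map X (sorted_list_of_set I))"
    and vs: "vs \<in> tuples p A"
  shows "P vs"
proof -
  have gens: "P (map X ks)" if ks: "length ks = p" "set ks \<subseteq> {..<n}" for ks
  proof (cases "distinct ks")
    case False
    then obtain i j where "i < j" "j < p" "ks ! i = ks ! j"
      using ks by (metis distinct_conv_nth linorder_neqE_nat)
    moreover have "map X ks \<in> tuples p A" using ks X by (auto simp: tuples_def)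
    ultimately show ?thesis using ks by (intro repeat[of "map X ks" i j]) auto
  next
    case True
    let ?Q = "\<lambda>ks. length ks = p \<and> set ks \<subseteq> {..<n} \<and> P (map X ks)"
    have card: "card (set ks) = p" using True ks distinct_card by blast
    have "?Q ks"
    proof (rule swap_closed_mset_eq[of ?Q "sorted_list_of_set (set ks)"])
      show "mset (sorted_list_of_set (set ks)) = mset ks"
        using True by (simp add: set_eq_iff_mset_eq_distinct[symmetric])
      show "?Q (sorted_list_of_set (set ks))"
        using ks card base by simp
      fix xs i j assume *: "?Q xs" "i < j" "j < length xs"
      then have "map X xs \<in> tuples p A" using X by (auto simp: tuples_def)
      then have "P ((map X xs)[i := map X xs ! j, j := map X xs ! i])"
        using * by (intro swap) auto
      moreover have "(map X xs)[i := map X xs ! j, j := map X xs ! i] = map X (xs[i := xs ! j, j := xs ! i])"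
        using * by (simp add: map_update)
      moreover have "set (xs[i := xs ! j, j := xs ! i]) = set xs"
        using * by simp
      ultimately show "?Q (xs[i := xs ! j, j := xs ! i])"
        using * by (metis length_list_update)
    qed
    then show ?thesis by blast
  qed
  \<comment> \<open>The first \<open>m\<close> entries are arbitrary and the others are generators;
    induction on \<open>m\<close> converts one entry at a time.\<close>
  have "\<forall>vs\<in>tuples p A. (\<forall>i. m \<le> i \<and> i < p \<longrightarrow> vs ! i \<in> X ` {..<n}) \<longrightarrow> P vs" if "m \<le> p" for m
    using that
  proof (induction m)
    case 0
    show ?case
    proof (intro ballI impI)
      fix vs assume vs: "vs \<in> tuples p A" "\<forall>i. 0 \<le> i \<and> i < p \<longrightarrow> vs ! i \<in> X ` {..<n}"
      then have "\<forall>v\<in>set vs. \<exists>k. k < n \<and> v = X k"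
        by (fastforce simp: tuples_def in_set_conv_nth)
      then obtain f where f: "\<And>v. v \<in> set vs \<Longrightarrow> f v < n \<and> v = X (f v)"
        by metis
      then have "map X (map f vs) = vs" by (auto simp: map_idI)
      moreover have "P (map X (map f vs))"
        using f vs by (intro gens) (auto simp: tuples_def)
      ultimately show "P vs" by simp
    qed
  next
    case (Suc m)
    show ?case
    proof (intro ballI impI)
      fix vs assume vs: "vs \<in> tuples p A" "\<forall>i. Suc m \<le> i \<and> i < p \<longrightarrow> vs ! i \<in> X ` {..<n}"
      show "P vs"
      proof (rule lin[OF vs(1)])
        show m: "m < p" using Suc.prems by simp
        fix k assume k: "k < n"
        have "vs[m := X k] \<in> tuples p A" using vs(1) X[OF k] by (rule tuples_update)
        moreover have "vs[m := X k] ! i \<in> X ` {..<n}" if "m \<le> i" "i < p" for i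
          using that vs k by (cases "i = m") (auto simp: tuples_def)
        ultimately show "P (vs[m := X k])" using Suc by simp
      qed
    qed
  qed
  from this[of p] vs show ?thesis by fastforce
qed

section \<open>Jacobian determinants\<close>

text \<open>All conditions are restricted to \<open>polys n\<close>, since a Poisson bracket is
  controlled only on the carrier of \<open>R\<close>.\<close>

definition derivation_on :: "nat \<Rightarrow> ('k::field mpoly \<Rightarrow> 'k mpoly) \<Rightarrow> bool"
  where "derivation_on n D \<longleftrightarrow> (\<forall>a\<in>polys n. \<forall>b\<in>polys n. D (a + b) = D a + D b) \<and>
    (\<forall>c. \<forall>a\<in>polys n. D (mmonom 0 c * a) = mmonom 0 c * D a) \<and>
    (\<forall>a\<in>polys n. \<forall>b\<in>polys n. D (a * b) = a * D b + b * D a)"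

lemma derivation_onI:
  assumes "\<And>a b. a \<in> polys n \<Longrightarrow> b \<in> polys n \<Longrightarrow> D (a + b) = D a + D b"
    and "\<And>c a. a \<in> polys n \<Longrightarrow> D (mmonom 0 c * a) = mmonom 0 c * D a"
    and "\<And>a b. a \<in> polys n \<Longrightarrow> b \<in> polys n \<Longrightarrow> D (a * b) = a * D b + b * D a"
  shows "derivation_on n D"
  unfolding derivation_on_def by (intro conjI ballI allI assms)

lemma derivation_on_add: "\<lbrakk>derivation_on n D; a \<in> polys n; b \<in> polys n\<rbrakk> \<Longrightarrow> D (a + b) = D a + D b"
  unfolding derivation_on_def by metis

lemma derivation_on_smult: "\<lbrakk>derivation_on n D; a \<in> polys n\<rbrakk> \<Longrightarrow> D (mmonom 0 c * a) = mmonom 0 c * D a"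
  unfolding derivation_on_def by metis

lemma derivation_on_mult: "\<lbrakk>derivation_on n D; a \<in> polys n; b \<in> polys n\<rbrakk> \<Longrightarrow> D (a * b) = a * D b + b * D a"
  unfolding derivation_on_def by metis

text \<open>Chain rule. Both sides obey the same sum and product rules, so it is enough to compare
  them on constants, where both vanish, and on variables.\<close>

lemma derivation_expand:
  assumes D: "derivation_on n D" and a: "a \<in> polys n"
  shows "D a = (\<Sum>k<n. pd k a * D (poly_var k))"
  using a
proof (induction rule: polys_induct)
  case (const c)
  have "D 1 = 0"
    using derivation_on_mult[OF D polys_1 polys_1] by (metis add_cancel_right_right mult_1)
  then show ?case
    using derivation_on_smult[OF D polys_1, of c] by simp
next
  case (var k)
  then show ?case by (simp add: pd_var if_distrib[of "\<lambda>x. x * _"] sum.delta cong: if_cong)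
next
  case (add f g)
  then show ?case by (simp add: derivation_on_add[OF D] pd_add distrib_right sum.distrib)
next
  case (mult f g)
  then show ?case
    by (simp add: derivation_on_mult[OF D] pd_mult distrib_right sum.distrib sum_distrib_left mult.assoc)
qed

lemma derivation_zero:
  assumes "derivation_on n D" "\<And>k. k < n \<Longrightarrow> D (poly_var k) = 0" "a \<in> polys n"
  shows "D a = 0"
  using derivation_expand[OF assms(1,3)] assms(2) by simp

definition jac :: "nat \<Rightarrow> 'k::field mpoly list \<Rightarrow> 'k mpoly"
  where "jac n cs = rows_det n (map (\<lambda>a k. pd k a) cs)"

lemma jac_wrong_length: "length cs \<noteq> n \<Longrightarrow> jac n cs = 0"
  by (simp add: jac_def rows_det_wrong_length)

lemma jac_closed: "set cs \<subseteq> polys m \<Longrightarrow> jac n cs \<in> polys m"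
  unfolding jac_def by (intro rows_det_closed) auto

lemma jac_add: "i < length cs \<Longrightarrow> jac n (cs[i := a + b]) = jac n (cs[i := a]) + jac n (cs[i := b])"
  unfolding jac_def map_update by (rule rows_det_add) (simp_all add: pd_add)

lemma jac_smult: "i < length cs \<Longrightarrow> jac n (cs[i := mmonom 0 c * a]) = mmonom 0 c * jac n (cs[i := a])"
  unfolding jac_def map_update by (rule rows_det_smult) (simp_all add: pd_smult)

lemma jac_mult:
  assumes "i < length cs"
  shows "jac n (cs[i := a * b]) = a * jac n (cs[i := b]) + b * jac n (cs[i := a])"
proof -
  let ?vs = "map (\<lambda>a k. pd k a) cs"
  have "jac n (cs[i := a * b]) = rows_det n (?vs[i := \<lambda>k. a * pd k b]) + rows_det n (?vs[i := \<lambda>k. b * pd k a])"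
    unfolding jac_def map_update by (rule rows_det_add) (use assms in \<open>simp_all add: pd_mult\<close>)
  also have "rows_det n (?vs[i := \<lambda>k. a * pd k b]) = a * jac n (cs[i := b])"
    unfolding jac_def map_update by (rule rows_det_smult) (use assms in simp_all)
  also have "rows_det n (?vs[i := \<lambda>k. b * pd k a]) = b * jac n (cs[i := a])"
    unfolding jac_def map_update by (rule rows_det_smult) (use assms in simp_all)
  finally show ?thesis .
qed

lemma jac_derivation: "i < length cs \<Longrightarrow> derivation_on n (\<lambda>a. jac m (cs[i := a]))"
  by (intro derivation_onI jac_add jac_smult jac_mult)

lemma jac_uminus: "i < length cs \<Longrightarrow> jac n (cs[i := - a]) = - jac n (cs[i := a])"
  using jac_smult[of i cs n "-1" a] by (simp add: single_uminus)

lemma jac_repeat: "\<lbrakk>i < length cs; j < length cs; i \<noteq> j; cs ! i = cs ! j\<rbrakk> \<Longrightarrow> jac n cs = 0"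
  unfolding jac_def by (rule rows_det_repeat[of i _ j]) auto

lemma jac_swap:
  assumes "i < length cs" "j < length cs" "i \<noteq> j"
  shows "jac n (cs[i := cs ! j, j := cs ! i]) = - jac n cs"
  unfolding jac_def using rows_det_swap[of i "map (\<lambda>a k. pd k a) cs" j n] assms
  by (simp add: map_update)

text \<open>Moving \<open>z\<close> to the front past the entries of \<open>us\<close> takes
  \<open>length us\<close> adjacent transpositions.\<close>

lemma jac_move: "jac n (us @ z # ws) = (- 1) ^ length us * jac n (z # us @ ws)"
proof (induction us arbitrary: ws rule: rev_induct)
  case (snoc u us)
  let ?cs = "us @ u # z # ws" and ?i = "length us"
  have "?cs[?i := ?cs ! Suc ?i, Suc ?i := ?cs ! ?i] = us @ z # u # ws"
    by (simp add: nth_append list_update_append)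
  then have "jac n (us @ z # u # ws) = - jac n ?cs"
    using jac_swap[of ?i ?cs "Suc ?i" n] by simp
  then show ?case using snoc[of "u # ws"] by (simp add: minus_equation_iff)
qed simp

lemma jac_update_front:
  assumes "k < length cs"
  shows "jac n (cs[k := z]) = (- 1) ^ k * jac n (z # omit k cs)"
  using jac_move[of n "take k cs" z "drop (Suc k) cs"] assms
  by (simp add: upd_conv_take_nth_drop omit_def min_def)

lemma jac_vars: "jac n (map poly_var [0..<n]) = (1 :: 'k::field mpoly)"
proof -
  have "map (\<lambda>a k. pd k a) (map poly_var [0..<n] :: 'k mpoly list) = map (\<lambda>i k. if k = i then 1 else 0) [0..<n]"
    by (auto simp: pd_var)
  then show ?thesis
    unfolding jac_def by (simp only: rows_det_unit)
qed

lemma jac_vars_repeat: "\<not> distinct ks \<Longrightarrow> jac n (map poly_var ks) = 0"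
proof -
  assume "\<not> distinct ks"
  then obtain i j where "i < length ks" "j < length ks" "i \<noteq> j" "ks ! i = ks ! j"
    by (auto simp: distinct_conv_nth)
  then show ?thesis by (intro jac_repeat[of i _ j]) auto
qed

lemma jac_vars_perm:
  assumes "distinct ks" "set ks = {..<n}"
  shows "jac n (map poly_var ks :: 'k::field mpoly list) = 1 \<or> jac n (map poly_var ks :: 'k mpoly list) = - 1"
proof -
  define P where "P ks \<longleftrightarrow> jac n (map poly_var ks :: 'k mpoly list) = 1 \<or> jac n (map poly_var ks :: 'k mpoly list) = - 1" for ks
  have "P ks"
  proof (rule swap_closed_mset_eq[of P "[0..<n]"])
    show "mset [0..<n] = mset ks"
      by (rule set_eq_iff_mset_eq_distinct[THEN iffD1])
        (simp_all only: assms distinct_upt set_upt atLeast0LessThan)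
    show "P [0..<n]" unfolding P_def by (simp only: jac_vars) simp
    fix xs i j assume "P xs" "i < j" "j < length xs"
    then show "P (xs[i := xs ! j, j := xs ! i])"
      using jac_swap[of i "map poly_var xs :: 'k mpoly list" j n] by (auto simp: map_update P_def)
  qed
  then show ?thesis by (simp add: P_def)
qed

text \<open>The Jacobian of a tuple of variables is 1, -1 or 0, hence has no derivative; this is the
  base case of \<open>jac_divergence_free\<close>.\<close>

lemma pd_jac_vars:
  assumes "set ks \<subseteq> {..<n}"
  shows "pd l (jac n (map poly_var ks :: 'k::field mpoly list)) = 0"
proof (cases "distinct ks \<and> length ks = n")
  case True
  then have "set ks = {..<n}"
    using assms by (metis card_subset_eq card_lessThan distinct_card finite_lessThan)
  with True have "jac n (map poly_var ks :: 'k mpoly list) = 1 \<or> jac n (map poly_var ks :: 'k mpoly list) = - 1"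
    by (intro jac_vars_perm) simp_all
  then show ?thesis by (elim disjE) (simp_all only: pd_1 pd_uminus minus_zero)
next
  case False
  then have "jac n (map poly_var ks :: 'k mpoly list) = 0"
    using jac_vars_repeat jac_wrong_length by (metis length_map)
  then show ?thesis by simp
qed

text \<open>As a derivation in slot \<open>k\<close> the left side is determined by its values on
  variables, and another variable in slot \<open>k\<close> repeats an entry.\<close>

lemma jac_var_update:
  assumes "k < n" "a \<in> polys n"
  shows "jac n ((map poly_var [0..<n])[k := a]) = pd k a"
proof -
  let ?x = "map poly_var [0..<n] :: 'a mpoly list"
  have "jac n (?x[k := poly_var l]) = (if l = k then 1 else 0)" if "l < n" for l
  proof (cases "l = k")
    case True
    then have "?x[k := poly_var l] = ?x" using assms by (intro list_update_same_conv[THEN iffD2]) auto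
    with True show ?thesis by (simp only: jac_vars) simp
  next
    case False
    then show ?thesis using assms that by (auto intro!: jac_repeat[of k _ l])
  qed
  then have "(\<Sum>l<n. pd l a * jac n (?x[k := poly_var l])) = (\<Sum>l<n. if l = k then pd l a else 0)"
    by (intro sum.cong) auto
  then show ?thesis
    using derivation_expand[OF jac_derivation[of k ?x n n] assms(2)] assms by simp
qed

text \<open>The chain rule reduces an arbitrary derivation to the partial derivatives, which are the
  columns of the Jacobian matrix.\<close>

lemma jac_laplace:
  assumes c: "length cs = Suc n" "set cs \<subseteq> polys n" and D: "derivation_on n D"
  shows "(\<Sum>i<Suc n. (- 1) ^ i * jac n (omit i cs) * D (cs ! i)) = 0"
proof -
  have "(\<Sum>i<Suc n. (- 1) ^ i * jac n (omit i cs) * D (cs ! i)) =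
    (\<Sum>i<Suc n. \<Sum>k<n. (- 1) ^ i * jac n (omit i cs) * pd k (cs ! i) * D (poly_var k))"
  proof (rule sum.cong[OF refl])
    fix i assume "i \<in> {..<Suc n}"
    then have "cs ! i \<in> polys n" using c by (auto simp: subset_iff)
    from derivation_expand[OF D this] show "(- 1) ^ i * jac n (omit i cs) * D (cs ! i) =
        (\<Sum>k<n. (- 1) ^ i * jac n (omit i cs) * pd k (cs ! i) * D (poly_var k))"
      by (simp add: sum_distrib_left mult.assoc)
  qed
  also have "\<dots> = (\<Sum>k<n. (\<Sum>i<Suc n. (- 1) ^ i * jac n (omit i cs) * pd k (cs ! i)) * D (poly_var k))"
    by (subst sum.swap) (simp only: sum_distrib_right)
  also have "\<dots> = 0"
  proof (rule sum.neutral, rule ballI)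
    fix k assume "k \<in> {..<n}"
    then have "(\<Sum>i<Suc n. (- 1) ^ i * rows_det n (omit i (map (\<lambda>a k. pd k a) cs)) *
        (map (\<lambda>a k. pd k a) cs ! i) k) = 0"
      using c by (intro rows_det_laplace_zero) auto
    moreover have "(\<Sum>i<Suc n. (- 1) ^ i * rows_det n (omit i (map (\<lambda>a k. pd k a) cs)) *
        (map (\<lambda>a k. pd k a) cs ! i) k) = (\<Sum>i<Suc n. (- 1) ^ i * jac n (omit i cs) * pd k (cs ! i))"
      using c by (intro sum.cong) (auto simp: jac_def omit_def take_map drop_map)
    ultimately show "(\<Sum>i<Suc n. (- 1) ^ i * jac n (omit i cs) * pd k (cs ! i)) * D (poly_var k) = 0"
      by simp
  qed
  finally show ?thesis .
qed

text \<open>Coordinate form of the closedness of da_1 \<and> ... \<and> da_{n-1}: the Jacobians with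
  \<open>poly_var k\<close> appended are the components of the vector field that corresponds to this
  form, and its divergence vanishes. The sum \<open>G\<close> is alternating and, after the cross
  terms cancel, a derivation in every slot, so it suffices to look at variables.\<close>

lemma jac_divergence_free:
  fixes as :: "'k::field_char_0 mpoly list"
  assumes "as \<in> tuples p (polys n)" "Suc p = n"
  shows "(\<Sum>k<n. pd k (jac n (as @ [poly_var k]))) = 0"
proof -
  define G where "G as = (\<Sum>k<n. pd k (jac n (as @ [poly_var k])))" for as :: "'k mpoly list"
  have upd: "as[i := a] @ [b] = (as @ [b])[i := a]" if "i < p" "length as = p" for as :: "'k mpoly list" and i a b
    using that by (simp add: list_update_append)
  have swap: "G (as[i := as ! j, j := as ! i]) = - G as" if "length as = p" "i < p" "j < p" "i \<noteq> j" for as i j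
  proof -
    have "jac n (as[i := as ! j, j := as ! i] @ [b]) = - jac n (as @ [b])" for b
      using that jac_swap[of i "as @ [b]" j n] by (simp add: upd nth_append)
    then show ?thesis by (simp add: G_def pd_uminus sum_negf)
  qed
  have "G as = 0"
  proof (rule alternating_reduction[where X = poly_var and n = n and P = "\<lambda>as. G as = 0" and A = "polys n" and p = p])
    show "poly_var k \<in> polys n" if "k < n" for k using that by simp
    show "as \<in> tuples p (polys n)" by fact
  next
    fix I assume "I \<subseteq> {..<n}" "card I = p"
    have "set (sorted_list_of_set I @ [k]) \<subseteq> {..<n}" if "k < n" for k
      using that \<open>I \<subseteq> {..<n}\<close> finite_subset[OF \<open>I \<subseteq> {..<n}\<close>] by auto
    from pd_jac_vars[OF this] show "G (map poly_var (sorted_list_of_set I)) = 0"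
      by (auto simp: G_def intro!: sum.neutral)
  next
    fix vs :: "'k mpoly list" and i j
    assume vs: "vs \<in> tuples p (polys n)" "i < j" "j < p"
    then have neg: "G (vs[i := vs ! j, j := vs ! i]) = - G vs"
      by (intro swap) (auto simp: tuples_def)
    {
      assume "vs ! i = vs ! j"
      \<comment> \<open>Swapping equal entries changes nothing, so \<open>G vs\<close> equals its
        own negative and vanishes in characteristic zero.\<close>
      then have "vs[i := vs ! j, j := vs ! i] = vs" by (metis list_update_id)
      with neg show "G vs = 0" by simp
    }
    assume "G vs = 0"
    with neg show "G (vs[i := vs ! j, j := vs ! i]) = 0" by simp
  next
    fix vs :: "'k mpoly list" and i
    assume vs: "vs \<in> tuples p (polys n)" and i: "i < p"
      and var: "\<And>k. k < n \<Longrightarrow> G (vs[i := poly_var k]) = 0"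
    have len: "length vs = p" using vs by (simp add: tuples_def)
    \<comment> \<open>By the chain rule, pairing the gradient of \<open>a\<close> with the last slot
      substitutes \<open>a\<close> for the variable there.\<close>
    have cross: "(\<Sum>k<n. pd k a * jac n (vs[i := b] @ [poly_var k])) = jac n (vs[i := b] @ [a])"
      if "a \<in> polys n" for a b
      using derivation_expand[OF jac_derivation[of p "vs[i := b] @ [a]" n n] that] len i
      by (simp add: list_update_append)
    have anti: "jac n (vs[i := b] @ [a]) = - jac n (vs[i := a] @ [b])" for a b
      using jac_swap[of i "vs[i := a] @ [b]" p n] len i
      by (simp add: nth_append list_update_append)
    \<comment> \<open>These are the cross terms of the product rule in slot \<open>i\<close>.
      Exchanging \<open>a\<close> and \<open>b\<close> swaps two entries of a Jacobian, so the two
      sums are opposite.\<close>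
    have cancel: "(\<Sum>k<n. pd k a * jac n (vs[i := b] @ [poly_var k])) +
        (\<Sum>k<n. pd k b * jac n (vs[i := a] @ [poly_var k])) = 0" if "a \<in> polys n" "b \<in> polys n" for a b
      unfolding cross[OF that(1)] cross[OF that(2)] anti[of a b] by (rule add.right_inverse)
    have "derivation_on n (\<lambda>a. G (vs[i := a]))"
    proof (rule derivation_onI)
      fix a b :: "'k mpoly" assume ab: "a \<in> polys n" "b \<in> polys n"
      show "G (vs[i := a + b]) = G (vs[i := a]) + G (vs[i := b])"
        using len i by (simp add: G_def upd jac_add pd_add sum.distrib)
      have "G (vs[i := a * b]) = a * G (vs[i := b]) + b * G (vs[i := a]) +
        ((\<Sum>k<n. pd k a * jac n (vs[i := b] @ [poly_var k])) +
        (\<Sum>k<n. pd k b * jac n (vs[i := a] @ [poly_var k])))"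
        using len i by (simp add: G_def upd jac_mult pd_add pd_mult sum.distrib sum_distrib_left algebra_simps)
      with cancel[OF ab] show "G (vs[i := a * b]) = a * G (vs[i := b]) + b * G (vs[i := a])" by simp
    next
      fix c and a :: "'k mpoly"
      show "G (vs[i := mmonom 0 c * a]) = mmonom 0 c * G (vs[i := a])"
        using len i by (simp add: G_def upd jac_smult pd_smult sum_distrib_left)
    qed
    from derivation_zero[OF this var] have "G (vs[i := vs ! i]) = 0"
      using tuples_nth[OF vs i] by blast
    then show "G vs = 0" by simp
  qed
  then show ?thesis by (simp add: G_def)
qed

section \<open>Poisson brackets on polynomial algebras\<close>

lemma poly_poisson_alg_simps [simp]:
  "carrier (poly_poisson_alg n br) = polys n"
  "a \<otimes>\<^bsub>poly_poisson_alg n br\<^esub> b = a * b"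
  "\<one>\<^bsub>poly_poisson_alg n br\<^esub> = 1"
  "\<zero>\<^bsub>poly_poisson_alg n br\<^esub> = 0"
  "a \<oplus>\<^bsub>poly_poisson_alg n br\<^esub> b = a + b"
  "c \<odot>\<^bsub>poly_poisson_alg n br\<^esub> a = mmonom 0 c * a"
  "pbracket (poly_poisson_alg n br) = br"
  by (auto simp: poly_poisson_alg_def polys_def)

lemma type_field_simps [simp]: "carrier type_field = UNIV"
  by (simp add: type_field_def)

locale poly_poisson =
  fixes n :: nat and br :: "'k::field_char_0 mpoly \<Rightarrow> 'k mpoly \<Rightarrow> 'k mpoly"
    and K :: "'k ring" and R :: "('k, 'k mpoly) poisson_alg"
  assumes K_def: "K = type_field" and R_def: "R = poly_poisson_alg n br"
    and poisson: "poisson_algebra K R"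
begin

lemma
  shows br_closed [simp]: "\<lbrakk>a \<in> polys n; b \<in> polys n\<rbrakk> \<Longrightarrow> br a b \<in> polys n"
    and br_add_r: "\<lbrakk>a \<in> polys n; b \<in> polys n; c \<in> polys n\<rbrakk> \<Longrightarrow> br a (b + c) = br a b + br a c"
    and br_add_l: "\<lbrakk>a \<in> polys n; b \<in> polys n; c \<in> polys n\<rbrakk> \<Longrightarrow> br (a + b) c = br a c + br b c"
    and br_smult_r: "\<lbrakk>a \<in> polys n; b \<in> polys n\<rbrakk> \<Longrightarrow> br a (mmonom 0 s * b) = mmonom 0 s * br a b"
    and br_smult_l: "\<lbrakk>a \<in> polys n; b \<in> polys n\<rbrakk> \<Longrightarrow> br (mmonom 0 s * a) b = mmonom 0 s * br a b"
    and br_self: "a \<in> polys n \<Longrightarrow> br a a = 0"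
    and br_mult_r: "\<lbrakk>a \<in> polys n; b \<in> polys n; c \<in> polys n\<rbrakk> \<Longrightarrow> br a (b * c) = b * br a c + c * br a b"
    and br_mult_l: "\<lbrakk>a \<in> polys n; b \<in> polys n; c \<in> polys n\<rbrakk> \<Longrightarrow> br (a * b) c = a * br b c + b * br a c"
  using poisson_algebra.pbracket_closed[OF poisson] poisson_algebra.pbracket_add_r[OF poisson]
    poisson_algebra.pbracket_add_l[OF poisson] poisson_algebra.pbracket_smult_r[OF poisson]
    poisson_algebra.pbracket_smult_l[OF poisson] poisson_algebra.pbracket_self[OF poisson]
    poisson_algebra.pbracket_mult_r[OF poisson] poisson_algebra.pbracket_mult_l[OF poisson]
  by (simp_all add: R_def K_def)

lemma br_antisym:
  assumes "a \<in> polys n" "b \<in> polys n"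
  shows "br a b = - br b a"
proof -
  have "br (a + b) (a + b) = br a a + br a b + (br b a + br b b)"
    using assms by (simp add: br_add_l br_add_r)
  then have "br a b + br b a = 0" using assms by (simp add: br_self)
  then show ?thesis by (simp add: add_eq_0_iff2)
qed

lemma br_derivation_r: "a \<in> polys n \<Longrightarrow> derivation_on n (br a)"
  by (intro derivation_onI br_add_r br_smult_r br_mult_r)

lemma br_derivation_l: "b \<in> polys n \<Longrightarrow> derivation_on n (\<lambda>a. br a b)"
  by (intro derivation_onI br_add_l br_smult_l br_mult_l)

text \<open>The coordinate expression of the modular derivation, the divergence of the Hamiltonian
  vector field of \<open>f\<close>. Agreement with the definition by the Lie derivative is
  \<open>modular_derivation_eq\<close>.\<close>

definition modular :: "'k mpoly \<Rightarrow> 'k mpoly"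
  where "modular f = (\<Sum>k<n. pd k (br f (poly_var k)))"

lemma modular_closed [simp]: "f \<in> polys n \<Longrightarrow> modular f \<in> polys n"
  unfolding modular_def by (intro polys_sum pd_closed br_closed polys_var) auto

text \<open>The Leibniz rules for the bracket and for \<open>pd\<close> leave the extra terms
  \<open>br b a + br a b\<close>, which cancel by antisymmetry.\<close>

lemma modular_derivation_on: "derivation_on n modular"
proof (rule derivation_onI)
  fix a b :: "'k mpoly" assume ab: "a \<in> polys n" "b \<in> polys n"
  show "modular (a + b) = modular a + modular b"
    using ab by (simp add: modular_def br_add_l pd_add sum.distrib)
  have "modular (a * b) = a * modular b + b * modular a +
    ((\<Sum>k<n. pd k a * br b (poly_var k)) + (\<Sum>k<n. pd k b * br a (poly_var k)))"
    using ab by (simp add: modular_def br_mult_l pd_add pd_mult sum.distrib sum_distrib_left algebra_simps)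
  also have "(\<Sum>k<n. pd k a * br b (poly_var k)) = br b a"
    using derivation_expand[OF br_derivation_r[OF ab(2)] ab(1)] by simp
  also have "(\<Sum>k<n. pd k b * br a (poly_var k)) = br a b"
    using derivation_expand[OF br_derivation_r[OF ab(1)] ab(2)] by simp
  finally show "modular (a * b) = a * modular b + b * modular a"
    using br_antisym[OF ab] by simp
next
  fix c and a :: "'k mpoly" assume "a \<in> polys n"
  then show "modular (mmonom 0 c * a) = mmonom 0 c * modular a"
    by (simp add: modular_def br_smult_l pd_smult sum_distrib_left)
qed

text \<open>The defect \<open>G\<close> of the identity is alternating and a derivation in each
  entry, so it is determined by the single tuple of all variables in order. There the Jacobian is 1
  and the sum is the definition of \<open>modular f\<close>.\<close>

lemma br_jac:
  assumes f: "f \<in> polys n" and cs: "cs \<in> tuples n (polys n)"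
  shows "br f (jac n cs) = (\<Sum>k<n. jac n (cs[k := br f (cs ! k)])) - modular f * jac n cs"
proof -
  define G where "G cs = (\<Sum>k<n. jac n (cs[k := br f (cs ! k)])) - modular f * jac n cs - br f (jac n cs)" for cs
  have br0: "br f 0 = 0" using br_smult_r[OF f polys_0, of 0] by simp
  have br_neg: "br f (- g) = - br f g" if "g \<in> polys n" for g
    using br_smult_r[OF f that, of "-1"] by (simp add: single_uminus)
  have br1: "br f 1 = 0" using br_mult_r[OF f polys_1 polys_1] by simp
  have swap: "G (cs[i := cs ! j, j := cs ! i]) = - G cs"
    if "cs \<in> tuples n (polys n)" "i < n" "j < n" "i \<noteq> j" for cs i j
  proof -
    have len: "length cs = n" "set cs \<subseteq> polys n" using that by (auto simp: tuples_def)
    let ?s = "transpose i j" and ?ds = "cs[i := cs ! j, j := cs ! i]"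
    have nth: "?ds ! k = cs ! ?s k" if "k < n" for k
      using that len \<open>i < n\<close> \<open>j < n\<close> by (auto simp: transpose_def nth_list_update)
    \<comment> \<open>Applying the bracket in position \<open>k\<close> of the swapped list amounts
      to swapping the list in which it was applied at the transposed position; the sum is then
      reindexed by the transposition.\<close>
    have term_eq: "jac n (?ds[k := br f (?ds ! k)]) = - jac n (cs[?s k := br f (cs ! ?s k)])" if k: "k < n" for k
    proof -
      let ?es = "cs[?s k := br f (cs ! ?s k)]"
      have "?ds[k := br f (?ds ! k)] = ?es[i := ?es ! j, j := ?es ! i]"
        using len \<open>i < n\<close> \<open>j < n\<close> \<open>i \<noteq> j\<close> k
        by (intro nth_equalityI) (auto simp: nth_list_update transpose_def)
      then show ?thesis
        using jac_swap[of i ?es j n] len \<open>i < n\<close> \<open>j < n\<close> \<open>i \<noteq> j\<close> by simp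
    qed
    have "(\<Sum>k<n. jac n (?ds[k := br f (?ds ! k)])) = - (\<Sum>k<n. jac n (cs[?s k := br f (cs ! ?s k)]))"
      using term_eq by (simp add: sum_negf)
    also have "(\<Sum>k<n. jac n (cs[?s k := br f (cs ! ?s k)])) = (\<Sum>k<n. jac n (cs[k := br f (cs ! k)]))"
      using \<open>i < n\<close> \<open>j < n\<close>
      by (intro sum.reindex_bij_betw[of ?s "{..<n}" "{..<n}" "\<lambda>k. jac n (cs[k := br f (cs ! k)])"]
          permutes_imp_bij permutes_swap_id) auto
    finally show ?thesis
      using jac_swap[of i cs j n] len \<open>i < n\<close> \<open>j < n\<close> \<open>i \<noteq> j\<close>
      by (simp add: G_def br_neg jac_closed)
  qed
  have "G cs = 0"
  proof (rule alternating_reduction[where X = poly_var and n = n and P = "\<lambda>cs. G cs = 0" and A = "polys n" and p = n])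
    show "poly_var k \<in> polys n" if "k < n" for k using that by simp
    show "cs \<in> tuples n (polys n)" by fact
  next
    fix I assume "I \<subseteq> {..<n}" "card I = n"
    then have "I = {..<n}" by (simp add: card_subset_eq)
    then have I: "sorted_list_of_set I = [0..<n]" by (simp add: lessThan_atLeast0)
    have "jac n ((map poly_var [0..<n])[k := br f (map poly_var [0..<n] ! k)]) = pd k (br f (poly_var k))" if "k < n" for k
      using that f by (simp add: jac_var_update del: map_update)
    then have "(\<Sum>k<n. jac n ((map poly_var [0..<n])[k := br f (map poly_var [0..<n] ! k)])) = modular f"
      unfolding modular_def by (intro sum.cong) auto
    then show "G (map poly_var (sorted_list_of_set I)) = 0"
      unfolding I G_def jac_vars by (simp add: br1)
  next
    fix vs :: "'k mpoly list" and i j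
    assume vs: "vs \<in> tuples n (polys n)" "i < j" "j < n"
    then have neg: "G (vs[i := vs ! j, j := vs ! i]) = - G vs"
      by (intro swap) auto
    {
      assume "vs ! i = vs ! j"
      then have "vs[i := vs ! j, j := vs ! i] = vs" by (metis list_update_id)
      with neg show "G vs = 0" by simp
    }
    assume "G vs = 0"
    with neg show "G (vs[i := vs ! j, j := vs ! i]) = 0" by simp
  next
    fix vs :: "'k mpoly list" and i
    assume vs: "vs \<in> tuples n (polys n)" and i: "i < n"
      and var: "\<And>k. k < n \<Longrightarrow> G (vs[i := poly_var k]) = 0"
    have len: "length vs = n" "set vs \<subseteq> polys n" using vs by (auto simp: tuples_def)
    have J [simp]: "jac n (vs[i := a]) \<in> polys n" if "a \<in> polys n" for a
      using that len set_update_subset_insert[of vs i a] by (intro jac_closed) auto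
    \<comment> \<open>The summand at position \<open>i\<close> brackets \<open>a\<close> itself and
      is split off: for a product in slot \<open>i\<close> it yields cross terms, bracket of one
      factor times Jacobian with the other, and the last term of \<open>G\<close> yields the same
      ones with opposite sign.\<close>
    have G: "G (vs[i := a]) = jac n (vs[i := br f a]) + (\<Sum>k\<in>{..<n} - {i}. jac n ((vs[k := br f (vs ! k)])[i := a]))
        - modular f * jac n (vs[i := a]) - br f (jac n (vs[i := a]))" for a
    proof -
      have "(\<Sum>k<n. jac n (vs[i := a, k := br f (vs[i := a] ! k)])) =
        jac n (vs[i := a, i := br f (vs[i := a] ! i)]) +
        (\<Sum>k\<in>{..<n} - {i}. jac n (vs[i := a, k := br f (vs[i := a] ! k)]))"
        using i by (intro sum.remove) auto
      also have "(\<Sum>k\<in>{..<n} - {i}. jac n (vs[i := a, k := br f (vs[i := a] ! k)])) =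
        (\<Sum>k\<in>{..<n} - {i}. jac n ((vs[k := br f (vs ! k)])[i := a]))"
        by (intro sum.cong) (auto simp: list_update_swap)
      finally show ?thesis using i len by (simp add: G_def)
    qed
    have "derivation_on n (\<lambda>a. G (vs[i := a]))"
    proof (rule derivation_onI)
      fix a b :: "'k mpoly" assume ab: "a \<in> polys n" "b \<in> polys n"
      show "G (vs[i := a + b]) = G (vs[i := a]) + G (vs[i := b])"
        using ab len i f unfolding G by (simp add: br_add_r jac_add sum.distrib algebra_simps)
      show "G (vs[i := a * b]) = a * G (vs[i := b]) + b * G (vs[i := a])"
        using ab len i f unfolding G
        by (simp add: br_mult_r br_add_r jac_add jac_mult sum.distrib sum_distrib_left algebra_simps)
    next
      fix c and a :: "'k mpoly" assume "a \<in> polys n"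
      then show "G (vs[i := mmonom 0 c * a]) = mmonom 0 c * G (vs[i := a])"
        using len i f unfolding G
        by (simp add: br_smult_r jac_smult sum_distrib_left[symmetric] right_diff_distrib distrib_left
            mult.left_commute[of "modular f"])
    qed
    from derivation_zero[OF this var] have "G (vs[i := vs ! i]) = 0"
      using tuples_nth[OF vs i] by blast
    then show "G vs = 0" by simp
  qed
  then show ?thesis by (simp add: G_def algebra_simps)
qed

end

section \<open>Sums over split or punctured index ranges, and lists with entries left out\<close>

lemma sum_lessThan_add: "sum g {..<p + r} = sum g {..<p} + (\<Sum>i<r. g (p + i))"
  for g :: "nat \<Rightarrow> 'a::comm_monoid_add"
  by (induction r) (simp_all add: add.assoc)

lemma sum_skip:
  fixes g :: "nat \<Rightarrow> 'a::comm_monoid_add"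
  assumes "i \<le> n"
  shows "sum g {..<Suc n} = g i + (\<Sum>k<n. g (if k < i then k else Suc k))"
proof -
  have "sum g {..<Suc n} = g i + sum g ({..<Suc n} - {i})"
    using assms by (intro sum.remove) auto
  also have "sum g ({..<Suc n} - {i}) = (\<Sum>k<n. g (if k < i then k else Suc k))"
    using assms
    by (intro sum.reindex_bij_witness[where i = "\<lambda>k. if k < i then k else Suc k" and j = "\<lambda>k. if k < i then k else k - 1"])
      (auto split: if_splits)
  finally show ?thesis .
qed

text \<open>Double sums over \<open>i < j\<close> are compared with sums over the full square, where
  rows and blocks can be rearranged freely; the factor 2 is cancelled later in characteristic
  zero.\<close>

lemma sum_symmetric_triangle:
  fixes f :: "nat \<Rightarrow> nat \<Rightarrow> 'a::comm_ring_1"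
  assumes "\<And>i j. f i j = f j i" "\<And>i. f i i = 0"
  shows "(\<Sum>i<m. \<Sum>j<m. f i j) = 2 * (\<Sum>j<m. \<Sum>i<j. f i j)"
proof (induction m)
  case (Suc m)
  have "(\<Sum>j<m. f m j) = (\<Sum>i<m. f i m)"
    using assms(1) by (intro sum.cong) auto
  with Suc show ?case by (simp add: sum.distrib assms(2) algebra_simps)
qed simp

lemma omit_append:
  "i < length xs \<Longrightarrow> omit i (xs @ ys) = omit i xs @ ys"
  "omit (length xs + i) (xs @ ys) = xs @ omit i ys"
  by (simp_all add: omit_def)

lemma omit_omit:
  assumes "i \<le> k" "Suc k < length xs"
  shows "omit k (omit i xs) = omit i (omit (Suc k) xs)"
  using assms by (intro nth_equalityI) (auto simp: nth_omit)

lemma set_omit: "set (omit i xs) \<subseteq> set xs"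
  unfolding omit_def using set_take_subset[of i xs] set_drop_subset[of "Suc i" xs] by auto

lemma omit_tuples: "\<lbrakk>xs \<in> tuples (Suc p) A; i < Suc p\<rbrakk> \<Longrightarrow> omit i xs \<in> tuples p A"
  using set_omit[of i xs] by (auto simp: tuples_def)

section \<open>The polynomial identity behind the compatibility of the differentials\<close>

context poly_poisson begin

text \<open>By the Leibniz rule the sum is a divergence of Laplace expansions with two equal columns, which vanish.\<close>

lemma br_jac_laplace:
  assumes c: "length c = Suc n" "set c \<subseteq> polys n"
  shows "(\<Sum>i<Suc n. (- 1) ^ i * br (c ! i) (jac n (omit i c))) = 0"
proof -
  have ci: "c ! i \<in> polys n" if "i < Suc n" for i
    using that c by (auto simp: subset_iff)
  have J: "jac n (omit i c) \<in> polys n" for i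
    using c set_omit[of i c] by (intro jac_closed) blast
  have "(\<Sum>i<Suc n. (- 1) ^ i * br (c ! i) (jac n (omit i c))) =
    (\<Sum>i<Suc n. \<Sum>l<n. (- 1) ^ i * (br (c ! i) (poly_var l) * pd l (jac n (omit i c))))"
  proof (rule sum.cong[OF refl])
    fix i assume "i \<in> {..<Suc n}"
    then show "(- 1) ^ i * br (c ! i) (jac n (omit i c)) =
      (\<Sum>l<n. (- 1) ^ i * (br (c ! i) (poly_var l) * pd l (jac n (omit i c))))"
      using derivation_expand[OF br_derivation_r[OF ci] J, of i i] by (simp add: sum_distrib_left mult.commute)
  qed
  also have "\<dots> = (\<Sum>l<n. \<Sum>i<Suc n. (- 1) ^ i * (br (c ! i) (poly_var l) * pd l (jac n (omit i c))))"
    by (rule sum.swap)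
  also have "\<dots> = (\<Sum>l<n. - (\<Sum>i<Suc n. (- 1) ^ i * (jac n (omit i c) * pd l (br (c ! i) (poly_var l)))))"
  proof (rule sum.cong[OF refl])
    fix l assume "l \<in> {..<n}"
    then have "(\<Sum>i<Suc n. (- 1) ^ i * jac n (omit i c) * br (c ! i) (poly_var l)) = 0"
      using jac_laplace[OF c br_derivation_l[of "poly_var l"]] by simp
    then have "pd l (\<Sum>i<Suc n. (- 1) ^ i * jac n (omit i c) * br (c ! i) (poly_var l)) = 0"
      by (simp only: pd_0)
    moreover have "pd l ((- 1) ^ i * jac n (omit i c) * br (c ! i) (poly_var l)) =
        (- 1) ^ i * (br (c ! i) (poly_var l) * pd l (jac n (omit i c))) +
        (- 1) ^ i * (jac n (omit i c) * pd l (br (c ! i) (poly_var l)))" for i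
      by (cases "even i") (simp_all add: pd_mult pd_uminus algebra_simps)
    ultimately have "(\<Sum>i<Suc n. (- 1) ^ i * (br (c ! i) (poly_var l) * pd l (jac n (omit i c)))) +
        (\<Sum>i<Suc n. (- 1) ^ i * (jac n (omit i c) * pd l (br (c ! i) (poly_var l)))) = 0"
      by (simp only: pd_sum sum.distrib)
    then show "(\<Sum>i<Suc n. (- 1) ^ i * (br (c ! i) (poly_var l) * pd l (jac n (omit i c)))) =
        - (\<Sum>i<Suc n. (- 1) ^ i * (jac n (omit i c) * pd l (br (c ! i) (poly_var l))))"
      by (rule eq_neg_iff_add_eq_0[THEN iffD2])
  qed
  also have "\<dots> = - (\<Sum>l<n. \<Sum>i<Suc n. (- 1) ^ i * (jac n (omit i c) * pd l (br (c ! i) (poly_var l))))"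
    by (rule sum_negf)
  also have "(\<Sum>l<n. \<Sum>i<Suc n. (- 1) ^ i * (jac n (omit i c) * pd l (br (c ! i) (poly_var l)))) =
    (\<Sum>i<Suc n. (- 1) ^ i * jac n (omit i c) * modular (c ! i))"
    unfolding modular_def by (subst sum.swap) (simp only: sum_distrib_left mult.assoc)
  also have "\<dots> = 0"
    by (rule jac_laplace[OF c modular_derivation_on])
  finally show ?thesis by simp
qed

text \<open>The summand of the differential that belongs to the positions \<open>i\<close> and
  \<open>j\<close>, extended symmetrically and by zero on the diagonal so that it can be summed over
  a square.\<close>

definition pair_term :: "'k mpoly list \<Rightarrow> nat \<Rightarrow> nat \<Rightarrow> 'k mpoly"
  where "pair_term c i j = (if i = j then 0 else
    (- 1) ^ (i + j) * jac n (br (c ! min i j) (c ! max i j) # omit (min i j) (omit (max i j) c)))"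

lemma pair_term_sym: "pair_term c i j = pair_term c j i" and pair_term_diag: "pair_term c i i = 0"
  by (simp_all add: pair_term_def min.commute max.commute add.commute)

lemma pair_term_less:
  "i < j \<Longrightarrow> pair_term c i j = (- 1) ^ (i + j) * jac n (br (c ! i) (c ! j) # omit i (omit j c))"
  by (simp add: pair_term_def min_def max_def)

lemma jac_hd_uminus: "jac n (- z # xs) = - jac n (z # xs)"
  using jac_uminus[of 0 "z # xs" n z] by simp

text \<open>This is \<open>br_jac\<close> for the Hamiltonian of the entry \<open>c ! i\<close> and
  the remaining entries. Bringing the bracket to the front costs (-1)^k, and position
  \<open>k\<close> of the shortened list is position \<open>k\<close> or \<open>k + 1\<close> of
  \<open>c\<close>. Before \<open>i\<close> the antisymmetry of the bracket supplies the minus sign,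
  after \<open>i\<close> the shifted exponent does.\<close>

lemma pair_term_sum:
  assumes c: "length c = Suc n" "set c \<subseteq> polys n" and i: "i < Suc n"
  shows "(- 1) ^ i * (br (c ! i) (jac n (omit i c)) + modular (c ! i) * jac n (omit i c)) =
    - (\<Sum>j<Suc n. pair_term c i j)"
proof -
  have cj: "c ! j \<in> polys n" if "j < Suc n" for j
    using that c by (auto simp: subset_iff)
  have "omit i c \<in> tuples n (polys n)"
    using c i by (intro omit_tuples) (auto simp: tuples_def)
  from br_jac[OF cj[OF i] this]
  have "br (c ! i) (jac n (omit i c)) + modular (c ! i) * jac n (omit i c) =
    (\<Sum>k<n. jac n ((omit i c)[k := br (c ! i) (omit i c ! k)]))" by simp
  moreover have "(- 1) ^ i * jac n ((omit i c)[k := br (c ! i) (omit i c ! k)]) =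
    - pair_term c i (if k < i then k else Suc k)" if k: "k < n" for k
  proof -
    have upd: "jac n ((omit i c)[k := br (c ! i) (omit i c ! k)]) =
      (- 1) ^ k * jac n (br (c ! i) (omit i c ! k) # omit k (omit i c))"
      using c i k by (intro jac_update_front) simp
    show ?thesis
    proof (cases "k < i")
      case True
      have "br (c ! i) (c ! k) = - br (c ! k) (c ! i)"
        using i k by (intro br_antisym cj) auto
      with True show ?thesis
        unfolding upd using c i k
        by (simp add: nth_omit jac_hd_uminus pair_term_sym[of c i k] pair_term_less power_add mult_ac)
    next
      case False
      then have "omit k (omit i c) = omit i (omit (Suc k) c)"
        using c k by (intro omit_omit) auto
      with False show ?thesis
        unfolding upd using c i k by (simp add: nth_omit pair_term_less power_add mult_ac)
    qed
  qed
  ultimately have "(- 1) ^ i * (br (c ! i) (jac n (omit i c)) + modular (c ! i) * jac n (omit i c)) =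
    (\<Sum>k<n. - pair_term c i (if k < i then k else Suc k))"
    by (simp add: sum_distrib_left)
  also have "\<dots> = - (\<Sum>j<Suc n. pair_term c i j)"
    using i by (subst sum_skip[of i n]) (simp_all add: pair_term_diag sum_negf)
  finally show ?thesis .
qed

text \<open>Summing \<open>pair_term_sum\<close> over all \<open>i\<close> produces one alternating
  sum with brackets and one with \<open>modular\<close>; they vanish by
  \<open>br_jac_laplace\<close> and \<open>jac_laplace\<close>.\<close>

lemma pair_term_total:
  assumes c: "length c = Suc n" "set c \<subseteq> polys n"
  shows "(\<Sum>i<Suc n. \<Sum>j<Suc n. pair_term c i j) = 0"
proof -
  have "(\<Sum>i<Suc n. - (\<Sum>j<Suc n. pair_term c i j)) =
    (\<Sum>i<Suc n. (- 1) ^ i * (br (c ! i) (jac n (omit i c)) + modular (c ! i) * jac n (omit i c)))"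
    by (rule sum.cong[OF refl], rule pair_term_sum[OF c, symmetric]) simp
  also have "\<dots> = (\<Sum>i<Suc n. (- 1) ^ i * br (c ! i) (jac n (omit i c))) +
    (\<Sum>i<Suc n. (- 1) ^ i * jac n (omit i c) * modular (c ! i))"
    unfolding sum.distrib[symmetric] by (intro sum.cong) (simp_all add: algebra_simps)
  also have "\<dots> = 0"
    unfolding br_jac_laplace[OF c] jac_laplace[OF c modular_derivation_on] by simp
  finally show ?thesis by (simp only: sum_negf neg_equal_0_iff_equal)
qed

text \<open>The part of the compatibility in which polynomials multiply \<open>m\<close>. For the n
  + 1 entries of \<open>b\<close> followed by \<open>a\<close>, the square of pair terms falls into
  the block \<open>X\<close> of two entries of \<open>b\<close>, the block \<open>Z\<close> of two
  entries of \<open>a\<close>, and twice the mixed block \<open>Y\<close>. Only \<open>X\<close> and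
  \<open>Z\<close> occur in the differentials; \<open>Y\<close> is eliminated through the row sums,
  which contain the brackets with Jacobians.\<close>

lemma jac_chain_identity:
  assumes b: "b \<in> tuples p (polys n)" and a: "a \<in> tuples r (polys n)" and pr: "p + r = Suc n"
  shows "(\<Sum>i<p. (- 1) ^ i * jac n (omit i b @ a) * modular (b ! i)) +
      (\<Sum>j<p. \<Sum>i<j. (- 1) ^ (i + j) * jac n (br (b ! i) (b ! j) # omit i (omit j b) @ a)) =
    (- 1) ^ p * ((\<Sum>i<r. (- 1) ^ Suc i * br (jac n (b @ omit i a)) (a ! i)) +
      (\<Sum>j<r. \<Sum>i<j. (- 1) ^ (i + j) * jac n (b @ br (a ! i) (a ! j) # omit i (omit j a))))"
    (is "?B + ?BB = (- 1) ^ p * (?A + ?AA)")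
proof -
  define c where "c = b @ a"
  have len: "length b = p" "length a = r" "length c = Suc n" and sub: "set c \<subseteq> polys n"
    using a b pr by (auto simp: c_def tuples_def)
  define f where "f = pair_term c"
  define \<phi> where "\<phi> i = (- 1) ^ i * jac n (omit i c) * modular (c ! i)" for i
  note sym = pair_term_sym[of c, folded f_def] and diag = pair_term_diag[of c, folded f_def]
  have c_nth: "c ! i = b ! i" if "i < p" for i using that len by (simp add: c_def nth_append)
  have c_nth': "c ! (p + i) = a ! i" for i using len by (simp add: c_def nth_append)
  have o: "omit i c = omit i b @ a" if "i < p" for i using that len by (simp add: c_def omit_append)
  have o': "omit (p + i) c = b @ omit i a" for i using len omit_append(2)[of b i a] by (simp add: c_def)
  have B: "?B = (\<Sum>i<p. \<phi> i)"
    unfolding \<phi>_def by (intro sum.cong) (auto simp: o c_nth)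
  have BB: "?BB = (\<Sum>j<p. \<Sum>i<j. f i j)"
  proof (intro sum.cong refl)
    fix j i assume ij: "j \<in> {..<p}" "i \<in> {..<j}"
    then have "omit i (omit j c) = omit i (omit j b) @ a"
      using len by (simp add: o omit_append)
    with ij show "(- 1) ^ (i + j) * jac n (br (b ! i) (b ! j) # omit i (omit j b) @ a) = f i j"
      by (simp add: f_def pair_term_less c_nth)
  qed
  have AA: "(- 1) ^ p * ?AA = (\<Sum>j<r. \<Sum>i<j. f (p + i) (p + j))"
    unfolding sum_distrib_left
  proof (intro sum.cong refl)
    fix j i assume ij: "j \<in> {..<r}" "i \<in> {..<j}"
    have "omit (p + i) (omit (p + j) c) = b @ omit i (omit j a)"
      using len omit_append(2)[of b i "omit j a"] by (simp add: o')
    then have "f (p + i) (p + j) = (- 1) ^ (p + i + (p + j)) * jac n (br (a ! i) (a ! j) # b @ omit i (omit j a))"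
      using ij by (simp add: f_def pair_term_less c_nth')
    also have "(- 1) ^ (p + i + (p + j)) = (- 1) ^ (i + j) * ((- 1) ^ p * (- 1) ^ p :: 'k mpoly)"
      by (simp add: power_add mult_ac)
    also have "\<dots> * jac n (br (a ! i) (a ! j) # b @ omit i (omit j a)) =
        (- 1) ^ p * ((- 1) ^ (i + j) * jac n (b @ br (a ! i) (a ! j) # omit i (omit j a)))"
      unfolding jac_move[of n b] len by (simp only: mult_ac)
    finally show "(- 1) ^ p * ((- 1) ^ (i + j) * jac n (b @ br (a ! i) (a ! j) # omit i (omit j a))) =
        f (p + i) (p + j)" by simp
  qed
  \<comment> \<open>A row sum trades the bracket of an entry of \<open>a\<close> with a Jacobian for
    pair terms and one modular term.\<close>
  have A: "(- 1) ^ p * ?A = (\<Sum>i<r. - (\<Sum>j<Suc n. f (p + i) j) - \<phi> (p + i))"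
    unfolding sum_distrib_left
  proof (rule sum.cong[OF refl])
    fix i assume i: "i \<in> {..<r}"
    have ai: "a ! i \<in> polys n" using a i by (auto simp: tuples_nth)
    have "jac n (b @ omit i a) \<in> polys n"
      using a b set_omit[of i a] by (intro jac_closed) (auto simp: tuples_def)
    from br_antisym[OF this ai]
    have "(- 1) ^ p * ((- 1) ^ Suc i * br (jac n (b @ omit i a)) (a ! i)) =
      (- 1) ^ (p + i) * br (c ! (p + i)) (jac n (omit (p + i) c))"
      by (simp add: power_add o' c_nth')
    also have "\<dots> = - (\<Sum>j<Suc n. f (p + i) j) - \<phi> (p + i)"
      using pair_term_sum[OF len(3) sub, of "p + i"] i pr
      unfolding f_def \<phi>_def by (simp add: algebra_simps)
    finally show "(- 1) ^ p * ((- 1) ^ Suc i * br (jac n (b @ omit i a)) (a ! i)) =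
      - (\<Sum>j<Suc n. f (p + i) j) - \<phi> (p + i)" .
  qed
  define X where "X = (\<Sum>i<p. \<Sum>j<p. f i j)"
  define Y where "Y = (\<Sum>i<r. \<Sum>j<p. f (p + i) j)"
  define Z where "Z = (\<Sum>i<r. \<Sum>j<r. f (p + i) (p + j))"
  have "(\<Sum>i<p. \<Sum>j<r. f i (p + j)) = Y"
    unfolding Y_def by (subst sum.swap) (simp only: sym)
  moreover have "(\<Sum>i<Suc n. \<Sum>j<Suc n. f i j) = 0"
    unfolding f_def by (rule pair_term_total[OF len(3) sub])
  \<comment> \<open>The whole square sums to zero, and its two mixed blocks are equal by
    symmetry.\<close>
  ultimately have XYZ: "X + Y + (Y + Z) = 0"
    unfolding pr[symmetric] sum_lessThan_add sum.distrib X_def Y_def Z_def by simp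
  have YZ: "(\<Sum>i<r. \<Sum>j<Suc n. f (p + i) j) = Y + Z"
    unfolding pr[symmetric] sum_lessThan_add sum.distrib Y_def Z_def ..
  have bb: "2 * ?BB = X"
    unfolding BB X_def by (rule sum_symmetric_triangle[OF sym diag, symmetric])
  have aa: "2 * ((- 1) ^ p * ?AA) = Z"
    unfolding AA Z_def by (rule sum_symmetric_triangle[OF sym diag, symmetric])
  have "(\<Sum>i<Suc n. \<phi> i) = 0"
    unfolding \<phi>_def by (rule jac_laplace[OF len(3) sub modular_derivation_on])
  \<comment> \<open>The Laplace identity for \<open>modular\<close> moves the modular terms from the
    entries of \<open>a\<close> to those of \<open>b\<close>, which is where the twist of the chain
    side produces them.\<close>
  then have \<phi>: "(\<Sum>i<p. \<phi> i) = - (\<Sum>i<r. \<phi> (p + i))"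
    unfolding pr[symmetric] sum_lessThan_add by (simp add: eq_neg_iff_add_eq_0)
  have AA': "(- 1) ^ p * ?A = - (Y + Z) + ?B"
    unfolding A sum_subtractf sum_negf YZ B \<phi> by simp
  have "2 * (?B + ?BB) = 2 * ?B + X"
    unfolding bb[symmetric] by (simp only: distrib_left)
  also have "\<dots> = 2 * ?B - 2 * (Y + Z) + Z"
    using XYZ by (simp add: algebra_simps eq_neg_iff_add_eq_0)
  also have "\<dots> = 2 * ((- 1) ^ p * ?A) + 2 * ((- 1) ^ p * ?AA)"
    unfolding AA' aa by (simp add: algebra_simps)
  also have "\<dots> = 2 * ((- 1) ^ p * (?A + ?AA))"
    by (simp only: distrib_left)
  finally have two: "2 * (?B + ?BB) = 2 * ((- 1) ^ p * (?A + ?AA))" .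
  \<comment> \<open>Both sides were doubled to pass from triangles to squares; 2 is cancelled, being
    nonzero in characteristic zero.\<close>
  show ?thesis by (rule mult_left_cancel[THEN iffD1, OF _ two]) simp
qed

end

section \<open>Differential forms on affine space\<close>

text \<open>Polarization: a wedge with the same sum of two one-forms in both slots vanishes, and its
  expansion leaves the two mixed terms.\<close>

lemma wedge_swap:
  assumes V: "module R V" and vs: "vs \<in> tuples p (carrier V)" and ij: "i < j" "j < p"
  shows "wedge R p V (vs[i := vs ! j, j := vs ! i]) = \<ominus>\<^bsub>exterior_power R p V\<^esub> wedge R p V vs"
proof -
  interpret V: module R V by (rule V)
  interpret E: module R "exterior_power R p V" by (rule exterior_module[OF V])
  let ?E = "exterior_power R p V"
  let ?w = "\<lambda>a b. wedge R p V (vs[i := a, j := b])"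
  have len: "length vs = p" using vs by (simp add: tuples_def)
  have t: "vs[i := a, j := b] \<in> tuples p (carrier V)" if "a \<in> carrier V" "b \<in> carrier V" for a b
    using vs that by (intro tuples_update)
  have cl: "?w a b \<in> carrier ?E" if "a \<in> carrier V" "b \<in> carrier V" for a b
    by (rule wedge_closed[OF V t[OF that]])
  have alt: "?w a a = \<zero>\<^bsub>?E\<^esub>" if "a \<in> carrier V" for a
    by (rule wedge_repeat[OF V t[OF that that] ij]) (use ij len in simp)
  have add_r: "?w a (b \<oplus>\<^bsub>V\<^esub> c) = ?w a b \<oplus>\<^bsub>?E\<^esub> ?w a c"
    if "a \<in> carrier V" "b \<in> carrier V" "c \<in> carrier V" for a b c
    by (rule wedge_add[OF V tuples_update[OF vs that(1)] ij(2) that(2,3)])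
  have add_l: "?w (b \<oplus>\<^bsub>V\<^esub> c) a = ?w b a \<oplus>\<^bsub>?E\<^esub> ?w c a"
    if "a \<in> carrier V" "b \<in> carrier V" "c \<in> carrier V" for a b c
    using wedge_add[OF V tuples_update[OF vs that(1), of j] _ that(2,3), of i] ij
    by (simp add: list_update_swap[of i j])
  let ?a = "vs ! i" and ?b = "vs ! j"
  have ab: "?a \<in> carrier V" "?b \<in> carrier V"
    using vs ij by (auto intro!: tuples_nth)
  note s = V.M.add.m_closed[OF ab]
  have "\<zero>\<^bsub>?E\<^esub> = ?w (?a \<oplus>\<^bsub>V\<^esub> ?b) (?a \<oplus>\<^bsub>V\<^esub> ?b)"
    by (rule alt[OF s, symmetric])
  also have "\<dots> = (?w ?a ?a \<oplus>\<^bsub>?E\<^esub> ?w ?b ?a) \<oplus>\<^bsub>?E\<^esub> (?w ?a ?b \<oplus>\<^bsub>?E\<^esub> ?w ?b ?b)"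
    by (simp only: add_r[OF s ab] add_l[OF ab(1) ab] add_l[OF ab(2) ab])
  also have "\<dots> = ?w ?b ?a \<oplus>\<^bsub>?E\<^esub> ?w ?a ?b"
    unfolding alt[OF ab(1)] alt[OF ab(2)] using cl[OF ab] cl[OF ab(2,1)] by (simp only: E.M.l_zero E.M.r_zero)
  finally have "?w ?b ?a = \<ominus>\<^bsub>?E\<^esub> ?w ?a ?b"
    using cl[OF ab] cl[OF ab(2,1)] by (metis E.M.minus_equality)
  moreover have "vs[i := ?a, j := ?b] = vs" by simp
  ultimately show ?thesis by (simp only:)
qed

text \<open>The regular module, the target when coordinate functionals are obtained from universal
  properties.\<close>

definition self_module :: "('a, 'r) ring_scheme \<Rightarrow> ('a, 'a) module"
  where "self_module R = \<lparr>carrier = carrier R, mult = mult R, one = one R, zero = zero R,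
    add = add R, module.smult = mult R\<rparr>"

lemma self_module_simps [simp]:
  "carrier (self_module R) = carrier R" "\<zero>\<^bsub>self_module R\<^esub> = \<zero>\<^bsub>R\<^esub>"
  "a \<oplus>\<^bsub>self_module R\<^esub> b = a \<oplus>\<^bsub>R\<^esub> b" "a \<odot>\<^bsub>self_module R\<^esub> b = a \<otimes>\<^bsub>R\<^esub> b"
  by (simp_all add: self_module_def)

lemma (in cring) self_module_is_module: "module R (self_module R)"
proof (rule moduleI)
  show "abelian_group (self_module R)"
    by (rule abelian_groupI) (auto simp: a_ac intro: l_neg a_inv_closed)
qed (auto simp: is_cring l_distr r_distr m_assoc)

definition var_list :: "nat set \<Rightarrow> 'k::field mpoly list"
  where "var_list I = map poly_var (sorted_list_of_set I)"

definition subsets :: "nat \<Rightarrow> nat \<Rightarrow> nat set set"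
  where "subsets n p = {I. I \<subseteq> {..<n} \<and> card I = p}"

lemma finite_subsets [simp]: "finite (subsets n p)"
  unfolding subsets_def by (rule finite_subset[of _ "Pow {..<n}"]) auto

lemma subsets_empty: "n < p \<Longrightarrow> subsets n p = {}"
  unfolding subsets_def by (auto dest: card_mono[OF finite_lessThan])

lemma var_list_tuples: "I \<subseteq> {..<n} \<Longrightarrow> var_list I \<in> tuples (card I) (polys n)"
  using finite_subset[of I "{..<n}"] by (auto simp: var_list_def tuples_def)

lemma compl_subsets: "\<lbrakk>I \<in> subsets n p; p \<le> n\<rbrakk> \<Longrightarrow> {..<n} - I \<in> subsets n (n - p)"
  by (auto simp: subsets_def card_Diff_subset finite_subset[of I "{..<n}"])

text \<open>For \<open>I\<close> among the indices below n this is the sign of the permutation that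
  lists \<open>I\<close> and then its complement, both in increasing order.\<close>

definition eps :: "nat \<Rightarrow> nat set \<Rightarrow> 'k::field mpoly"
  where "eps n I = jac n (var_list I @ var_list ({..<n} - I))"

lemma eps_closed [simp]: "I \<subseteq> {..<n} \<Longrightarrow> eps n I \<in> polys n"
  unfolding eps_def using var_list_tuples[of I n] var_list_tuples[of "{..<n} - I" n]
  by (intro jac_closed) (auto simp: tuples_def)

lemma eps_square:
  assumes "I \<subseteq> {..<n}"
  shows "eps n I * eps n I = (1 :: 'k::field mpoly)"
proof -
  have fin: "finite I" using assms by (rule finite_subset) simp
  let ?ks = "sorted_list_of_set I @ sorted_list_of_set ({..<n} - I)"
  have "distinct ?ks" "set ?ks = {..<n}"
    using fin assms by auto
  then have "jac n (map poly_var ?ks) = (1 :: 'k mpoly) \<or> jac n (map poly_var ?ks) = (- 1 :: 'k mpoly)"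
    by (rule jac_vars_perm)
  then show ?thesis
    unfolding eps_def var_list_def map_append by (elim disjE) (simp_all only: mult_1 minus_mult_minus)
qed

text \<open>Distinct finite sets of equal size are not nested, so some variable of \<open>I\<close>
  lies in the complement of \<open>J\<close> and is repeated.\<close>

lemma jac_var_lists:
  assumes I: "I \<in> subsets n p" and J: "J \<in> subsets n p" and "p \<le> n"
  shows "jac n (var_list I @ var_list ({..<n} - J)) = (if I = J then eps n I else 0)"
proof (cases "I = J")
  case False
  have fin: "finite I" "finite J" using I J by (auto simp: subsets_def intro: finite_subset)
  have "\<not> I \<subseteq> J"
    using False I J fin card_subset_eq[of J I] by (auto simp: subsets_def)
  then have "\<not> distinct (sorted_list_of_set I @ sorted_list_of_set ({..<n} - J))"
    using I fin by (auto simp: subsets_def)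
  from jac_vars_repeat[OF this] False show ?thesis
    by (simp add: var_list_def)
qed (simp add: eps_def)

section \<open>Coordinates of differential forms over the polynomial algebra\<close>

context poly_poisson begin

lemma R_simps [simp]:
  "carrier R = polys n" "a \<otimes>\<^bsub>R\<^esub> b = a * b" "\<one>\<^bsub>R\<^esub> = 1" "\<zero>\<^bsub>R\<^esub> = 0" "a \<oplus>\<^bsub>R\<^esub> b = a + b"
  "c \<odot>\<^bsub>R\<^esub> a = mmonom 0 c * a" "pbracket R = br" "carrier K = UNIV"
  by (simp_all add: R_def K_def)

lemma R_algebra: "algebra K R"
  using poisson by (simp add: poisson_algebra_def)

lemma R_cring: "cring R"
  by (rule algebra.M_cring[OF R_algebra])

lemma R_uminus: "a \<in> polys n \<Longrightarrow> \<ominus>\<^bsub>R\<^esub> a = - a"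
  using abelian_group.minus_equality[OF ring.is_abelian_group[OF cring.axioms(1)[OF R_cring]], of "- a" a]
  by simp

abbreviation "\<Omega>\<^sub>1 \<equiv> kaehler K R"
abbreviation "dd \<equiv> kaehler_d K R"
abbreviation "\<Omega> \<equiv> forms K R"

lemma Om1_module: "module R \<Omega>\<^sub>1"
  by (rule kaehler_module[OF R_algebra])

lemma Om_module: "module R (\<Omega> p)"
  unfolding forms_def by (rule exterior_module[OF Om1_module])

lemma self_module: "module R (self_module R)"
  by (rule cring.self_module_is_module[OF R_cring])

lemma dd_closed: "a \<in> polys n \<Longrightarrow> dd a \<in> carrier \<Omega>\<^sub>1"
  using kaehler_d_closed[OF R_algebra] by simp

text \<open>One-forms are \<open>R\<close>-linear combinations of differentials of variables: the
  polynomials \<open>a\<close> for which \<open>dd a\<close> has the property are closed under sums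
  and, by the Leibniz rule, under products.\<close>

lemma dd_var_induct:
  assumes v: "v \<in> carrier \<Omega>\<^sub>1" and zero: "Q \<zero>\<^bsub>\<Omega>\<^sub>1\<^esub>"
    and add: "\<And>x y. \<lbrakk>x \<in> carrier \<Omega>\<^sub>1; y \<in> carrier \<Omega>\<^sub>1; Q x; Q y\<rbrakk> \<Longrightarrow> Q (x \<oplus>\<^bsub>\<Omega>\<^sub>1\<^esub> y)"
    and smult: "\<And>c x. \<lbrakk>c \<in> polys n; x \<in> carrier \<Omega>\<^sub>1; Q x\<rbrakk> \<Longrightarrow> Q (c \<odot>\<^bsub>\<Omega>\<^sub>1\<^esub> x)"
    and var: "\<And>k. k < n \<Longrightarrow> Q (dd (poly_var k))"
  shows "Q v"
proof -
  interpret O1: module R \<Omega>\<^sub>1 by (rule Om1_module)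
  have "Q (dd a)" if "a \<in> polys n" for a
    using that
  proof (induction rule: polys_induct)
    case (const c)
    \<comment> \<open>The Leibniz rule for 1 = 1 * 1 gives d1 = 0, so constants have zero
      differential.\<close>
    have "dd 1 = dd 1 \<oplus>\<^bsub>\<Omega>\<^sub>1\<^esub> dd 1"
      using kaehler_d_mult[OF R_algebra, of 1 1] O1.smult_one[of "dd 1"] dd_closed[OF polys_1] by simp
    then have one: "dd 1 = \<zero>\<^bsub>\<Omega>\<^sub>1\<^esub>"
      using dd_closed[OF polys_1] by (metis O1.M.add.r_cancel_one')
    have "dd (mmonom 0 c * 1) = (mmonom 0 c * 1) \<odot>\<^bsub>\<Omega>\<^sub>1\<^esub> dd 1"
      using kaehler_d_smult[OF R_algebra, of c 1] by (simp add: scalar_def)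
    then have "dd (mmonom 0 c) = \<zero>\<^bsub>\<Omega>\<^sub>1\<^esub>"
      using O1.smult_r_null[of "mmonom 0 c"] by (simp add: one)
    with zero show ?case by simp
  next
    case (var k)
    then show ?case by (rule assms(5))
  next
    case (add f g)
    then show ?case
      using kaehler_d_add[OF R_algebra, of f g] assms(3)[OF dd_closed dd_closed] by simp
  next
    case (mult f g)
    then show ?case
      using kaehler_d_mult[OF R_algebra, of f g] dd_closed O1.smult_closed
        assms(3)[of "f \<odot>\<^bsub>\<Omega>\<^sub>1\<^esub> dd g" "g \<odot>\<^bsub>\<Omega>\<^sub>1\<^esub> dd f"] smult by simp
  qed
  then have "Q (c \<odot>\<^bsub>\<Omega>\<^sub>1\<^esub> dd a)" if "c \<in> polys n" "a \<in> polys n" for c a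
    using that by (intro smult dd_closed)
  then show ?thesis
    by (intro kaehler_induct[OF R_algebra v zero add]) simp_all
qed

lemma theta_exists: "\<exists>g\<in>lin_hom R \<Omega>\<^sub>1 (self_module R). \<forall>a\<in>polys n. g (dd a) = pd k a"
  using kaehler_lift[OF R_algebra self_module, of "pd k"]
  by (simp add: pd_add pd_mult scalar_def)

text \<open>The functional reading off the coefficient of the \<open>k\<close>-th coordinate
  differential, obtained from the universal property of one-forms applied to the derivation
  \<open>pd k\<close>.\<close>

definition theta :: "nat \<Rightarrow> ('k mpoly \<Rightarrow> 'k mpoly) set \<Rightarrow> 'k mpoly"
  where "theta k = (SOME g. g \<in> lin_hom R \<Omega>\<^sub>1 (self_module R) \<and> (\<forall>a\<in>polys n. g (dd a) = pd k a))"

lemma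
  shows theta_hom: "theta k \<in> lin_hom R \<Omega>\<^sub>1 (self_module R)"
    and theta_d: "a \<in> polys n \<Longrightarrow> theta k (dd a) = pd k a"
proof -
  have "theta k \<in> lin_hom R \<Omega>\<^sub>1 (self_module R) \<and> (\<forall>a\<in>polys n. theta k (dd a) = pd k a)"
    unfolding theta_def by (rule someI_ex[OF theta_exists[unfolded Bex_def]])
  then show "theta k \<in> lin_hom R \<Omega>\<^sub>1 (self_module R)" "a \<in> polys n \<Longrightarrow> theta k (dd a) = pd k a"
    by simp_all
qed

abbreviation "lam_fun as vs \<equiv> rows_det n (map (\<lambda>v k. theta k v) vs @ map (\<lambda>a k. pd k a) as)"

lemma lam_exists:
  assumes as: "set as \<subseteq> polys n"
  shows "\<exists>g\<in>lin_hom R (\<Omega> p) (self_module R). \<forall>vs\<in>tuples p (carrier \<Omega>\<^sub>1). g (wedge R p \<Omega>\<^sub>1 vs) = lam_fun as vs"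
  unfolding forms_def
proof (rule exterior_lift[OF Om1_module self_module])
  have upd: "map (\<lambda>v k. theta k v) (vs[i := v]) @ map (\<lambda>a k. pd k a) as =
      (map (\<lambda>v k. theta k v) vs @ map (\<lambda>a k. pd k a) as)[i := \<lambda>k. theta k v]"
    if "i < length vs" for vs i v
    using that by (simp add: map_update list_update_append)
  have th: "theta k v \<in> polys n" if "v \<in> carrier \<Omega>\<^sub>1" for k v
    using lin_hom_closed[OF theta_hom that] by simp
  show "lam_fun as \<in> tuples p (carrier \<Omega>\<^sub>1) \<rightarrow> carrier (self_module R)"
    using as th by (auto simp: tuples_def subset_iff intro!: rows_det_closed)
  fix vs assume vs: "vs \<in> tuples p (carrier \<Omega>\<^sub>1)"
  then have len: "length vs = p" by (simp add: tuples_def)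
  show "lam_fun as (vs[i := v \<oplus>\<^bsub>\<Omega>\<^sub>1\<^esub> w]) = lam_fun as (vs[i := v]) \<oplus>\<^bsub>self_module R\<^esub> lam_fun as (vs[i := w])"
    if "i < p" "v \<in> carrier \<Omega>\<^sub>1" "w \<in> carrier \<Omega>\<^sub>1" for i v w
    unfolding upd[OF that(1)[folded len]] self_module_simps R_simps
    by (rule rows_det_add) (use that len lin_hom_add[OF theta_hom that(2,3)] in simp_all)
  show "lam_fun as (vs[i := r \<odot>\<^bsub>\<Omega>\<^sub>1\<^esub> v]) = r \<odot>\<^bsub>self_module R\<^esub> lam_fun as (vs[i := v])"
    if "i < p" "r \<in> carrier R" "v \<in> carrier \<Omega>\<^sub>1" for i r v
    unfolding upd[OF that(1)[folded len]] self_module_simps R_simps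
    by (rule rows_det_smult) (use that len lin_hom_smult[OF theta_hom that(2,3)] in simp_all)
  show "lam_fun as vs = \<zero>\<^bsub>self_module R\<^esub>" if "i < j" "j < p" "vs ! i = vs ! j" for i j
    using that len by (simp add: rows_det_repeat[of i _ j] nth_append)
qed

text \<open>For \<open>as\<close> of length n - p this is the coefficient of w \<and> da_1 \<and>
  ... \<and> da_{n-p} with respect to the volume form. It extends the determinant in
  \<open>lam_fun\<close>, whose rows mix coordinates of one-forms with gradients, from pure wedges
  to all forms.\<close>

definition lam :: "nat \<Rightarrow> 'k mpoly list \<Rightarrow> 'k mpoly form \<Rightarrow> 'k mpoly"
  where "lam p as = (SOME g. g \<in> lin_hom R (\<Omega> p) (self_module R) \<and>
    (\<forall>vs\<in>tuples p (carrier \<Omega>\<^sub>1). g (wedge R p \<Omega>\<^sub>1 vs) = lam_fun as vs))"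

lemma
  assumes "set as \<subseteq> polys n"
  shows lam_hom: "lam p as \<in> lin_hom R (\<Omega> p) (self_module R)"
    and lam_wedge: "vs \<in> tuples p (carrier \<Omega>\<^sub>1) \<Longrightarrow> lam p as (wedge R p \<Omega>\<^sub>1 vs) = lam_fun as vs"
proof -
  have "lam p as \<in> lin_hom R (\<Omega> p) (self_module R) \<and>
    (\<forall>vs\<in>tuples p (carrier \<Omega>\<^sub>1). lam p as (wedge R p \<Omega>\<^sub>1 vs) = lam_fun as vs)"
    unfolding lam_def by (rule someI_ex[OF lam_exists[OF assms, unfolded Bex_def[of "lin_hom _ _ _"]]])
  then show "lam p as \<in> lin_hom R (\<Omega> p) (self_module R)"
    "vs \<in> tuples p (carrier \<Omega>\<^sub>1) \<Longrightarrow> lam p as (wedge R p \<Omega>\<^sub>1 vs) = lam_fun as vs"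
    by simp_all
qed

lemma lam_closed: "\<lbrakk>set as \<subseteq> polys n; w \<in> carrier (\<Omega> p)\<rbrakk> \<Longrightarrow> lam p as w \<in> polys n"
  using lin_hom_closed[OF lam_hom] by simp

lemma lam_add: "\<lbrakk>set as \<subseteq> polys n; v \<in> carrier (\<Omega> p); w \<in> carrier (\<Omega> p)\<rbrakk> \<Longrightarrow>
    lam p as (v \<oplus>\<^bsub>\<Omega> p\<^esub> w) = lam p as v + lam p as w"
  using lin_hom_add[OF lam_hom] by simp

lemma lam_smult: "\<lbrakk>set as \<subseteq> polys n; r \<in> polys n; w \<in> carrier (\<Omega> p)\<rbrakk> \<Longrightarrow>
    lam p as (r \<odot>\<^bsub>\<Omega> p\<^esub> w) = r * lam p as w"
  using lin_hom_smult[OF lam_hom] by simp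

lemma map_dd_tuples: "bs \<in> tuples p (polys n) \<Longrightarrow> map dd bs \<in> tuples p (carrier \<Omega>\<^sub>1)"
  using dd_closed by (auto simp: tuples_def)

lemma d_wedge_closed: "bs \<in> tuples p (polys n) \<Longrightarrow> d_wedge K R bs \<in> carrier (\<Omega> p)"
  using wedge_closed[OF Om1_module map_dd_tuples, of bs p]
  by (auto simp: d_wedge_def forms_def tuples_def)

lemma lam_d_wedge:
  assumes "set as \<subseteq> polys n" "bs \<in> tuples p (polys n)"
  shows "lam p as (d_wedge K R bs) = jac n (bs @ as)"
proof -
  have "map (\<lambda>v k. theta k v) (map dd bs) = map (\<lambda>a k. pd k a) bs"
    using assms theta_d by (auto simp: tuples_def)
  moreover have "length bs = p" using assms by (simp add: tuples_def)
  ultimately show ?thesis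
    unfolding d_wedge_def jac_def map_append
    using lam_wedge[OF assms(1) map_dd_tuples[OF assms(2)]] by (simp only:)
qed

abbreviation "dx I \<equiv> d_wedge K R (var_list I)"
abbreviation "compl I \<equiv> var_list ({..<n} - I) :: 'k mpoly list"

lemma compl_closed: "set (compl I) \<subseteq> polys n"
  using var_list_tuples[of "{..<n} - I" n] by (auto simp: tuples_def)

lemma dx_closed: "I \<in> subsets n p \<Longrightarrow> dx I \<in> carrier (\<Omega> p)"
  using var_list_tuples[of I n] by (auto simp: subsets_def intro!: d_wedge_closed)

lemma lam_dx:
  assumes "I \<in> subsets n p" "J \<in> subsets n p"
  shows "lam p (compl J) (dx I) = (if I = J then eps n I else 0)"
proof -
  have t: "var_list I \<in> tuples p (polys n)" using assms var_list_tuples[of I n] by (auto simp: subsets_def)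
  have "p \<le> n" using assms card_mono[of "{..<n}" I] by (auto simp: subsets_def)
  then show ?thesis
    unfolding lam_d_wedge[OF compl_closed t] by (rule jac_var_lists[OF assms])
qed

text \<open>The \<open>I\<close>-component of \<open>w\<close>: pairing with the complementary
  variables isolates it up to the sign \<open>eps n I\<close>, which is its own inverse.\<close>

abbreviation "coord p I w \<equiv> (eps n I * lam p (compl I) w) \<odot>\<^bsub>\<Omega> p\<^esub> dx I"

lemma coord_closed: "\<lbrakk>I \<in> subsets n p; w \<in> carrier (\<Omega> p)\<rbrakk> \<Longrightarrow> coord p I w \<in> carrier (\<Omega> p)"
  using module.smult_closed[OF Om_module] lam_closed[OF compl_closed] dx_closed
  by (auto simp: subsets_def)

text \<open>The right-hand side defines an \<open>R\<close>-linear endomorphism \<open>E\<close>. It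
  fixes every \<open>dx I\<close> and hence, by multilinearity and alternation of the wedge, every
  wedge; as wedges generate, \<open>E\<close> is the identity.\<close>

lemma form_expand:
  assumes w: "w \<in> carrier (\<Omega> p)"
  shows "w = (\<Oplus>\<^bsub>\<Omega> p\<^esub>I\<in>subsets n p. coord p I w)"
proof -
  interpret O: module R "\<Omega> p" by (rule Om_module)
  interpret O1: module R \<Omega>\<^sub>1 by (rule Om1_module)
  define E where "E w = (\<Oplus>\<^bsub>\<Omega> p\<^esub>I\<in>subsets n p. coord p I w)" for w
  have cl: "coord p I w \<in> carrier (\<Omega> p)" if "w \<in> carrier (\<Omega> p)" "I \<in> subsets n p" for w I
    by (rule coord_closed[OF that(2,1)])
  have cP: "eps n I * lam p (compl I) w \<in> polys n" if "w \<in> carrier (\<Omega> p)" "I \<in> subsets n p" for w I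
    using that lam_closed[OF compl_closed] by (simp add: subsets_def)
  have E_add: "E (v \<oplus>\<^bsub>\<Omega> p\<^esub> w) = E v \<oplus>\<^bsub>\<Omega> p\<^esub> E w" if vw: "v \<in> carrier (\<Omega> p)" "w \<in> carrier (\<Omega> p)" for v w
  proof -
    have "coord p I (v \<oplus>\<^bsub>\<Omega> p\<^esub> w) = coord p I v \<oplus>\<^bsub>\<Omega> p\<^esub> coord p I w" if I: "I \<in> subsets n p" for I
      using O.smult_l_distr[OF cP[OF vw(1) I, folded R_simps(1)] cP[OF vw(2) I, folded R_simps(1)] dx_closed[OF I]] vw
      by (simp add: lam_add[OF compl_closed] distrib_left)
    then have "E (v \<oplus>\<^bsub>\<Omega> p\<^esub> w) = (\<Oplus>\<^bsub>\<Omega> p\<^esub>I\<in>subsets n p. coord p I v \<oplus>\<^bsub>\<Omega> p\<^esub> coord p I w)"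
      unfolding E_def using cl[OF vw(1)] cl[OF vw(2)] by (intro O.M.finsum_cong') (auto intro!: O.M.add.m_closed)
    also have "\<dots> = E v \<oplus>\<^bsub>\<Omega> p\<^esub> E w"
      unfolding E_def using cl[OF vw(1)] cl[OF vw(2)] by (intro O.M.finsum_addf) auto
    finally show ?thesis .
  qed
  have E_closed: "E w \<in> carrier (\<Omega> p)" if "w \<in> carrier (\<Omega> p)" for w
    unfolding E_def using cl[OF that] by (intro O.M.finsum_closed) auto
  have E_smult: "E (r \<odot>\<^bsub>\<Omega> p\<^esub> w) = r \<odot>\<^bsub>\<Omega> p\<^esub> E w" if r: "r \<in> polys n" and w: "w \<in> carrier (\<Omega> p)" for r w
  proof -
    have "coord p I (r \<odot>\<^bsub>\<Omega> p\<^esub> w) = r \<odot>\<^bsub>\<Omega> p\<^esub> coord p I w" if I: "I \<in> subsets n p" for I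
      using O.smult_assoc1[OF r[folded R_simps(1)] cP[OF w I, folded R_simps(1)] dx_closed[OF I]] r w
      by (simp add: lam_smult[OF compl_closed] mult.left_commute)
    then have "E (r \<odot>\<^bsub>\<Omega> p\<^esub> w) = (\<Oplus>\<^bsub>\<Omega> p\<^esub>I\<in>subsets n p. r \<odot>\<^bsub>\<Omega> p\<^esub> coord p I w)"
      unfolding E_def using cl[OF w] r by (intro O.M.finsum_cong') (auto intro!: O.smult_closed)
    also have "\<dots> = r \<odot>\<^bsub>\<Omega> p\<^esub> E w"
      unfolding E_def using cl[OF w] r by (intro O.finsum_smult_ldistr[symmetric]) auto
    finally show ?thesis .
  qed
  interpret E: additive_map "\<Omega> p" "\<Omega> p" E
    by unfold_locales (simp_all add: E_closed E_add)
  let ?w = "wedge R p \<Omega>\<^sub>1"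
  have wcl: "?w vs \<in> carrier (\<Omega> p)" if "vs \<in> tuples p (carrier \<Omega>\<^sub>1)" for vs
    using wedge_closed[OF Om1_module that] by (simp add: forms_def)
  have wedge_fixed: "E (?w vs) = ?w vs" if "vs \<in> tuples p (carrier \<Omega>\<^sub>1)" for vs
  proof (rule alternating_reduction[where X = "\<lambda>k. dd (poly_var k)" and n = n and A = "carrier \<Omega>\<^sub>1" and p = p
        and P = "\<lambda>vs. E (?w vs) = ?w vs"])
    show "dd (poly_var k) \<in> carrier \<Omega>\<^sub>1" if "k < n" for k using that by (simp add: dd_closed)
    show "vs \<in> tuples p (carrier \<Omega>\<^sub>1)" by fact
  next
    fix vs i
    assume vs: "vs \<in> tuples p (carrier \<Omega>\<^sub>1)" and i: "i < p"
      and var: "\<And>k. k < n \<Longrightarrow> E (?w (vs[i := dd (poly_var k)])) = ?w (vs[i := dd (poly_var k)])"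
    note wadd = wedge_add[OF Om1_module vs i, folded forms_def]
      and wsmult = wedge_smult[OF Om1_module vs i, folded forms_def]
    note wcl' = wcl[OF tuples_update[OF vs]]
    \<comment> \<open>A slot holding an arbitrary one-form is reduced to differentials of variables,
      both sides being \<open>R\<close>-linear in that slot.\<close>
    have "E (?w (vs[i := v])) = ?w (vs[i := v])" if "v \<in> carrier \<Omega>\<^sub>1" for v
      using that
    proof (rule dd_var_induct)
      have "?w (vs[i := \<zero>\<^bsub>\<Omega>\<^sub>1\<^esub>]) = \<zero>\<^bsub>\<Omega> p\<^esub>"
        using wsmult[OF _ O1.M.zero_closed, of 0] O1.smult_r_null[of 0] O.smult_l_null[OF wcl'[OF O1.M.zero_closed]] by simp
      then show "E (?w (vs[i := \<zero>\<^bsub>\<Omega>\<^sub>1\<^esub>])) = ?w (vs[i := \<zero>\<^bsub>\<Omega>\<^sub>1\<^esub>])"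
        by (simp only: E.zero)
      show "E (?w (vs[i := x \<oplus>\<^bsub>\<Omega>\<^sub>1\<^esub> y])) = ?w (vs[i := x \<oplus>\<^bsub>\<Omega>\<^sub>1\<^esub> y])"
        if "x \<in> carrier \<Omega>\<^sub>1" "y \<in> carrier \<Omega>\<^sub>1" "E (?w (vs[i := x])) = ?w (vs[i := x])" "E (?w (vs[i := y])) = ?w (vs[i := y])" for x y
        using that by (simp only: wadd E_add[OF wcl'[OF that(1)] wcl'[OF that(2)]])
      show "E (?w (vs[i := c \<odot>\<^bsub>\<Omega>\<^sub>1\<^esub> x])) = ?w (vs[i := c \<odot>\<^bsub>\<Omega>\<^sub>1\<^esub> x])"
        if "c \<in> polys n" "x \<in> carrier \<Omega>\<^sub>1" "E (?w (vs[i := x])) = ?w (vs[i := x])" for c x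
        using that by (simp only: wsmult R_simps(1) E_smult[OF that(1) wcl'[OF that(2)]])
    qed (rule var)
    from this[of "vs ! i"] show "E (?w vs) = ?w vs"
      using tuples_nth[OF vs i] by simp
  next
    fix vs i j
    assume vs: "vs \<in> tuples p (carrier \<Omega>\<^sub>1)" and ij: "i < j" "j < p"
    show "E (?w vs) = ?w vs" if "vs ! i = vs ! j"
      using wedge_repeat[OF Om1_module vs ij that, folded forms_def] by (simp only: E.zero)
    show "E (?w (vs[i := vs ! j, j := vs ! i])) = ?w (vs[i := vs ! j, j := vs ! i])" if "E (?w vs) = ?w vs"
      using wedge_swap[OF Om1_module vs ij, folded forms_def] that by (simp only: E.uminus[OF wcl[OF vs]])
  next
    fix I assume "I \<subseteq> {..<n}" "card I = p"
    then have I: "I \<in> subsets n p" by (simp add: subsets_def)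
    have "E (dx I) = (\<Oplus>\<^bsub>\<Omega> p\<^esub>J\<in>subsets n p. if I = J then dx I else \<zero>\<^bsub>\<Omega> p\<^esub>)"
      unfolding E_def
    proof (rule O.M.finsum_cong')
      show "(\<lambda>J. if I = J then dx I else \<zero>\<^bsub>\<Omega> p\<^esub>) \<in> subsets n p \<rightarrow> carrier (\<Omega> p)"
        using dx_closed[OF I] by auto
      show "coord p J (dx I) = (if I = J then dx I else \<zero>\<^bsub>\<Omega> p\<^esub>)" if J: "J \<in> subsets n p" for J
      proof (cases "I = J")
        case True
        have "eps n I * eps n I = (1 :: 'k mpoly)" by (rule eps_square[OF \<open>I \<subseteq> {..<n}\<close>])
        with True show ?thesis
          using lam_dx[OF I I] O.smult_one[OF dx_closed[OF I]] by simp
      next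
        case False
        then show ?thesis
          using lam_dx[OF I J] O.smult_l_null[OF dx_closed[OF J]] by simp
      qed
    qed simp
    also have "\<dots> = dx I"
      by (rule O.M.add.finprod_singleton[OF I finite_subsets]) (simp add: dx_closed[OF I])
    finally have "E (dx I) = dx I" .
    moreover have "dx I = ?w (map (\<lambda>k. dd (poly_var k)) (sorted_list_of_set I))"
      using \<open>card I = p\<close> by (simp add: d_wedge_def var_list_def comp_def)
    ultimately show "E (?w (map (\<lambda>k. dd (poly_var k)) (sorted_list_of_set I))) =
        ?w (map (\<lambda>k. dd (poly_var k)) (sorted_list_of_set I))" by simp
  qed
  have "E w = w"
    using w unfolding forms_def
  proof (rule exterior_induct[OF Om1_module], fold forms_def)
    show "E \<zero>\<^bsub>\<Omega> p\<^esub> = \<zero>\<^bsub>\<Omega> p\<^esub>" by (rule E.zero)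
    show "E (x \<oplus>\<^bsub>\<Omega> p\<^esub> y) = x \<oplus>\<^bsub>\<Omega> p\<^esub> y" if "x \<in> carrier (\<Omega> p)" "y \<in> carrier (\<Omega> p)" "E x = x" "E y = y" for x y
      using that by (simp only: E_add)
    show "E (c \<odot>\<^bsub>\<Omega> p\<^esub> ?w vs) = c \<odot>\<^bsub>\<Omega> p\<^esub> ?w vs" if "c \<in> carrier R" "vs \<in> tuples p (carrier \<Omega>\<^sub>1)" for c vs
      using that by (simp only: E_smult wcl wedge_fixed R_simps(1))
  qed
  then show ?thesis by (simp add: E_def)
qed

end

section \<open>The duality between chains and cochains\<close>

text \<open>The module is an arbitrary \<open>R\<close>-module without bracket, so that the scalar
  arithmetic proved here is also available for forms, chains and the regular module.\<close>

locale poly_module = poly_poisson n br K R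
  for n :: nat and br :: "'k::field_char_0 mpoly \<Rightarrow> 'k mpoly \<Rightarrow> 'k mpoly"
    and K :: "'k ring" and R :: "('k, 'k mpoly) poisson_alg" +
  fixes M :: "('k mpoly, 'm, 't) module_scheme"
  assumes M_module: "module R M"
begin

sublocale M: module R M by (rule M_module)

lemma
  shows sm_closed: "\<lbrakk>r \<in> polys n; m \<in> carrier M\<rbrakk> \<Longrightarrow> r \<odot>\<^bsub>M\<^esub> m \<in> carrier M"
    and sm_add_l: "\<lbrakk>r \<in> polys n; s \<in> polys n; m \<in> carrier M\<rbrakk> \<Longrightarrow> (r + s) \<odot>\<^bsub>M\<^esub> m = r \<odot>\<^bsub>M\<^esub> m \<oplus>\<^bsub>M\<^esub> s \<odot>\<^bsub>M\<^esub> m"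
    and sm_add_r: "\<lbrakk>r \<in> polys n; m \<in> carrier M; m' \<in> carrier M\<rbrakk> \<Longrightarrow> r \<odot>\<^bsub>M\<^esub> (m \<oplus>\<^bsub>M\<^esub> m') = r \<odot>\<^bsub>M\<^esub> m \<oplus>\<^bsub>M\<^esub> r \<odot>\<^bsub>M\<^esub> m'"
    and sm_mult: "\<lbrakk>r \<in> polys n; s \<in> polys n; m \<in> carrier M\<rbrakk> \<Longrightarrow> (r * s) \<odot>\<^bsub>M\<^esub> m = r \<odot>\<^bsub>M\<^esub> (s \<odot>\<^bsub>M\<^esub> m)"
    and sm_1: "m \<in> carrier M \<Longrightarrow> 1 \<odot>\<^bsub>M\<^esub> m = m"
    and sm_0: "m \<in> carrier M \<Longrightarrow> 0 \<odot>\<^bsub>M\<^esub> m = \<zero>\<^bsub>M\<^esub>"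
    and sm_0_r: "r \<in> polys n \<Longrightarrow> r \<odot>\<^bsub>M\<^esub> \<zero>\<^bsub>M\<^esub> = \<zero>\<^bsub>M\<^esub>"
    and sm_uminus: "\<lbrakk>r \<in> polys n; m \<in> carrier M\<rbrakk> \<Longrightarrow> (- r) \<odot>\<^bsub>M\<^esub> m = \<ominus>\<^bsub>M\<^esub> (r \<odot>\<^bsub>M\<^esub> m)"
    and sm_finsum: "\<lbrakk>finite A; r \<in> polys n; f \<in> A \<rightarrow> carrier M\<rbrakk> \<Longrightarrow>
      r \<odot>\<^bsub>M\<^esub> (\<Oplus>\<^bsub>M\<^esub>i\<in>A. f i) = (\<Oplus>\<^bsub>M\<^esub>i\<in>A. r \<odot>\<^bsub>M\<^esub> f i)"
  using M.smult_closed[of r m] M.smult_l_distr[of r s m] M.smult_r_distr[of r m m'] M.smult_assoc1[of r s m]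
    M.smult_one[of m] M.smult_l_null[of m] M.smult_r_null[of r] M.smult_l_minus[of r m] R_uminus[of r]
    M.finsum_smult_ldistr[of A r f]
  by simp_all

lemma sm_sum:
  assumes "finite A" "\<And>i. i \<in> A \<Longrightarrow> r i \<in> polys n" "m \<in> carrier M"
  shows "(\<Oplus>\<^bsub>M\<^esub>i\<in>A. r i \<odot>\<^bsub>M\<^esub> m) = (\<Sum>i\<in>A. r i) \<odot>\<^bsub>M\<^esub> m"
  using assms
proof (induction rule: finite_induct)
  case empty
  then show ?case by (simp add: sm_0)
next
  case (insert a A)
  have "(\<lambda>i. r i \<odot>\<^bsub>M\<^esub> m) \<in> A \<rightarrow> carrier M" "r a \<odot>\<^bsub>M\<^esub> m \<in> carrier M"
    using insert.prems sm_closed by auto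
  with insert show ?case by (simp add: sm_add_l)
qed

lemma sm_sign: "m \<in> carrier M \<Longrightarrow> signed M i m = (- 1) ^ i \<odot>\<^bsub>M\<^esub> m"
  by (cases "even i") (simp_all add: signed_def sm_1 sm_uminus)

lemma sm_signed: "\<lbrakk>r \<in> polys n; m \<in> carrier M\<rbrakk> \<Longrightarrow> signed M i (r \<odot>\<^bsub>M\<^esub> m) = ((- 1) ^ i * r) \<odot>\<^bsub>M\<^esub> m"
  by (simp add: sm_sign sm_closed sm_mult)

lemma scalar_eq: "scalar R M c m = mmonom 0 c \<odot>\<^bsub>M\<^esub> m"
  by (simp add: scalar_def)

text \<open>Multiplication by the constant polynomial 1/2 allows halving in \<open>M\<close>. This
  turns the skew-symmetry of cochains into vanishing on repeated arguments.\<close>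

lemma double_eq_zero:
  assumes "m \<in> carrier M" "m = \<ominus>\<^bsub>M\<^esub> m"
  shows "m = \<zero>\<^bsub>M\<^esub>"
proof -
  have "m \<oplus>\<^bsub>M\<^esub> m = \<zero>\<^bsub>M\<^esub>" using assms by (metis M.M.r_neg)
  then have "(mmonom 0 (1 / 2)) \<odot>\<^bsub>M\<^esub> (m \<oplus>\<^bsub>M\<^esub> m) = \<zero>\<^bsub>M\<^esub>"
    by (simp add: sm_0_r)
  then have "(mmonom 0 (1 / 2) + mmonom 0 (1 / 2)) \<odot>\<^bsub>M\<^esub> m = \<zero>\<^bsub>M\<^esub>"
    by (simp only: sm_add_l[OF polys_const polys_const assms(1)] sm_add_r[OF polys_const assms(1) assms(1)])
  moreover have "mmonom 0 (1 / 2) + mmonom 0 (1 / 2) = (1 :: 'k mpoly)"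
    by (simp add: single_add[symmetric])
  ultimately show ?thesis using assms(1) by (simp add: sm_1)
qed

text \<open>Common form of \<open>mbracket M m\<close> and of a cochain in one of its arguments;
  both are thereby determined by their values on variables.\<close>

definition module_derivation :: "('k mpoly \<Rightarrow> 'm) \<Rightarrow> bool"
  where "module_derivation D \<longleftrightarrow> (\<forall>a\<in>polys n. D a \<in> carrier M) \<and>
    (\<forall>a\<in>polys n. \<forall>b\<in>polys n. D (a + b) = D a \<oplus>\<^bsub>M\<^esub> D b) \<and>
    (\<forall>c. \<forall>a\<in>polys n. D (mmonom 0 c * a) = mmonom 0 c \<odot>\<^bsub>M\<^esub> D a) \<and>
    (\<forall>a\<in>polys n. \<forall>b\<in>polys n. D (a * b) = a \<odot>\<^bsub>M\<^esub> D b \<oplus>\<^bsub>M\<^esub> b \<odot>\<^bsub>M\<^esub> D a)"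

lemma
  assumes "module_derivation D"
  shows module_derivation_closed: "a \<in> polys n \<Longrightarrow> D a \<in> carrier M"
    and module_derivation_add: "\<lbrakk>a \<in> polys n; b \<in> polys n\<rbrakk> \<Longrightarrow> D (a + b) = D a \<oplus>\<^bsub>M\<^esub> D b"
    and module_derivation_smult: "a \<in> polys n \<Longrightarrow> D (mmonom 0 c * a) = mmonom 0 c \<odot>\<^bsub>M\<^esub> D a"
    and module_derivation_mult: "\<lbrakk>a \<in> polys n; b \<in> polys n\<rbrakk> \<Longrightarrow>
      D (a * b) = a \<odot>\<^bsub>M\<^esub> D b \<oplus>\<^bsub>M\<^esub> b \<odot>\<^bsub>M\<^esub> D a"
proof -
  note D = assms[unfolded module_derivation_def]
  show "a \<in> polys n \<Longrightarrow> D a \<in> carrier M" using D by (elim conjE) (rule bspec)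
  show "\<lbrakk>a \<in> polys n; b \<in> polys n\<rbrakk> \<Longrightarrow> D (a + b) = D a \<oplus>\<^bsub>M\<^esub> D b" using D by metis
  show "a \<in> polys n \<Longrightarrow> D (mmonom 0 c * a) = mmonom 0 c \<odot>\<^bsub>M\<^esub> D a" using D by metis
  show "\<lbrakk>a \<in> polys n; b \<in> polys n\<rbrakk> \<Longrightarrow> D (a * b) = a \<odot>\<^bsub>M\<^esub> D b \<oplus>\<^bsub>M\<^esub> b \<odot>\<^bsub>M\<^esub> D a" using D by metis
qed

lemma module_derivation_const:
  assumes D: "module_derivation D"
  shows "D (mmonom 0 c) = \<zero>\<^bsub>M\<^esub>"
proof -
  have 1: "D 1 \<in> carrier M" by (rule module_derivation_closed[OF D polys_1])
  have "D (1 * 1) = 1 \<odot>\<^bsub>M\<^esub> D 1 \<oplus>\<^bsub>M\<^esub> 1 \<odot>\<^bsub>M\<^esub> D 1" by (rule module_derivation_mult[OF D polys_1 polys_1])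
  then have "D 1 = D 1 \<oplus>\<^bsub>M\<^esub> D 1" by (simp only: sm_1[OF 1] mult_1)
  then have "D 1 = \<zero>\<^bsub>M\<^esub>" using 1 by (metis M.M.add.r_cancel_one')
  moreover have "D (mmonom 0 c * 1) = mmonom 0 c \<odot>\<^bsub>M\<^esub> D 1" by (rule module_derivation_smult[OF D polys_1])
  ultimately show ?thesis by (simp only: mult_1_right sm_0_r polys_const)
qed

lemma module_derivation_expand:
  assumes D: "module_derivation D" and a: "a \<in> polys n"
  shows "D a = (\<Oplus>\<^bsub>M\<^esub>k\<in>{..<n}. pd k a \<odot>\<^bsub>M\<^esub> D (poly_var k))"
proof -
  have x: "D (poly_var k) \<in> carrier M" if "k \<in> {..<n}" for k
    using that by (intro module_derivation_closed[OF D]) simp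
  have t: "(\<lambda>k. pd k a \<odot>\<^bsub>M\<^esub> D (poly_var k)) \<in> {..<n} \<rightarrow> carrier M" if "a \<in> polys n" for a
    using that x by (intro Pi_I sm_closed) auto
  show ?thesis using a
  proof (induction rule: polys_induct)
    case (const c)
    have "(\<Oplus>\<^bsub>M\<^esub>k\<in>{..<n}. pd k (mmonom 0 c) \<odot>\<^bsub>M\<^esub> D (poly_var k)) = \<zero>\<^bsub>M\<^esub>"
      by (rule M.M.add.finprod_one_eqI) (simp add: sm_0 x)
    then show ?case by (simp only: module_derivation_const[OF D])
  next
    case (var j)
    have "(\<Oplus>\<^bsub>M\<^esub>k\<in>{..<n}. pd k (poly_var j) \<odot>\<^bsub>M\<^esub> D (poly_var k)) =
      (\<Oplus>\<^bsub>M\<^esub>k\<in>{..<n}. if j = k then D (poly_var k) else \<zero>\<^bsub>M\<^esub>)"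
      using x by (intro M.M.finsum_cong') (auto simp: pd_var sm_1 sm_0)
    also have "\<dots> = D (poly_var j)"
      using var x by (intro M.M.add.finprod_singleton) auto
    finally show ?case by (rule sym)
  next
    case (add f g)
    have "(\<Oplus>\<^bsub>M\<^esub>k\<in>{..<n}. pd k (f + g) \<odot>\<^bsub>M\<^esub> D (poly_var k)) =
      (\<Oplus>\<^bsub>M\<^esub>k\<in>{..<n}. pd k f \<odot>\<^bsub>M\<^esub> D (poly_var k) \<oplus>\<^bsub>M\<^esub> pd k g \<odot>\<^bsub>M\<^esub> D (poly_var k))"
      using x add by (intro M.M.finsum_cong') (auto simp: pd_add sm_add_l sm_closed)
    also have "\<dots> = D f \<oplus>\<^bsub>M\<^esub> D g"
      unfolding add.IH using t add by (intro M.M.finsum_addf)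
    finally show ?case using module_derivation_add[OF D add.hyps] by (simp only:)
  next
    case (mult f g)
    have "(\<Oplus>\<^bsub>M\<^esub>k\<in>{..<n}. pd k (f * g) \<odot>\<^bsub>M\<^esub> D (poly_var k)) =
      (\<Oplus>\<^bsub>M\<^esub>k\<in>{..<n}. f \<odot>\<^bsub>M\<^esub> (pd k g \<odot>\<^bsub>M\<^esub> D (poly_var k)) \<oplus>\<^bsub>M\<^esub> g \<odot>\<^bsub>M\<^esub> (pd k f \<odot>\<^bsub>M\<^esub> D (poly_var k)))"
      using x mult by (intro M.M.finsum_cong') (auto simp: pd_mult sm_add_l sm_mult sm_closed)
    also have "\<dots> = (\<Oplus>\<^bsub>M\<^esub>k\<in>{..<n}. f \<odot>\<^bsub>M\<^esub> (pd k g \<odot>\<^bsub>M\<^esub> D (poly_var k))) \<oplus>\<^bsub>M\<^esub>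
      (\<Oplus>\<^bsub>M\<^esub>k\<in>{..<n}. g \<odot>\<^bsub>M\<^esub> (pd k f \<odot>\<^bsub>M\<^esub> D (poly_var k)))"
      using x mult by (intro M.M.finsum_addf Pi_I sm_closed) auto
    also have "\<dots> = f \<odot>\<^bsub>M\<^esub> D g \<oplus>\<^bsub>M\<^esub> g \<odot>\<^bsub>M\<^esub> D f"
      unfolding mult.IH using t mult by (simp add: sm_finsum)
    finally show ?case using module_derivation_mult[OF D mult.hyps] by (simp only:)
  qed
qed

lemma module_derivation_agree:
  assumes D: "module_derivation D" and D': "module_derivation D'"
    and "\<And>k. k < n \<Longrightarrow> D (poly_var k) = D' (poly_var k)" and a: "a \<in> polys n"
  shows "D a = D' a"
  unfolding module_derivation_expand[OF D a] module_derivation_expand[OF D' a]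
  using assms(3) a module_derivation_closed[OF D']
  by (intro M.M.finsum_cong') (auto intro!: sm_closed)

text \<open>After the chain rule for \<open>D\<close>, the coefficient of the value of
  \<open>D\<close> at the \<open>k\<close>-th variable is the polynomial alternating sum for the
  derivation \<open>pd k\<close>, which is zero.\<close>

lemma jac_laplace_module:
  assumes c: "length cs = Suc n" "set cs \<subseteq> polys n" and D: "module_derivation D"
  shows "(\<Oplus>\<^bsub>M\<^esub>i\<in>{..<Suc n}. ((- 1) ^ i * jac n (omit i cs)) \<odot>\<^bsub>M\<^esub> D (cs ! i)) = \<zero>\<^bsub>M\<^esub>"
proof -
  have ci: "cs ! i \<in> polys n" if "i < Suc n" for i using that c by (auto simp: subset_iff)
  have J: "(- 1) ^ i * jac n (omit i cs) \<in> polys n" for i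
    using c set_omit[of i cs] by (intro polys_mult polys_sign jac_closed) blast
  have x: "D (poly_var k) \<in> carrier M" if "k < n" for k
    using that by (intro module_derivation_closed[OF D]) simp
  define f where "f i k = ((- 1) ^ i * jac n (omit i cs) * pd k (cs ! i)) \<odot>\<^bsub>M\<^esub> D (poly_var k)" for i k
  have f: "f i k \<in> carrier M" if "i < Suc n" "k < n" for i k
    unfolding f_def using that by (intro sm_closed polys_mult J pd_closed ci x)
  \<comment> \<open>Induction on the number of summands interchanges the two finite sums.\<close>
  have "(\<Oplus>\<^bsub>M\<^esub>i\<in>{..<m}. ((- 1) ^ i * jac n (omit i cs)) \<odot>\<^bsub>M\<^esub> D (cs ! i)) =
      (\<Oplus>\<^bsub>M\<^esub>k\<in>{..<n}. \<Oplus>\<^bsub>M\<^esub>i\<in>{..<m}. f i k)" if "m \<le> Suc n" for m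
    using that
  proof (induction m)
    case 0
    have "(\<Oplus>\<^bsub>M\<^esub>k\<in>{..<n}. \<Oplus>\<^bsub>M\<^esub>i\<in>{..<0::nat}. f i k) = \<zero>\<^bsub>M\<^esub>"
      by (rule M.M.add.finprod_one_eqI) simp
    then show ?case by simp
  next
    case (Suc m)
    have Dm: "D (cs ! m) \<in> carrier M" using Suc.prems by (intro module_derivation_closed[OF D] ci) simp
    have "((- 1) ^ m * jac n (omit m cs)) \<odot>\<^bsub>M\<^esub> D (cs ! m) =
        (\<Oplus>\<^bsub>M\<^esub>k\<in>{..<n}. ((- 1) ^ m * jac n (omit m cs)) \<odot>\<^bsub>M\<^esub> (pd k (cs ! m) \<odot>\<^bsub>M\<^esub> D (poly_var k)))"
      unfolding module_derivation_expand[OF D ci[of m, OF Suc_le_lessD[OF Suc.prems]]]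
      using Suc.prems ci x J by (intro sm_finsum Pi_I sm_closed) auto
    also have "\<dots> = (\<Oplus>\<^bsub>M\<^esub>k\<in>{..<n}. f m k)"
      using Suc.prems ci x J f unfolding f_def by (intro M.M.finsum_cong') (auto simp: sm_mult)
    finally have step: "((- 1) ^ m * jac n (omit m cs)) \<odot>\<^bsub>M\<^esub> D (cs ! m) = (\<Oplus>\<^bsub>M\<^esub>k\<in>{..<n}. f m k)" .
    have cl: "(\<lambda>i. ((- 1) ^ i * jac n (omit i cs)) \<odot>\<^bsub>M\<^esub> D (cs ! i)) \<in> {..<m} \<rightarrow> carrier M"
      using Suc.prems by (intro Pi_I sm_closed J module_derivation_closed[OF D] ci) auto
    have "(\<Oplus>\<^bsub>M\<^esub>i\<in>{..<Suc m}. ((- 1) ^ i * jac n (omit i cs)) \<odot>\<^bsub>M\<^esub> D (cs ! i)) =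
      ((- 1) ^ m * jac n (omit m cs)) \<odot>\<^bsub>M\<^esub> D (cs ! m) \<oplus>\<^bsub>M\<^esub>
      (\<Oplus>\<^bsub>M\<^esub>i\<in>{..<m}. ((- 1) ^ i * jac n (omit i cs)) \<odot>\<^bsub>M\<^esub> D (cs ! i))"
      unfolding lessThan_Suc by (rule M.M.finsum_insert) (use cl sm_closed[OF J Dm] in auto)
    also have "\<dots> = (\<Oplus>\<^bsub>M\<^esub>k\<in>{..<n}. f m k) \<oplus>\<^bsub>M\<^esub> (\<Oplus>\<^bsub>M\<^esub>k\<in>{..<n}. \<Oplus>\<^bsub>M\<^esub>i\<in>{..<m}. f i k)"
      using Suc by (simp only: step Suc_leD)
    also have "\<dots> = (\<Oplus>\<^bsub>M\<^esub>k\<in>{..<n}. f m k \<oplus>\<^bsub>M\<^esub> (\<Oplus>\<^bsub>M\<^esub>i\<in>{..<m}. f i k))"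
      using f Suc.prems by (intro M.M.finsum_addf[symmetric] Pi_I M.M.finsum_closed) auto
    also have "\<dots> = (\<Oplus>\<^bsub>M\<^esub>k\<in>{..<n}. \<Oplus>\<^bsub>M\<^esub>i\<in>{..<Suc m}. f i k)"
    proof (rule M.M.finsum_cong')
      show "(\<lambda>k. \<Oplus>\<^bsub>M\<^esub>i\<in>{..<Suc m}. f i k) \<in> {..<n} \<rightarrow> carrier M"
        using f Suc.prems by (intro Pi_I M.M.finsum_closed) auto
      show "f m k \<oplus>\<^bsub>M\<^esub> (\<Oplus>\<^bsub>M\<^esub>i\<in>{..<m}. f i k) = (\<Oplus>\<^bsub>M\<^esub>i\<in>{..<Suc m}. f i k)" if "k \<in> {..<n}" for k
        using f[of _ k] that Suc.prems by (simp add: lessThan_Suc Pi_iff)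
    qed simp
    finally show ?case .
  qed
  from this[of "Suc n"] have "(\<Oplus>\<^bsub>M\<^esub>i\<in>{..<Suc n}. ((- 1) ^ i * jac n (omit i cs)) \<odot>\<^bsub>M\<^esub> D (cs ! i)) =
      (\<Oplus>\<^bsub>M\<^esub>k\<in>{..<n}. \<Oplus>\<^bsub>M\<^esub>i\<in>{..<Suc n}. f i k)" by simp
  also have "\<dots> = \<zero>\<^bsub>M\<^esub>"
  proof (rule M.M.add.finprod_one_eqI)
    fix k assume k: "k \<in> {..<n}"
    have "(\<Oplus>\<^bsub>M\<^esub>i\<in>{..<Suc n}. f i k) =
        (\<Sum>i<Suc n. (- 1) ^ i * jac n (omit i cs) * pd k (cs ! i)) \<odot>\<^bsub>M\<^esub> D (poly_var k)"
      unfolding f_def using k by (intro sm_sum polys_mult[OF J] pd_closed ci x) auto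
    also have "(\<Sum>i<Suc n. (- 1) ^ i * jac n (omit i cs) * pd k (cs ! i)) = 0"
      by (rule jac_laplace[OF c]) (intro derivation_onI pd_add pd_smult pd_mult)
    finally show "(\<Oplus>\<^bsub>M\<^esub>i\<in>{..<Suc n}. f i k) = \<zero>\<^bsub>M\<^esub>" using k x by (simp add: sm_0)
  qed
  finally show ?thesis .
qed

end

lemma restrict_scalars_simps [simp]:
  "carrier (restrict_scalars R V) = carrier V" "\<zero>\<^bsub>restrict_scalars R V\<^esub> = \<zero>\<^bsub>V\<^esub>"
  "x \<oplus>\<^bsub>restrict_scalars R V\<^esub> y = x \<oplus>\<^bsub>V\<^esub> y" "c \<odot>\<^bsub>restrict_scalars R V\<^esub> x = scalar R V c x"
  by (simp_all add: restrict_scalars_def)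

lemma restrict_scalars_a_inv [simp]: "\<ominus>\<^bsub>restrict_scalars R V\<^esub> x = \<ominus>\<^bsub>V\<^esub> x"
  by (simp add: a_inv_def m_inv_def restrict_scalars_def)

lemma restrict_scalars_finsum [simp]: "finsum (restrict_scalars R V) f A = finsum V f A"
  by (simp add: finsum_def finprod_def restrict_scalars_def)

lemma restrict_scalars_signed [simp]: "signed (restrict_scalars R V) i x = signed V i x"
  by (simp add: signed_def)

lemma cochains_simps [simp]:
  "\<zero>\<^bsub>cochains K R M q\<^esub> = (\<lambda>as\<in>tuples q (carrier R). \<zero>\<^bsub>M\<^esub>)"
  "F \<oplus>\<^bsub>cochains K R M q\<^esub> G = (\<lambda>as\<in>tuples q (carrier R). F as \<oplus>\<^bsub>M\<^esub> G as)"
  "c \<odot>\<^bsub>cochains K R M q\<^esub> F = (\<lambda>as\<in>tuples q (carrier R). scalar R M c (F as))"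
  by (simp_all add: cochains_def)

section \<open>The pairing of chains with tuples of polynomials and its inverse\<close>

context poly_module begin

abbreviation "\<T> p \<equiv> tensor R M (\<Omega> p)"
abbreviation "pure p \<equiv> pure_tensor R M (\<Omega> p)"

lemma T_module: "module R (\<T> p)"
  by (rule tensor_module[OF M_module Om_module])

lemma T_poly_module: "poly_module n br K R (\<T> p)"
  by (intro poly_module.intro poly_module_axioms.intro poly_poisson_axioms T_module)

lemma T_abelian: "abelian_group (\<T> p)"
  by (rule module.axioms(2)[OF T_module])

lemma pure_closed: "\<lbrakk>m \<in> carrier M; w \<in> carrier (\<Omega> p)\<rbrakk> \<Longrightarrow> pure p m w \<in> carrier (\<T> p)"
  by (rule pure_tensor_closed[OF M_module Om_module])

lemma pure_move: "\<lbrakk>r \<in> polys n; m \<in> carrier M; w \<in> carrier (\<Omega> p)\<rbrakk> \<Longrightarrow> pure p m (r \<odot>\<^bsub>\<Omega> p\<^esub> w) = pure p (r \<odot>\<^bsub>M\<^esub> m) w"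
  using pure_tensor_smult_l[OF M_module Om_module, of r m w p] pure_tensor_smult_r[OF M_module Om_module, of r m w p]
  by simp

lemma pure_additive: "m \<in> carrier M \<Longrightarrow> additive_map (\<Omega> p) (\<T> p) (pure p m)"
  using pure_closed pure_tensor_add_r[OF M_module Om_module] T_abelian module.axioms(2)[OF Om_module]
  by (intro additive_map.intro additive_map_axioms.intro) auto

lemma pure_expand:
  assumes m: "m \<in> carrier M" and w: "w \<in> carrier (\<Omega> p)"
  shows "pure p m w = (\<Oplus>\<^bsub>\<T> p\<^esub>I\<in>subsets n p. pure p ((eps n I * lam p (compl I) w) \<odot>\<^bsub>M\<^esub> m) (dx I))"
proof -
  interpret T: abelian_group "\<T> p" by (rule T_abelian)
  interpret pm: additive_map "\<Omega> p" "\<T> p" "pure p m" by (rule pure_additive[OF m])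
  have r: "eps n I * lam p (compl I) w \<in> polys n" if "I \<in> subsets n p" for I
    using that lam_closed[OF compl_closed w] by (simp add: subsets_def)
  have "pure p m w = pure p m (\<Oplus>\<^bsub>\<Omega> p\<^esub>I\<in>subsets n p. coord p I w)"
    using form_expand[OF w] by simp
  also have "\<dots> = (\<Oplus>\<^bsub>\<T> p\<^esub>I\<in>subsets n p. pure p m (coord p I w))"
    using coord_closed[OF _ w] by (intro pm.finsum) auto
  also have "\<dots> = (\<Oplus>\<^bsub>\<T> p\<^esub>I\<in>subsets n p. pure p ((eps n I * lam p (compl I) w) \<odot>\<^bsub>M\<^esub> m) (dx I))"
    using pure_move[OF r m dx_closed] pure_closed[OF sm_closed[OF r m] dx_closed]
    by (intro T.finsum_cong') auto
  finally show ?thesis .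
qed

text \<open>Coefficients of a form are moved into \<open>M\<close>, so chains are sums of tensors of
  \<open>m\<close> with some \<open>dx I\<close> and no scalar is left in front. This is what makes
  the principle usable for the boundary, which is additive but not \<open>R\<close>-linear.\<close>

lemma chain_induct [consumes 1, case_names zero add pure]:
  assumes x: "x \<in> carrier (\<T> p)" and zero: "Q \<zero>\<^bsub>\<T> p\<^esub>"
    and add: "\<And>x y. \<lbrakk>x \<in> carrier (\<T> p); y \<in> carrier (\<T> p); Q x; Q y\<rbrakk> \<Longrightarrow> Q (x \<oplus>\<^bsub>\<T> p\<^esub> y)"
    and pure: "\<And>m I. \<lbrakk>m \<in> carrier M; I \<in> subsets n p\<rbrakk> \<Longrightarrow> Q (pure p m (dx I))"
  shows "Q x"
proof (rule tensor_induct[OF M_module Om_module x zero add])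
  interpret T: abelian_group "\<T> p" by (rule T_abelian)
  fix m w assume m: "m \<in> carrier M" and w: "w \<in> carrier (\<Omega> p)"
  define f where "f I = pure p ((eps n I * lam p (compl I) w) \<odot>\<^bsub>M\<^esub> m) (dx I)" for I
  have r: "(eps n I * lam p (compl I) w) \<odot>\<^bsub>M\<^esub> m \<in> carrier M" if "I \<in> subsets n p" for I
    using that lam_closed[OF compl_closed w] m by (intro sm_closed) (simp_all add: subsets_def)
  have f: "f I \<in> carrier (\<T> p)" "Q (f I)" if "I \<in> subsets n p" for I
    unfolding f_def using pure_closed[OF r[OF that] dx_closed[OF that]] pure[OF r[OF that] that] by simp_all
  have "Q (\<Oplus>\<^bsub>\<T> p\<^esub>I\<in>A. f I) \<and> (\<Oplus>\<^bsub>\<T> p\<^esub>I\<in>A. f I) \<in> carrier (\<T> p)" if "A \<subseteq> subsets n p" for A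
  proof -
    have "finite A" using that finite_subsets by (rule finite_subset)
    then show ?thesis using that
    proof (induction rule: finite_induct)
      case empty
      then show ?case using zero by simp
    next
      case (insert I A)
      then have "(\<Oplus>\<^bsub>\<T> p\<^esub>J\<in>insert I A. f J) = f I \<oplus>\<^bsub>\<T> p\<^esub> (\<Oplus>\<^bsub>\<T> p\<^esub>J\<in>A. f J)"
        using f by (intro T.finsum_insert) auto
      then show ?case using insert add f by simp
    qed
  qed
  from this[of "subsets n p"] show "Q (pure p m w)"
    unfolding pure_expand[OF m w] f_def by simp
qed

lemma psi_exists:
  assumes as: "set as \<subseteq> polys n"
  shows "\<exists>g. g \<in> lin_hom R (\<T> p) M \<and> (\<forall>m\<in>carrier M. \<forall>w\<in>carrier (\<Omega> p). g (pure p m w) = lam p as w \<odot>\<^bsub>M\<^esub> m)"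
proof -
  note l = lam_closed[OF as] lam_add[OF as] lam_smult[OF as]
  have "\<exists>g\<in>lin_hom R (\<T> p) M. \<forall>m\<in>carrier M. \<forall>w\<in>carrier (\<Omega> p). g (pure p m w) = lam p as w \<odot>\<^bsub>M\<^esub> m"
  proof (rule tensor_lift[OF M_module Om_module M_module])
    show "lam p as w \<odot>\<^bsub>M\<^esub> (r \<odot>\<^bsub>M\<^esub> m) = r \<odot>\<^bsub>M\<^esub> (lam p as w \<odot>\<^bsub>M\<^esub> m)"
      if "r \<in> carrier R" "m \<in> carrier M" "w \<in> carrier (\<Omega> p)" for r m w
      using that l by (simp add: sm_mult[symmetric] mult.commute)
  qed (simp_all add: l sm_closed sm_add_l sm_add_r sm_mult)
  then show ?thesis unfolding Bex_def by blast
qed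

text \<open>The pairing for fixed arguments \<open>as\<close>: the form is contracted to a
  polynomial by \<open>lam p as\<close>, which then acts on the module factor. Unlike the boundary,
  it is \<open>R\<close>-linear in the chain.\<close>

definition psi :: "nat \<Rightarrow> 'k mpoly list \<Rightarrow> ('k mpoly, 'm) chain \<Rightarrow> 'm"
  where "psi p as = (SOME g. g \<in> lin_hom R (\<T> p) M \<and>
    (\<forall>m\<in>carrier M. \<forall>w\<in>carrier (\<Omega> p). g (pure p m w) = lam p as w \<odot>\<^bsub>M\<^esub> m))"

lemma
  assumes "set as \<subseteq> polys n"
  shows psi_hom: "psi p as \<in> lin_hom R (\<T> p) M"
    and psi_pure: "\<lbrakk>m \<in> carrier M; w \<in> carrier (\<Omega> p)\<rbrakk> \<Longrightarrow> psi p as (pure p m w) = lam p as w \<odot>\<^bsub>M\<^esub> m"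
proof -
  have "psi p as \<in> lin_hom R (\<T> p) M \<and> (\<forall>m\<in>carrier M. \<forall>w\<in>carrier (\<Omega> p). psi p as (pure p m w) = lam p as w \<odot>\<^bsub>M\<^esub> m)"
    unfolding psi_def by (rule someI_ex[OF psi_exists[OF assms]])
  then show "psi p as \<in> lin_hom R (\<T> p) M"
    "\<lbrakk>m \<in> carrier M; w \<in> carrier (\<Omega> p)\<rbrakk> \<Longrightarrow> psi p as (pure p m w) = lam p as w \<odot>\<^bsub>M\<^esub> m" by simp_all
qed

lemma psi_additive: "set as \<subseteq> polys n \<Longrightarrow> additive_map (\<T> p) M (psi p as)"
  by (rule lin_hom_additive_map[OF psi_hom T_abelian M.M.abelian_group_axioms])

lemma psi_elem:
  assumes "set as \<subseteq> polys n" "m \<in> carrier M" "bs \<in> tuples p (polys n)"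
  shows "psi p as (elem_chain K R M m bs) = jac n (bs @ as) \<odot>\<^bsub>M\<^esub> m"
proof -
  have "length bs = p" using assms by (simp add: tuples_def)
  then show ?thesis
    using psi_pure[OF assms(1,2) d_wedge_closed[OF assms(3)]] lam_d_wedge[OF assms(1,3)]
    by (simp add: elem_chain_def)
qed

lemma elem_closed: "\<lbrakk>m \<in> carrier M; bs \<in> tuples p (polys n)\<rbrakk> \<Longrightarrow> elem_chain K R M m bs \<in> carrier (\<T> p)"
  using pure_closed[OF _ d_wedge_closed] by (auto simp: elem_chain_def tuples_def)

lemma pure_dx: "I \<in> subsets n p \<Longrightarrow> pure p m (dx I) = elem_chain K R M m (var_list I)"
  by (simp add: elem_chain_def var_list_def subsets_def)

text \<open>The map from chains to cochains described in the overview, cut down to tuples of length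
  n - p because cochains are extensional functions on them.\<close>

definition Psi :: "nat \<Rightarrow> ('k mpoly, 'm) chain \<Rightarrow> ('k mpoly, 'm) cochain"
  where "Psi p x = (\<lambda>as\<in>tuples (n - p) (polys n). psi p as x)"

text \<open>The inverse: the coefficient at \<open>dx I\<close> is the value of the cochain on the
  complementary variables, corrected by the sign that the pairing introduces.\<close>

definition Theta :: "nat \<Rightarrow> ('k mpoly, 'm) cochain \<Rightarrow> ('k mpoly, 'm) chain"
  where "Theta p F = (\<Oplus>\<^bsub>\<T> p\<^esub>I\<in>subsets n p. pure p (eps n I \<odot>\<^bsub>M\<^esub> F (compl I)) (dx I))"

lemma compl_tuples: "\<lbrakk>I \<in> subsets n p; p \<le> n\<rbrakk> \<Longrightarrow> compl I \<in> tuples (n - p) (polys n)"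
  using compl_subsets[of I n p] var_list_tuples[of "{..<n} - I" n] by (auto simp: subsets_def)

lemma tuples_subset: "as \<in> tuples q A \<Longrightarrow> set as \<subseteq> A"
  by (simp add: tuples_def)

lemma Theta_summand:
  assumes "\<And>as. as \<in> tuples (n - p) (polys n) \<Longrightarrow> F as \<in> carrier M" "p \<le> n" "I \<in> subsets n p"
  shows "pure p (eps n I \<odot>\<^bsub>M\<^esub> F (compl I)) (dx I) \<in> carrier (\<T> p)"
  using assms by (intro pure_closed sm_closed dx_closed assms(1) compl_tuples) (auto simp: subsets_def)

lemma Theta_closed:
  assumes "\<And>as. as \<in> tuples (n - p) (polys n) \<Longrightarrow> F as \<in> carrier M" "p \<le> n"
  shows "Theta p F \<in> carrier (\<T> p)"
  unfolding Theta_def using Theta_summand[where F = F, OF assms] by (intro abelian_monoid.finsum_closed[OF abelian_group.axioms(1)[OF T_abelian]]) auto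

text \<open>The relation between \<open>H\<close>, \<open>F\<close> and \<open>G\<close> is required
  only on tuples of length n - p. In the construction of the boundary these are signed coboundaries,
  pointwise expressions not cut down to the extensional functions that cochains are.\<close>

lemma Theta_add:
  assumes F: "\<And>as. as \<in> tuples (n - p) (polys n) \<Longrightarrow> F as \<in> carrier M"
    and G: "\<And>as. as \<in> tuples (n - p) (polys n) \<Longrightarrow> G as \<in> carrier M" and p: "p \<le> n"
    and H: "\<And>as. as \<in> tuples (n - p) (polys n) \<Longrightarrow> H as = F as \<oplus>\<^bsub>M\<^esub> G as"
  shows "Theta p H = Theta p F \<oplus>\<^bsub>\<T> p\<^esub> Theta p G"
proof -
  interpret T: abelian_group "\<T> p" by (rule T_abelian)
  have "Theta p H = (\<Oplus>\<^bsub>\<T> p\<^esub>I\<in>subsets n p. pure p (eps n I \<odot>\<^bsub>M\<^esub> F (compl I)) (dx I) \<oplus>\<^bsub>\<T> p\<^esub>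
      pure p (eps n I \<odot>\<^bsub>M\<^esub> G (compl I)) (dx I))"
    unfolding Theta_def
  proof (rule T.finsum_cong')
    show "(\<lambda>I. pure p (eps n I \<odot>\<^bsub>M\<^esub> F (compl I)) (dx I) \<oplus>\<^bsub>\<T> p\<^esub> pure p (eps n I \<odot>\<^bsub>M\<^esub> G (compl I)) (dx I))
        \<in> subsets n p \<rightarrow> carrier (\<T> p)"
      using Theta_summand[where F = F, OF F p] Theta_summand[where F = G, OF G p] by auto
    fix I assume I: "I \<in> subsets n p"
    then have e: "eps n I \<in> polys n" by (simp add: subsets_def)
    note c = compl_tuples[OF I p]
    show "pure p (eps n I \<odot>\<^bsub>M\<^esub> H (compl I)) (dx I) = pure p (eps n I \<odot>\<^bsub>M\<^esub> F (compl I)) (dx I) \<oplus>\<^bsub>\<T> p\<^esub>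
        pure p (eps n I \<odot>\<^bsub>M\<^esub> G (compl I)) (dx I)"
      unfolding H[OF c] sm_add_r[OF e F[OF c] G[OF c]]
      by (rule pure_tensor_add_l[OF M_module Om_module sm_closed[OF e F[OF c]] sm_closed[OF e G[OF c]] dx_closed[OF I]])
  qed simp
  also have "\<dots> = Theta p F \<oplus>\<^bsub>\<T> p\<^esub> Theta p G"
    unfolding Theta_def using Theta_summand[where F = F, OF F p] Theta_summand[where F = G, OF G p] by (intro T.finsum_addf) auto
  finally show ?thesis .
qed

lemma Theta_smult:
  assumes F: "\<And>as. as \<in> tuples (n - p) (polys n) \<Longrightarrow> F as \<in> carrier M" and p: "p \<le> n" and r: "r \<in> polys n"
    and H: "\<And>as. as \<in> tuples (n - p) (polys n) \<Longrightarrow> H as = r \<odot>\<^bsub>M\<^esub> F as"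
  shows "Theta p H = r \<odot>\<^bsub>\<T> p\<^esub> Theta p F"
proof -
  interpret T: module R "\<T> p" by (rule T_module)
  have "Theta p H = (\<Oplus>\<^bsub>\<T> p\<^esub>I\<in>subsets n p. r \<odot>\<^bsub>\<T> p\<^esub> pure p (eps n I \<odot>\<^bsub>M\<^esub> F (compl I)) (dx I))"
    unfolding Theta_def
  proof (rule T.M.finsum_cong')
    show "(\<lambda>I. r \<odot>\<^bsub>\<T> p\<^esub> pure p (eps n I \<odot>\<^bsub>M\<^esub> F (compl I)) (dx I)) \<in> subsets n p \<rightarrow> carrier (\<T> p)"
      using Theta_summand[where F = F, OF F p] r by (intro Pi_I T.smult_closed) auto
    fix I assume I: "I \<in> subsets n p"
    then have e: "eps n I \<in> polys n" by (simp add: subsets_def)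
    note c = compl_tuples[OF I p]
    have "eps n I \<odot>\<^bsub>M\<^esub> (r \<odot>\<^bsub>M\<^esub> F (compl I)) = r \<odot>\<^bsub>M\<^esub> (eps n I \<odot>\<^bsub>M\<^esub> F (compl I))"
      using sm_mult[OF e r F[OF c]] sm_mult[OF r e F[OF c]] by (simp only: mult.commute)
    then show "pure p (eps n I \<odot>\<^bsub>M\<^esub> H (compl I)) (dx I) = r \<odot>\<^bsub>\<T> p\<^esub> pure p (eps n I \<odot>\<^bsub>M\<^esub> F (compl I)) (dx I)"
      unfolding H[OF c] using pure_tensor_smult_l[OF M_module Om_module _ sm_closed[OF e F[OF c]] dx_closed[OF I], of r] r
      by simp
  qed simp
  also have "\<dots> = r \<odot>\<^bsub>\<T> p\<^esub> Theta p F"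
    unfolding Theta_def using Theta_summand[where F = F, OF F p] r by (intro T.finsum_smult_ldistr[symmetric]) auto
  finally show ?thesis .
qed

lemma psi_closed: "\<lbrakk>x \<in> carrier (\<T> p); set as \<subseteq> polys n\<rbrakk> \<Longrightarrow> psi p as x \<in> carrier M"
  using lin_hom_closed[OF psi_hom] .

lemma Psi_closed: "\<lbrakk>x \<in> carrier (\<T> p); as \<in> tuples (n - p) (polys n)\<rbrakk> \<Longrightarrow> Psi p x as \<in> carrier M"
  unfolding Psi_def using psi_closed[OF _ tuples_subset] by simp

lemma Psi_add: "\<lbrakk>x \<in> carrier (\<T> p); y \<in> carrier (\<T> p); as \<in> tuples (n - p) (polys n)\<rbrakk> \<Longrightarrow>
    Psi p (x \<oplus>\<^bsub>\<T> p\<^esub> y) as = Psi p x as \<oplus>\<^bsub>M\<^esub> Psi p y as"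
  unfolding Psi_def using lin_hom_add[OF psi_hom[OF tuples_subset]] by simp

lemma Psi_smult: "\<lbrakk>x \<in> carrier (\<T> p); r \<in> polys n; as \<in> tuples (n - p) (polys n)\<rbrakk> \<Longrightarrow>
    Psi p (r \<odot>\<^bsub>\<T> p\<^esub> x) as = r \<odot>\<^bsub>M\<^esub> Psi p x as"
  unfolding Psi_def using lin_hom_smult[OF psi_hom[OF tuples_subset]] by simp

lemma Psi_elem: "\<lbrakk>m \<in> carrier M; bs \<in> tuples p (polys n); as \<in> tuples (n - p) (polys n)\<rbrakk> \<Longrightarrow>
    Psi p (elem_chain K R M m bs) as = jac n (bs @ as) \<odot>\<^bsub>M\<^esub> m"
  unfolding Psi_def using psi_elem[OF tuples_subset] by simp

text \<open>Both sides are additive in the chain, and on a pure tensor the composite is exactly the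
  coordinate expansion \<open>pure_expand\<close>.\<close>

lemma Theta_Psi:
  assumes x: "x \<in> carrier (\<T> p)" and p: "p \<le> n"
  shows "Theta p (Psi p x) = x"
  using x
proof (rule tensor_induct[OF M_module Om_module])
  interpret T: module R "\<T> p" by (rule T_module)
  \<comment> \<open>The zero chain is reached through multiplication by the scalar 0, which
    \<open>Theta\<close> respects.\<close>
  have "Theta p (Psi p \<zero>\<^bsub>\<T> p\<^esub>) = 0 \<odot>\<^bsub>\<T> p\<^esub> Theta p (Psi p \<zero>\<^bsub>\<T> p\<^esub>)"
    using T.smult_l_null[OF T.M.zero_closed] Psi_closed[OF T.M.zero_closed]
    by (intro Theta_smult[OF _ p]) (simp_all add: Psi_smult[of _ p 0, symmetric])
  then show "Theta p (Psi p \<zero>\<^bsub>\<T> p\<^esub>) = \<zero>\<^bsub>\<T> p\<^esub>"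
    using T.smult_l_null[OF Theta_closed[OF Psi_closed[OF T.M.zero_closed] p]] by simp
  show "Theta p (Psi p (x \<oplus>\<^bsub>\<T> p\<^esub> y)) = x \<oplus>\<^bsub>\<T> p\<^esub> y"
    if "x \<in> carrier (\<T> p)" "y \<in> carrier (\<T> p)" "Theta p (Psi p x) = x" "Theta p (Psi p y) = y" for x y
    using Theta_add[OF Psi_closed[OF that(1)] Psi_closed[OF that(2)] p Psi_add[OF that(1,2)]] that(3,4) by simp
  fix m w assume m: "m \<in> carrier M" and w: "w \<in> carrier (\<Omega> p)"
  have "Theta p (Psi p (pure p m w)) = (\<Oplus>\<^bsub>\<T> p\<^esub>I\<in>subsets n p. pure p ((eps n I * lam p (compl I) w) \<odot>\<^bsub>M\<^esub> m) (dx I))"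
    unfolding Theta_def
  proof (rule T.M.finsum_cong')
    fix I assume I: "I \<in> subsets n p"
    then have e: "eps n I \<in> polys n" by (simp add: subsets_def)
    show "pure p (eps n I \<odot>\<^bsub>M\<^esub> Psi p (pure p m w) (compl I)) (dx I) = pure p ((eps n I * lam p (compl I) w) \<odot>\<^bsub>M\<^esub> m) (dx I)"
      unfolding Psi_def using compl_tuples[OF I p] psi_pure[OF compl_closed m w] sm_mult[OF e lam_closed[OF compl_closed w] m] by simp
  next
    show "(\<lambda>I. pure p ((eps n I * lam p (compl I) w) \<odot>\<^bsub>M\<^esub> m) (dx I)) \<in> subsets n p \<rightarrow> carrier (\<T> p)"
      using m lam_closed[OF compl_closed w] by (intro Pi_I pure_closed sm_closed dx_closed) (auto simp: subsets_def)
  qed simp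
  then show "Theta p (Psi p (pure p m w)) = pure p m w"
    by (simp only: pure_expand[OF m w, symmetric])
qed

lemma Psi_extensional: "Psi p x \<in> extensional (tuples (n - p) (polys n))"
  by (simp add: Psi_def)

end

lemma (in abelian_group) finsum_lessThan_add:
  fixes p r :: nat
  assumes "\<And>i. i < p + r \<Longrightarrow> f i \<in> carrier G"
  shows "(\<Oplus>i\<in>{..<p + r}. f i) = (\<Oplus>i\<in>{..<p}. f i) \<oplus> (\<Oplus>i\<in>{..<r}. f (p + i))"
  using assms
proof (induction r)
  case 0
  then show ?case by (simp add: Pi_iff)
next
  case (Suc r)
  have "(\<Oplus>i\<in>{..<p + Suc r}. f i) = f (p + r) \<oplus> (\<Oplus>i\<in>{..<p + r}. f i)"
    unfolding add_Suc_right lessThan_Suc using Suc.prems by (intro finsum_insert) auto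
  also have "(\<Oplus>i\<in>{..<p + r}. f i) = (\<Oplus>i\<in>{..<p}. f i) \<oplus> (\<Oplus>i\<in>{..<r}. f (p + i))"
    using Suc by simp
  also have "f (p + r) \<oplus> \<dots> = (\<Oplus>i\<in>{..<p}. f i) \<oplus> (f (p + r) \<oplus> (\<Oplus>i\<in>{..<r}. f (p + i)))"
    using Suc.prems by (intro a_lcomm finsum_closed) auto
  also have "f (p + r) \<oplus> (\<Oplus>i\<in>{..<r}. f (p + i)) = (\<Oplus>i\<in>{..<Suc r}. f (p + i))"
    unfolding lessThan_Suc using Suc.prems by (intro finsum_insert[symmetric]) auto
  finally show ?case .
qed

section \<open>Skew multiderivations and the bijection between chains and cochains\<close>

context poly_module begin

lemma cochainI:
  assumes "\<And>as. as \<in> tuples q (polys n) \<Longrightarrow> F as \<in> carrier M" "F \<in> extensional (tuples q (polys n))"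
    and "\<And>as i a b. \<lbrakk>as \<in> tuples q (polys n); i < q; a \<in> polys n; b \<in> polys n\<rbrakk> \<Longrightarrow>
      F (as[i := a + b]) = F (as[i := a]) \<oplus>\<^bsub>M\<^esub> F (as[i := b])"
    and "\<And>as i c a. \<lbrakk>as \<in> tuples q (polys n); i < q; a \<in> polys n\<rbrakk> \<Longrightarrow>
      F (as[i := mmonom 0 c * a]) = mmonom 0 c \<odot>\<^bsub>M\<^esub> F (as[i := a])"
    and "\<And>as i j. \<lbrakk>as \<in> tuples q (polys n); i < q; j < q; i \<noteq> j\<rbrakk> \<Longrightarrow>
      F (as[i := as ! j, j := as ! i]) = \<ominus>\<^bsub>M\<^esub> F as"
    and "\<And>as i a b. \<lbrakk>as \<in> tuples q (polys n); i < q; a \<in> polys n; b \<in> polys n\<rbrakk> \<Longrightarrow>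
      F (as[i := a * b]) = a \<odot>\<^bsub>M\<^esub> F (as[i := b]) \<oplus>\<^bsub>M\<^esub> b \<odot>\<^bsub>M\<^esub> F (as[i := a])"
  shows "F \<in> carrier (cochains K R M q)"
  using assms by (simp add: cochains_def scalar_eq PiE_iff)

lemma
  assumes "F \<in> carrier (cochains K R M q)"
  shows cochain_closed: "as \<in> tuples q (polys n) \<Longrightarrow> F as \<in> carrier M"
    and cochain_ext: "F \<in> extensional (tuples q (polys n))"
    and cochain_swap: "\<lbrakk>as \<in> tuples q (polys n); i < q; j < q; i \<noteq> j\<rbrakk> \<Longrightarrow>
      F (as[i := as ! j, j := as ! i]) = \<ominus>\<^bsub>M\<^esub> F as"
    and cochain_add: "\<lbrakk>as \<in> tuples q (polys n); i < q; a \<in> polys n; b \<in> polys n\<rbrakk> \<Longrightarrow>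
      F (as[i := a + b]) = F (as[i := a]) \<oplus>\<^bsub>M\<^esub> F (as[i := b])"
    and cochain_mult: "\<lbrakk>as \<in> tuples q (polys n); i < q; a \<in> polys n; b \<in> polys n\<rbrakk> \<Longrightarrow>
      F (as[i := a * b]) = a \<odot>\<^bsub>M\<^esub> F (as[i := b]) \<oplus>\<^bsub>M\<^esub> b \<odot>\<^bsub>M\<^esub> F (as[i := a])"
  using assms by (simp_all add: cochains_def scalar_eq PiE_iff)

lemma cochain_smult:
  assumes "F \<in> carrier (cochains K R M q)" "as \<in> tuples q (polys n)" "i < q" "a \<in> polys n"
  shows "F (as[i := mmonom 0 c * a]) = mmonom 0 c \<odot>\<^bsub>M\<^esub> F (as[i := a])"
proof -
  have "\<forall>as\<in>tuples q (polys n). \<forall>i<q. \<forall>c\<in>UNIV. \<forall>a\<in>polys n. F (as[i := mmonom 0 c * a]) = mmonom 0 c \<odot>\<^bsub>M\<^esub> F (as[i := a])"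
    using assms(1) unfolding cochains_def partial_object.select_convs mem_Collect_eq scalar_eq R_simps
    by (elim conjE)
  with assms(2-) show ?thesis by blast
qed

lemma cochain_derivation:
  assumes F: "F \<in> carrier (cochains K R M q)" and as: "as \<in> tuples q (polys n)" and i: "i < q"
  shows "module_derivation (\<lambda>a. F (as[i := a]))"
  unfolding module_derivation_def
  using cochain_closed[OF F tuples_update[OF as]] cochain_add[OF F as i] cochain_smult[OF F as i] cochain_mult[OF F as i]
  by simp

lemma cochain_sum:
  assumes F: "F \<in> carrier (cochains K R M q)" and G: "G \<in> carrier (cochains K R M q)"
    and H: "\<And>as. as \<in> tuples q (polys n) \<Longrightarrow> H as = F as \<oplus>\<^bsub>M\<^esub> G as"
    and ext: "H \<in> extensional (tuples q (polys n))"
  shows "H \<in> carrier (cochains K R M q)"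
proof (rule cochainI[OF _ ext])
  show "H as \<in> carrier M" if "as \<in> tuples q (polys n)" for as
    using cochain_closed[OF F that] cochain_closed[OF G that] by (simp add: H[OF that])
  fix as :: "'k mpoly list" and i assume as: "as \<in> tuples q (polys n)" and i: "i < q"
  note t = tuples_update[OF as]
  note cl = cochain_closed[OF F t] cochain_closed[OF G t]
  {
    fix a b :: "'k mpoly" assume ab: "a \<in> polys n" "b \<in> polys n"
    show "H (as[i := a + b]) = H (as[i := a]) \<oplus>\<^bsub>M\<^esub> H (as[i := b])"
      using ab cl[OF ab(1)] cl[OF ab(2)]
      by (simp add: H t cochain_add[OF F as i] cochain_add[OF G as i] M.M.a_ac)
    show "H (as[i := a * b]) = a \<odot>\<^bsub>M\<^esub> H (as[i := b]) \<oplus>\<^bsub>M\<^esub> b \<odot>\<^bsub>M\<^esub> H (as[i := a])"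
      using ab cl[OF ab(1)] cl[OF ab(2)]
      by (simp add: H t cochain_mult[OF F as i] cochain_mult[OF G as i] sm_add_r sm_closed M.M.a_ac)
  }
  show "H (as[i := mmonom 0 c * a]) = mmonom 0 c \<odot>\<^bsub>M\<^esub> H (as[i := a])" if "a \<in> polys n" for c a
    using that cl[OF that] by (simp add: H t cochain_smult[OF F as i] cochain_smult[OF G as i] sm_add_r)
  show "H (as[i := as ! j, j := as ! i]) = \<ominus>\<^bsub>M\<^esub> H as" if "j < q" "i \<noteq> j" for j
  proof -
    have "as[i := as ! j, j := as ! i] \<in> tuples q (polys n)"
      using as i that by (intro tuples_update tuples_nth)
    then show ?thesis
      using cochain_closed[OF F as] cochain_closed[OF G as]
      by (simp add: H as cochain_swap[OF F as i that] cochain_swap[OF G as i that] M.M.minus_add)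
  qed
qed

text \<open>Argument \<open>i\<close> of the cochain sits at position \<open>p + i\<close> of the
  Jacobian, so the cochain conditions are the rules for \<open>jac\<close> in that slot, acting on
  the fixed element \<open>m\<close>.\<close>

lemma Psi_elem_cochain:
  assumes m: "m \<in> carrier M" and bs: "bs \<in> tuples p (polys n)"
  shows "Psi p (elem_chain K R M m bs) \<in> carrier (cochains K R M (n - p))"
proof (rule cochainI[OF _ Psi_extensional])
  have len: "length bs = p" using bs by (simp add: tuples_def)
  have J: "jac n (bs @ as) \<in> polys n" if "as \<in> tuples (n - p) (polys n)" for as
    using that bs by (intro jac_closed) (auto simp: tuples_def)
  note E = Psi_elem[OF m bs]
  show "Psi p (elem_chain K R M m bs) as \<in> carrier M" if "as \<in> tuples (n - p) (polys n)" for as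
    using E[OF that] sm_closed[OF J[OF that] m] by simp
  fix as :: "'k mpoly list" and i assume as: "as \<in> tuples (n - p) (polys n)" and i: "i < n - p"
  have las: "length as = n - p" using as by (simp add: tuples_def)
  have upd: "bs @ as[j := a] = (bs @ as)[p + j := a]" for j a
    using len by (simp add: list_update_append)
  have lt: "p + i < length (bs @ as)" using i len las by simp
  note t = tuples_update[OF as]
  {
    fix a b :: "'k mpoly" assume ab: "a \<in> polys n" "b \<in> polys n"
    show "Psi p (elem_chain K R M m bs) (as[i := a + b]) =
        Psi p (elem_chain K R M m bs) (as[i := a]) \<oplus>\<^bsub>M\<^esub> Psi p (elem_chain K R M m bs) (as[i := b])"
      using ab J[OF t[OF ab(1)]] J[OF t[OF ab(2)]] m
      by (simp add: E t upd jac_add[OF lt] sm_add_l)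
    show "Psi p (elem_chain K R M m bs) (as[i := a * b]) =
        a \<odot>\<^bsub>M\<^esub> Psi p (elem_chain K R M m bs) (as[i := b]) \<oplus>\<^bsub>M\<^esub> b \<odot>\<^bsub>M\<^esub> Psi p (elem_chain K R M m bs) (as[i := a])"
      using ab J[OF t[OF ab(1)]] J[OF t[OF ab(2)]] m
      by (simp add: E t upd jac_mult[OF lt] sm_add_l sm_mult)
  }
  show "Psi p (elem_chain K R M m bs) (as[i := mmonom 0 c * a]) =
      mmonom 0 c \<odot>\<^bsub>M\<^esub> Psi p (elem_chain K R M m bs) (as[i := a])" if "a \<in> polys n" for c a
    using that J[OF t[OF that]] m by (simp add: E t upd jac_smult[OF lt] sm_mult)
  show "Psi p (elem_chain K R M m bs) (as[i := as ! j, j := as ! i]) = \<ominus>\<^bsub>M\<^esub> Psi p (elem_chain K R M m bs) as"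
    if j: "j < n - p" "i \<noteq> j" for j
  proof -
    have t': "as[i := as ! j, j := as ! i] \<in> tuples (n - p) (polys n)"
      using as i j by (intro tuples_update tuples_nth)
    have "bs @ as[i := as ! j, j := as ! i] = (bs @ as)[p + i := (bs @ as) ! (p + j), p + j := (bs @ as) ! (p + i)]"
      using len by (simp add: list_update_append nth_append)
    then have "jac n (bs @ as[i := as ! j, j := as ! i]) = - jac n (bs @ as)"
      using jac_swap[of "p + i" "bs @ as" "p + j" n] i j len las by simp
    then show ?thesis
      using sm_uminus[OF J[OF as] m] by (simp add: E[OF t'] E[OF as])
  qed
qed

lemma Psi_cochain:
  assumes "x \<in> carrier (\<T> p)"
  shows "Psi p x \<in> carrier (cochains K R M (n - p))"
  using assms
proof (induction rule: chain_induct)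
  case zero
  interpret T: module R "\<T> p" by (rule T_module)
  have z: "Psi p \<zero>\<^bsub>\<T> p\<^esub> as = \<zero>\<^bsub>M\<^esub>" if "as \<in> tuples (n - p) (polys n)" for as
    unfolding Psi_def using that additive_map.zero[OF psi_additive[OF tuples_subset[OF that]]] by simp
  have sw: "as[i := as ! j, j := as ! i] \<in> tuples (n - p) (polys n)"
    if "as \<in> tuples (n - p) (polys n)" "i < n - p" "j < n - p" for as :: "'k mpoly list" and i j
    using that by (intro tuples_update tuples_nth)
  show ?case
    by (rule cochainI[OF _ Psi_extensional]) (simp_all add: z sw tuples_update sm_0_r M.M.uminus_zero)
next
  case (add x y)
  show ?case by (rule cochain_sum[OF add(3,4) Psi_add[OF add(1,2)] Psi_extensional])
next
  case (pure m I)
  then have "var_list I \<in> tuples p (polys n)" using var_list_tuples[of I n] by (auto simp: subsets_def)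
  from Psi_elem_cochain[OF pure(1) this] show ?case by (simp add: pure_dx[OF pure(2)])
qed

text \<open>A cochain is a module derivation in each argument, hence determined by variables;
  skew-symmetry sorts them, and repetitions give zero by \<open>double_eq_zero\<close>.\<close>

lemma cochain_agree:
  assumes F: "F \<in> carrier (cochains K R M q)" and G: "G \<in> carrier (cochains K R M q)"
    and base: "\<And>I. I \<in> subsets n q \<Longrightarrow> F (var_list I) = G (var_list I)"
  shows "F = G"
proof (rule extensionalityI[OF cochain_ext[OF F] cochain_ext[OF G]])
  have zero: "F vs = \<zero>\<^bsub>M\<^esub>"
    if F: "F \<in> carrier (cochains K R M q)" and vs: "vs \<in> tuples q (polys n)" "i < j" "j < q" "vs ! i = vs ! j" for F vs i j
  proof (rule double_eq_zero)
    show "F vs \<in> carrier M" by (rule cochain_closed[OF F vs(1)])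
    have "vs[i := vs ! j, j := vs ! i] = vs" using vs(4) by (metis list_update_id)
    with cochain_swap[OF F vs(1), of i j] vs show "F vs = \<ominus>\<^bsub>M\<^esub> F vs" by simp
  qed
  fix as :: "'k mpoly list" assume "as \<in> tuples q (polys n)"
  then show "F as = G as"
  proof (rule alternating_reduction[where X = poly_var and n = n and A = "polys n" and p = q and P = "\<lambda>as. F as = G as", rotated -1])
    fix vs :: "'k mpoly list" and i
    assume vs: "vs \<in> tuples q (polys n)" and i: "i < q"
      and var: "\<And>k. k < n \<Longrightarrow> F (vs[i := poly_var k]) = G (vs[i := poly_var k])"
    from module_derivation_agree[OF cochain_derivation[OF F vs i] cochain_derivation[OF G vs i] var tuples_nth[OF vs i]]
    show "F vs = G vs" by simp
  next
    fix vs :: "'k mpoly list" and i j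
    assume vs: "vs \<in> tuples q (polys n)" and ij: "i < j" "j < q"
    show "F vs = G vs" if "vs ! i = vs ! j"
      using zero[OF F vs ij that] zero[OF G vs ij that] by simp
    show "F (vs[i := vs ! j, j := vs ! i]) = G (vs[i := vs ! j, j := vs ! i])" if "F vs = G vs"
      using cochain_swap[OF F vs, of i j] cochain_swap[OF G vs, of i j] ij that by simp
  next
    fix I assume "I \<subseteq> {..<n}" "card I = q"
    then show "F (map poly_var (sorted_list_of_set I)) = G (map poly_var (sorted_list_of_set I))"
      using base[of I] by (simp add: subsets_def var_list_def)
  qed simp
qed

text \<open>Increasing tuples of variables suffice. At the tuple of \<open>J\<close> every summand
  of \<open>Theta\<close> pairs to zero except the one indexed by the complement of
  \<open>J\<close>, where the two signs multiply to 1.\<close>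

lemma Psi_Theta:
  assumes F: "F \<in> carrier (cochains K R M (n - p))" and p: "p \<le> n"
  shows "Psi p (Theta p F) = F"
proof (rule cochain_agree[OF Psi_cochain[OF Theta_closed[OF cochain_closed[OF F] p]] F])
  fix J assume J: "J \<in> subsets n (n - p)"
  define I where "I = {..<n} - J"
  have I: "I \<in> subsets n p" using compl_subsets[OF J] p by (simp add: I_def)
  have JI: "J = {..<n} - I" using J by (auto simp: I_def subsets_def)
  note t = compl_tuples[OF I p]
  have e: "eps n I \<in> polys n" using I by (simp add: subsets_def)
  have sq: "eps n I * eps n I = (1 :: 'k mpoly)" using I by (intro eps_square) (simp add: subsets_def)
  interpret ps: additive_map "\<T> p" M "psi p (compl I)" by (rule psi_additive[OF compl_closed])
  note FI = cochain_closed[OF F t]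
  have "psi p (compl I) (Theta p F) = (\<Oplus>\<^bsub>M\<^esub>L\<in>subsets n p. psi p (compl I) (pure p (eps n L \<odot>\<^bsub>M\<^esub> F (compl L)) (dx L)))"
    unfolding Theta_def using Theta_summand[where F = F, OF cochain_closed[OF F] p] by (intro ps.finsum) auto
  also have "\<dots> = (\<Oplus>\<^bsub>M\<^esub>L\<in>subsets n p. if I = L then F (compl I) else \<zero>\<^bsub>M\<^esub>)"
  proof (rule M.M.finsum_cong')
    show "(\<lambda>L. if I = L then F (compl I) else \<zero>\<^bsub>M\<^esub>) \<in> subsets n p \<rightarrow> carrier M" using FI by auto
    fix L assume L: "L \<in> subsets n p"
    then have eL: "eps n L \<in> polys n" by (simp add: subsets_def)
    note FL = cochain_closed[OF F compl_tuples[OF L p]]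
    have "psi p (compl I) (pure p (eps n L \<odot>\<^bsub>M\<^esub> F (compl L)) (dx L)) = lam p (compl I) (dx L) \<odot>\<^bsub>M\<^esub> (eps n L \<odot>\<^bsub>M\<^esub> F (compl L))"
      by (rule psi_pure[OF compl_closed sm_closed[OF eL FL] dx_closed[OF L]])
    also have "\<dots> = (if I = L then F (compl I) else \<zero>\<^bsub>M\<^esub>)"
    proof (cases "I = L")
      case True
      then show ?thesis using lam_dx[OF I I] sm_mult[OF e e FI] sq sm_1[OF FI] by simp
    next
      case False
      then show ?thesis using lam_dx[OF L I] sm_0[OF sm_closed[OF eL FL]] by simp
    qed
    finally show "psi p (compl I) (pure p (eps n L \<odot>\<^bsub>M\<^esub> F (compl L)) (dx L)) = (if I = L then F (compl I) else \<zero>\<^bsub>M\<^esub>)" .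
  qed simp
  also have "\<dots> = F (compl I)"
    by (rule M.M.add.finprod_singleton[OF I finite_subsets]) (simp add: FI)
  finally show "Psi p (Theta p F) (var_list J) = F (var_list J)"
    unfolding Psi_def JI using t by simp
qed

lemma Psi_inj:
  assumes "x \<in> carrier (\<T> p)" "y \<in> carrier (\<T> p)" "p \<le> n"
    and "\<And>as. as \<in> tuples (n - p) (polys n) \<Longrightarrow> psi p as x = psi p as y"
  shows "x = y"
proof -
  have "Psi p x = Psi p y" unfolding Psi_def using assms(4) by (intro restrict_ext) simp
  then show ?thesis using Theta_Psi[OF assms(1,3)] Theta_Psi[OF assms(2,3)] by metis
qed

lemma chain_zero:
  assumes "n < p" "x \<in> carrier (\<T> p)"
  shows "x = \<zero>\<^bsub>\<T> p\<^esub>"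
  using assms(2)
proof (induction rule: chain_induct)
  case (add x y)
  then show ?case using module.axioms(2)[OF T_module, of p] by (simp add: abelian_groupE(5) abelian_groupE(2))
next
  case (pure m I)
  then show ?case using subsets_empty[OF assms(1)] by simp
qed simp

end

section \<open>The boundary and coboundary maps\<close>

lemma twist_simps [simp]:
  "carrier (twist \<phi> M) = carrier M" "\<zero>\<^bsub>twist \<phi> M\<^esub> = \<zero>\<^bsub>M\<^esub>" "x \<oplus>\<^bsub>twist \<phi> M\<^esub> y = x \<oplus>\<^bsub>M\<^esub> y"
  "a \<odot>\<^bsub>twist \<phi> M\<^esub> x = a \<odot>\<^bsub>M\<^esub> x" "mbracket (twist \<phi> M) m a = mbracket M m a \<oplus>\<^bsub>M\<^esub> \<phi> a \<odot>\<^bsub>M\<^esub> m"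
  by (simp_all add: twist_def)

text \<open>Twisting alters only the bracket, so the modules \<open>M\<close> and
  \<open>twist \<phi> M\<close> have the same chains; only the boundary differs.\<close>

lemma tensor_twist [simp]: "tensor R (twist \<phi> M) W = tensor R M W"
  by (simp add: tensor_def tensor_rels_def)

lemma pure_tensor_twist [simp]: "pure_tensor R (twist \<phi> M) W = pure_tensor R M W"
  by (intro ext) (simp add: pure_tensor_def tensor_rels_def)

lemma chains_twist [simp]: "chains K R (twist \<phi> M) p = restrict_scalars R (tensor R M (forms K R p))"
  by (simp add: chains_def)

lemma elem_chain_twist [simp]: "elem_chain K R (twist \<phi> M) = elem_chain K R M"
  by (intro ext) (simp add: elem_chain_def)

text \<open>Agreement of \<open>\<phi>\<close> with \<open>modular\<close> is asked only on
  \<open>polys n\<close>: elsewhere the definite description of the modular derivation is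
  uncontrolled.\<close>

locale poly_poisson_module = poly_poisson n br K R
  for n :: nat and br :: "'k::field_char_0 mpoly \<Rightarrow> 'k mpoly \<Rightarrow> 'k mpoly"
    and K :: "'k ring" and R :: "('k, 'k mpoly) poisson_alg" +
  fixes M :: "('k mpoly, 'm) poisson_mod" and \<phi> :: "'k mpoly \<Rightarrow> 'k mpoly"
  assumes M_poisson: "poisson_module K R M" and phi: "\<And>a. a \<in> polys n \<Longrightarrow> \<phi> a = modular a"
begin

sublocale poly_module n br K R M
  by (intro poly_module.intro poly_module_axioms.intro poly_poisson_axioms)
    (rule poisson_module.axioms(2)[OF M_poisson])

lemma
  shows mb_closed: "\<lbrakk>m \<in> carrier M; a \<in> polys n\<rbrakk> \<Longrightarrow> mbracket M m a \<in> carrier M"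
    and mb_add_l: "\<lbrakk>m \<in> carrier M; m' \<in> carrier M; a \<in> polys n\<rbrakk> \<Longrightarrow>
      mbracket M (m \<oplus>\<^bsub>M\<^esub> m') a = mbracket M m a \<oplus>\<^bsub>M\<^esub> mbracket M m' a"
    and mb_add_r: "\<lbrakk>m \<in> carrier M; a \<in> polys n; b \<in> polys n\<rbrakk> \<Longrightarrow>
      mbracket M m (a + b) = mbracket M m a \<oplus>\<^bsub>M\<^esub> mbracket M m b"
    and mb_smult_l: "\<lbrakk>m \<in> carrier M; a \<in> polys n\<rbrakk> \<Longrightarrow> mbracket M (mmonom 0 c \<odot>\<^bsub>M\<^esub> m) a = mmonom 0 c \<odot>\<^bsub>M\<^esub> mbracket M m a"
    and mb_smult_r: "\<lbrakk>m \<in> carrier M; a \<in> polys n\<rbrakk> \<Longrightarrow> mbracket M m (mmonom 0 c * a) = mmonom 0 c \<odot>\<^bsub>M\<^esub> mbracket M m a"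
    and mb_action: "\<lbrakk>m \<in> carrier M; a \<in> polys n; b \<in> polys n\<rbrakk> \<Longrightarrow>
      mbracket M (a \<odot>\<^bsub>M\<^esub> m) b = a \<odot>\<^bsub>M\<^esub> mbracket M m b \<oplus>\<^bsub>M\<^esub> br a b \<odot>\<^bsub>M\<^esub> m"
    and mb_mult: "\<lbrakk>m \<in> carrier M; a \<in> polys n; b \<in> polys n\<rbrakk> \<Longrightarrow>
      mbracket M m (a * b) = b \<odot>\<^bsub>M\<^esub> mbracket M m a \<oplus>\<^bsub>M\<^esub> a \<odot>\<^bsub>M\<^esub> mbracket M m b"
  using poisson_module.mbracket_closed[OF M_poisson, of m a] poisson_module.mbracket_add_l[OF M_poisson, of m m' a]
    poisson_module.mbracket_add_r[OF M_poisson, of m a b] poisson_module.mbracket_smult_l[OF M_poisson, of c m a]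
    poisson_module.mbracket_smult_r[OF M_poisson, of c m a] poisson_module.mbracket_action[OF M_poisson, of m a b]
    poisson_module.mbracket_mult[OF M_poisson, of m a b]
  by (simp_all add: scalar_eq)

lemma mb_derivation:
  assumes m: "m \<in> carrier M"
  shows "module_derivation (mbracket M m)"
proof -
  have mult: "mbracket M m (a * b) = a \<odot>\<^bsub>M\<^esub> mbracket M m b \<oplus>\<^bsub>M\<^esub> b \<odot>\<^bsub>M\<^esub> mbracket M m a"
    if "a \<in> polys n" "b \<in> polys n" for a b
    unfolding mb_mult[OF m that] using that m by (intro M.M.a_comm sm_closed mb_closed)
  show ?thesis
    unfolding module_derivation_def by (intro conjI ballI allI mb_closed mb_add_r mb_smult_r mult m)
qed

abbreviation "N \<equiv> twist \<phi> M"

lemma N_bracket: "\<lbrakk>m \<in> carrier M; a \<in> polys n\<rbrakk> \<Longrightarrow> mbracket N m a = mbracket M m a \<oplus>\<^bsub>M\<^esub> modular a \<odot>\<^bsub>M\<^esub> m"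
  by (simp add: phi)

lemma N_bracket_closed: "\<lbrakk>m \<in> carrier M; a \<in> polys n\<rbrakk> \<Longrightarrow> mbracket N m a \<in> carrier M"
  by (simp add: phi mb_closed sm_closed)

lemma double_sum:
  assumes "m \<in> carrier M" "\<And>i j. i < j \<Longrightarrow> j < p \<Longrightarrow> f i j \<in> polys n"
  shows "(\<Oplus>\<^bsub>M\<^esub>j\<in>{..<p}. \<Oplus>\<^bsub>M\<^esub>i\<in>{..<j}. signed M (i + j) (f i j \<odot>\<^bsub>M\<^esub> m)) =
    (\<Sum>j<p. \<Sum>i<j. (- 1) ^ (i + j) * f i j) \<odot>\<^bsub>M\<^esub> m"
proof -
  have "(\<Oplus>\<^bsub>M\<^esub>j\<in>{..<p}. \<Oplus>\<^bsub>M\<^esub>i\<in>{..<j}. signed M (i + j) (f i j \<odot>\<^bsub>M\<^esub> m)) =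
    (\<Oplus>\<^bsub>M\<^esub>j\<in>{..<p}. (\<Sum>i<j. (- 1) ^ (i + j) * f i j) \<odot>\<^bsub>M\<^esub> m)"
  proof (rule M.M.finsum_cong')
    show "(\<lambda>j. (\<Sum>i<j. (- 1) ^ (i + j) * f i j) \<odot>\<^bsub>M\<^esub> m) \<in> {..<p} \<rightarrow> carrier M"
      using assms by (intro Pi_I sm_closed polys_sum polys_mult polys_sign) auto
    fix j assume j: "j \<in> {..<p}"
    have "(\<Oplus>\<^bsub>M\<^esub>i\<in>{..<j}. signed M (i + j) (f i j \<odot>\<^bsub>M\<^esub> m)) = (\<Oplus>\<^bsub>M\<^esub>i\<in>{..<j}. ((- 1) ^ (i + j) * f i j) \<odot>\<^bsub>M\<^esub> m)"
      using assms j by (intro M.M.finsum_cong') (auto simp: sm_signed intro!: sm_closed)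
    also have "\<dots> = (\<Sum>i<j. (- 1) ^ (i + j) * f i j) \<odot>\<^bsub>M\<^esub> m"
      using assms j by (intro sm_sum) auto
    finally show "(\<Oplus>\<^bsub>M\<^esub>i\<in>{..<j}. signed M (i + j) (f i j \<odot>\<^bsub>M\<^esub> m)) = (\<Sum>i<j. (- 1) ^ (i + j) * f i j) \<odot>\<^bsub>M\<^esub> m" .
  qed simp
  also have "\<dots> = (\<Sum>j<p. \<Sum>i<j. (- 1) ^ (i + j) * f i j) \<odot>\<^bsub>M\<^esub> m"
    using assms by (intro sm_sum polys_sum) auto
  finally show ?thesis .
qed

text \<open>Separates the terms that contain a bracket with \<open>m\<close> from those in which a
  polynomial merely multiplies \<open>m\<close>.\<close>

lemma split_sum:
  fixes p :: nat
  assumes m: "m \<in> carrier M" and "\<And>i. i < p \<Longrightarrow> f i \<in> polys n" "\<And>i. i < p \<Longrightarrow> D i \<in> carrier M" "\<And>i. i < p \<Longrightarrow> g i \<in> polys n"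
    and h: "\<And>i. i < p \<Longrightarrow> h i = f i \<odot>\<^bsub>M\<^esub> D i \<oplus>\<^bsub>M\<^esub> g i \<odot>\<^bsub>M\<^esub> m"
  shows "(\<Oplus>\<^bsub>M\<^esub>i\<in>{..<p}. h i) = (\<Oplus>\<^bsub>M\<^esub>i\<in>{..<p}. f i \<odot>\<^bsub>M\<^esub> D i) \<oplus>\<^bsub>M\<^esub> (\<Sum>i<p. g i) \<odot>\<^bsub>M\<^esub> m"
proof -
  have "(\<Oplus>\<^bsub>M\<^esub>i\<in>{..<p}. h i) = (\<Oplus>\<^bsub>M\<^esub>i\<in>{..<p}. f i \<odot>\<^bsub>M\<^esub> D i \<oplus>\<^bsub>M\<^esub> g i \<odot>\<^bsub>M\<^esub> m)"
    using assms by (intro M.M.finsum_cong' Pi_I M.M.add.m_closed sm_closed) auto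
  also have "\<dots> = (\<Oplus>\<^bsub>M\<^esub>i\<in>{..<p}. f i \<odot>\<^bsub>M\<^esub> D i) \<oplus>\<^bsub>M\<^esub> (\<Oplus>\<^bsub>M\<^esub>i\<in>{..<p}. g i \<odot>\<^bsub>M\<^esub> m)"
    using assms by (intro M.M.finsum_addf Pi_I sm_closed) auto
  also have "(\<Oplus>\<^bsub>M\<^esub>i\<in>{..<p}. g i \<odot>\<^bsub>M\<^esub> m) = (\<Sum>i<p. g i) \<odot>\<^bsub>M\<^esub> m"
    using assms by (intro sm_sum) auto
  finally show ?thesis .
qed

text \<open>The value at \<open>a\<close> of the cochain attached to the boundary of the elementary
  chain of \<open>m\<close> and \<open>b\<close>, with all chains already paired; see
  \<open>psi_bform\<close>.\<close>

definition boundary_value :: "'m \<Rightarrow> 'k mpoly list \<Rightarrow> 'k mpoly list \<Rightarrow> 'm"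
  where "boundary_value m b a =
    (\<Oplus>\<^bsub>M\<^esub>i\<in>{..<length b}. signed M i (jac n (omit i b @ a) \<odot>\<^bsub>M\<^esub> mbracket N m (b ! i))) \<oplus>\<^bsub>M\<^esub>
    (\<Oplus>\<^bsub>M\<^esub>j\<in>{..<length b}. \<Oplus>\<^bsub>M\<^esub>i\<in>{..<j}. signed M (i + j) (jac n ((br (b ! i) (b ! j) # omit i (omit j b)) @ a) \<odot>\<^bsub>M\<^esub> m))"

text \<open>The value at \<open>a\<close> of the coboundary of the cochain attached to the same
  elementary chain; see \<open>coboundary_Psi_elem\<close>.\<close>

definition coboundary_value :: "'m \<Rightarrow> 'k mpoly list \<Rightarrow> 'k mpoly list \<Rightarrow> 'm"
  where "coboundary_value m b a =
    (\<Oplus>\<^bsub>M\<^esub>i\<in>{..<length a}. signed M (Suc i) (mbracket M (jac n (b @ omit i a) \<odot>\<^bsub>M\<^esub> m) (a ! i))) \<oplus>\<^bsub>M\<^esub>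
    (\<Oplus>\<^bsub>M\<^esub>j\<in>{..<length a}. \<Oplus>\<^bsub>M\<^esub>i\<in>{..<j}. signed M (i + j) (jac n (b @ br (a ! i) (a ! j) # omit i (omit j a)) \<odot>\<^bsub>M\<^esub> m))"

lemma set_omit2: "set (omit i (omit j xs)) \<subseteq> set xs"
  using set_omit[of i "omit j xs"] set_omit[of j xs] by (rule subset_trans)

text \<open>Both sides split into a part with brackets of \<open>m\<close> and a part where a
  polynomial multiplies \<open>m\<close>. The twist on the left, and on the right the Leibniz rule
  for the bracket of a multiple of \<open>m\<close>, contribute to the second part besides the
  brackets of polynomials. The parts match separately, the first by
  \<open>jac_laplace_module\<close>, the second by \<open>jac_chain_identity\<close>.\<close>

lemma boundary_value_eq_coboundary_value:
  assumes m: "m \<in> carrier M" and b: "b \<in> tuples p (polys n)" and a: "a \<in> tuples r (polys n)" and pr: "p + r = Suc n"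
  shows "boundary_value m b a = signed M p (coboundary_value m b a)"
proof -
  have len: "length b = p" "length a = r" and sub: "set b \<subseteq> polys n" "set a \<subseteq> polys n"
    using a b by (auto simp: tuples_def)
  have bi: "b ! i \<in> polys n" if "i < p" for i using tuples_nth[OF b that] .
  have ai: "a ! i \<in> polys n" if "i < r" for i using tuples_nth[OF a that] .
  have J1: "jac n (omit i b @ a) \<in> polys n" for i
    using sub set_omit[of i b] by (intro jac_closed) auto
  have J2: "jac n (b @ omit i a) \<in> polys n" for i
    using sub set_omit[of i a] by (intro jac_closed) auto
  have J3: "jac n ((br (b ! i) (b ! j) # omit i (omit j b)) @ a) \<in> polys n" if "i < j" "j < p" for i j
    using sub set_omit2[of i j b] bi[of i] bi[of j] that by (intro jac_closed) auto
  have J4: "jac n (b @ br (a ! i) (a ! j) # omit i (omit j a)) \<in> polys n" if "i < j" "j < r" for i j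
    using sub set_omit2[of i j a] ai[of i] ai[of j] that by (intro jac_closed) auto
  let ?D = "mbracket M m"
  define B where "B = (\<Sum>i<p. (- 1) ^ i * jac n (omit i b @ a) * modular (b ! i))"
  define BB where "BB = (\<Sum>j<p. \<Sum>i<j. (- 1) ^ (i + j) * jac n ((br (b ! i) (b ! j) # omit i (omit j b)) @ a))"
  define A where "A = (\<Sum>i<r. (- 1) ^ Suc i * br (jac n (b @ omit i a)) (a ! i))"
  define AA where "AA = (\<Sum>j<r. \<Sum>i<j. (- 1) ^ (i + j) * jac n (b @ br (a ! i) (a ! j) # omit i (omit j a)))"
  have pol: "B \<in> polys n" "BB \<in> polys n" "A \<in> polys n" "AA \<in> polys n"
    unfolding B_def BB_def A_def AA_def
    by (auto intro!: polys_sum polys_mult polys_uminus modular_closed br_closed J1 J2 J3[unfolded append_Cons] J4 bi ai)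
  have id: "B + BB = (- 1) ^ p * (A + AA)"
    using jac_chain_identity[OF b a pr] unfolding B_def BB_def A_def AA_def by simp
  define DB where "DB = (\<Oplus>\<^bsub>M\<^esub>i\<in>{..<p}. ((- 1) ^ i * jac n (omit i b @ a)) \<odot>\<^bsub>M\<^esub> ?D (b ! i))"
  define DA where "DA = (\<Oplus>\<^bsub>M\<^esub>i\<in>{..<r}. ((- 1) ^ Suc i * jac n (b @ omit i a)) \<odot>\<^bsub>M\<^esub> ?D (a ! i))"
  have DBc: "DB \<in> carrier M" unfolding DB_def using m by (intro M.M.finsum_closed Pi_I sm_closed polys_mult polys_sign J1 mb_closed bi) auto
  have DAt: "(\<lambda>i. ((- 1) ^ Suc i * jac n (b @ omit i a)) \<odot>\<^bsub>M\<^esub> ?D (a ! i)) \<in> {..<r} \<rightarrow> carrier M"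
    using m by (intro Pi_I sm_closed polys_mult polys_sign J2 mb_closed ai) auto
  then have DAc: "DA \<in> carrier M" unfolding DA_def by (rule M.M.finsum_closed)
  \<comment> \<open>The twisted bracket adds \<open>modular (b ! i)\<close> acting on
    \<open>m\<close>; these terms form \<open>B\<close>.\<close>
  have "(\<Oplus>\<^bsub>M\<^esub>i\<in>{..<p}. signed M i (jac n (omit i b @ a) \<odot>\<^bsub>M\<^esub> mbracket N m (b ! i))) = DB \<oplus>\<^bsub>M\<^esub> B \<odot>\<^bsub>M\<^esub> m"
    unfolding DB_def B_def
  proof (rule split_sum[OF m])
    fix i assume i: "i < p"
    have Dc: "?D (b ! i) \<in> carrier M" using m i by (intro mb_closed bi)
    have mc: "modular (b ! i) \<in> polys n" using i bi by simp
    have J: "(- 1) ^ i * jac n (omit i b @ a) \<in> polys n" by (intro polys_mult polys_sign J1)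
    show "signed M i (jac n (omit i b @ a) \<odot>\<^bsub>M\<^esub> mbracket N m (b ! i)) =
      ((- 1) ^ i * jac n (omit i b @ a)) \<odot>\<^bsub>M\<^esub> ?D (b ! i) \<oplus>\<^bsub>M\<^esub> ((- 1) ^ i * jac n (omit i b @ a) * modular (b ! i)) \<odot>\<^bsub>M\<^esub> m"
      unfolding sm_signed[OF J1 N_bracket_closed[OF m bi[OF i]]]
      unfolding N_bracket[OF m bi[OF i]] sm_add_r[OF J Dc sm_closed[OF mc m]] sm_mult[OF J mc m] ..
    show "?D (b ! i) \<in> carrier M" by (rule Dc)
    show "(- 1) ^ i * jac n (omit i b @ a) \<in> polys n" by (rule J)
    show "(- 1) ^ i * jac n (omit i b @ a) * modular (b ! i) \<in> polys n" using J mc by (rule polys_mult)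
  qed
  moreover have "(\<Oplus>\<^bsub>M\<^esub>j\<in>{..<p}. \<Oplus>\<^bsub>M\<^esub>i\<in>{..<j}. signed M (i + j) (jac n ((br (b ! i) (b ! j) # omit i (omit j b)) @ a) \<odot>\<^bsub>M\<^esub> m)) = BB \<odot>\<^bsub>M\<^esub> m"
    unfolding BB_def by (rule double_sum[OF m J3])
  ultimately have L: "boundary_value m b a = DB \<oplus>\<^bsub>M\<^esub> (B + BB) \<odot>\<^bsub>M\<^esub> m"
    unfolding boundary_value_def len using DBc m pol by (simp add: sm_add_l sm_closed M.M.a_assoc)
  \<comment> \<open>Bracketing a Jacobian multiple of \<open>m\<close> also brackets the Jacobian
    with \<open>a ! i\<close>; these terms form \<open>A\<close>.\<close>
  have "(\<Oplus>\<^bsub>M\<^esub>i\<in>{..<r}. signed M (Suc i) (mbracket M (jac n (b @ omit i a) \<odot>\<^bsub>M\<^esub> m) (a ! i))) = DA \<oplus>\<^bsub>M\<^esub> A \<odot>\<^bsub>M\<^esub> m"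
    unfolding DA_def A_def
  proof (rule split_sum[OF m])
    fix i assume i: "i < r"
    have Dc: "?D (a ! i) \<in> carrier M" using m i by (intro mb_closed ai)
    have bc: "br (jac n (b @ omit i a)) (a ! i) \<in> polys n" using J2 i ai by simp
    have s: "(- 1) ^ Suc i \<in> polys n" by (rule polys_sign)
    show "signed M (Suc i) (mbracket M (jac n (b @ omit i a) \<odot>\<^bsub>M\<^esub> m) (a ! i)) =
      ((- 1) ^ Suc i * jac n (b @ omit i a)) \<odot>\<^bsub>M\<^esub> ?D (a ! i) \<oplus>\<^bsub>M\<^esub> ((- 1) ^ Suc i * br (jac n (b @ omit i a)) (a ! i)) \<odot>\<^bsub>M\<^esub> m"
      unfolding mb_action[OF m J2 ai[OF i]]
      unfolding sm_sign[OF M.M.add.m_closed[OF sm_closed[OF J2 Dc] sm_closed[OF bc m]]]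
        sm_add_r[OF s sm_closed[OF J2 Dc] sm_closed[OF bc m]] sm_mult[OF s J2 Dc] sm_mult[OF s bc m] ..
    show "?D (a ! i) \<in> carrier M" by (rule Dc)
    show "(- 1) ^ Suc i * jac n (b @ omit i a) \<in> polys n" using s J2 by (rule polys_mult)
    show "(- 1) ^ Suc i * br (jac n (b @ omit i a)) (a ! i) \<in> polys n" using s bc by (rule polys_mult)
  qed
  moreover have "(\<Oplus>\<^bsub>M\<^esub>j\<in>{..<r}. \<Oplus>\<^bsub>M\<^esub>i\<in>{..<j}. signed M (i + j) (jac n (b @ br (a ! i) (a ! j) # omit i (omit j a)) \<odot>\<^bsub>M\<^esub> m)) = AA \<odot>\<^bsub>M\<^esub> m"
    unfolding AA_def by (rule double_sum[OF m J4])
  ultimately have C: "coboundary_value m b a = DA \<oplus>\<^bsub>M\<^esub> (A + AA) \<odot>\<^bsub>M\<^esub> m"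
    unfolding coboundary_value_def len using DAc m pol by (simp add: sm_add_l sm_closed M.M.a_assoc)
  define c where "c = b @ a"
  have cl: "length c = Suc n" "set c \<subseteq> polys n" using len sub pr by (auto simp: c_def)
  have cJ: "jac n (omit i c) \<in> polys n" for i
    using cl set_omit[of i c] by (intro jac_closed) auto
  \<comment> \<open>The Laplace identity for \<open>b\<close> followed by \<open>a\<close>: its
    first \<open>p\<close> summands are \<open>DB\<close>, the remaining ones are \<open>DA\<close>
    up to sign.\<close>
  have "(\<Oplus>\<^bsub>M\<^esub>i\<in>{..<p + r}. ((- 1) ^ i * jac n (omit i c)) \<odot>\<^bsub>M\<^esub> ?D (c ! i)) = \<zero>\<^bsub>M\<^esub>"
    unfolding pr by (rule jac_laplace_module[OF cl mb_derivation[OF m]])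
  moreover have "(\<Oplus>\<^bsub>M\<^esub>i\<in>{..<p + r}. ((- 1) ^ i * jac n (omit i c)) \<odot>\<^bsub>M\<^esub> ?D (c ! i)) =
    (\<Oplus>\<^bsub>M\<^esub>i\<in>{..<p}. ((- 1) ^ i * jac n (omit i c)) \<odot>\<^bsub>M\<^esub> ?D (c ! i)) \<oplus>\<^bsub>M\<^esub>
    (\<Oplus>\<^bsub>M\<^esub>i\<in>{..<r}. ((- 1) ^ (p + i) * jac n (omit (p + i) c)) \<odot>\<^bsub>M\<^esub> ?D (c ! (p + i)))"
    using cl m pr by (intro M.M.finsum_lessThan_add sm_closed polys_mult polys_sign cJ mb_closed) (auto simp: subset_iff)
  moreover have "(\<Oplus>\<^bsub>M\<^esub>i\<in>{..<p}. ((- 1) ^ i * jac n (omit i c)) \<odot>\<^bsub>M\<^esub> ?D (c ! i)) = DB"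
    unfolding DB_def
  proof (rule M.M.finsum_cong')
    show "(\<lambda>i. ((- 1) ^ i * jac n (omit i b @ a)) \<odot>\<^bsub>M\<^esub> ?D (b ! i)) \<in> {..<p} \<rightarrow> carrier M"
      using m by (intro Pi_I sm_closed polys_mult polys_sign J1 mb_closed bi) auto
  qed (auto simp: c_def omit_append len nth_append)
  moreover have "(\<Oplus>\<^bsub>M\<^esub>i\<in>{..<r}. ((- 1) ^ (p + i) * jac n (omit (p + i) c)) \<odot>\<^bsub>M\<^esub> ?D (c ! (p + i))) =
    (\<Oplus>\<^bsub>M\<^esub>i\<in>{..<r}. (- ((- 1) ^ p)) \<odot>\<^bsub>M\<^esub> (((- 1) ^ Suc i * jac n (b @ omit i a)) \<odot>\<^bsub>M\<^esub> ?D (a ! i)))"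
  proof (rule M.M.finsum_cong')
    show "(\<lambda>i. (- ((- 1) ^ p)) \<odot>\<^bsub>M\<^esub> (((- 1) ^ Suc i * jac n (b @ omit i a)) \<odot>\<^bsub>M\<^esub> ?D (a ! i))) \<in> {..<r} \<rightarrow> carrier M"
      using m by (intro Pi_I sm_closed polys_mult polys_sign polys_uminus J2 mb_closed ai) auto
    fix i assume "i \<in> {..<r}"
    then have Dc: "?D (a ! i) \<in> carrier M" using m by (intro mb_closed ai) auto
    have "omit (p + i) c = b @ omit i a" "c ! (p + i) = a ! i"
      using omit_append(2)[of b i a] len by (simp_all add: c_def nth_append)
    \<comment> \<open>The factor is -(-1)^p because \<open>DA\<close> carries the exponent
      \<open>Suc i\<close> of the coboundary instead of \<open>i\<close>.\<close>
    moreover have "(- 1) ^ (p + i) * jac n (b @ omit i a) = - ((- 1) ^ p) * ((- 1) ^ Suc i * jac n (b @ omit i a))"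
      by (simp add: power_add)
    ultimately show "((- 1) ^ (p + i) * jac n (omit (p + i) c)) \<odot>\<^bsub>M\<^esub> ?D (c ! (p + i)) =
      (- ((- 1) ^ p)) \<odot>\<^bsub>M\<^esub> (((- 1) ^ Suc i * jac n (b @ omit i a)) \<odot>\<^bsub>M\<^esub> ?D (a ! i))"
      using sm_mult[OF polys_uminus[OF polys_sign] polys_mult[OF polys_sign J2] Dc] by (simp only:)
  qed simp
  moreover have "\<dots> = (- ((- 1) ^ p)) \<odot>\<^bsub>M\<^esub> DA"
    unfolding DA_def by (intro sm_finsum[symmetric] DAt polys_uminus polys_sign) simp
  moreover have "(- ((- 1) ^ p)) \<odot>\<^bsub>M\<^esub> DA = \<ominus>\<^bsub>M\<^esub> ((- 1) ^ p \<odot>\<^bsub>M\<^esub> DA)"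
    by (rule sm_uminus[OF polys_sign DAc])
  ultimately have "DB \<oplus>\<^bsub>M\<^esub> \<ominus>\<^bsub>M\<^esub> ((- 1) ^ p \<odot>\<^bsub>M\<^esub> DA) = \<zero>\<^bsub>M\<^esub>"
    by (simp only:)
  then have DBA: "DB = (- 1) ^ p \<odot>\<^bsub>M\<^esub> DA"
    using M.diff_eq_zero_iff[OF DBc sm_closed[OF polys_sign DAc]] by (simp only: M.M.minus_eq)
  have AAc: "(A + AA) \<odot>\<^bsub>M\<^esub> m \<in> carrier M" using pol m by (intro sm_closed) auto
  show ?thesis
    unfolding L C DBA id
    unfolding sm_sign[OF M.M.add.m_closed[OF DAc AAc]] sm_add_r[OF polys_sign DAc AAc]
      sm_mult[OF polys_sign polys_add[OF pol(3,4)] m] ..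
qed

end

lemma (in abelian_group) finsum_add_cong:
  assumes "\<And>i. i \<in> A \<Longrightarrow> f i \<in> carrier G" "\<And>i. i \<in> A \<Longrightarrow> g i \<in> carrier G"
    and "\<And>i. i \<in> A \<Longrightarrow> h i = f i \<oplus> g i"
  shows "(\<Oplus>i\<in>A. h i) = (\<Oplus>i\<in>A. f i) \<oplus> (\<Oplus>i\<in>A. g i)"
proof -
  have "(\<Oplus>i\<in>A. h i) = (\<Oplus>i\<in>A. f i \<oplus> g i)"
    by (rule finsum_cong'[OF refl]) (simp_all add: assms)
  also have "\<dots> = (\<Oplus>i\<in>A. f i) \<oplus> (\<Oplus>i\<in>A. g i)"
    by (rule finsum_addf) (simp_all add: assms)
  finally show ?thesis .
qed

section \<open>The boundary formula on elementary chains and the coboundary at a single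
  tuple\<close>

context poly_poisson_module begin

text \<open>The value that \<open>boundary\<close> must take on the elementary chain of
  \<open>m\<close> and \<open>b\<close>, written over the untwisted tensor module. For
  \<open>p = 0\<close> the degree \<open>p - 1\<close> is again 0 and both sums are empty.\<close>

definition bform :: "nat \<Rightarrow> 'm \<Rightarrow> 'k mpoly list \<Rightarrow> ('k mpoly, 'm) chain"
  where "bform p m b =
    (\<Oplus>\<^bsub>\<T> (p - 1)\<^esub>i\<in>{..<p}. signed (\<T> (p - 1)) i (elem_chain K R M (mbracket N m (b ! i)) (omit i b))) \<oplus>\<^bsub>\<T> (p - 1)\<^esub>
    (\<Oplus>\<^bsub>\<T> (p - 1)\<^esub>j\<in>{..<p}. \<Oplus>\<^bsub>\<T> (p - 1)\<^esub>i\<in>{..<j}. signed (\<T> (p - 1)) (i + j)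
      (elem_chain K R M m (br (b ! i) (b ! j) # omit i (omit j b))))"

lemma bracket_omit_tuples:
  assumes "b \<in> tuples (Suc q) (polys n)" "i < j" "j < Suc q"
  shows "br (b ! i) (b ! j) # omit i (omit j b) \<in> tuples q (polys n)"
proof -
  have "b ! i \<in> polys n" "b ! j \<in> polys n" using assms by (auto intro!: tuples_nth)
  moreover have "set (omit i (omit j b)) \<subseteq> polys n" "length b = Suc q"
    using assms set_omit2[of i j b] by (auto simp: tuples_def)
  ultimately show ?thesis using assms by (simp add: tuples_def)
qed

lemma
  assumes m: "m \<in> carrier M" and b: "b \<in> tuples p (polys n)" and p: "0 < p"
  shows bform_summand1: "i < p \<Longrightarrow> elem_chain K R M (mbracket N m (b ! i)) (omit i b) \<in> carrier (\<T> (p - 1))"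
    and bform_summand2: "\<lbrakk>i < j; j < p\<rbrakk> \<Longrightarrow> elem_chain K R M m (br (b ! i) (b ! j) # omit i (omit j b)) \<in> carrier (\<T> (p - 1))"
proof -
  have b': "b \<in> tuples (Suc (p - 1)) (polys n)" using b p by simp
  show "elem_chain K R M (mbracket N m (b ! i)) (omit i b) \<in> carrier (\<T> (p - 1))" if "i < p"
    using that p by (intro elem_closed N_bracket_closed m tuples_nth[OF b] omit_tuples[OF b']) auto
  show "elem_chain K R M m (br (b ! i) (b ! j) # omit i (omit j b)) \<in> carrier (\<T> (p - 1))" if "i < j" "j < p"
    using that p by (intro elem_closed m bracket_omit_tuples[OF b']) auto
qed

lemma bform_0:
  assumes "m \<in> carrier M"
  shows "bform 0 m b = \<zero>\<^bsub>\<T> 0\<^esub>"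
proof -
  interpret T: abelian_group "\<T> 0" by (rule T_abelian)
  show ?thesis by (simp add: bform_def)
qed

lemma bform_closed:
  assumes m: "m \<in> carrier M" and b: "b \<in> tuples p (polys n)"
  shows "bform p m b \<in> carrier (\<T> (p - 1))"
proof (cases "p = 0")
  case True
  then show ?thesis using bform_0[OF m] abelian_groupE(2)[OF T_abelian, of 0] by simp
next
  case False
  interpret T: abelian_group "\<T> (p - 1)" by (rule T_abelian)
  from False show ?thesis
    unfolding bform_def using bform_summand1[OF m b] bform_summand2[OF m b]
    by (intro T.add.m_closed T.finsum_closed Pi_I T.signed_closed) auto
qed

lemma psi_bform:
  assumes m: "m \<in> carrier M" and b: "b \<in> tuples p (polys n)" and p: "0 < p" and a: "set a \<subseteq> polys n"
  shows "psi (p - 1) a (bform p m b) = boundary_value m b a"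
proof -
  interpret T: abelian_group "\<T> (p - 1)" by (rule T_abelian)
  interpret ps: additive_map "\<T> (p - 1)" M "psi (p - 1) a" by (rule psi_additive[OF a])
  have b': "b \<in> tuples (Suc (p - 1)) (polys n)" using b p by simp
  have len: "length b = p" using b by (simp add: tuples_def)
  note s1 = bform_summand1[OF m b p] and s2 = bform_summand2[OF m b p]
  have c1: "(\<lambda>i. signed (\<T> (p - 1)) i (elem_chain K R M (mbracket N m (b ! i)) (omit i b))) \<in> {..<p} \<rightarrow> carrier (\<T> (p - 1))"
    by (intro Pi_I T.signed_closed s1) simp
  have c2: "(\<lambda>i. signed (\<T> (p - 1)) (i + j) (elem_chain K R M m (br (b ! i) (b ! j) # omit i (omit j b)))) \<in> {..<j} \<rightarrow> carrier (\<T> (p - 1))"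
    if "j < p" for j
    using that by (intro Pi_I T.signed_closed s2) simp_all
  have c3: "(\<lambda>j. \<Oplus>\<^bsub>\<T> (p - 1)\<^esub>i\<in>{..<j}. signed (\<T> (p - 1)) (i + j)
      (elem_chain K R M m (br (b ! i) (b ! j) # omit i (omit j b)))) \<in> {..<p} \<rightarrow> carrier (\<T> (p - 1))"
    using c2 by (intro Pi_I T.finsum_closed) auto
  have v1: "psi (p - 1) a (signed (\<T> (p - 1)) i (elem_chain K R M (mbracket N m (b ! i)) (omit i b))) =
      signed M i (jac n (omit i b @ a) \<odot>\<^bsub>M\<^esub> mbracket N m (b ! i))" if "i < p" for i
    unfolding ps.signed[OF s1[OF that]]
    using psi_elem[OF a N_bracket_closed[OF m tuples_nth[OF b that]] omit_tuples[OF b', of i]] that p by simp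
  have v2: "psi (p - 1) a (signed (\<T> (p - 1)) (i + j) (elem_chain K R M m (br (b ! i) (b ! j) # omit i (omit j b)))) =
      signed M (i + j) (jac n ((br (b ! i) (b ! j) # omit i (omit j b)) @ a) \<odot>\<^bsub>M\<^esub> m)" if "i < j" "j < p" for i j
    unfolding ps.signed[OF s2[OF that]]
    using psi_elem[OF a m bracket_omit_tuples[OF b' that(1)]] that p by simp
  have d2: "signed M (i + j) (jac n ((br (b ! i) (b ! j) # omit i (omit j b)) @ a) \<odot>\<^bsub>M\<^esub> m) \<in> carrier M" if "i < j" "j < p" for i j
    using v2[OF that] ps.closed[OF T.signed_closed[OF s2[OF that]], of "i + j"] by simp
  have d1: "signed M i (jac n (omit i b @ a) \<odot>\<^bsub>M\<^esub> mbracket N m (b ! i)) \<in> carrier M" if "i < p" for i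
    using v1[OF that] ps.closed[OF T.signed_closed[OF s1[OF that]], of i] by simp
  have "psi (p - 1) a (bform p m b) =
    (\<Oplus>\<^bsub>M\<^esub>i\<in>{..<p}. psi (p - 1) a (signed (\<T> (p - 1)) i (elem_chain K R M (mbracket N m (b ! i)) (omit i b)))) \<oplus>\<^bsub>M\<^esub>
    (\<Oplus>\<^bsub>M\<^esub>j\<in>{..<p}. psi (p - 1) a (\<Oplus>\<^bsub>\<T> (p - 1)\<^esub>i\<in>{..<j}. signed (\<T> (p - 1)) (i + j)
      (elem_chain K R M m (br (b ! i) (b ! j) # omit i (omit j b)))))"
    unfolding bform_def using c1 c3
    by (subst ps.add) (simp_all add: T.finsum_closed ps.finsum del: One_nat_def)
  also have "(\<Oplus>\<^bsub>M\<^esub>i\<in>{..<p}. psi (p - 1) a (signed (\<T> (p - 1)) i (elem_chain K R M (mbracket N m (b ! i)) (omit i b)))) =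
    (\<Oplus>\<^bsub>M\<^esub>i\<in>{..<p}. signed M i (jac n (omit i b @ a) \<odot>\<^bsub>M\<^esub> mbracket N m (b ! i)))"
    using v1 d1 by (intro M.M.finsum_cong' Pi_I) simp_all
  also have "(\<Oplus>\<^bsub>M\<^esub>j\<in>{..<p}. psi (p - 1) a (\<Oplus>\<^bsub>\<T> (p - 1)\<^esub>i\<in>{..<j}. signed (\<T> (p - 1)) (i + j)
      (elem_chain K R M m (br (b ! i) (b ! j) # omit i (omit j b))))) =
    (\<Oplus>\<^bsub>M\<^esub>j\<in>{..<p}. \<Oplus>\<^bsub>M\<^esub>i\<in>{..<j}. signed M (i + j) (jac n ((br (b ! i) (b ! j) # omit i (omit j b)) @ a) \<odot>\<^bsub>M\<^esub> m))"
  proof (rule M.M.finsum_cong')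
    show "(\<lambda>j. \<Oplus>\<^bsub>M\<^esub>i\<in>{..<j}. signed M (i + j) (jac n ((br (b ! i) (b ! j) # omit i (omit j b)) @ a) \<odot>\<^bsub>M\<^esub> m)) \<in> {..<p} \<rightarrow> carrier M"
      using d2 by (intro Pi_I M.M.finsum_closed) simp
    fix j assume j: "j \<in> {..<p}"
    show "psi (p - 1) a (\<Oplus>\<^bsub>\<T> (p - 1)\<^esub>i\<in>{..<j}. signed (\<T> (p - 1)) (i + j)
      (elem_chain K R M m (br (b ! i) (b ! j) # omit i (omit j b)))) =
      (\<Oplus>\<^bsub>M\<^esub>i\<in>{..<j}. signed M (i + j) (jac n ((br (b ! i) (b ! j) # omit i (omit j b)) @ a) \<odot>\<^bsub>M\<^esub> m))"
      using j c2[of j] v2 d2 by (subst ps.finsum) (auto intro!: M.M.finsum_cong' simp del: append_Cons)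
  qed simp
  finally show ?thesis unfolding boundary_value_def len .
qed

lemma coboundary_eq:
  "a \<in> tuples (Suc q) (polys n) \<Longrightarrow> coboundary R M q F a =
     (\<Oplus>\<^bsub>M\<^esub>i\<in>{..<Suc q}. signed M (Suc i) (mbracket M (F (omit i a)) (a ! i))) \<oplus>\<^bsub>M\<^esub>
     (\<Oplus>\<^bsub>M\<^esub>j\<in>{..<Suc q}. \<Oplus>\<^bsub>M\<^esub>i\<in>{..<j}. signed M (i + j) (F (br (a ! i) (a ! j) # omit i (omit j a))))"
  by (simp add: coboundary_def)

context
  fixes a :: "'k mpoly list" and q :: nat
  assumes a: "a \<in> tuples (Suc q) (polys n)"
begin

lemma coboundary_summand1:
  assumes "\<And>as. as \<in> tuples q (polys n) \<Longrightarrow> F as \<in> carrier M" "i < Suc q"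
  shows "signed M (Suc i) (mbracket M (F (omit i a)) (a ! i)) \<in> carrier M"
  using assms by (intro M.M.signed_closed mb_closed assms(1) omit_tuples[OF a] tuples_nth[OF a])

lemma coboundary_summand2:
  assumes "\<And>as. as \<in> tuples q (polys n) \<Longrightarrow> F as \<in> carrier M" "i < j" "j < Suc q"
  shows "signed M (i + j) (F (br (a ! i) (a ! j) # omit i (omit j a))) \<in> carrier M"
  using assms by (intro M.M.signed_closed assms(1) bracket_omit_tuples[OF a])

lemma coboundary_closed:
  assumes F: "\<And>as. as \<in> tuples q (polys n) \<Longrightarrow> F as \<in> carrier M"
  shows "coboundary R M q F a \<in> carrier M"
  unfolding coboundary_eq[OF a] using coboundary_summand1[where F = F, OF F] coboundary_summand2[where F = F, OF F]
  by (intro M.M.add.m_closed M.M.finsum_closed Pi_I) auto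

text \<open>Stated at a single tuple and for \<open>M\<close>-valued functions, since the coboundary
  enters only through its values, which are compared with paired boundaries.\<close>

lemma coboundary_add:
  assumes F: "\<And>as. as \<in> tuples q (polys n) \<Longrightarrow> F as \<in> carrier M"
    and G: "\<And>as. as \<in> tuples q (polys n) \<Longrightarrow> G as \<in> carrier M"
    and H: "\<And>as. as \<in> tuples q (polys n) \<Longrightarrow> H as = F as \<oplus>\<^bsub>M\<^esub> G as"
  shows "coboundary R M q H a = coboundary R M q F a \<oplus>\<^bsub>M\<^esub> coboundary R M q G a"
proof -
  note f1 = coboundary_summand1[where F = F, OF F] and g1 = coboundary_summand1[where F = G, OF G]
    and f2 = coboundary_summand2[where F = F, OF F] and g2 = coboundary_summand2[where F = G, OF G]
  have s: "signed M i (x \<oplus>\<^bsub>M\<^esub> y) = signed M i x \<oplus>\<^bsub>M\<^esub> signed M i y" if "x \<in> carrier M" "y \<in> carrier M" for i x y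
    using that by (simp add: sm_sign sm_add_r)
  have t1: "signed M (Suc i) (mbracket M (H (omit i a)) (a ! i)) =
      signed M (Suc i) (mbracket M (F (omit i a)) (a ! i)) \<oplus>\<^bsub>M\<^esub> signed M (Suc i) (mbracket M (G (omit i a)) (a ! i))" if "i < Suc q" for i
    using F G omit_tuples[OF a that] tuples_nth[OF a that] by (simp add: H mb_add_l s mb_closed)
  have t2: "signed M (i + j) (H (br (a ! i) (a ! j) # omit i (omit j a))) =
      signed M (i + j) (F (br (a ! i) (a ! j) # omit i (omit j a))) \<oplus>\<^bsub>M\<^esub> signed M (i + j) (G (br (a ! i) (a ! j) # omit i (omit j a)))"
    if "i < j" "j < Suc q" for i j
    using F G bracket_omit_tuples[OF a that] by (simp add: H s)
  have 1: "(\<Oplus>\<^bsub>M\<^esub>i\<in>{..<Suc q}. signed M (Suc i) (mbracket M (H (omit i a)) (a ! i))) =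
    (\<Oplus>\<^bsub>M\<^esub>i\<in>{..<Suc q}. signed M (Suc i) (mbracket M (F (omit i a)) (a ! i))) \<oplus>\<^bsub>M\<^esub>
    (\<Oplus>\<^bsub>M\<^esub>i\<in>{..<Suc q}. signed M (Suc i) (mbracket M (G (omit i a)) (a ! i)))"
    using f1 g1 t1 by (intro M.M.finsum_add_cong) (simp_all del: M.M.finsum_addf)
  have 2: "(\<Oplus>\<^bsub>M\<^esub>i\<in>{..<j}. signed M (i + j) (H (br (a ! i) (a ! j) # omit i (omit j a)))) =
    (\<Oplus>\<^bsub>M\<^esub>i\<in>{..<j}. signed M (i + j) (F (br (a ! i) (a ! j) # omit i (omit j a)))) \<oplus>\<^bsub>M\<^esub>
    (\<Oplus>\<^bsub>M\<^esub>i\<in>{..<j}. signed M (i + j) (G (br (a ! i) (a ! j) # omit i (omit j a))))" if "j < Suc q" for j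
    using f2 g2 t2 that by (intro M.M.finsum_add_cong) (simp_all del: M.M.finsum_addf)
  have 3: "(\<Oplus>\<^bsub>M\<^esub>j\<in>{..<Suc q}. \<Oplus>\<^bsub>M\<^esub>i\<in>{..<j}. signed M (i + j) (H (br (a ! i) (a ! j) # omit i (omit j a)))) =
    (\<Oplus>\<^bsub>M\<^esub>j\<in>{..<Suc q}. \<Oplus>\<^bsub>M\<^esub>i\<in>{..<j}. signed M (i + j) (F (br (a ! i) (a ! j) # omit i (omit j a)))) \<oplus>\<^bsub>M\<^esub>
    (\<Oplus>\<^bsub>M\<^esub>j\<in>{..<Suc q}. \<Oplus>\<^bsub>M\<^esub>i\<in>{..<j}. signed M (i + j) (G (br (a ! i) (a ! j) # omit i (omit j a))))"
    by (intro M.M.finsum_add_cong M.M.finsum_closed Pi_I 2 f2 g2) simp_all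
  have c: "(\<Oplus>\<^bsub>M\<^esub>i\<in>{..<Suc q}. signed M (Suc i) (mbracket M (F (omit i a)) (a ! i))) \<in> carrier M"
    "(\<Oplus>\<^bsub>M\<^esub>i\<in>{..<Suc q}. signed M (Suc i) (mbracket M (G (omit i a)) (a ! i))) \<in> carrier M"
    "(\<Oplus>\<^bsub>M\<^esub>j\<in>{..<Suc q}. \<Oplus>\<^bsub>M\<^esub>i\<in>{..<j}. signed M (i + j) (F (br (a ! i) (a ! j) # omit i (omit j a)))) \<in> carrier M"
    "(\<Oplus>\<^bsub>M\<^esub>j\<in>{..<Suc q}. \<Oplus>\<^bsub>M\<^esub>i\<in>{..<j}. signed M (i + j) (G (br (a ! i) (a ! j) # omit i (omit j a)))) \<in> carrier M"
    using f1 f2 g1 g2 by (intro M.M.finsum_closed Pi_I; simp)+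
  show ?thesis
    unfolding coboundary_eq[OF a] 1 3 using c by (simp only: M.M.a_ac M.M.add.m_closed)
qed

lemma coboundary_smult:
  assumes F: "\<And>as. as \<in> tuples q (polys n) \<Longrightarrow> F as \<in> carrier M"
    and H: "\<And>as. as \<in> tuples q (polys n) \<Longrightarrow> H as = mmonom 0 c \<odot>\<^bsub>M\<^esub> F as"
  shows "coboundary R M q H a = mmonom 0 c \<odot>\<^bsub>M\<^esub> coboundary R M q F a"
proof -
  note f1 = coboundary_summand1[where F = F, OF F] and f2 = coboundary_summand2[where F = F, OF F]
  have s: "signed M i (mmonom 0 c \<odot>\<^bsub>M\<^esub> x) = mmonom 0 c \<odot>\<^bsub>M\<^esub> signed M i x" if "x \<in> carrier M" for i x
    using that by (simp add: sm_sign sm_closed sm_mult[symmetric] mult.commute)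
  have t1: "signed M (Suc i) (mbracket M (H (omit i a)) (a ! i)) =
      mmonom 0 c \<odot>\<^bsub>M\<^esub> signed M (Suc i) (mbracket M (F (omit i a)) (a ! i))" if "i < Suc q" for i
    using F omit_tuples[OF a that] tuples_nth[OF a that] by (simp add: H mb_smult_l s mb_closed)
  have t2: "signed M (i + j) (H (br (a ! i) (a ! j) # omit i (omit j a))) =
      mmonom 0 c \<odot>\<^bsub>M\<^esub> signed M (i + j) (F (br (a ! i) (a ! j) # omit i (omit j a)))" if "i < j" "j < Suc q" for i j
    using F bracket_omit_tuples[OF a that] by (simp add: H s)
  have c: "(\<Oplus>\<^bsub>M\<^esub>i\<in>{..<Suc q}. signed M (Suc i) (mbracket M (F (omit i a)) (a ! i))) \<in> carrier M"
    "(\<Oplus>\<^bsub>M\<^esub>j\<in>{..<Suc q}. \<Oplus>\<^bsub>M\<^esub>i\<in>{..<j}. signed M (i + j) (F (br (a ! i) (a ! j) # omit i (omit j a)))) \<in> carrier M"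
    using f1 f2 by (intro M.M.finsum_closed Pi_I; simp)+
  have 1: "(\<Oplus>\<^bsub>M\<^esub>i\<in>{..<Suc q}. signed M (Suc i) (mbracket M (H (omit i a)) (a ! i))) =
    mmonom 0 c \<odot>\<^bsub>M\<^esub> (\<Oplus>\<^bsub>M\<^esub>i\<in>{..<Suc q}. signed M (Suc i) (mbracket M (F (omit i a)) (a ! i)))"
    using f1 t1 by (subst sm_finsum) (auto intro!: M.M.finsum_cong' sm_closed)
  have 2: "(\<Oplus>\<^bsub>M\<^esub>i\<in>{..<j}. signed M (i + j) (H (br (a ! i) (a ! j) # omit i (omit j a)))) =
    mmonom 0 c \<odot>\<^bsub>M\<^esub> (\<Oplus>\<^bsub>M\<^esub>i\<in>{..<j}. signed M (i + j) (F (br (a ! i) (a ! j) # omit i (omit j a))))" if "j < Suc q" for j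
    using f2 t2 that by (subst sm_finsum) (auto intro!: M.M.finsum_cong' sm_closed)
  have 3: "(\<Oplus>\<^bsub>M\<^esub>j\<in>{..<Suc q}. \<Oplus>\<^bsub>M\<^esub>i\<in>{..<j}. signed M (i + j) (H (br (a ! i) (a ! j) # omit i (omit j a)))) =
    mmonom 0 c \<odot>\<^bsub>M\<^esub> (\<Oplus>\<^bsub>M\<^esub>j\<in>{..<Suc q}. \<Oplus>\<^bsub>M\<^esub>i\<in>{..<j}. signed M (i + j) (F (br (a ! i) (a ! j) # omit i (omit j a))))"
    using f2 2 by (subst sm_finsum) (auto intro!: M.M.finsum_cong' sm_closed M.M.finsum_closed)
  show ?thesis unfolding coboundary_eq[OF a] 1 3 using c by (simp only: sm_add_r polys_const)
qed

lemma coboundary_Psi_elem: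
  assumes m: "m \<in> carrier M" and b: "b \<in> tuples p (polys n)" and q: "q = n - p"
  shows "coboundary R M q (Psi p (elem_chain K R M m b)) a = coboundary_value m b a"
proof -
  have len: "length a = Suc q" using a by (simp add: tuples_def)
  have cl: "Psi p (elem_chain K R M m b) as \<in> carrier M" if "as \<in> tuples q (polys n)" for as
    using Psi_closed[OF elem_closed[OF m b]] that q by simp
  note f1 = coboundary_summand1[where F = "Psi p (elem_chain K R M m b)", OF cl]
    and f2 = coboundary_summand2[where F = "Psi p (elem_chain K R M m b)", OF cl]
  note v1 = Psi_elem[OF m b, folded q, OF omit_tuples[OF a]]
    and v2 = Psi_elem[OF m b, folded q, OF bracket_omit_tuples[OF a]]
  show ?thesis
    unfolding coboundary_eq[OF a] coboundary_value_def len
    using f1 f2 v1 v2 by (intro arg_cong2[where f = "add M"] M.M.finsum_cong' Pi_I M.M.finsum_closed refl) auto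
qed

end

end

lemma restrict_scalars_abelian:
  assumes "abelian_group V"
  shows "abelian_group (restrict_scalars R V)"
proof -
  interpret V: abelian_group V by (rule assms)
  show ?thesis
    by (rule abelian_groupI) (auto simp: V.a_assoc V.a_comm V.a_lcomm intro: V.l_neg V.a_inv_closed)
qed

section \<open>Existence and uniqueness of the boundary map, and its comparison with the
  coboundary\<close>

context poly_poisson_module begin

lemma Theta_cong:
  assumes F: "\<And>as. as \<in> tuples (n - p) (polys n) \<Longrightarrow> F as \<in> carrier M" and p: "p \<le> n"
    and H: "\<And>as. as \<in> tuples (n - p) (polys n) \<Longrightarrow> H as = F as"
  shows "Theta p H = Theta p F"
proof -
  interpret T: abelian_group "\<T> p" by (rule T_abelian)
  show ?thesis
    unfolding Theta_def
    by (rule T.finsum_cong'[OF refl]) (simp_all add: H[OF compl_tuples[OF _ p]] Theta_summand[where F = F, OF F p])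
qed

lemma scalar_T: "scalar R (\<T> p) c x = mmonom 0 c \<odot>\<^bsub>\<T> p\<^esub> x"
  by (rule poly_module.scalar_eq[OF T_poly_module])

text \<open>The condition that defines \<open>boundary\<close>, with the twist removed from the
  chain modules and the prescribed values abbreviated by \<open>bform\<close>.\<close>

definition is_boundary :: "nat \<Rightarrow> (('k mpoly, 'm) chain \<Rightarrow> ('k mpoly, 'm) chain) \<Rightarrow> bool"
  where "is_boundary p h \<longleftrightarrow>
    h \<in> lin_hom K (restrict_scalars R (\<T> p)) (restrict_scalars R (\<T> (p - 1))) \<and>
    h \<in> extensional (carrier (\<T> p)) \<and>
    (\<forall>m\<in>carrier M. \<forall>b\<in>tuples p (polys n). h (elem_chain K R M m b) = bform p m b)"

lemma boundary_eq: "boundary K R N p = (THE h. is_boundary p h)"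
  unfolding boundary_def is_boundary_def bform_def
  by (simp only: chains_twist elem_chain_twist restrict_scalars_simps restrict_scalars_finsum
      restrict_scalars_signed R_simps twist_simps(1))

lemma elem_chain_var_list: "I \<in> subsets n p \<Longrightarrow> (var_list I :: 'k mpoly list) \<in> tuples p (polys n)"
  using var_list_tuples[of I n] by (auto simp: subsets_def)

lemma
  assumes "is_boundary p h"
  shows is_boundary_add: "\<lbrakk>x \<in> carrier (\<T> p); y \<in> carrier (\<T> p)\<rbrakk> \<Longrightarrow> h (x \<oplus>\<^bsub>\<T> p\<^esub> y) = h x \<oplus>\<^bsub>\<T> (p - 1)\<^esub> h y"
    and is_boundary_closed: "x \<in> carrier (\<T> p) \<Longrightarrow> h x \<in> carrier (\<T> (p - 1))"
    and is_boundary_zero: "h \<zero>\<^bsub>\<T> p\<^esub> = \<zero>\<^bsub>\<T> (p - 1)\<^esub>"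
    and is_boundary_elem: "\<lbrakk>m \<in> carrier M; b \<in> tuples p (polys n)\<rbrakk> \<Longrightarrow> h (elem_chain K R M m b) = bform p m b"
proof -
  have hom: "h \<in> lin_hom K (restrict_scalars R (\<T> p)) (restrict_scalars R (\<T> (p - 1)))"
    using assms by (simp add: is_boundary_def)
  show "h (x \<oplus>\<^bsub>\<T> p\<^esub> y) = h x \<oplus>\<^bsub>\<T> (p - 1)\<^esub> h y" if "x \<in> carrier (\<T> p)" "y \<in> carrier (\<T> p)"
    using lin_hom_add[OF hom] that by simp
  show "h x \<in> carrier (\<T> (p - 1))" if "x \<in> carrier (\<T> p)"
    using lin_hom_closed[OF hom] that by simp
  show "h \<zero>\<^bsub>\<T> p\<^esub> = \<zero>\<^bsub>\<T> (p - 1)\<^esub>"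
    using additive_map.zero[OF lin_hom_additive_map[OF hom restrict_scalars_abelian[OF T_abelian] restrict_scalars_abelian[OF T_abelian]]]
    by simp
  show "h (elem_chain K R M m b) = bform p m b" if "m \<in> carrier M" "b \<in> tuples p (polys n)"
    using assms that by (simp add: is_boundary_def)
qed

lemma is_boundary_unique:
  assumes h: "is_boundary p h" and h': "is_boundary p h'"
  shows "h = h'"
proof (rule extensionalityI)
  show "h \<in> extensional (carrier (\<T> p))" "h' \<in> extensional (carrier (\<T> p))"
    using h h' by (simp_all add: is_boundary_def)
  fix x assume "x \<in> carrier (\<T> p)"
  then show "h x = h' x"
  proof (induction rule: chain_induct)
    case zero
    show ?case by (simp only: is_boundary_zero[OF h] is_boundary_zero[OF h'])
  next
    case (add x y)
    then show ?case by (simp only: is_boundary_add[OF h] is_boundary_add[OF h'])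
  next
    case (pure m I)
    then show ?case
      by (simp only: pure_dx is_boundary_elem[OF h] is_boundary_elem[OF h'] elem_chain_var_list)
  qed
qed

text \<open>In degree 0 the sums are empty, and above degree n + 1 the target is zero. The delicate
  degree is n + 1, where chains vanish but the target need not: there the formula is paired with the
  empty tuple and compared with a coboundary value that has no summands.\<close>

lemma bform_vanishes:
  assumes m: "m \<in> carrier M" and b: "b \<in> tuples p (polys n)" and p: "p = 0 \<or> n < p"
  shows "bform p m b = \<zero>\<^bsub>\<T> (p - 1)\<^esub>"
proof (cases "p = 0")
  case True
  then show ?thesis using bform_0[OF m] by simp
next
  case False
  then have np: "n \<le> p - 1" "0 < p" using p by auto
  show ?thesis
  proof (cases "p = Suc n")
    case True
    have "bform p m b = \<zero>\<^bsub>\<T> n\<^esub>"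
    proof (rule Psi_inj)
      show "bform p m b \<in> carrier (\<T> n)" using bform_closed[OF m b] True by simp
      show "\<zero>\<^bsub>\<T> n\<^esub> \<in> carrier (\<T> n)" by (rule abelian_groupE(2)[OF T_abelian])
      fix as :: "'k mpoly list" assume "as \<in> tuples (n - n) (polys n)"
      then have as: "as = []" by (simp add: tuples_def)
      have "psi n [] (bform p m b) = boundary_value m b []"
        using psi_bform[OF m b np(2), of "[]"] True by simp
      also have "\<dots> = signed M p (coboundary_value m b [])"
        by (rule boundary_value_eq_coboundary_value[OF m b, of _ 0]) (simp_all add: True tuples_def)
      also have "\<dots> = \<zero>\<^bsub>M\<^esub>"
        by (simp add: coboundary_value_def signed_def M.M.uminus_zero)
      also have "\<dots> = psi n [] \<zero>\<^bsub>\<T> n\<^esub>"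
        using additive_map.zero[OF psi_additive[of "[]" n]] by simp
      finally show "psi n as (bform p m b) = psi n as \<zero>\<^bsub>\<T> n\<^esub>" by (simp add: as)
    qed simp
    then show ?thesis by (simp add: True)
  next
    case False
    then have "n < p - 1" using np p by auto
    then show ?thesis by (rule chain_zero[OF _ bform_closed[OF m b]])
  qed
qed

lemma
  assumes x: "x \<in> carrier (\<T> p)" and a: "a \<in> tuples (Suc (n - p)) (polys n)"
  shows coboundary_Psi_closed: "coboundary R M (n - p) (Psi p x) a \<in> carrier M"
    and coboundary_Psi_add: "y \<in> carrier (\<T> p) \<Longrightarrow> coboundary R M (n - p) (Psi p (x \<oplus>\<^bsub>\<T> p\<^esub> y)) a =
      coboundary R M (n - p) (Psi p x) a \<oplus>\<^bsub>M\<^esub> coboundary R M (n - p) (Psi p y) a"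
    and coboundary_Psi_smult: "coboundary R M (n - p) (Psi p (mmonom 0 c \<odot>\<^bsub>\<T> p\<^esub> x)) a =
      mmonom 0 c \<odot>\<^bsub>M\<^esub> coboundary R M (n - p) (Psi p x) a"
  by (intro coboundary_closed coboundary_add coboundary_smult a Psi_closed Psi_add Psi_smult x polys_const; assumption)+

lemma signed_coboundary_closed:
  assumes "x \<in> carrier (\<T> p)" "a \<in> tuples (Suc (n - p)) (polys n)"
  shows "signed M p (coboundary R M (n - p) (Psi p x) a) \<in> carrier M"
  using assms by (intro M.M.signed_closed coboundary_Psi_closed)

text \<open>Outside the degrees 1 to n the zero map works because the prescribed values vanish.
  Inside, the map is \<open>Theta (p - 1)\<close> applied to (-1)^p times the coboundary of
  \<open>Psi p x\<close>. It is \<open>k\<close>-linear as a composite, and its values on elementary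
  chains are right because \<open>boundary_value\<close> and \<open>coboundary_value\<close> agree
  up to this sign.\<close>

lemma is_boundary_exists: "\<exists>h. is_boundary p h"
proof (cases "p = 0 \<or> n < p")
  case True
  interpret T: module R "\<T> p" by (rule T_module)
  interpret T': module R "\<T> (p - 1)" by (rule T_module)
  have "is_boundary p (\<lambda>x\<in>carrier (\<T> p). \<zero>\<^bsub>\<T> (p - 1)\<^esub>)"
    unfolding is_boundary_def
  proof (intro conjI ballI)
    show "(\<lambda>x\<in>carrier (\<T> p). \<zero>\<^bsub>\<T> (p - 1)\<^esub>) \<in> lin_hom K (restrict_scalars R (\<T> p)) (restrict_scalars R (\<T> (p - 1)))"
      by (rule lin_homI) (simp_all add: scalar_T T'.smult_r_null T.smult_closed del: One_nat_def)
    fix m and b :: "'k mpoly list" assume "m \<in> carrier M" "b \<in> tuples p (polys n)"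
    then show "(\<lambda>x\<in>carrier (\<T> p). \<zero>\<^bsub>\<T> (p - 1)\<^esub>) (elem_chain K R M m b) = bform p m b"
      using bform_vanishes[OF _ _ True] elem_closed by simp
  qed simp
  then show ?thesis by blast
next
  case False
  then have p: "0 < p" "p \<le> n" "p - 1 \<le> n" "n - (p - 1) = Suc (n - p)" by auto
  interpret T: module R "\<T> p" by (rule T_module)
  define G where "G x a = signed M p (coboundary R M (n - p) (Psi p x) a)" for x a
  define h where "h = (\<lambda>x\<in>carrier (\<T> p). Theta (p - 1) (G x))"
  have G: "G x a \<in> carrier M" if "x \<in> carrier (\<T> p)" "a \<in> tuples (n - (p - 1)) (polys n)" for x a
    unfolding G_def using that p by (intro signed_coboundary_closed) simp_all
  have "is_boundary p h"
    unfolding is_boundary_def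
  proof (intro conjI ballI)
    show "h \<in> extensional (carrier (\<T> p))" by (simp add: h_def)
    show "h \<in> lin_hom K (restrict_scalars R (\<T> p)) (restrict_scalars R (\<T> (p - 1)))"
    proof (rule lin_homI, unfold restrict_scalars_simps scalar_T)
      show "h x \<in> carrier (\<T> (p - 1))" if "x \<in> carrier (\<T> p)" for x
        using Theta_closed[OF G[OF that] p(3)] that by (simp add: h_def)
      fix x assume x: "x \<in> carrier (\<T> p)"
      show "h (x \<oplus>\<^bsub>\<T> p\<^esub> y) = h x \<oplus>\<^bsub>\<T> (p - 1)\<^esub> h y" if y: "y \<in> carrier (\<T> p)" for y
      proof -
        have "G (x \<oplus>\<^bsub>\<T> p\<^esub> y) a = G x a \<oplus>\<^bsub>M\<^esub> G y a" if "a \<in> tuples (n - (p - 1)) (polys n)" for a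
        proof -
          have a: "a \<in> tuples (Suc (n - p)) (polys n)" using that p by simp
          note c = coboundary_Psi_closed[OF x a] coboundary_Psi_closed[OF y a]
          show ?thesis
            unfolding G_def coboundary_Psi_add[OF x a y]
            using c by (simp add: sm_sign sm_add_r)
        qed
        from Theta_add[OF G[OF x] G[OF y] p(3) this] show ?thesis using x y by (simp add: h_def)
      qed
      fix c :: 'k
      have "G (mmonom 0 c \<odot>\<^bsub>\<T> p\<^esub> x) a = mmonom 0 c \<odot>\<^bsub>M\<^esub> G x a" if "a \<in> tuples (n - (p - 1)) (polys n)" for a
      proof -
        have a: "a \<in> tuples (Suc (n - p)) (polys n)" using that p by simp
        note cl = coboundary_Psi_closed[OF x a]
        show ?thesis
          unfolding G_def coboundary_Psi_smult[OF x a]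
          using cl by (simp add: sm_sign sm_closed sm_mult[symmetric] mult.commute)
      qed
      from Theta_smult[OF G[OF x] p(3) polys_const this] show "h (mmonom 0 c \<odot>\<^bsub>\<T> p\<^esub> x) = mmonom 0 c \<odot>\<^bsub>\<T> (p - 1)\<^esub> h x"
        using x T.smult_closed[OF _ x, of "mmonom 0 c"] by (simp add: h_def)
    qed
    fix m and b :: "'k mpoly list" assume m: "m \<in> carrier M" and b: "b \<in> tuples p (polys n)"
    have "G (elem_chain K R M m b) a = Psi (p - 1) (bform p m b) a" if "a \<in> tuples (n - (p - 1)) (polys n)" for a
    proof -
      have a: "a \<in> tuples (Suc (n - p)) (polys n)" using that p by simp
      have "G (elem_chain K R M m b) a = boundary_value m b a"
        unfolding G_def coboundary_Psi_elem[OF a m b refl]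
        by (rule boundary_value_eq_coboundary_value[OF m b a, symmetric]) (use p in simp)
      also have "\<dots> = Psi (p - 1) (bform p m b) a"
        unfolding Psi_def using psi_bform[OF m b p(1) tuples_subset[OF that]] that by simp
      finally show ?thesis .
    qed
    from Theta_cong[OF Psi_closed[OF bform_closed[OF m b]] p(3) this]
    show "h (elem_chain K R M m b) = bform p m b"
      using elem_closed[OF m b] Theta_Psi[OF bform_closed[OF m b] p(3)] by (simp add: h_def)
  qed
  then show ?thesis by blast
qed

lemma boundary_is_boundary: "is_boundary p (boundary K R N p)"
  unfolding boundary_eq using is_boundary_exists is_boundary_unique by (rule ex_ex1I[THEN theI'])

lemmas boundary_closed = is_boundary_closed[OF boundary_is_boundary]
  and boundary_add = is_boundary_add[OF boundary_is_boundary]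
  and boundary_zero = is_boundary_zero[OF boundary_is_boundary]
  and boundary_elem = is_boundary_elem[OF boundary_is_boundary]

lemma Psi_zero: "as \<in> tuples (n - p) (polys n) \<Longrightarrow> Psi p \<zero>\<^bsub>\<T> p\<^esub> as = \<zero>\<^bsub>M\<^esub>"
  unfolding Psi_def using additive_map.zero[OF psi_additive[OF tuples_subset]] by simp

lemma coboundary_Psi_zero:
  assumes a: "a \<in> tuples (Suc (n - p)) (polys n)"
  shows "coboundary R M (n - p) (Psi p \<zero>\<^bsub>\<T> p\<^esub>) a = \<zero>\<^bsub>M\<^esub>"
proof -
  note z = abelian_groupE(2)[OF T_abelian, of p]
  have "coboundary R M (n - p) (Psi p (mmonom 0 0 \<odot>\<^bsub>\<T> p\<^esub> \<zero>\<^bsub>\<T> p\<^esub>)) a =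
      mmonom 0 0 \<odot>\<^bsub>M\<^esub> coboundary R M (n - p) (Psi p \<zero>\<^bsub>\<T> p\<^esub>) a"
    by (rule coboundary_Psi_smult[OF z a])
  then show ?thesis
    using coboundary_Psi_closed[OF z a] poly_module.sm_0[OF T_poly_module z] by (simp add: sm_0)
qed

lemma Psi_boundary:
  assumes x: "x \<in> carrier (\<T> p)" and p: "0 < p" "p \<le> n" and a: "a \<in> tuples (Suc (n - p)) (polys n)"
  shows "Psi (p - 1) (boundary K R N p x) a = signed M p (coboundary R M (n - p) (Psi p x) a)"
  using x
proof (induction rule: chain_induct)
  have "n - (p - 1) = Suc (n - p)" using p by simp
  with a have a': "a \<in> tuples (n - (p - 1)) (polys n)" by (simp only:)
  {
    case zero
    show ?case unfolding boundary_zero Psi_zero[OF a'] coboundary_Psi_zero[OF a]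
      by (simp add: signed_def M.M.uminus_zero)
  next
    case (add x y)
    note c = coboundary_Psi_closed[OF add(1) a] coboundary_Psi_closed[OF add(2) a]
    show ?case
      unfolding boundary_add[OF add(1,2)] Psi_add[OF boundary_closed[OF add(1)] boundary_closed[OF add(2)] a']
        coboundary_Psi_add[OF add(1) a add(2)] add(3,4)
      using c by (simp add: sm_sign sm_add_r)
  next
    case (pure m I)
    note b = elem_chain_var_list[OF pure(2)]
    show ?case
      unfolding pure_dx[OF pure(2)] boundary_elem[OF pure(1) b] coboundary_Psi_elem[OF a pure(1) b refl]
      using psi_bform[OF pure(1) b p(1) tuples_subset[OF a]] a'
        boundary_value_eq_coboundary_value[OF pure(1) b a] p
      by (simp add: Psi_def)
  }
qed

text \<open>The case of an elementary chain without differentials: \<open>boundary_value\<close>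
  consists of empty sums, so the coboundary value, equal to it up to sign, is zero.\<close>

lemma coboundary_Psi_0:
  assumes x: "x \<in> carrier (\<T> 0)" and a: "a \<in> tuples (Suc n) (polys n)"
  shows "coboundary R M n (Psi 0 x) a = \<zero>\<^bsub>M\<^esub>"
  using x
proof (induction rule: chain_induct)
  have a': "a \<in> tuples (Suc (n - 0)) (polys n)" using a by simp
  {
    case zero
    show ?case using coboundary_Psi_zero[OF a'] by simp
  next
    case (add x y)
    show ?case
      using coboundary_Psi_add[OF add(1) a' add(2)] add(3,4)
      by simp
  next
    case (pure m I)
    note b = elem_chain_var_list[OF pure(2)]
    have b0: "var_list I = ([] :: 'k mpoly list)" using b by (simp add: tuples_def)
    have "boundary_value m (var_list I) a = signed M 0 (coboundary_value m (var_list I) a)"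
      by (rule boundary_value_eq_coboundary_value[OF pure(1) b a]) simp
    then have "coboundary_value m (var_list I) a = \<zero>\<^bsub>M\<^esub>"
      by (simp add: boundary_value_def signed_def b0)
    then show ?case
      using coboundary_Psi_elem[OF a' pure(1) b refl] by (simp add: pure_dx[OF pure(2)])
  }
qed

lemma boundary_0: "x \<in> carrier (\<T> 0) \<Longrightarrow> boundary K R N 0 x = \<zero>\<^bsub>\<T> 0\<^esub>"
proof (induction rule: chain_induct)
  case zero
  show ?case using boundary_zero[of 0] by simp
next
  case (add x y)
  then show ?case using boundary_add[of x 0 y] abelian_groupE(5)[OF T_abelian abelian_groupE(2)[OF T_abelian]] by simp
next
  case (pure m I)
  then show ?case using boundary_elem[OF pure(1) elem_chain_var_list[OF pure(2)]] bform_0 by (simp add: pure_dx)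
qed

end

section \<open>The modular derivation\<close>

context poly_poisson begin

lemma Om_poly_module: "poly_module n br K R (\<Omega> p)"
  by (intro poly_module.intro poly_module_axioms.intro poly_poisson_axioms Om_module)

lemma Om_abelian: "abelian_group (\<Omega> p)"
  by (rule module.axioms(2)[OF Om_module])

lemma form_induct [consumes 1, case_names zero add gen]:
  assumes w: "w \<in> carrier (\<Omega> p)" and zero: "Q \<zero>\<^bsub>\<Omega> p\<^esub>"
    and add: "\<And>v w. \<lbrakk>v \<in> carrier (\<Omega> p); w \<in> carrier (\<Omega> p); Q v; Q w\<rbrakk> \<Longrightarrow> Q (v \<oplus>\<^bsub>\<Omega> p\<^esub> w)"
    and gen: "\<And>r I. \<lbrakk>r \<in> polys n; I \<in> subsets n p\<rbrakk> \<Longrightarrow> Q (r \<odot>\<^bsub>\<Omega> p\<^esub> dx I)"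
  shows "Q w"
proof -
  interpret O: abelian_group "\<Omega> p" by (rule Om_abelian)
  have c: "coord p I w \<in> carrier (\<Omega> p)" "Q (coord p I w)" if "I \<in> subsets n p" for I
    using coord_closed[OF that w] gen[OF _ that] lam_closed[OF compl_closed w] that by (auto simp: subsets_def)
  have "Q (\<Oplus>\<^bsub>\<Omega> p\<^esub>I\<in>A. coord p I w) \<and> (\<Oplus>\<^bsub>\<Omega> p\<^esub>I\<in>A. coord p I w) \<in> carrier (\<Omega> p)" if "A \<subseteq> subsets n p" for A
  proof -
    have "finite A" using that finite_subsets by (rule finite_subset)
    then show ?thesis using that
    proof (induction rule: finite_induct)
      case empty
      then show ?case using zero by simp
    next
      case (insert I A)
      then have "(\<Oplus>\<^bsub>\<Omega> p\<^esub>J\<in>insert I A. coord p J w) = coord p I w \<oplus>\<^bsub>\<Omega> p\<^esub> (\<Oplus>\<^bsub>\<Omega> p\<^esub>J\<in>A. coord p J w)"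
        using c by (intro O.finsum_insert) auto
      then show ?case using insert add c by simp
    qed
  qed
  from this[of "subsets n p"] show ?thesis using form_expand[OF w] by simp
qed

text \<open>The coordinates of a form are pairings with complementary variables, so a form is
  determined by its pairings.\<close>

lemma form_eqI:
  assumes "v \<in> carrier (\<Omega> p)" "w \<in> carrier (\<Omega> p)" "p \<le> n"
    and "\<And>as. as \<in> tuples (n - p) (polys n) \<Longrightarrow> lam p as v = lam p as w"
  shows "v = w"
proof -
  interpret O: abelian_group "\<Omega> p" by (rule Om_abelian)
  have "compl I \<in> tuples (n - p) (polys n)" if "I \<in> subsets n p" for I
    using compl_subsets[OF that assms(3)] var_list_tuples[of "{..<n} - I" n] by (auto simp: subsets_def)
  then have "(\<Oplus>\<^bsub>\<Omega> p\<^esub>I\<in>subsets n p. coord p I v) = (\<Oplus>\<^bsub>\<Omega> p\<^esub>I\<in>subsets n p. coord p I w)"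
    using coord_closed[OF _ assms(2)] assms(4) by (intro O.finsum_cong') auto
  then show ?thesis using form_expand[OF assms(1)] form_expand[OF assms(2)] by simp
qed

lemma form_above:
  assumes "n < p" "w \<in> carrier (\<Omega> p)"
  shows "w = \<zero>\<^bsub>\<Omega> p\<^esub>"
proof -
  have "w = (\<Oplus>\<^bsub>\<Omega> p\<^esub>I\<in>subsets n p. coord p I w)" by (rule form_expand[OF assms(2)])
  also have "\<dots> = \<zero>\<^bsub>\<Omega> p\<^esub>"
    unfolding subsets_empty[OF assms(1)]
    by (rule abelian_monoid.finsum_empty[OF abelian_group.axioms(1)[OF Om_abelian]])
  finally show ?thesis .
qed

abbreviation "vol \<equiv> volume_form R n"
abbreviation "vars \<equiv> map poly_var [0..<n] :: 'k mpoly list"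

lemma vars_tuples: "vars \<in> tuples n (polys n)"
  by (auto simp: tuples_def)

lemma vol_eq: "vol = d_wedge K R vars"
  by (simp add: volume_form_def K_def)

lemma vol_closed: "vol \<in> carrier (\<Omega> n)"
  unfolding vol_eq by (rule d_wedge_closed[OF vars_tuples])

lemma lam_vol: "lam n [] vol = 1"
  unfolding vol_eq using lam_d_wedge[OF _ vars_tuples, of "[]"] jac_vars[of n] by simp

text \<open>Pairing with the empty list reads off the coefficient of a top form, and the volume form
  has coefficient 1.\<close>

lemma top_form:
  assumes w: "w \<in> carrier (\<Omega> n)"
  shows "w = lam n [] w \<odot>\<^bsub>\<Omega> n\<^esub> vol"
proof (rule form_eqI[OF w _ order_refl])
  have l: "lam n [] w \<in> polys n" using lam_closed[OF _ w, of "[]"] by simp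
  show "lam n [] w \<odot>\<^bsub>\<Omega> n\<^esub> vol \<in> carrier (\<Omega> n)"
    by (rule poly_module.sm_closed[OF Om_poly_module l vol_closed])
  fix as :: "'k mpoly list" assume "as \<in> tuples (n - n) (polys n)"
  then have "as = []" by (simp add: tuples_def)
  then show "lam n as w = lam n as (lam n [] w \<odot>\<^bsub>\<Omega> n\<^esub> vol)"
    using lam_smult[OF _ l vol_closed, of "[]"] lam_vol by simp
qed

lemma d_wedge_top:
  assumes c: "c \<in> tuples n (polys n)"
  shows "d_wedge K R c = jac n c \<odot>\<^bsub>\<Omega> n\<^esub> vol"
proof -
  have "d_wedge K R c = lam n [] (d_wedge K R c) \<odot>\<^bsub>\<Omega> n\<^esub> vol"
    by (rule top_form[OF d_wedge_closed[OF c]])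
  also have "lam n [] (d_wedge K R c) = jac n c"
    using lam_d_wedge[OF _ c, of "[]"] by simp
  finally show ?thesis .
qed

text \<open>Forms of degree n + 1 vanish, so exactly one map meets the description of
  \<open>de_rham\<close> in degree n.\<close>

lemma de_rham_top:
  assumes "w \<in> carrier (\<Omega> n)"
  shows "de_rham K R n w = \<zero>\<^bsub>\<Omega> (Suc n)\<^esub>"
proof -
  interpret O: module R "\<Omega> n" by (rule Om_module)
  interpret O': module R "\<Omega> (Suc n)" by (rule Om_module)
  have z: "w = \<zero>\<^bsub>\<Omega> (Suc n)\<^esub>" if "w \<in> carrier (\<Omega> (Suc n))" for w
    by (rule form_above[OF lessI that])
  have "de_rham K R n = (\<lambda>w\<in>carrier (\<Omega> n). \<zero>\<^bsub>\<Omega> (Suc n)\<^esub>)"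
    unfolding de_rham_def
  proof (rule the_equality, intro conjI ballI)
    show "(\<lambda>w\<in>carrier (\<Omega> n). \<zero>\<^bsub>\<Omega> (Suc n)\<^esub>) \<in> lin_hom K (restrict_scalars R (\<Omega> n)) (restrict_scalars R (\<Omega> (Suc n)))"
      by (rule lin_homI) (simp_all add: scalar_def O'.smult_r_null O.smult_closed)
    fix a as assume a: "a \<in> carrier R" and as: "as \<in> tuples n (carrier R)"
    then have "a # as \<in> tuples (Suc n) (polys n)" by (simp add: tuples_def)
    from z[OF d_wedge_closed[OF this]] show "(\<lambda>w\<in>carrier (\<Omega> n). \<zero>\<^bsub>\<Omega> (Suc n)\<^esub>) (a \<odot>\<^bsub>\<Omega> n\<^esub> d_wedge K R as) = d_wedge K R (a # as)"
      using O.smult_closed[OF a] d_wedge_closed[of as n] as by simp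
  next
    fix h assume h: "h \<in> lin_hom K (restrict_scalars R (\<Omega> n)) (restrict_scalars R (\<Omega> (Suc n))) \<and>
      h \<in> extensional (carrier (\<Omega> n)) \<and>
      (\<forall>a\<in>carrier R. \<forall>as\<in>tuples n (carrier R). h (a \<odot>\<^bsub>\<Omega> n\<^esub> d_wedge K R as) = d_wedge K R (a # as))"
    show "h = (\<lambda>w\<in>carrier (\<Omega> n). \<zero>\<^bsub>\<Omega> (Suc n)\<^esub>)"
    proof (rule extensionalityI)
      show "h \<in> extensional (carrier (\<Omega> n))" using h by blast
      fix w assume w: "w \<in> carrier (\<Omega> n)"
      have "h w \<in> carrier (\<Omega> (Suc n))"
        using lin_hom_closed[of h K "restrict_scalars R (\<Omega> n)" "restrict_scalars R (\<Omega> (Suc n))" w] h w by simp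
      from z[OF this] show "h w = (\<lambda>w\<in>carrier (\<Omega> n). \<zero>\<^bsub>\<Omega> (Suc n)\<^esub>) w" using w by simp
    qed simp
  qed simp
  with assms show ?thesis by simp
qed

section \<open>Contraction with a derivation in degrees n and n + 1\<close>

context
  fixes D :: "'k mpoly \<Rightarrow> 'k mpoly"
  assumes D: "derivation_on n D" and D_closed: "\<And>a. a \<in> polys n \<Longrightarrow> D a \<in> polys n"
begin

definition contracted :: "nat \<Rightarrow> 'k mpoly list \<Rightarrow> 'k mpoly form"
  where "contracted p c = (\<Oplus>\<^bsub>\<Omega> (p - 1)\<^esub>i\<in>{..<p}. signed (\<Omega> (p - 1)) i (D (c ! i) \<odot>\<^bsub>\<Omega> (p - 1)\<^esub> d_wedge K R (omit i c)))"

lemma contracted_summand: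
  assumes "c \<in> tuples p (polys n)" "i < p"
  shows "D (c ! i) \<in> polys n" "d_wedge K R (omit i c) \<in> carrier (\<Omega> (p - 1))"
    "D (c ! i) \<odot>\<^bsub>\<Omega> (p - 1)\<^esub> d_wedge K R (omit i c) \<in> carrier (\<Omega> (p - 1))"
proof -
  have "c \<in> tuples (Suc (p - 1)) (polys n)" using assms by simp
  then show d: "d_wedge K R (omit i c) \<in> carrier (\<Omega> (p - 1))"
    using assms by (intro d_wedge_closed omit_tuples) auto
  show c: "D (c ! i) \<in> polys n" using assms by (intro D_closed tuples_nth)
  show "D (c ! i) \<odot>\<^bsub>\<Omega> (p - 1)\<^esub> d_wedge K R (omit i c) \<in> carrier (\<Omega> (p - 1))"
    by (rule poly_module.sm_closed[OF Om_poly_module c d])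
qed

lemma contracted_closed: "c \<in> tuples p (polys n) \<Longrightarrow> contracted p c \<in> carrier (\<Omega> (p - 1))"
proof -
  interpret O: abelian_group "\<Omega> (p - 1)" by (rule Om_abelian)
  show "contracted p c \<in> carrier (\<Omega> (p - 1))" if "c \<in> tuples p (polys n)"
    unfolding contracted_def using contracted_summand[OF that] by (intro O.finsum_closed Pi_I O.signed_closed) simp
qed

text \<open>In degree n + 1 the source of the contraction vanishes but its target, generated by the
  volume form, does not. The prescribed value is a Laplace sum times the volume form, hence zero,
  which makes the description of \<open>contraction\<close> satisfiable there.\<close>

lemma contracted_above:
  assumes c: "c \<in> tuples (Suc n) (polys n)"
  shows "contracted (Suc n) c = \<zero>\<^bsub>\<Omega> n\<^esub>"
proof -
  interpret O: poly_module n br K R "\<Omega> n" by (rule Om_poly_module)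
  have len: "length c = Suc n" "set c \<subseteq> polys n" using c by (auto simp: tuples_def)
  have J: "jac n (omit i c) \<in> polys n" for i
    using len set_omit[of i c] by (intro jac_closed) auto
  note s = contracted_summand[OF c]
  have Di: "D (c ! i) \<in> polys n" if "i < Suc n" for i using s(1)[OF that] .
  have t: "signed (\<Omega> n) i (D (c ! i) \<odot>\<^bsub>\<Omega> n\<^esub> d_wedge K R (omit i c)) = ((- 1) ^ i * jac n (omit i c) * D (c ! i)) \<odot>\<^bsub>\<Omega> n\<^esub> vol"
    if i: "i < Suc n" for i
  proof -
    have "D (c ! i) \<odot>\<^bsub>\<Omega> n\<^esub> d_wedge K R (omit i c) = (jac n (omit i c) * D (c ! i)) \<odot>\<^bsub>\<Omega> n\<^esub> vol"
      unfolding d_wedge_top[OF omit_tuples[OF c i]] O.sm_mult[OF Di[OF i] J vol_closed, symmetric]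
      by (simp only: mult.commute)
    then show ?thesis
      using O.sm_signed[OF polys_mult[OF J Di[OF i]] vol_closed] by (simp add: mult.assoc)
  qed
  have "contracted (Suc n) c = (\<Oplus>\<^bsub>\<Omega> n\<^esub>i\<in>{..<Suc n}. ((- 1) ^ i * jac n (omit i c) * D (c ! i)) \<odot>\<^bsub>\<Omega> n\<^esub> vol)"
    unfolding contracted_def diff_Suc_1
    by (rule O.M.M.finsum_cong'[OF refl]) (simp_all add: t O.sm_closed vol_closed J Di del: lessThan_Suc)
  also have "\<dots> = (\<Sum>i<Suc n. (- 1) ^ i * jac n (omit i c) * D (c ! i)) \<odot>\<^bsub>\<Omega> n\<^esub> vol"
    by (rule O.sm_sum) (simp_all add: vol_closed J Di)
  also have "\<dots> = \<zero>\<^bsub>\<Omega> n\<^esub>"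
    unfolding jac_laplace[OF len D] by (rule O.sm_0[OF vol_closed])
  finally show ?thesis .
qed

lemma contraction_above: "contraction K R D (Suc n) \<zero>\<^bsub>\<Omega> (Suc n)\<^esub> = \<zero>\<^bsub>\<Omega> n\<^esub>"
proof -
  interpret O: module R "\<Omega> n" by (rule Om_module)
  interpret O': module R "\<Omega> (Suc n)" by (rule Om_module)
  have z: "w = \<zero>\<^bsub>\<Omega> (Suc n)\<^esub>" if "w \<in> carrier (\<Omega> (Suc n))" for w
    by (rule form_above[OF lessI that])
  have "contraction K R D (Suc n) = (\<lambda>w\<in>carrier (\<Omega> (Suc n)). \<zero>\<^bsub>\<Omega> n\<^esub>)"
    unfolding contraction_def diff_Suc_1
  proof (rule the_equality, intro conjI ballI)
    show "(\<lambda>w\<in>carrier (\<Omega> (Suc n)). \<zero>\<^bsub>\<Omega> n\<^esub>) \<in> lin_hom R (\<Omega> (Suc n)) (\<Omega> n)"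
      by (rule lin_homI) (simp_all add: O.smult_r_null O'.smult_closed)
    fix as assume "as \<in> tuples (Suc n) (carrier R)"
    then have as: "as \<in> tuples (Suc n) (polys n)" by simp
    from contracted_above[OF this] show "(\<lambda>w\<in>carrier (\<Omega> (Suc n)). \<zero>\<^bsub>\<Omega> n\<^esub>) (d_wedge K R as) =
        (\<Oplus>\<^bsub>\<Omega> n\<^esub>i\<in>{..<Suc n}. signed (\<Omega> n) i (D (as ! i) \<odot>\<^bsub>\<Omega> n\<^esub> d_wedge K R (omit i as)))"
      using d_wedge_closed[OF as] by (simp add: contracted_def)
  next
    fix h assume h: "h \<in> lin_hom R (\<Omega> (Suc n)) (\<Omega> n) \<and> h \<in> extensional (carrier (\<Omega> (Suc n))) \<and>
      (\<forall>as\<in>tuples (Suc n) (carrier R). h (d_wedge K R as) =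
        (\<Oplus>\<^bsub>\<Omega> n\<^esub>i\<in>{..<Suc n}. signed (\<Omega> n) i (D (as ! i) \<odot>\<^bsub>\<Omega> n\<^esub> d_wedge K R (omit i as))))"
    show "h = (\<lambda>w\<in>carrier (\<Omega> (Suc n)). \<zero>\<^bsub>\<Omega> n\<^esub>)"
    proof (rule extensionalityI)
      show "h \<in> extensional (carrier (\<Omega> (Suc n)))" using h by blast
      fix w assume w: "w \<in> carrier (\<Omega> (Suc n))"
      have "h \<in> lin_hom R (\<Omega> (Suc n)) (\<Omega> n)" using h by blast
      from additive_map.zero[OF lin_hom_additive_map[OF this Om_abelian Om_abelian]]
      show "h w = (\<lambda>w\<in>carrier (\<Omega> (Suc n)). \<zero>\<^bsub>\<Omega> n\<^esub>) w" using w z[OF w] by simp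
    qed simp
  qed simp
  then show ?thesis by simp
qed

text \<open>Laplace expansion for \<open>c\<close> followed by \<open>b\<close>: its first n
  summands give the pairing, and the last one, (-1)^n times \<open>jac n c * D b\<close>, is moved
  to the other side.\<close>

lemma lam_contracted:
  assumes n: "0 < n" and c: "c \<in> tuples n (polys n)" and b: "b \<in> polys n"
  shows "lam (n - 1) [b] (contracted n c) = - ((- 1) ^ n * jac n c * D b)"
proof -
  interpret O: abelian_group "\<Omega> (n - 1)" by (rule Om_abelian)
  interpret S: poly_module n br K R "self_module R"
    by (intro poly_module.intro poly_module_axioms.intro poly_poisson_axioms self_module)
  have sb: "set [b] \<subseteq> polys n" using b by simp
  interpret l: additive_map "\<Omega> (n - 1)" "self_module R" "lam (n - 1) [b]"
    by (rule lin_hom_additive_map[OF lam_hom[OF sb] Om_abelian module.axioms(2)[OF self_module]])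
  have len: "length c = n" "set c \<subseteq> polys n" using c by (auto simp: tuples_def)
  have c': "c \<in> tuples (Suc (n - 1)) (polys n)" using c n by simp
  note s = contracted_summand[OF c]
  have J: "jac n (omit i c @ [b]) \<in> polys n" for i
    using len b set_omit[of i c] by (intro jac_closed) auto
  have t: "lam (n - 1) [b] (signed (\<Omega> (n - 1)) i (D (c ! i) \<odot>\<^bsub>\<Omega> (n - 1)\<^esub> d_wedge K R (omit i c))) =
      ((- 1) ^ i * jac n (omit i c @ [b]) * D (c ! i)) \<odot>\<^bsub>self_module R\<^esub> 1" if i: "i < n" for i
  proof -
    have "lam (n - 1) [b] (D (c ! i) \<odot>\<^bsub>\<Omega> (n - 1)\<^esub> d_wedge K R (omit i c)) = D (c ! i) * jac n (omit i c @ [b])"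
      using lam_smult[OF sb s(1)[OF i] s(2)[OF i]] lam_d_wedge[OF sb omit_tuples[OF c', of i]] i n by simp
    then have "lam (n - 1) [b] (signed (\<Omega> (n - 1)) i (D (c ! i) \<odot>\<^bsub>\<Omega> (n - 1)\<^esub> d_wedge K R (omit i c))) =
      signed (self_module R) i ((D (c ! i) * jac n (omit i c @ [b])) \<odot>\<^bsub>self_module R\<^esub> 1)"
      unfolding l.signed[OF s(3)[OF i]] by simp
    also have "\<dots> = ((- 1) ^ i * (D (c ! i) * jac n (omit i c @ [b]))) \<odot>\<^bsub>self_module R\<^esub> 1"
      by (rule S.sm_signed[OF polys_mult[OF s(1)[OF i] J]]) simp
    finally show ?thesis by (simp add: mult_ac)
  qed
  have "lam (n - 1) [b] (contracted n c) =
    (\<Oplus>\<^bsub>self_module R\<^esub>i\<in>{..<n}. lam (n - 1) [b] (signed (\<Omega> (n - 1)) i (D (c ! i) \<odot>\<^bsub>\<Omega> (n - 1)\<^esub> d_wedge K R (omit i c))))"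
    unfolding contracted_def using s(3) by (intro l.finsum Pi_I O.signed_closed) simp_all
  also have "\<dots> = (\<Oplus>\<^bsub>self_module R\<^esub>i\<in>{..<n}. ((- 1) ^ i * jac n (omit i c @ [b]) * D (c ! i)) \<odot>\<^bsub>self_module R\<^esub> 1)"
    by (rule S.M.M.finsum_cong'[OF refl]) (use t s(1) J in \<open>simp_all del: self_module_simps(4) One_nat_def add: self_module_simps(4)[of R _ 1]\<close>)
  also have "\<dots> = (\<Sum>i<n. (- 1) ^ i * jac n (omit i c @ [b]) * D (c ! i)) \<odot>\<^bsub>self_module R\<^esub> 1"
    by (rule S.sm_sum) (simp_all add: s(1) J)
  also have "\<dots> = (\<Sum>i<n. (- 1) ^ i * jac n (omit i c @ [b]) * D (c ! i))" by simp
  also have "\<dots> = - ((- 1) ^ n * jac n c * D b)"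
  proof -
    let ?cs = "c @ [b]"
    have "(\<Sum>i<Suc n. (- 1) ^ i * jac n (omit i ?cs) * D (?cs ! i)) = 0"
      using len b by (intro jac_laplace D) auto
    moreover have "(\<Sum>i<n. (- 1) ^ i * jac n (omit i ?cs) * D (?cs ! i)) = (\<Sum>i<n. (- 1) ^ i * jac n (omit i c @ [b]) * D (c ! i))"
      using len by (intro sum.cong) (auto simp: omit_append nth_append)
    moreover have "omit n ?cs = c" using omit_append(2)[of c 0 "[b]"] len by (simp add: omit_def)
    ultimately show ?thesis using len by (simp add: nth_append eq_neg_iff_add_eq_0)
  qed
  finally show ?thesis .
qed

text \<open>Top forms are multiples of the volume form, so the contraction must be the coefficient
  times \<open>contracted n vars\<close>. That this has the prescribed value on every wedge is
  checked by pairing (n - 1)-forms with one polynomial \<open>b\<close>; by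
  \<open>lam_contracted\<close> the result depends on the wedge only through its Jacobian.\<close>

lemma contraction_vol:
  assumes n: "0 < n"
  shows "contraction K R D n vol = contracted n vars"
proof -
  interpret O: poly_module n br K R "\<Omega> (n - 1)" by (rule Om_poly_module)
  have v: "contracted n vars \<in> carrier (\<Omega> (n - 1))" by (rule contracted_closed[OF vars_tuples])
  have "set [] \<subseteq> polys n" by simp
  note l = lam_closed[OF this, of _ n] and l_add = lam_add[OF this, of _ n] and l_smult = lam_smult[OF this, of _ _ n]
  let ?h = "\<lambda>w\<in>carrier (\<Omega> n). lam n [] w \<odot>\<^bsub>\<Omega> (n - 1)\<^esub> contracted n vars"
  interpret O': module R "\<Omega> n" by (rule Om_module)
  have "contraction K R D n = ?h"
    unfolding contraction_def
  proof (rule the_equality, intro conjI ballI)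
    show "?h \<in> lin_hom R (\<Omega> n) (\<Omega> (n - 1))"
      by (rule lin_homI) (use v l in \<open>simp_all add: l_add l_smult O.sm_closed O.sm_add_l O.sm_mult O'.smult_closed del: One_nat_def\<close>)
    fix as assume "as \<in> tuples n (carrier R)"
    then have as: "as \<in> tuples n (polys n)" by simp
    have J: "jac n as \<in> polys n" using as by (intro jac_closed) (simp add: tuples_def)
    have "jac n as \<odot>\<^bsub>\<Omega> (n - 1)\<^esub> contracted n vars = contracted n as"
    proof (rule form_eqI)
      show "jac n as \<odot>\<^bsub>\<Omega> (n - 1)\<^esub> contracted n vars \<in> carrier (\<Omega> (n - 1))" by (rule O.sm_closed[OF J v])
      show "contracted n as \<in> carrier (\<Omega> (n - 1))" by (rule contracted_closed[OF as])
      fix bs :: "'k mpoly list" assume "bs \<in> tuples (n - (n - 1)) (polys n)"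
      moreover have "n - (n - 1) = Suc 0" using n by simp
      ultimately obtain b where b: "bs = [b]" "b \<in> polys n"
        by (auto simp: tuples_def length_Suc_conv)
      then have "lam (n - 1) bs (jac n as \<odot>\<^bsub>\<Omega> (n - 1)\<^esub> contracted n vars) = jac n as * lam (n - 1) bs (contracted n vars)"
        by (intro lam_smult J v) simp
      also have "\<dots> = lam (n - 1) bs (contracted n as)"
        using lam_contracted[OF n vars_tuples b(2)] lam_contracted[OF n as b(2)] by (simp add: b(1) jac_vars)
      finally show "lam (n - 1) bs (jac n as \<odot>\<^bsub>\<Omega> (n - 1)\<^esub> contracted n vars) = lam (n - 1) bs (contracted n as)" .
    qed simp
    then show "?h (d_wedge K R as) = (\<Oplus>\<^bsub>\<Omega> (n - 1)\<^esub>i\<in>{..<n}. signed (\<Omega> (n - 1)) i (D (as ! i) \<odot>\<^bsub>\<Omega> (n - 1)\<^esub> d_wedge K R (omit i as)))"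
      using d_wedge_closed[OF as] lam_d_wedge[OF \<open>set [] \<subseteq> polys n\<close> as] by (simp add: contracted_def del: One_nat_def)
  next
    fix h assume h: "h \<in> lin_hom R (\<Omega> n) (\<Omega> (n - 1)) \<and> h \<in> extensional (carrier (\<Omega> n)) \<and>
      (\<forall>as\<in>tuples n (carrier R). h (d_wedge K R as) =
        (\<Oplus>\<^bsub>\<Omega> (n - 1)\<^esub>i\<in>{..<n}. signed (\<Omega> (n - 1)) i (D (as ! i) \<odot>\<^bsub>\<Omega> (n - 1)\<^esub> d_wedge K R (omit i as))))"
    have hom: "h \<in> lin_hom R (\<Omega> n) (\<Omega> (n - 1))" using h by blast
    have hv: "h vol = contracted n vars"
      unfolding vol_eq contracted_def using h vars_tuples by simp
    show "h = ?h"
    proof (rule extensionalityI)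
      show "h \<in> extensional (carrier (\<Omega> n))" using h by blast
      fix w assume w: "w \<in> carrier (\<Omega> n)"
      have "h w = h (lam n [] w \<odot>\<^bsub>\<Omega> n\<^esub> vol)" using top_form[OF w] by simp
      also have "\<dots> = lam n [] w \<odot>\<^bsub>\<Omega> (n - 1)\<^esub> contracted n vars"
        using lin_hom_smult[OF hom _ vol_closed, of "lam n [] w"] l[OF w] hv by simp
      finally show "h w = ?h w" using w by simp
    qed simp
  qed simp
  then show ?thesis using vol_closed lam_vol O.sm_1[OF v] by (simp del: One_nat_def)
qed

end

text \<open>An (n - 1)-form corresponds to the vector field whose components are its pairings with
  the variables; this is the divergence of that field.\<close>

definition divergence :: "'k mpoly form \<Rightarrow> 'k mpoly"
  where "divergence w = (\<Sum>k<n. pd k (lam (n - 1) [poly_var k] w))"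

text \<open>On \<open>a\<close> times a wedge of n - 1 differentials the divergence consists of a
  multiple of a divergence that vanishes by \<open>jac_divergence_free\<close> and of a Jacobian in
  which the chain rule puts \<open>a\<close> last. The factor (-1)^(n-1) moves \<open>a\<close> to
  the first slot, where the exterior derivative has it.\<close>

lemma de_rham_below_top:
  assumes n: "0 < n" and w: "w \<in> carrier (\<Omega> (n - 1))"
  shows "de_rham K R (n - 1) w = ((- 1) ^ (n - 1) * divergence w) \<odot>\<^bsub>\<Omega> n\<^esub> vol"
proof -
  interpret O: poly_module n br K R "\<Omega> n" by (rule Om_poly_module)
  interpret O': poly_module n br K R "\<Omega> (n - 1)" by (rule Om_poly_module)
  have xk: "set [poly_var k] \<subseteq> polys n" if "k < n" for k using that by simp
  have dcl: "divergence w \<in> polys n" if "w \<in> carrier (\<Omega> (n - 1))" for w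
    unfolding divergence_def by (intro polys_sum pd_closed lam_closed that) simp_all
  have dadd: "divergence (v \<oplus>\<^bsub>\<Omega> (n - 1)\<^esub> w) = divergence v + divergence w"
    if "v \<in> carrier (\<Omega> (n - 1))" "w \<in> carrier (\<Omega> (n - 1))" for v w
    unfolding divergence_def sum.distrib[symmetric] by (intro sum.cong refl) (simp add: lam_add[OF xk that] pd_add del: One_nat_def)
  have dsm: "divergence (mmonom 0 c \<odot>\<^bsub>\<Omega> (n - 1)\<^esub> w) = mmonom 0 c * divergence w"
    if "w \<in> carrier (\<Omega> (n - 1))" for w c
    unfolding divergence_def sum_distrib_left
    by (intro sum.cong refl) (simp add: lam_smult[OF xk polys_const that] pd_smult del: One_nat_def)
  let ?g = "\<lambda>w\<in>carrier (\<Omega> (n - 1)). ((- 1) ^ (n - 1) * divergence w) \<odot>\<^bsub>\<Omega> n\<^esub> vol"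
  have Sn: "Suc (n - 1) = n" using n by simp
  have sc: "scalar R (\<Omega> p) c x = mmonom 0 c \<odot>\<^bsub>\<Omega> p\<^esub> x" for p c x
    by (rule poly_module.scalar_eq[OF Om_poly_module])
  have elem: "((- 1) ^ (n - 1) * divergence (a \<odot>\<^bsub>\<Omega> (n - 1)\<^esub> d_wedge K R as)) \<odot>\<^bsub>\<Omega> n\<^esub> vol = d_wedge K R (a # as)"
    if a: "a \<in> polys n" and as: "as \<in> tuples (n - 1) (polys n)" for a as
  proof -
    have len: "length as = n - 1" using as by (simp add: tuples_def)
    have "divergence (a \<odot>\<^bsub>\<Omega> (n - 1)\<^esub> d_wedge K R as) = (\<Sum>k<n. pd k (a * jac n (as @ [poly_var k])))"
      unfolding divergence_def
      by (intro sum.cong refl) (simp add: lam_smult[OF xk a d_wedge_closed[OF as]] lam_d_wedge[OF xk as] del: One_nat_def)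
    also have "\<dots> = a * (\<Sum>k<n. pd k (jac n (as @ [poly_var k]))) + (\<Sum>k<n. pd k a * jac n (as @ [poly_var k]))"
      by (simp add: pd_mult sum.distrib sum_distrib_left mult.commute)
    also have "(\<Sum>k<n. pd k (jac n (as @ [poly_var k]))) = 0"
      by (rule jac_divergence_free[OF as Sn])
    also have "(\<Sum>k<n. pd k a * jac n (as @ [poly_var k])) = jac n (as @ [a])"
      using derivation_expand[OF jac_derivation[of "n - 1" "as @ [a]" n n] a] len by (simp add: list_update_append)
    also have "jac n (as @ [a]) = (- 1) ^ (n - 1) * jac n (a # as)"
      using jac_move[of n as a "[]"] len by simp
    finally have "(- 1) ^ (n - 1) * divergence (a \<odot>\<^bsub>\<Omega> (n - 1)\<^esub> d_wedge K R as) = ((- 1) ^ (n - 1) * (- 1) ^ (n - 1)) * jac n (a # as)"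
      by (simp add: mult.assoc)
    also have "(- 1) ^ (n - 1) * (- 1) ^ (n - 1) = (1 :: 'k mpoly)"
      by (simp add: power_mult_distrib[symmetric])
    finally have "(- 1) ^ (n - 1) * divergence (a \<odot>\<^bsub>\<Omega> (n - 1)\<^esub> d_wedge K R as) = jac n (a # as)" by simp
    moreover have "a # as \<in> tuples n (polys n)" using a as n by (auto simp: tuples_def)
    ultimately show ?thesis using d_wedge_top by simp
  qed
  have "de_rham K R (n - 1) = ?g"
    unfolding de_rham_def Sn
  proof (rule the_equality, intro conjI ballI)
    show "?g \<in> lin_hom K (restrict_scalars R (\<Omega> (n - 1))) (restrict_scalars R (\<Omega> n))"
    proof (rule lin_homI, unfold restrict_scalars_simps sc)
      show "?g x \<in> carrier (\<Omega> n)" if "x \<in> carrier (\<Omega> (n - 1))" for x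
        using that dcl vol_closed by (simp add: O.sm_closed del: One_nat_def)
      show "?g (x \<oplus>\<^bsub>\<Omega> (n - 1)\<^esub> y) = ?g x \<oplus>\<^bsub>\<Omega> n\<^esub> ?g y" if "x \<in> carrier (\<Omega> (n - 1))" "y \<in> carrier (\<Omega> (n - 1))" for x y
        using that dcl vol_closed by (simp add: dadd distrib_left O.sm_add_l del: One_nat_def)
      show "?g (mmonom 0 c \<odot>\<^bsub>\<Omega> (n - 1)\<^esub> x) = mmonom 0 c \<odot>\<^bsub>\<Omega> n\<^esub> ?g x" if "x \<in> carrier (\<Omega> (n - 1))" for c x
        using that dcl[OF that] vol_closed O'.sm_closed[OF polys_const that]
        by (simp add: dsm O.sm_mult[symmetric] mult.left_commute del: One_nat_def)
    qed
    fix a as assume a: "a \<in> carrier R" and as: "as \<in> tuples (n - 1) (carrier R)"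
    then show "?g (a \<odot>\<^bsub>\<Omega> (n - 1)\<^esub> d_wedge K R as) = d_wedge K R (a # as)"
      using elem[of a as] O'.sm_closed[OF _ d_wedge_closed, of a as] by (simp del: One_nat_def)
  next
    fix h assume h: "h \<in> lin_hom K (restrict_scalars R (\<Omega> (n - 1))) (restrict_scalars R (\<Omega> n)) \<and>
      h \<in> extensional (carrier (\<Omega> (n - 1))) \<and>
      (\<forall>a\<in>carrier R. \<forall>as\<in>tuples (n - 1) (carrier R). h (a \<odot>\<^bsub>\<Omega> (n - 1)\<^esub> d_wedge K R as) = d_wedge K R (a # as))"
    then have hom: "h \<in> lin_hom K (restrict_scalars R (\<Omega> (n - 1))) (restrict_scalars R (\<Omega> n))" by blast
    interpret h: additive_map "restrict_scalars R (\<Omega> (n - 1))" "restrict_scalars R (\<Omega> n)" h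
      by (rule lin_hom_additive_map[OF hom restrict_scalars_abelian[OF Om_abelian] restrict_scalars_abelian[OF Om_abelian]])
    show "h = ?g"
    proof (rule extensionalityI)
      show "h \<in> extensional (carrier (\<Omega> (n - 1)))" using h by blast
      fix w assume "w \<in> carrier (\<Omega> (n - 1))"
      then show "h w = ?g w"
      proof (induction rule: form_induct)
        case zero
        have "divergence \<zero>\<^bsub>\<Omega> (n - 1)\<^esub> = 0"
          using dadd[OF O'.M.M.zero_closed O'.M.M.zero_closed] O'.M.M.l_zero[OF O'.M.M.zero_closed] by simp
        then show ?case
          using h.zero O.sm_0[OF vol_closed] by (simp del: One_nat_def)
      next
        case (add v w)
        then show ?case
          using h.add[of v w] dcl vol_closed by (simp add: dadd distrib_left O.sm_add_l del: One_nat_def)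
      next
        case (gen r I)
        have t: "(var_list I :: 'k mpoly list) \<in> tuples (n - 1) (polys n)" using gen(2) var_list_tuples[of I n] by (auto simp: subsets_def)
        have "h (r \<odot>\<^bsub>\<Omega> (n - 1)\<^esub> dx I) = d_wedge K R (r # var_list I)" using h gen t by simp
        then show ?case using elem[OF gen(1) t] O'.sm_closed[OF gen(1) d_wedge_closed[OF t]] by (simp del: One_nat_def)
      qed
    qed simp
  qed simp
  with w show ?thesis by (simp del: One_nat_def)
qed

text \<open>In top degree only the exterior derivative of the contraction survives. The contracted
  volume form pairs with the \<open>k\<close>-th variable to -(-1)^n times
  \<open>br f (poly_var k)\<close>, and the factor (-1)^(n-1) of \<open>de_rham_below_top\<close>
  cancels this sign.\<close>

lemma lie_derivative_vol:
  assumes f: "f \<in> polys n"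
  shows "lie_derivative K R (br f) n vol = modular f \<odot>\<^bsub>\<Omega> n\<^esub> vol"
proof -
  interpret O: poly_module n br K R "\<Omega> n" by (rule Om_poly_module)
  note D = br_derivation_r[OF f]
  have Dc: "br f a \<in> polys n" if "a \<in> polys n" for a using f that by simp
  have top: "contraction K R (br f) (Suc n) (de_rham K R n vol) = \<zero>\<^bsub>\<Omega> n\<^esub>"
    unfolding de_rham_top[OF vol_closed] by (rule contraction_above[OF D Dc])
  show ?thesis
  \<comment> \<open>For n = 0 the Lie derivative is given by the separate clause for functions, and
    \<open>modular f\<close> is an empty sum.\<close>
  proof (cases "n = 0")
    case True
    have "modular f = 0" unfolding modular_def by (simp only: True lessThan_0 sum.empty)
    with True show ?thesis
      using top O.sm_0[OF vol_closed] by (simp add: lie_derivative_def)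
  next
    case False
    then have n: "0 < n" by simp
    let ?v = "contracted (br f) n vars"
    have v: "?v \<in> carrier (\<Omega> (n - 1))" by (rule contracted_closed[OF D Dc vars_tuples])
    have "divergence ?v = (\<Sum>k<n. pd k (- ((- 1) ^ n * br f (poly_var k))))"
      unfolding divergence_def
      by (intro sum.cong refl) (simp add: lam_contracted[OF D Dc n vars_tuples] jac_vars del: One_nat_def)
    also have "\<dots> = - ((- 1) ^ n * modular f)"
      unfolding modular_def sum_distrib_left sum_negf[symmetric]
      by (intro sum.cong refl) (cases "even n"; simp add: pd_uminus)
    finally have "(- 1) ^ (n - 1) * divergence ?v = modular f"
      using n by (cases n) (auto simp: power_mult_distrib[symmetric] mult.assoc[symmetric])
    then have "de_rham K R (n - 1) ?v = modular f \<odot>\<^bsub>\<Omega> n\<^esub> vol"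
      by (simp only: de_rham_below_top[OF n v])
    moreover have "contraction K R (br f) n vol = ?v"
      by (rule contraction_vol[OF D _ n]) (rule Dc)
    ultimately have "de_rham K R (n - 1) (contraction K R (br f) n vol) = modular f \<odot>\<^bsub>\<Omega> n\<^esub> vol"
      by (simp only:)
    then show ?thesis
      using False top O.sm_closed[OF modular_closed[OF f] vol_closed]
      by (simp add: lie_derivative_def del: One_nat_def)
  qed
qed

text \<open>The coefficient of the volume form is unique, since pairing with the empty list recovers
  it; the definite description therefore evaluates to \<open>modular f\<close>.\<close>

lemma modular_derivation_eq:
  assumes f: "f \<in> polys n"
  shows "modular_derivation K R n vol f = modular f"
  unfolding modular_derivation_def R_simps lie_derivative_vol[OF f]
proof (rule the_equality)
  show "modular f \<in> polys n \<and> modular f \<odot>\<^bsub>\<Omega> n\<^esub> vol = modular f \<odot>\<^bsub>\<Omega> n\<^esub> vol" using f by simp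
  fix c assume c: "c \<in> polys n \<and> modular f \<odot>\<^bsub>\<Omega> n\<^esub> vol = c \<odot>\<^bsub>\<Omega> n\<^esub> vol"
  have e: "set [] \<subseteq> polys n" by simp
  have "c = lam n [] (c \<odot>\<^bsub>\<Omega> n\<^esub> vol)"
    using lam_smult[OF e _ vol_closed, of c] c lam_vol by simp
  also have "\<dots> = lam n [] (modular f \<odot>\<^bsub>\<Omega> n\<^esub> vol)" using c by simp
  also have "\<dots> = modular f"
    using lam_smult[OF e modular_closed[OF f] vol_closed] lam_vol by simp
  finally show "c = modular f" .
qed

end

section \<open>Homology\<close>

lemma a_r_coset_image: "N +>\<^bsub>V\<^esub> x = (\<lambda>h. h \<oplus>\<^bsub>V\<^esub> x) ` N"
  by (auto simp: a_r_coset_def')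

lemma set_add_image: "A <+>\<^bsub>V\<^esub> B = (\<lambda>(a, b). a \<oplus>\<^bsub>V\<^esub> b) ` (A \<times> B)"
  by (auto simp: set_add_def')

lemma image_coset:
  assumes "\<And>x y. \<lbrakk>x \<in> C; y \<in> C\<rbrakk> \<Longrightarrow> g (x \<oplus>\<^bsub>V\<^esub> y) = g x \<oplus>\<^bsub>W\<^esub> g y" "N \<subseteq> C" "x \<in> C"
  shows "g ` (N +>\<^bsub>V\<^esub> x) = g ` N +>\<^bsub>W\<^esub> g x"
  using assms by (auto simp: a_r_coset_image image_image subset_iff intro!: image_cong)

text \<open>Formulated for cosets as sets inside an ambient \<open>C\<close> on which
  \<open>g\<close> is additive, homogeneous and injective: direct images then commute with the coset
  operations and are injective. It thus applies to cycles and boundaries as plain sets of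
  chains.\<close>

lemma quotient_module_transport:
  fixes V :: "('k, 'v, 's) module_scheme" and W :: "('k, 'w, 't) module_scheme"
  assumes add: "\<And>x y. \<lbrakk>x \<in> C; y \<in> C\<rbrakk> \<Longrightarrow> g (x \<oplus>\<^bsub>V\<^esub> y) = g x \<oplus>\<^bsub>W\<^esub> g y"
    and smult: "\<And>c x. \<lbrakk>c \<in> carrier K; x \<in> C\<rbrakk> \<Longrightarrow> g (c \<odot>\<^bsub>V\<^esub> x) = c \<odot>\<^bsub>W\<^esub> g x"
    and C_add: "\<And>x y. \<lbrakk>x \<in> C; y \<in> C\<rbrakk> \<Longrightarrow> x \<oplus>\<^bsub>V\<^esub> y \<in> C"
    and C_smult: "\<And>c x. \<lbrakk>c \<in> carrier K; x \<in> C\<rbrakk> \<Longrightarrow> c \<odot>\<^bsub>V\<^esub> x \<in> C"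
    and inj: "inj_on g C" and N: "N \<subseteq> C" and V: "carrier V \<subseteq> C" and W: "g ` carrier V = carrier W"
  shows "(\<lambda>X. g ` X) \<in> lin_iso K (quotient_module V N) (quotient_module W (g ` N))"
proof -
  have coset: "g ` (N +>\<^bsub>V\<^esub> x) = g ` N +>\<^bsub>W\<^esub> g x" if "x \<in> C" for x
    by (rule image_coset[OF add N that])
  have sub: "X \<subseteq> C" if "X \<in> a_rcosets\<^bsub>V\<^esub> N" for X
    using that N V C_add by (auto simp: a_rcosets_conv_image a_r_coset_image subset_iff)
  have img: "(\<lambda>X. g ` X) ` (a_rcosets\<^bsub>V\<^esub> N) = a_rcosets\<^bsub>W\<^esub> (g ` N)"
    unfolding a_rcosets_conv_image W[symmetric] image_image
    using coset V by (intro image_cong refl) blast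
  have "(\<lambda>X. g ` X) \<in> lin_hom K (quotient_module V N) (quotient_module W (g ` N))"
  proof (rule lin_homI, unfold quotient_module_simps)
    show "g ` X \<in> a_rcosets\<^bsub>W\<^esub> (g ` N)" if "X \<in> a_rcosets\<^bsub>V\<^esub> N" for X
      using that img by blast
    show "g ` (X <+>\<^bsub>V\<^esub> Y) = g ` X <+>\<^bsub>W\<^esub> g ` Y" if "X \<in> a_rcosets\<^bsub>V\<^esub> N" "Y \<in> a_rcosets\<^bsub>V\<^esub> N" for X Y
    proof -
      have "g (x \<oplus>\<^bsub>V\<^esub> y) = g x \<oplus>\<^bsub>W\<^esub> g y" if "x \<in> X" "y \<in> Y" for x y
        using that sub[OF \<open>X \<in> a_rcosets\<^bsub>V\<^esub> N\<close>] sub[OF \<open>Y \<in> a_rcosets\<^bsub>V\<^esub> N\<close>] by (intro add) blast+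
      then show ?thesis by (force simp: set_add_image image_iff)
    qed
    show "g ` (\<Union>x\<in>X. N +>\<^bsub>V\<^esub> (c \<odot>\<^bsub>V\<^esub> x)) = (\<Union>y\<in>g ` X. g ` N +>\<^bsub>W\<^esub> (c \<odot>\<^bsub>W\<^esub> y))"
      if "c \<in> carrier K" "X \<in> a_rcosets\<^bsub>V\<^esub> N" for c X
    proof -
      have "g ` (N +>\<^bsub>V\<^esub> (c \<odot>\<^bsub>V\<^esub> x)) = g ` N +>\<^bsub>W\<^esub> (c \<odot>\<^bsub>W\<^esub> g x)" if "x \<in> X" for x
        using that sub[OF \<open>X \<in> a_rcosets\<^bsub>V\<^esub> N\<close>] \<open>c \<in> carrier K\<close> by (subst coset) (auto intro!: C_smult simp: smult subset_iff)
      then show ?thesis by (simp add: image_UN)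
    qed
  qed
  moreover have "inj_on (\<lambda>X. g ` X) (a_rcosets\<^bsub>V\<^esub> N)"
    using sub inj by (intro inj_onI) (meson inj_on_image_eq_iff)
  ultimately show ?thesis
    using img by (simp add: lin_iso_def bij_betw_def)
qed

text \<open>The lift given by the universal property is restricted to the carrier because the
  definite description asks for an extensional map; induction over pure tensors gives
  uniqueness.\<close>

lemma
  assumes V: "module R V" and V': "module R V'" and W: "module R W" and h: "h \<in> lin_hom R V V'"
  shows tensor_map_hom: "tensor_map R V V' W h \<in> lin_hom R (tensor R V W) (tensor R V' W)"
    and tensor_map_pure: "\<lbrakk>v \<in> carrier V; w \<in> carrier W\<rbrakk> \<Longrightarrow>
      tensor_map R V V' W h (pure_tensor R V W v w) = pure_tensor R V' W (h v) w"
proof -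
  let ?P = "\<lambda>g. g \<in> lin_hom R (tensor R V W) (tensor R V' W) \<and> g \<in> extensional (carrier (tensor R V W)) \<and>
     (\<forall>v\<in>carrier V. \<forall>w\<in>carrier W. g (pure_tensor R V W v w) = pure_tensor R V' W (h v) w)"
  interpret T: module R "tensor R V W" by (rule tensor_module[OF V W])
  note hc = lin_hom_closed[OF h]
  have "\<exists>g\<in>lin_hom R (tensor R V W) (tensor R V' W).
      \<forall>v\<in>carrier V. \<forall>w\<in>carrier W. g (pure_tensor R V W v w) = pure_tensor R V' W (h v) w"
    by (rule tensor_lift[OF V W tensor_module[OF V' W]])
      (simp_all add: hc lin_hom_add[OF h] lin_hom_smult[OF h] pure_tensor_closed[OF V' W] pure_tensor_add_l[OF V' W]
        pure_tensor_add_r[OF V' W] pure_tensor_smult_l[OF V' W] pure_tensor_smult_r[OF V' W])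
  then obtain g where g: "g \<in> lin_hom R (tensor R V W) (tensor R V' W)"
    and gp: "\<forall>v\<in>carrier V. \<forall>w\<in>carrier W. g (pure_tensor R V W v w) = pure_tensor R V' W (h v) w"
    by (rule bexE)
  let ?g = "restrict g (carrier (tensor R V W))"
  have "?P ?g"
  proof (intro conjI ballI)
    show "?g \<in> lin_hom R (tensor R V W) (tensor R V' W)"
      by (rule lin_homI) (simp_all add: lin_hom_closed[OF g] lin_hom_add[OF g] lin_hom_smult[OF g])
    show "?g (pure_tensor R V W v w) = pure_tensor R V' W (h v) w" if "v \<in> carrier V" "w \<in> carrier W" for v w
      using that gp pure_tensor_closed[OF V W] by simp
  qed simp
  moreover have "f = f'" if f: "?P f" and f': "?P f'" for f f'
  proof (rule extensionalityI)
    have fl: "f \<in> lin_hom R (tensor R V W) (tensor R V' W)" and fl': "f' \<in> lin_hom R (tensor R V W) (tensor R V' W)"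
      using f f' by simp_all
    note ab = T.M.abelian_group_axioms module.axioms(2)[OF tensor_module[OF V' W]]
    fix x assume "x \<in> carrier (tensor R V W)"
    then show "f x = f' x"
    proof (rule tensor_induct[OF V W])
      show "f \<zero>\<^bsub>tensor R V W\<^esub> = f' \<zero>\<^bsub>tensor R V W\<^esub>"
        using additive_map.zero[OF lin_hom_additive_map[OF fl ab]] additive_map.zero[OF lin_hom_additive_map[OF fl' ab]] by simp
    qed (use f f' in \<open>simp_all add: lin_hom_add[OF fl] lin_hom_add[OF fl']\<close>)
  qed (use f f' in simp_all)
  ultimately have "?P (tensor_map R V V' W h)"
    unfolding tensor_map_def by (intro theI'[of ?P] ex1I[of ?P ?g])
  then show "tensor_map R V V' W h \<in> lin_hom R (tensor R V W) (tensor R V' W)"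
    "\<lbrakk>v \<in> carrier V; w \<in> carrier W\<rbrakk> \<Longrightarrow> tensor_map R V V' W h (pure_tensor R V W v w) = pure_tensor R V' W (h v) w"
    by simp_all
qed

lemma tensor_map_twist [simp]: "tensor_map R (twist \<phi> M) (twist \<phi> M') W h = tensor_map R M M' W h"
  by (simp add: tensor_map_def)

section \<open>Transfer of cycles and boundaries to cocycles and coboundaries\<close>

context poly_poisson_module begin

lemma Psi_inj_on: "p \<le> n \<Longrightarrow> inj_on (Psi p) (carrier (\<T> p))"
  by (rule inj_on_inverseI[where g = "Theta p"]) (rule Theta_Psi)

lemma Psi_image: "p \<le> n \<Longrightarrow> Psi p ` carrier (\<T> p) = carrier (cochains K R M (n - p))"
proof (intro equalityI subsetI)
  fix F assume p: "p \<le> n" and F: "F \<in> carrier (cochains K R M (n - p))"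
  show "F \<in> Psi p ` carrier (\<T> p)"
    by (rule image_eqI[where x = "Theta p F" and f = "Psi p", OF Psi_Theta[OF F p, symmetric]]) (rule Theta_closed[where F = F, OF cochain_closed[OF F] p])
qed (auto intro: Psi_cochain)

lemma signed_eq_zero: "x \<in> carrier M \<Longrightarrow> signed M i x = \<zero>\<^bsub>M\<^esub> \<longleftrightarrow> x = \<zero>\<^bsub>M\<^esub>"
  unfolding signed_def by (metis M.M.minus_minus M.M.uminus_zero)

lemma coboundary_zero_iff:
  "coboundary R M q F = \<zero>\<^bsub>cochains K R M (Suc q)\<^esub> \<longleftrightarrow> (\<forall>a\<in>tuples (Suc q) (polys n). coboundary R M q F a = \<zero>\<^bsub>M\<^esub>)"
proof
  assume "\<forall>a\<in>tuples (Suc q) (polys n). coboundary R M q F a = \<zero>\<^bsub>M\<^esub>"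
  then show "coboundary R M q F = \<zero>\<^bsub>cochains K R M (Suc q)\<^esub>"
    by (intro extensionalityI[where A = "tuples (Suc q) (polys n)"]) (auto simp: coboundary_def)
qed simp

text \<open>\<open>Psi\<close> is injective and turns the boundary into the coboundary up to sign,
  so zero corresponds to zero. In degree 0 both conditions hold for every chain.\<close>

lemma cycle_iff_cocycle:
  assumes x: "x \<in> carrier (\<T> p)" and p: "p \<le> n"
  shows "boundary K R N p x = \<zero>\<^bsub>\<T> (p - 1)\<^esub> \<longleftrightarrow> coboundary R M (n - p) (Psi p x) = \<zero>\<^bsub>cochains K R M (Suc (n - p))\<^esub>"
proof (cases "p = 0")
  case True
  then show ?thesis
    using x boundary_0[of x] coboundary_Psi_0[of x] by (simp add: coboundary_zero_iff del: cochains_simps)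
next
  case False
  then have p0: "0 < p" "p - 1 \<le> n" "n - (p - 1) = Suc (n - p)" using p by auto
  note bc = boundary_closed[OF x] and zc = abelian_groupE(2)[OF T_abelian, of "p - 1"]
  have "boundary K R N p x = \<zero>\<^bsub>\<T> (p - 1)\<^esub> \<longleftrightarrow>
      (\<forall>a\<in>tuples (n - (p - 1)) (polys n). Psi (p - 1) (boundary K R N p x) a = \<zero>\<^bsub>M\<^esub>)"
  proof
    assume z: "\<forall>a\<in>tuples (n - (p - 1)) (polys n). Psi (p - 1) (boundary K R N p x) a = \<zero>\<^bsub>M\<^esub>"
    show "boundary K R N p x = \<zero>\<^bsub>\<T> (p - 1)\<^esub>"
      by (rule Psi_inj[OF bc zc p0(2)]) (use z Psi_zero[of _ "p - 1"] in \<open>simp add: Psi_def del: One_nat_def\<close>)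
  next
    assume "boundary K R N p x = \<zero>\<^bsub>\<T> (p - 1)\<^esub>"
    then show "\<forall>a\<in>tuples (n - (p - 1)) (polys n). Psi (p - 1) (boundary K R N p x) a = \<zero>\<^bsub>M\<^esub>"
      by (simp add: Psi_zero del: One_nat_def)
  qed
  also have "\<dots> \<longleftrightarrow> (\<forall>a\<in>tuples (Suc (n - p)) (polys n). coboundary R M (n - p) (Psi p x) a = \<zero>\<^bsub>M\<^esub>)"
    unfolding p0(3) using Psi_boundary[OF x p0(1) p] signed_eq_zero[OF coboundary_Psi_closed[OF x]]
    by (intro ball_cong refl) (simp del: One_nat_def)
  finally show ?thesis unfolding coboundary_zero_iff .
qed

lemma Psi_cycles:
  assumes p: "p \<le> n"
  shows "Psi p ` cycles K R N p = cocycles K R M (n - p)"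
proof (intro equalityI subsetI)
  fix F assume "F \<in> Psi p ` cycles K R N p"
  then obtain x where x: "x \<in> carrier (\<T> p)" "boundary K R N p x = \<zero>\<^bsub>\<T> (p - 1)\<^esub>" "F = Psi p x"
    by (auto simp: cycles_def)
  then show "F \<in> cocycles K R M (n - p)"
    unfolding cocycles_def using Psi_cochain[OF x(1)] cycle_iff_cocycle[OF x(1) p] by blast
next
  fix F assume "F \<in> cocycles K R M (n - p)"
  then have F: "F \<in> carrier (cochains K R M (n - p))" "coboundary R M (n - p) F = \<zero>\<^bsub>cochains K R M (Suc (n - p))\<^esub>"
    unfolding cocycles_def by blast+
  note t = Theta_closed[where F = F, OF cochain_closed[OF F(1)] p]
  have "boundary K R N p (Theta p F) = \<zero>\<^bsub>\<T> (p - 1)\<^esub>"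
    using cycle_iff_cocycle[OF t p] F(2) by (simp only: Psi_Theta[OF F(1) p])
  then have "Theta p F \<in> cycles K R N p" using t by (simp add: cycles_def)
  then show "F \<in> Psi p ` cycles K R N p" by (rule image_eqI[where x = "Theta p F" and f = "Psi p", OF Psi_Theta[OF F(1) p, symmetric]])
qed

lemma mmonom_sign: "mmonom 0 ((- 1) ^ i) = ((- 1) ^ i :: 'k mpoly)"
  by (cases "even i") (simp_all add: single_uminus)

text \<open>The sign is placed inside, as a multiple of the chain, so that boundaries and
  coboundaries can be compared as images of sets.\<close>

lemma Psi_boundary_Suc:
  assumes x: "x \<in> carrier (\<T> (Suc p))" and p: "Suc p \<le> n"
  shows "Psi p (boundary K R N (Suc p) x) = coboundary R M (n - Suc p) (Psi (Suc p) ((- 1) ^ Suc p \<odot>\<^bsub>\<T> (Suc p)\<^esub> x))"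
proof (rule extensionalityI[OF Psi_extensional])
  have np: "n - p = Suc (n - Suc p)" using p by simp
  show "coboundary R M (n - Suc p) (Psi (Suc p) ((- 1) ^ Suc p \<odot>\<^bsub>\<T> (Suc p)\<^esub> x)) \<in> extensional (tuples (n - p) (polys n))"
    unfolding np by (simp add: coboundary_def)
  fix a :: "'k mpoly list" assume "a \<in> tuples (n - p) (polys n)"
  then have a: "a \<in> tuples (Suc (n - Suc p)) (polys n)" unfolding np .
  have "Psi p (boundary K R N (Suc p) x) a = signed M (Suc p) (coboundary R M (n - Suc p) (Psi (Suc p) x) a)"
    using Psi_boundary[OF x _ p a] by simp
  also have "\<dots> = (- 1) ^ Suc p \<odot>\<^bsub>M\<^esub> coboundary R M (n - Suc p) (Psi (Suc p) x) a"
    by (rule sm_sign[OF coboundary_Psi_closed[OF x a]])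
  also have "\<dots> = coboundary R M (n - Suc p) (Psi (Suc p) ((- 1) ^ Suc p \<odot>\<^bsub>\<T> (Suc p)\<^esub> x)) a"
    using coboundary_Psi_smult[OF x a, of "(- 1) ^ Suc p"] unfolding mmonom_sign by simp
  finally show "Psi p (boundary K R N (Suc p) x) a = coboundary R M (n - Suc p) (Psi (Suc p) ((- 1) ^ Suc p \<odot>\<^bsub>\<T> (Suc p)\<^esub> x)) a" .
qed

text \<open>Multiplication by the sign permutes the chains of degree p + 1, so it disappears from
  the image. For p = n the chains of degree n + 1 vanish, and in cohomological degree 0 only the
  zero coboundary exists by definition.\<close>

lemma Psi_boundaries:
  assumes p: "p \<le> n"
  shows "Psi p ` boundaries K R N p = coboundaries K R M (n - p)"
proof (cases "p = n")
  case True
  note z = abelian_groupE(2)[OF T_abelian, of "Suc n"]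
  have "carrier (\<T> (Suc n)) = {\<zero>\<^bsub>\<T> (Suc n)\<^esub>}"
    using chain_zero[of "Suc n"] z by blast
  then have "boundaries K R N n = {\<zero>\<^bsub>\<T> n\<^esub>}"
    using boundary_zero[of "Suc n"] by (simp add: boundaries_def)
  moreover have "Psi n \<zero>\<^bsub>\<T> n\<^esub> = \<zero>\<^bsub>cochains K R M 0\<^esub>"
    using Psi_zero[of _ n] Psi_extensional[of n "\<zero>\<^bsub>\<T> n\<^esub>"]
    by (intro extensionalityI[where A = "tuples 0 (polys n)"]) auto
  ultimately show ?thesis by (simp add: True coboundaries_def del: cochains_simps)
next
  case False
  then have p': "Suc p \<le> n" "n - p - 1 = n - Suc p" "n - p \<noteq> 0" using p by auto
  interpret T: poly_module n br K R "\<T> (Suc p)" by (rule T_poly_module)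
  let ?s = "(- 1) ^ Suc p :: 'k mpoly"
  have sq: "?s * ?s = 1" by (simp add: power_mult_distrib[symmetric])
  have "(\<lambda>x. ?s \<odot>\<^bsub>\<T> (Suc p)\<^esub> x) ` carrier (\<T> (Suc p)) = carrier (\<T> (Suc p))"
  proof (intro equalityI subsetI)
    fix x assume x: "x \<in> carrier (\<T> (Suc p))"
    have "x = ?s \<odot>\<^bsub>\<T> (Suc p)\<^esub> (?s \<odot>\<^bsub>\<T> (Suc p)\<^esub> x)"
      using T.sm_mult[OF polys_sign polys_sign x, of "Suc p" "Suc p"] T.sm_1[OF x] unfolding sq by simp
    then show "x \<in> (\<lambda>x. ?s \<odot>\<^bsub>\<T> (Suc p)\<^esub> x) ` carrier (\<T> (Suc p))"
      using T.sm_closed[OF polys_sign x] by (rule image_eqI)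
  qed (auto intro!: T.sm_closed simp del: power_Suc)
  then have im: "Psi (Suc p) ` (\<lambda>x. ?s \<odot>\<^bsub>\<T> (Suc p)\<^esub> x) ` carrier (\<T> (Suc p)) = carrier (cochains K R M (n - Suc p))"
    using Psi_image[OF p'(1)] by simp
  have "Psi p ` boundaries K R N p =
      (\<lambda>x. coboundary R M (n - Suc p) (Psi (Suc p) (?s \<odot>\<^bsub>\<T> (Suc p)\<^esub> x))) ` carrier (\<T> (Suc p))"
    unfolding boundaries_def image_image chains_twist restrict_scalars_simps
    by (rule image_cong[OF refl Psi_boundary_Suc[OF _ p'(1)]])
  also have "\<dots> = coboundary R M (n - Suc p) ` carrier (cochains K R M (n - Suc p))"
    unfolding im[symmetric] image_image ..
  finally show ?thesis unfolding coboundaries_def using p' by simp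
qed

lemma boundaries_closed: "boundaries K R N p \<subseteq> carrier (\<T> p)"
  using boundary_closed[of _ "Suc p"] by (auto simp: boundaries_def)

lemma Psi_iso:
  assumes p: "p \<le> n"
  shows "(\<lambda>X. Psi p ` X) \<in> lin_iso K (poisson_homology K R N p) (poisson_cohomology K R M (int n - int p))"
proof -
  interpret T: module R "\<T> p" by (rule T_module)
  have q: "\<not> int n - int p < 0" "nat (int n - int p) = n - p" using p by auto
  have "(\<lambda>X. Psi p ` X) \<in> lin_iso K (quotient_module ((chains K R N p)\<lparr>carrier := cycles K R N p\<rparr>) (boundaries K R N p))
    (quotient_module ((cochains K R M (n - p))\<lparr>carrier := cocycles K R M (n - p)\<rparr>) (Psi p ` boundaries K R N p))"
  proof (rule quotient_module_transport[where C = "carrier (\<T> p)"])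
    show "Psi p (x \<oplus>\<^bsub>(chains K R N p)\<lparr>carrier := cycles K R N p\<rparr>\<^esub> y) =
        Psi p x \<oplus>\<^bsub>(cochains K R M (n - p))\<lparr>carrier := cocycles K R M (n - p)\<rparr>\<^esub> Psi p y"
      if "x \<in> carrier (\<T> p)" "y \<in> carrier (\<T> p)" for x y
      by (rule extensionalityI[OF Psi_extensional]) (simp_all add: Psi_add[OF that])
    show "Psi p (c \<odot>\<^bsub>(chains K R N p)\<lparr>carrier := cycles K R N p\<rparr>\<^esub> x) =
        c \<odot>\<^bsub>(cochains K R M (n - p))\<lparr>carrier := cocycles K R M (n - p)\<rparr>\<^esub> Psi p x"
      if "c \<in> carrier K" "x \<in> carrier (\<T> p)" for c x
      by (rule extensionalityI[OF Psi_extensional]) (simp_all add: scalar_T scalar_eq Psi_smult[OF that(2) polys_const])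
    show "Psi p ` carrier ((chains K R N p)\<lparr>carrier := cycles K R N p\<rparr>) =
        carrier ((cochains K R M (n - p))\<lparr>carrier := cocycles K R M (n - p)\<rparr>)"
      using Psi_cycles[OF p] by simp
    show "carrier ((chains K R N p)\<lparr>carrier := cycles K R N p\<rparr>) \<subseteq> carrier (\<T> p)"
      by (auto simp: cycles_def)
  qed (simp_all add: Psi_inj_on[OF p] boundaries_closed scalar_T T.smult_closed)
  then show ?thesis
    unfolding poisson_homology_def poisson_cohomology_def Psi_boundaries[OF p] using q by simp
qed

text \<open>Chains above degree n vanish, so homology consists of a single coset; it is sent to
  \<open>{}\<close>, the only element of the module that represents cohomology in negative
  degree.\<close>

lemma homology_above:
  assumes p: "n < p"
  shows "(\<lambda>X. {}) \<in> lin_iso K (poisson_homology K R N p) (poisson_cohomology K R M (int n - int p))"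
proof -
  note z = abelian_groupE(2)[OF T_abelian, of p]
  have "cycles K R N p = {\<zero>\<^bsub>\<T> p\<^esub>}"
  proof (intro equalityI subsetI)
    fix x assume "x \<in> cycles K R N p"
    then have "x \<in> carrier (\<T> p)" by (simp add: cycles_def)
    then show "x \<in> {\<zero>\<^bsub>\<T> p\<^esub>}" using chain_zero[OF p] by simp
  next
    fix x assume "x \<in> {\<zero>\<^bsub>\<T> p\<^esub>}"
    then show "x \<in> cycles K R N p" using z boundary_zero[of p] by (simp add: cycles_def del: One_nat_def)
  qed
  then have "carrier (poisson_homology K R N p) = {boundaries K R N p +>\<^bsub>(chains K R N p)\<lparr>carrier := cycles K R N p\<rparr>\<^esub> \<zero>\<^bsub>\<T> p\<^esub>}"
    by (simp add: poisson_homology_def a_rcosets_conv_image)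
  moreover have "poisson_cohomology K R M (int n - int p) = zero_module {}"
    using p by (simp add: poisson_cohomology_def)
  ultimately show ?thesis
    by (auto simp: lin_iso_def zero_module_def bij_betw_def intro!: lin_homI)
qed

end

text \<open>An \<open>R\<close>-linear \<open>f\<close> commutes with multiplication by Jacobians,
  so the square commutes on pure tensors and hence on chains. The induced maps on classes are unions
  of cosets over representatives, which direct images respect.\<close>

lemma Psi_natural:
  fixes br :: "'k::field_char_0 mpoly \<Rightarrow> 'k mpoly \<Rightarrow> 'k mpoly"
  assumes M: "poly_poisson_module n br K R M \<phi>" and M': "poly_poisson_module n br K R M' \<phi>"
    and f: "f \<in> poisson_mod_hom R M M'" and p: "p \<le> n"
    and X: "X \<in> carrier (poisson_homology K R (twist \<phi> M) p)"
  shows "poly_module.Psi n K R M' p ` poisson_homology_map K R (twist \<phi> M) (twist \<phi> M') p f X =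
    poisson_cohomology_map K R M' (int n - int p) f (poly_module.Psi n K R M p ` X)"
proof -
  interpret M: poly_poisson_module n br K R M \<phi> by (rule M)
  interpret M': poly_poisson_module n br K R M' \<phi> by (rule M')
  have q: "\<not> int n - int p < 0" "nat (int n - int p) = n - p" using p by auto
  have fl: "f \<in> lin_hom R M M'" using f by (simp add: poisson_mod_hom_def)
  let ?t = "tensor_map R M M' (forms K R p) f"
  note th = tensor_map_hom[OF M.M_module M'.M_module M.Om_module fl]
    and tp = tensor_map_pure[OF M.M_module M'.M_module M.Om_module fl]
  have nat: "M'.Psi p (?t x) = (\<lambda>as\<in>tuples (n - p) (carrier R). f (M.Psi p x as))" if x: "x \<in> carrier (M.\<T> p)" for x
  proof (rule extensionalityI[OF M'.Psi_extensional])
    fix as :: "'k mpoly list" assume as: "as \<in> tuples (n - p) (polys n)"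
    note sub = M.tuples_subset[OF as]
    have "M'.psi p as (?t x) = f (M.psi p as x)"
      using x
    proof (rule tensor_induct[OF M.M_module M.Om_module])
      have "?t \<zero>\<^bsub>M.\<T> p\<^esub> = \<zero>\<^bsub>M'.\<T> p\<^esub>"
        by (rule additive_map.zero[OF lin_hom_additive_map[OF th M.T_abelian M'.T_abelian]])
      moreover have "f \<zero>\<^bsub>M\<^esub> = \<zero>\<^bsub>M'\<^esub>"
        by (rule additive_map.zero[OF lin_hom_additive_map[OF fl module.axioms(2)[OF M.M_module] module.axioms(2)[OF M'.M_module]]])
      ultimately show "M'.psi p as (?t \<zero>\<^bsub>M.\<T> p\<^esub>) = f (M.psi p as \<zero>\<^bsub>M.\<T> p\<^esub>)"
        using additive_map.zero[OF M.psi_additive[OF sub]] additive_map.zero[OF M'.psi_additive[OF sub]] by simp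
      show "M'.psi p as (?t (x \<oplus>\<^bsub>M.\<T> p\<^esub> y)) = f (M.psi p as (x \<oplus>\<^bsub>M.\<T> p\<^esub> y))"
        if "x \<in> carrier (M.\<T> p)" "y \<in> carrier (M.\<T> p)" "M'.psi p as (?t x) = f (M.psi p as x)" "M'.psi p as (?t y) = f (M.psi p as y)" for x y
        using that lin_hom_add[OF th] lin_hom_closed[OF th] lin_hom_add[OF M.psi_hom[OF sub]] lin_hom_add[OF M'.psi_hom[OF sub]]
          lin_hom_add[OF fl] M.psi_closed[OF _ sub] by simp
      fix m w assume mw: "m \<in> carrier M" "w \<in> carrier (forms K R p)"
      show "M'.psi p as (?t (M.pure p m w)) = f (M.psi p as (M.pure p m w))"
        using tp[OF mw] M.psi_pure[OF sub mw] M'.psi_pure[OF sub lin_hom_closed[OF fl mw(1)] mw(2)]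
          lin_hom_smult[OF fl _ mw(1)] M.lam_closed[OF sub mw(2)] by simp
    qed
    then show "M'.Psi p (?t x) as = (\<lambda>as\<in>tuples (n - p) (carrier R). f (M.Psi p x as)) as"
      using as by (simp add: M.Psi_def M'.Psi_def)
  qed simp
  have sub: "X \<subseteq> carrier (M.\<T> p)"
  proof
    fix y assume y: "y \<in> X"
    obtain x where "x \<in> cycles K R (twist \<phi> M) p"
      and "X = boundaries K R (twist \<phi> M) p +>\<^bsub>(chains K R (twist \<phi> M) p)\<lparr>carrier := cycles K R (twist \<phi> M) p\<rparr>\<^esub> x"
      using X by (auto simp: poisson_homology_def a_rcosets_conv_image)
    with y obtain h where "y = h \<oplus>\<^bsub>M.\<T> p\<^esub> x" "h \<in> carrier (M.\<T> p)" "x \<in> carrier (M.\<T> p)"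
      using M.boundaries_closed[of p] by (auto simp: a_r_coset_image cycles_def)
    then show "y \<in> carrier (M.\<T> p)"
      using abelian_groupE(1)[OF M.T_abelian] by simp
  qed
  have coset: "M'.Psi p ` (boundaries K R (twist \<phi> M') p +>\<^bsub>chains K R (twist \<phi> M') p\<^esub> ?t x) =
      coboundaries K R M' (n - p) +>\<^bsub>cochains K R M' (n - p)\<^esub> (\<lambda>as\<in>tuples (n - p) (carrier R). f (M.Psi p x as))"
    if x: "x \<in> X" for x
  proof -
    have xT: "x \<in> carrier (M.\<T> p)" using sub x by blast
    have "M'.Psi p ` (boundaries K R (twist \<phi> M') p +>\<^bsub>chains K R (twist \<phi> M') p\<^esub> ?t x) =
        M'.Psi p ` boundaries K R (twist \<phi> M') p +>\<^bsub>cochains K R M' (n - p)\<^esub> M'.Psi p (?t x)"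
    proof (rule image_coset[where C = "carrier (M'.\<T> p)"])
      show "M'.Psi p (y \<oplus>\<^bsub>chains K R (twist \<phi> M') p\<^esub> z) = M'.Psi p y \<oplus>\<^bsub>cochains K R M' (n - p)\<^esub> M'.Psi p z"
        if "y \<in> carrier (M'.\<T> p)" "z \<in> carrier (M'.\<T> p)" for y z
        by (rule extensionalityI[OF M'.Psi_extensional]) (simp_all add: M'.Psi_add[OF that])
    qed (rule M'.boundaries_closed lin_hom_closed[OF th xT])+
    then show ?thesis unfolding M'.Psi_boundaries[OF p] nat[OF xT] .
  qed
  show ?thesis
    unfolding poisson_homology_map_def poisson_cohomology_map_def induced_map_def tensor_map_twist
    using q coset by (simp add: image_UN del: chains_twist)
qed

theorem theorem3p5:
  fixes n p :: nat
    and br :: "'k::field_char_0 mpoly \<Rightarrow> 'k mpoly \<Rightarrow> 'k mpoly"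
  defines "K \<equiv> (type_field :: 'k ring)"
    and "R \<equiv> poly_poisson_alg n br"
  defines "\<phi> \<equiv> modular_derivation K R n (volume_form R n)"
  assumes "poisson_algebra K R"
  shows "\<exists>\<Phi> :: ('k mpoly, 'm) poisson_mod \<Rightarrow>
              ('k mpoly, 'm) chain set \<Rightarrow> ('k mpoly, 'm) cochain set.
    (\<forall>M. poisson_module K R M \<longrightarrow>
       \<Phi> M \<in> lin_iso K (poisson_homology K R (twist \<phi> M) p)
                         (poisson_cohomology K R M (int n - int p))) \<and>
    (\<forall>M M' f. poisson_module K R M \<and> poisson_module K R M' \<and> f \<in> poisson_mod_hom R M M' \<longrightarrow>
       (\<forall>x\<in>carrier (poisson_homology K R (twist \<phi> M) p).
          \<Phi> M' (poisson_homology_map K R (twist \<phi> M) (twist \<phi> M') p f x) =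
          poisson_cohomology_map K R M' (int n - int p) f (\<Phi> M x)))"
proof -
  have pp: "poly_poisson n br K R"
    by (rule poly_poisson.intro) (use assms in \<open>simp_all add: K_def R_def\<close>)
  \<comment> \<open>Here the modular derivation of the volume form, a definite description, is
    identified with its coordinate formula.\<close>
  have pm: "poly_poisson_module n br K R M \<phi>" if "poisson_module K R M" for M :: "('k mpoly, 'm) poisson_mod"
    by (intro poly_poisson_module.intro poly_poisson_module_axioms.intro pp that)
      (simp add: \<phi>_def poly_poisson.modular_derivation_eq[OF pp])
  \<comment> \<open>One formula serves all modules \<open>M\<close>. For \<open>p > n\<close> its
    value \<open>{}\<close> is the element of the zero module in negative degree.\<close>
  define \<Phi> :: "('k mpoly, 'm) poisson_mod \<Rightarrow> ('k mpoly, 'm) chain set \<Rightarrow> ('k mpoly, 'm) cochain set"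
    where "\<Phi> = (\<lambda>M X. if p \<le> n then poly_module.Psi n K R M p ` X else {})"
  show ?thesis
  proof (intro exI[of _ \<Phi>] conjI allI impI ballI)
    fix M :: "('k mpoly, 'm) poisson_mod" assume M: "poisson_module K R M"
    show "\<Phi> M \<in> lin_iso K (poisson_homology K R (twist \<phi> M) p) (poisson_cohomology K R M (int n - int p))"
    proof (cases "p \<le> n")
      case True
      then show ?thesis using poly_poisson_module.Psi_iso[OF pm[OF M] True] by (simp add: \<Phi>_def)
    next
      case False
      then show ?thesis using poly_poisson_module.homology_above[OF pm[OF M]] by (simp add: \<Phi>_def)
    qed
  next
    fix M M' :: "('k mpoly, 'm) poisson_mod" and f X
    assume h: "poisson_module K R M \<and> poisson_module K R M' \<and> f \<in> poisson_mod_hom R M M'"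
      and X: "X \<in> carrier (poisson_homology K R (twist \<phi> M) p)"
    then have f: "f \<in> poisson_mod_hom R M M'" by simp
    show "\<Phi> M' (poisson_homology_map K R (twist \<phi> M) (twist \<phi> M') p f X) =
        poisson_cohomology_map K R M' (int n - int p) f (\<Phi> M X)"
    proof (cases "p \<le> n")
      case True
      then show ?thesis using Psi_natural[OF pm pm f True X] h by (simp add: \<Phi>_def)
    next
      case False
      then show ?thesis by (simp add: \<Phi>_def poisson_cohomology_map_def)
    qed
  qed
qed

end
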